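(* Let $X$ be a normal affine variety over $\mathbf{C}$ with a good $\mathbf{C}^*$-action and let $\omega$ be an algebraic symplectic 2-form on $X_{reg}$ of weight $l$ with $l \neq 0$. Then $\omega$ is the unique symplectic structure of weight $l$ on $X$ up to equivalence; that is, for every algebraic symplectic 2-form $\omega'$ on $X_{reg}$ of weight $l$ there is a $\mathbf{C}^*$-equivariant automorphism $\phi: X \to X$ such that $\omega = \phi^*(\omega')$.
   Context: A $\mathbf{C}^*$-action on an affine variety $X$ is called good if $X$ has a unique fixed point $0 \in X$ and the cotangent space $m_{X,0}/m_{X,0}^2$ has only positive weights; equivalently, the affine ring $R$ of $X$ is graded by the action as $R = \oplus_{i \geq 0} R_i$ with $R_0 = \mathbf{C}$. $X_{reg}$ denotes the regular (smooth) locus of $X$. An algebraic symplectic 2-form on $X_{reg}$ is a regular 2-form that is $d$-closed and non-degenerate at every point. Writing the action as automorphisms $\{\phi_t\}_{t \in \mathbf{C}^*}$ of $X$, the form $\omega$ has weight $l \in \mathbf{Z}$ if $\phi_t^*\omega = t^l \omega$ for all $t$. *)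

theory Defs
  imports "HOL-Analysis.Analysis" "HOL-Library.Extended_Nat"
begin

section \<open>Affine varieties in complex affine space\<close>

inductive polyfun :: "(complex^'n \<Rightarrow> complex) \<Rightarrow> bool" where
  const: "polyfun (\<lambda>x. c)"
| coord: "polyfun (\<lambda>x. x $ i)"
| add: "polyfun f \<Longrightarrow> polyfun g \<Longrightarrow> polyfun (\<lambda>x. f x + g x)"
| mult: "polyfun f \<Longrightarrow> polyfun g \<Longrightarrow> polyfun (\<lambda>x. f x * g x)"

definition zariski_closed :: "(complex^'n) set \<Rightarrow> bool" where
  "zariski_closed Z \<longleftrightarrow> (\<exists>S. (\<forall>f\<in>S. polyfun f) \<and> Z = {x. \<forall>f\<in>S. f x = 0})"

definition affine_variety :: "(complex^'n) set \<Rightarrow> bool" where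
  "affine_variety X \<longleftrightarrow> zariski_closed X \<and> X \<noteq> {} \<and>
     (\<forall>Y Z. zariski_closed Y \<and> zariski_closed Z \<and> X = Y \<union> Z \<longrightarrow> X = Y \<or> X = Z)"

definition variety_dim :: "(complex^'n) set \<Rightarrow> enat" where
  "variety_dim X = Sup {enat k | k. \<exists>Z. (\<forall>i\<le>k. affine_variety (Z i) \<and> Z i \<subseteq> X) \<and>
                                        (\<forall>i<k. Z i \<subset> Z (Suc i))}"

text \<open>Elements of the coordinate ring are represented by functions on the ambient space whose values
  off \<open>X\<close> are irrelevant; accordingly two of them are only ever compared on \<open>X\<close>.\<close>

definition coord_ring :: "(complex^'n) set \<Rightarrow> (complex^'n \<Rightarrow> complex) set" where
  "coord_ring X = {f. \<exists>F. polyfun F \<and> (\<forall>x\<in>X. f x = F x)}"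

text \<open>The coordinate ring is integrally closed in its field of fractions; for irreducible \<open>X\<close>,
  an identity between fractions with denominators powers of \<open>b\<close> may be tested where \<open>b\<close> does not
  vanish.\<close>

definition normal_variety :: "(complex^'n) set \<Rightarrow> bool" where
  "normal_variety X \<longleftrightarrow> affine_variety X \<and>
     (\<forall>a\<in>coord_ring X. \<forall>b\<in>coord_ring X.
        (\<exists>x\<in>X. b x \<noteq> 0) \<and>
        (\<exists>m c. (\<forall>k<m. c k \<in> coord_ring X) \<and>
               (\<forall>x\<in>X. b x \<noteq> 0 \<longrightarrow> (a x / b x) ^ m + (\<Sum>k<m. c k x * (a x / b x) ^ k) = 0))
        \<longrightarrow> (\<exists>f\<in>coord_ring X. \<forall>x\<in>X. b x \<noteq> 0 \<longrightarrow> a x / b x = f x))"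

definition morphism :: "(complex^'n) set \<Rightarrow> (complex^'m) set \<Rightarrow> (complex^'n \<Rightarrow> complex^'m) \<Rightarrow> bool" where
  "morphism X Y f \<longleftrightarrow> f ` X \<subseteq> Y \<and> (\<forall>i. (\<lambda>x. f x $ i) \<in> coord_ring X)"

definition automorphism :: "(complex^'n) set \<Rightarrow> (complex^'n \<Rightarrow> complex^'n) \<Rightarrow> bool" where
  "automorphism X f \<longleftrightarrow> morphism X X f \<and>
     (\<exists>g. morphism X X g \<and> (\<forall>x\<in>X. g (f x) = x \<and> f (g x) = x))"


section \<open>Tangent spaces and the regular locus\<close>

definition tangent_space :: "(complex^'n) set \<Rightarrow> complex^'n \<Rightarrow> (complex^'n) set" where
  "tangent_space X p =
     {v. \<forall>f. polyfun f \<and> (\<forall>x\<in>X. f x = 0) \<longrightarrow> frechet_derivative f (at p) v = 0}"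

text \<open>\<open>vec.dim\<close> is the dimension over the complex numbers.\<close>

definition regular_locus :: "(complex^'n) set \<Rightarrow> (complex^'n) set" where
  "regular_locus X = {p\<in>X. enat (vec.dim (tangent_space X p)) = variety_dim X}"

text \<open>The differential of a morphism is that of any polynomial map representing it on \<open>X\<close>; on
  tangent vectors of \<open>X\<close> this does not depend on the representative, see \<open>differential_eq\<close> below.\<close>

definition differential ::
    "(complex^'n) set \<Rightarrow> (complex^'n \<Rightarrow> complex^'m) \<Rightarrow> complex^'n \<Rightarrow> complex^'n \<Rightarrow> complex^'m" where
  "differential X f p u =
     (THE w. \<forall>F. (\<forall>i. polyfun (\<lambda>x. F x $ i)) \<and> (\<forall>x\<in>X. F x = f x)
                 \<longrightarrow> frechet_derivative F (at p) u = w)"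

lemma polyfun_differentiable: "polyfun f \<Longrightarrow> f differentiable (at p)"
proof (induction rule: polyfun.induct)
  case (coord i)
  show ?case
    by (rule bounded_linear_imp_differentiable[OF bounded_linear_vec_nth])
qed auto

lemma polymap_has_derivative:
  fixes F :: "complex^'n \<Rightarrow> complex^'m"
  assumes "\<And>i. polyfun (\<lambda>x. F x $ i)"
  shows "(F has_derivative (\<lambda>u. \<chi> i. frechet_derivative (\<lambda>x. F x $ i) (at p) u)) (at p)"
proof -
  have "((\<lambda>x. F x $ i) has_derivative frechet_derivative (\<lambda>x. F x $ i) (at p)) (at p)" for i
    using polyfun_differentiable[OF assms] by (simp add: frechet_derivative_works)
  then have "((\<lambda>x. F x $ i \<bullet> c) has_derivative
      (\<lambda>u. frechet_derivative (\<lambda>x. F x $ i) (at p) u \<bullet> c)) (at p)" for i c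
    by (rule has_derivative_inner_left)
  then show ?thesis
    by (subst has_derivative_componentwise_within) (auto simp: Basis_vec_def inner_axis)
qed

lemma differential_eq:
  fixes F f :: "complex^'n \<Rightarrow> complex^'m"
  assumes F: "\<And>i. polyfun (\<lambda>x. F x $ i)" "\<And>x. x \<in> X \<Longrightarrow> F x = f x"
    and u: "u \<in> tangent_space X p"
  shows "differential X f p u = frechet_derivative F (at p) u"
proof -
  have *: "frechet_derivative G (at p) u = frechet_derivative F (at p) u"
    if G: "\<forall>i. polyfun (\<lambda>x. G x $ i)" "\<forall>x\<in>X. G x = f x" for G :: "complex^'n \<Rightarrow> complex^'m"
  proof -
    have "frechet_derivative (\<lambda>x. G x $ i) (at p) u = frechet_derivative (\<lambda>x. F x $ i) (at p) u" for i
    proof -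
      have d: "(\<lambda>x. G x $ i) differentiable (at p)" "(\<lambda>x. F x $ i) differentiable (at p)"
        using G F by (auto intro: polyfun_differentiable)
      have "polyfun (\<lambda>x. G x $ i + (-1) * F x $ i)"
        using G F by (intro polyfun.intros) auto
      then have "polyfun (\<lambda>x. G x $ i - F x $ i)" by simp
      then have "frechet_derivative (\<lambda>x. G x $ i - F x $ i) (at p) u = 0"
        using u G(2) F(2) by (auto simp: tangent_space_def)
      moreover have "frechet_derivative (\<lambda>x. G x $ i - F x $ i) (at p) =
          (\<lambda>h. frechet_derivative (\<lambda>x. G x $ i) (at p) h - frechet_derivative (\<lambda>x. F x $ i) (at p) h)"
        by (rule frechet_derivative_at[symmetric], rule has_derivative_diff)
           (use d in \<open>auto simp: frechet_derivative_works\<close>)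
      ultimately show ?thesis by simp
    qed
    moreover have "frechet_derivative G (at p) u = (\<chi> i. frechet_derivative (\<lambda>x. G x $ i) (at p) u)"
      using fun_cong[OF frechet_derivative_at[OF polymap_has_derivative[of G p]], of u] G by simp
    moreover have "frechet_derivative F (at p) u = (\<chi> i. frechet_derivative (\<lambda>x. F x $ i) (at p) u)"
      using fun_cong[OF frechet_derivative_at[OF polymap_has_derivative[of F p]], of u] F by simp
    ultimately show ?thesis by simp
  qed
  show ?thesis
    unfolding differential_def
  proof (rule the_equality)
    show "\<forall>G. (\<forall>i. polyfun (\<lambda>x. G x $ i)) \<and> (\<forall>x\<in>X. G x = f x) \<longrightarrow>
        frechet_derivative G (at p) u = frechet_derivative F (at p) u"
      using * by blast
    show "w = frechet_derivative F (at p) u"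
      if "\<forall>G. (\<forall>i. polyfun (\<lambda>x. G x $ i)) \<and> (\<forall>x\<in>X. G x = f x) \<longrightarrow>
        frechet_derivative G (at p) u = w" for w
      using that[rule_format, of F] F by blast
  qed
qed


section \<open>Algebraic 2-forms on the regular locus\<close>

text \<open>A 2-form is represented by its values \<open>\<omega> p u v\<close>; only those at regular points \<open>p\<close> of \<open>X\<close> and
  tangent vectors \<open>u\<close>, \<open>v\<close> of \<open>X\<close> at \<open>p\<close> are meaningful.\<close>

type_synonym 'n two_form = "complex^'n \<Rightarrow> complex^'n \<Rightarrow> complex^'n \<Rightarrow> complex"

definition form_eq :: "(complex^'n) set \<Rightarrow> 'n two_form \<Rightarrow> 'n two_form \<Rightarrow> bool" where
  "form_eq X \<omega> \<eta> \<longleftrightarrow> (\<forall>p\<in>regular_locus X. \<forall>u\<in>tangent_space X p. \<forall>v\<in>tangent_space X p.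
                        \<omega> p u v = \<eta> p u v)"

text \<open>The rational 2-form \<open>\<Sum>\<^sub>i\<^sub>j (a\<^sub>i\<^sub>j / g) dx\<^sub>i \<and> dx\<^sub>j\<close> on the ambient space.\<close>

definition rational_form ::
    "('n::finite \<Rightarrow> 'n \<Rightarrow> complex^'n \<Rightarrow> complex) \<Rightarrow> (complex^'n \<Rightarrow> complex) \<Rightarrow> 'n two_form" where
  "rational_form a g q u v =
     (\<Sum>i\<in>UNIV. \<Sum>j\<in>UNIV. a i j q / g q * (u $ i * v $ j - u $ j * v $ i))"

definition local_expression ::
    "(complex^'n) set \<Rightarrow> 'n two_form \<Rightarrow> complex^'n \<Rightarrow>
     ('n::finite \<Rightarrow> 'n \<Rightarrow> complex^'n \<Rightarrow> complex) \<Rightarrow> (complex^'n \<Rightarrow> complex) \<Rightarrow> bool" where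
  "local_expression X \<omega> p a g \<longleftrightarrow>
     (\<forall>i j. polyfun (a i j)) \<and> polyfun g \<and> g p \<noteq> 0 \<and>
     (\<forall>q\<in>regular_locus X. g q \<noteq> 0 \<longrightarrow>
        (\<forall>u\<in>tangent_space X q. \<forall>v\<in>tangent_space X q. \<omega> q u v = rational_form a g q u v))"

definition regular_two_form :: "(complex^'n) set \<Rightarrow> 'n two_form \<Rightarrow> bool" where
  "regular_two_form X \<omega> \<longleftrightarrow> (\<forall>p\<in>regular_locus X. \<exists>a g. local_expression X \<omega> p a g)"

definition ext_deriv ::
    "'n::finite two_form \<Rightarrow> complex^'n \<Rightarrow> complex^'n \<Rightarrow> complex^'n \<Rightarrow> complex^'n \<Rightarrow> complex" where
  "ext_deriv \<Omega> p u v w =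
     frechet_derivative (\<lambda>q. \<Omega> q v w) (at p) u
     - frechet_derivative (\<lambda>q. \<Omega> q u w) (at p) v
     + frechet_derivative (\<lambda>q. \<Omega> q u v) (at p) w"

definition d_closed :: "(complex^'n) set \<Rightarrow> 'n two_form \<Rightarrow> bool" where
  "d_closed X \<omega> \<longleftrightarrow> (\<forall>p\<in>regular_locus X. \<forall>a g. local_expression X \<omega> p a g \<longrightarrow>
     (\<forall>u\<in>tangent_space X p. \<forall>v\<in>tangent_space X p. \<forall>w\<in>tangent_space X p.
        ext_deriv (rational_form a g) p u v w = 0))"

definition nondegenerate :: "(complex^'n) set \<Rightarrow> 'n two_form \<Rightarrow> bool" where
  "nondegenerate X \<omega> \<longleftrightarrow> (\<forall>p\<in>regular_locus X. \<forall>u\<in>tangent_space X p.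
     (\<forall>v\<in>tangent_space X p. \<omega> p u v = 0) \<longrightarrow> u = 0)"

definition symplectic_form :: "(complex^'n) set \<Rightarrow> 'n two_form \<Rightarrow> bool" where
  "symplectic_form X \<omega> \<longleftrightarrow> regular_two_form X \<omega> \<and> d_closed X \<omega> \<and> nondegenerate X \<omega>"

definition pullback :: "(complex^'n) set \<Rightarrow> (complex^'n \<Rightarrow> complex^'n) \<Rightarrow> 'n two_form \<Rightarrow> 'n two_form" where
  "pullback X f \<omega> p u v = \<omega> (f p) (differential X f p u) (differential X f p v)"


section \<open>Good actions of the multiplicative group\<close>

text \<open>Algebraicity: the coordinates of \<open>(t, x) \<mapsto> \<sigma> t x\<close> lie in
  \<open>\<complex>[t, t\<^sup>-\<^sup>1] \<otimes> \<complex>[X]\<close>, the ring of regular functions on \<open>\<complex>\<^sup>* \<times> X\<close>.\<close>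

definition Cstar_action :: "(complex^'n) set \<Rightarrow> (complex \<Rightarrow> complex^'n \<Rightarrow> complex^'n) \<Rightarrow> bool" where
  "Cstar_action X \<sigma> \<longleftrightarrow>
     (\<forall>t. t \<noteq> 0 \<longrightarrow> \<sigma> t ` X \<subseteq> X) \<and>
     (\<forall>x\<in>X. \<sigma> 1 x = x) \<and>
     (\<forall>s t. s \<noteq> 0 \<and> t \<noteq> 0 \<longrightarrow> (\<forall>x\<in>X. \<sigma> (s * t) x = \<sigma> s (\<sigma> t x))) \<and>
     (\<forall>i. \<exists>(N::nat) c. (\<forall>j. c j \<in> coord_ring X) \<and>
        (\<forall>t x. t \<noteq> 0 \<and> x \<in> X \<longrightarrow> \<sigma> t x $ i = (\<Sum>j = - int N..int N. t powi j * c j x)))"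

definition max_ideal :: "(complex^'n) set \<Rightarrow> complex^'n \<Rightarrow> (complex^'n \<Rightarrow> complex) set" where
  "max_ideal X p = {f\<in>coord_ring X. f p = 0}"

definition max_ideal_sq :: "(complex^'n) set \<Rightarrow> complex^'n \<Rightarrow> (complex^'n \<Rightarrow> complex) set" where
  "max_ideal_sq X p = {f. \<exists>(k::nat) a b. (\<forall>i<k. a i \<in> max_ideal X p \<and> b i \<in> max_ideal X p) \<and>
                                        (\<forall>x\<in>X. f x = (\<Sum>i<k. a i x * b i x))}"

definition cotangent_weight ::
    "(complex^'n) set \<Rightarrow> (complex \<Rightarrow> complex^'n \<Rightarrow> complex^'n) \<Rightarrow> complex^'n \<Rightarrow> int \<Rightarrow> bool" where
  "cotangent_weight X \<sigma> p k \<longleftrightarrow>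
     (\<exists>f \<in> max_ideal X p - max_ideal_sq X p.
        \<forall>t. t \<noteq> 0 \<longrightarrow> (\<lambda>x. f (\<sigma> t x) - t powi k * f x) \<in> max_ideal_sq X p)"

definition fixed_points ::
    "(complex^'n) set \<Rightarrow> (complex \<Rightarrow> complex^'n \<Rightarrow> complex^'n) \<Rightarrow> (complex^'n) set" where
  "fixed_points X \<sigma> = {p\<in>X. \<forall>t. t \<noteq> 0 \<longrightarrow> \<sigma> t p = p}"

definition good_Cstar_action :: "(complex^'n) set \<Rightarrow> (complex \<Rightarrow> complex^'n \<Rightarrow> complex^'n) \<Rightarrow> bool" where
  "good_Cstar_action X \<sigma> \<longleftrightarrow> Cstar_action X \<sigma> \<and>
     (\<exists>p. fixed_points X \<sigma> = {p} \<and> (\<forall>k. cotangent_weight X \<sigma> p k \<longrightarrow> k > 0))"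

definition form_weight ::
    "(complex^'n) set \<Rightarrow> (complex \<Rightarrow> complex^'n \<Rightarrow> complex^'n) \<Rightarrow> 'n two_form \<Rightarrow> int \<Rightarrow> bool" where
  "form_weight X \<sigma> \<omega> l \<longleftrightarrow>
     (\<forall>t. t \<noteq> 0 \<longrightarrow> form_eq X (pullback X (\<sigma> t) \<omega>) (\<lambda>p u v. t powi l * \<omega> p u v))"

definition equivariant ::
    "(complex^'n) set \<Rightarrow> (complex \<Rightarrow> complex^'n \<Rightarrow> complex^'n) \<Rightarrow> (complex^'n \<Rightarrow> complex^'n) \<Rightarrow> bool" where
  "equivariant X \<sigma> f \<longleftrightarrow> (\<forall>t x. t \<noteq> 0 \<and> x \<in> X \<longrightarrow> f (\<sigma> t x) = \<sigma> t (f x))"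

end

(*
  Moser's argument, made algebraic by the grading. Put w(s) = (1 - s) w + s w' and d = w' - w, and let E
  be the Euler field of the action. Cartan's formula gives d(i_E d) = l d. The determinant of w(s)
  relative to w is an invariant regular function on the regular locus, hence (normality and good action)
  a constant, polynomial in s; so 0 and 1 are joined by a path s(t) along which w(s(t)) is
  nondegenerate. The field V(t) with i_V w(s(t)) = (s'(t) / l) i_E d has weight 0 and extends to X by
  normality. It acts linearly on the finite-dimensional space spanned by generators of the coordinate
  ring in each weight, so its flow consists of linear ODEs: it is complete and algebraic, preserves X
  and commutes with the action. Along the flow of -V(t) the form w(s(t)) is constant, so its time-1 map
  pulls w' back to w.
*)
theory Submission
  imports Defs "HOL-Library.Function_Algebras" "HOL-Computational_Algebra.Polynomial"
    "HOL-Computational_Algebra.Fundamental_Theorem_Algebra"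
begin

section \<open>Polynomial functions\<close>

text \<open>Three obstacles shape the proof. The dimension of X is given by chains of subvarieties,
  but regularity compares it with tangent spaces; the link is that the least tangent dimension grows
  strictly from a proper closed irreducible subset to the irreducible set around it. Extension
  across the singular locus would follow from its having codimension at least two; instead, an ideal
  of denominators, maximal among its kind, is shown to vanish at some regular point, where a
  denominator outside it exists. Forms are known only on tangent vectors of X, but are
  differentiated in the ambient space: Cartan's formula is applied to rational representatives, and
  their ambiguity, 1-forms vanishing along X, has no exterior derivative on tangent pairs. The path
  of parameters is complex, because the segment from 0 to 1 may meet zeros of the determinant, while
  time stays real. The flow is linear because a good action makes functions of weight 0 constant, so
  that every weight space of the coordinate ring is finite-dimensional.\<close>

lemma polyfun_uminus: "polyfun f \<Longrightarrow> polyfun (\<lambda>x. - f x)"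
  using polyfun.mult[OF polyfun.const[of "-1"]] by force

lemma polyfun_diff: "polyfun f \<Longrightarrow> polyfun g \<Longrightarrow> polyfun (\<lambda>x. f x - g x)"
  using polyfun.add[OF _ polyfun_uminus] by force

lemma polyfun_sum: "(\<And>i. i \<in> I \<Longrightarrow> polyfun (f i)) \<Longrightarrow> polyfun (\<lambda>x. \<Sum>i\<in>I. f i x)"
  by (induction I rule: infinite_finite_induct) (auto intro: polyfun.intros)

lemma polyfun_prod: "(\<And>i. i \<in> I \<Longrightarrow> polyfun (f i)) \<Longrightarrow> polyfun (\<lambda>x. \<Prod>i\<in>I. f i x)"
  by (induction I rule: infinite_finite_induct) (auto intro: polyfun.intros)

lemma polyfun_power: "polyfun f \<Longrightarrow> polyfun (\<lambda>x. f x ^ k)"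
  by (induction k) (auto intro: polyfun.intros)

lemmas polyfun_intros = polyfun.intros polyfun_uminus polyfun_diff polyfun_sum polyfun_prod polyfun_power

text \<open>Recording which coordinates occur allows inductions that bring in one coordinate at a
  time, in the basis theorem and in the elimination argument.\<close>

inductive polyfun_in :: "'n set \<Rightarrow> (complex^'n \<Rightarrow> complex) \<Rightarrow> bool" for S where
  const: "polyfun_in S (\<lambda>x. c)"
| coord: "i \<in> S \<Longrightarrow> polyfun_in S (\<lambda>x. x $ i)"
| add: "polyfun_in S f \<Longrightarrow> polyfun_in S g \<Longrightarrow> polyfun_in S (\<lambda>x. f x + g x)"
| mult: "polyfun_in S f \<Longrightarrow> polyfun_in S g \<Longrightarrow> polyfun_in S (\<lambda>x. f x * g x)"

lemma polyfun_in_imp: "polyfun_in S f \<Longrightarrow> polyfun f"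
  by (induction rule: polyfun_in.induct) (auto intro: polyfun.intros)

lemma polyfun_in_UNIV: "polyfun f \<Longrightarrow> polyfun_in UNIV f"
  by (induction rule: polyfun.induct) (auto intro: polyfun_in.intros)

lemma polyfun_in_sum: "(\<And>i. i \<in> I \<Longrightarrow> polyfun_in S (f i)) \<Longrightarrow> polyfun_in S (\<lambda>x. \<Sum>i\<in>I. f i x)"
  by (induction I rule: infinite_finite_induct) (auto intro: polyfun_in.intros)

lemma polyfun_in_cong: "polyfun_in S f \<Longrightarrow> (\<And>i. i \<in> S \<Longrightarrow> x $ i = y $ i) \<Longrightarrow> f x = f y"
  by (induction rule: polyfun_in.induct) auto

lemma polyfun_compose:
  assumes "polyfun f" "\<And>i. polyfun (\<lambda>x. y x $ i)"
  shows "polyfun (\<lambda>x. f (y x))"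
  using assms(1) by induction (auto intro: polyfun.intros assms(2))

section \<open>Partial and directional derivatives of polynomial functions\<close>

definition pd :: "'n \<Rightarrow> (complex^'n \<Rightarrow> complex) \<Rightarrow> complex^'n \<Rightarrow> complex" where
  "pd i f x = frechet_derivative f (at x) (axis i 1)"

text \<open>\<open>frechet_derivative\<close> is linear over the reals only. Built from partial
  derivatives, \<open>dd\<close> is complex linear in v by definition, and it agrees with
  \<open>frechet_derivative\<close> on polynomial functions.\<close>

definition dd :: "(complex^'n \<Rightarrow> complex) \<Rightarrow> complex^'n \<Rightarrow> complex^'n \<Rightarrow> complex" where
  "dd f x v = (\<Sum>i\<in>UNIV. v $ i * pd i f x)"

lemma has_derivative_pdI:
  assumes "(f has_derivative (\<lambda>v. \<Sum>i\<in>UNIV. v $ i * g i)) (at x)"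
  shows "pd i f x = g i"
proof -
  have "frechet_derivative f (at x) = (\<lambda>v. \<Sum>i\<in>UNIV. v $ i * g i)"
    using frechet_derivative_at[OF assms] by simp
  then show ?thesis
    by (simp add: pd_def axis_def if_distrib[where f="\<lambda>z. z * _"] cong: if_cong)
qed

text \<open>The gradient is built along with the polynomial; uniqueness of derivatives
  (\<open>has_derivative_pdI\<close>) then identifies it with \<open>pd\<close>, which is how
  partial derivatives inherit polynomiality and the coordinate set S.\<close>

lemma polyfun_in_derivative_aux:
  assumes "polyfun_in S f"
  shows "\<exists>g. (\<forall>i. polyfun_in S (g i)) \<and> (\<forall>i. i \<notin> S \<longrightarrow> g i = (\<lambda>_. 0)) \<and>
             (\<forall>x. (f has_derivative (\<lambda>v. \<Sum>i\<in>UNIV. v $ i * g i x)) (at x))"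
  using assms
proof induction
  case (const c)
  show ?case by (rule exI[of _ "\<lambda>i x. 0"]) (auto intro: polyfun_in.const)
next
  case (coord i)
  have "((\<lambda>x. x $ i) has_derivative (\<lambda>v::complex^'a. \<Sum>j\<in>UNIV. v $ j * (if j = i then 1 else 0))) (at x)" for x
    by (auto simp: if_distrib[where f="\<lambda>z. _ * z"] cong: if_cong
        intro: bounded_linear_imp_has_derivative bounded_linear_vec_nth)
  then show ?case using coord
    by (intro exI[of _ "\<lambda>j x. if j = i then 1 else 0"]) (auto intro: polyfun_in.const)
next
  case (add f g)
  then obtain f' g' where
    f: "\<And>i. polyfun_in S (f' i)" "\<And>i. i \<notin> S \<Longrightarrow> f' i = (\<lambda>_. 0)"
       "\<And>x. (f has_derivative (\<lambda>v. \<Sum>i\<in>UNIV. v $ i * f' i x)) (at x)" and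
    g: "\<And>i. polyfun_in S (g' i)" "\<And>i. i \<notin> S \<Longrightarrow> g' i = (\<lambda>_. 0)"
       "\<And>x. (g has_derivative (\<lambda>v. \<Sum>i\<in>UNIV. v $ i * g' i x)) (at x)" by blast
  have "((\<lambda>x. f x + g x) has_derivative (\<lambda>v. \<Sum>i\<in>UNIV. v $ i * (f' i x + g' i x))) (at x)" for x
    using has_derivative_add[OF f(3) g(3), of x] by (simp add: sum.distrib distrib_left)
  then show ?case using f g
    by (intro exI[of _ "\<lambda>i x. f' i x + g' i x"]) (auto intro: polyfun_in.add)
next
  case (mult f g)
  then obtain f' g' where
    f: "\<And>i. polyfun_in S (f' i)" "\<And>i. i \<notin> S \<Longrightarrow> f' i = (\<lambda>_. 0)"
       "\<And>x. (f has_derivative (\<lambda>v. \<Sum>i\<in>UNIV. v $ i * f' i x)) (at x)" and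
    g: "\<And>i. polyfun_in S (g' i)" "\<And>i. i \<notin> S \<Longrightarrow> g' i = (\<lambda>_. 0)"
       "\<And>x. (g has_derivative (\<lambda>v. \<Sum>i\<in>UNIV. v $ i * g' i x)) (at x)" by blast
  have "((\<lambda>x. f x * g x) has_derivative (\<lambda>v. \<Sum>i\<in>UNIV. v $ i * (f x * g' i x + f' i x * g x))) (at x)" for x
    using has_derivative_mult[OF f(3) g(3), of x]
    by (simp add: sum.distrib distrib_left sum_distrib_left sum_distrib_right algebra_simps)
  then show ?case using f g mult
    by (intro exI[of _ "\<lambda>i x. f x * g' i x + f' i x * g x"]) (auto intro!: polyfun_in.add polyfun_in.mult)
qed

lemma polyfun_in_pd:
  assumes "polyfun_in S f"
  shows "polyfun_in S (pd i f)" "i \<notin> S \<Longrightarrow> pd i f x = 0"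
proof -
  obtain g where g: "\<And>i. polyfun_in S (g i)" "\<And>i. i \<notin> S \<Longrightarrow> g i = (\<lambda>_. 0)"
       "\<And>x. (f has_derivative (\<lambda>v. \<Sum>i\<in>UNIV. v $ i * g i x)) (at x)"
    using polyfun_in_derivative_aux[OF assms] by blast
  have "pd i f = g i" for i using has_derivative_pdI[OF g(3)] by blast
  with g show "polyfun_in S (pd i f)" "i \<notin> S \<Longrightarrow> pd i f x = 0" by auto
qed

lemma polyfun_pd: "polyfun f \<Longrightarrow> polyfun (pd i f)"
  using polyfun_in_pd(1) polyfun_in_UNIV polyfun_in_imp by blast

lemma polyfun_has_derivative: "polyfun f \<Longrightarrow> (f has_derivative dd f x) (at x)"
proof -
  assume "polyfun f"
  then obtain g where g: "\<And>x. (f has_derivative (\<lambda>v. \<Sum>i\<in>UNIV. v $ i * g i x)) (at x)"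
    using polyfun_in_derivative_aux[OF polyfun_in_UNIV] by blast
  have "pd i f = g i" for i using has_derivative_pdI[OF g] by blast
  then show ?thesis using g[of x] by (simp add: dd_def[abs_def])
qed

lemma polyfun_frechet: "polyfun f \<Longrightarrow> frechet_derivative f (at x) v = dd f x v"
  using frechet_derivative_at[OF polyfun_has_derivative] by metis

lemma polyfun_dd: "polyfun f \<Longrightarrow> polyfun (\<lambda>x. dd f x v)"
  unfolding dd_def by (intro polyfun_intros polyfun_pd)

lemma ddI:
  assumes "polyfun f" "(f has_derivative f') (at x)"
  shows "dd f x v = f' v"
  using has_derivative_unique[OF polyfun_has_derivative[OF assms(1)] assms(2)] by simp

lemma dd_const [simp]: "dd (\<lambda>x. c) x v = 0"
  by (rule ddI) (auto intro: polyfun_intros)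

lemma dd_coord [simp]: "dd (\<lambda>x. x $ i) x v = v $ i"
  by (rule ddI) (auto intro: polyfun_intros bounded_linear_imp_has_derivative bounded_linear_vec_nth)

lemma dd_plus: "polyfun f \<Longrightarrow> polyfun g \<Longrightarrow> dd (\<lambda>x. f x + g x) x v = dd f x v + dd g x v"
  by (rule ddI) (auto intro!: polyfun_intros derivative_eq_intros polyfun_has_derivative)

lemma dd_minus: "polyfun f \<Longrightarrow> polyfun g \<Longrightarrow> dd (\<lambda>x. f x - g x) x v = dd f x v - dd g x v"
  by (rule ddI) (auto intro!: polyfun_intros derivative_eq_intros polyfun_has_derivative)

lemma dd_mult: "polyfun f \<Longrightarrow> polyfun g \<Longrightarrow> dd (\<lambda>x. f x * g x) x v = f x * dd g x v + dd f x v * g x"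
  by (rule ddI) (auto intro!: polyfun_intros derivative_eq_intros polyfun_has_derivative)

lemma dd_sum: "(\<And>i. i \<in> I \<Longrightarrow> polyfun (f i)) \<Longrightarrow>
    dd (\<lambda>x. \<Sum>i\<in>I. f i x) x v = (\<Sum>i\<in>I. dd (f i) x v)"
proof (induction I rule: infinite_finite_induct)
  case (insert i I)
  then show ?case by (simp add: dd_plus polyfun_sum)
qed auto

lemma dd_cmult: "polyfun f \<Longrightarrow> dd (\<lambda>x. c * f x) x v = c * dd f x v"
  by (subst dd_mult) (auto intro: polyfun_intros)

lemma dd_vadd: "dd f x (v + w) = dd f x v + dd f x w"
  and dd_vscale: "dd f x (c *s v) = c * dd f x v"
  and dd_vdiff: "dd f x (v - w) = dd f x v - dd f x w"
  and dd_vzero [simp]: "dd f x 0 = 0"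
  by (auto simp: dd_def distrib_right sum.distrib sum_distrib_left algebra_simps sum_subtractf)

lemma dd_axis: "dd f x (axis i 1) = pd i f x"
  by (simp add: dd_def axis_def if_distrib[where f="\<lambda>z. z * _"] cong: if_cong)

lemma dd_compose:
  assumes f: "polyfun f" and y: "\<And>i. polyfun (\<lambda>x. y x $ i)"
  shows "dd (\<lambda>x. f (y x)) x v = dd f (y x) (\<chi> i. dd (\<lambda>x. y x $ i) x v)"
  using f
proof induction
  case (add f g)
  then show ?case
    using polyfun_compose[OF _ y] by (simp add: dd_plus)
next
  case (mult f g)
  then show ?case
    using polyfun_compose[OF _ y] by (simp add: dd_mult)
qed (simp_all)

text \<open>Symmetry of the Hessian; it is what finally removes the exterior derivative in
  \<open>vanishing_one_form_closed\<close>.\<close>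

lemma dd_commute:
  assumes "polyfun f"
  shows "dd (\<lambda>x. dd f x v) x w = dd (\<lambda>x. dd f x w) x v"
  using assms
proof induction
  case (add f g)
  then show ?case by (simp add: dd_plus polyfun_dd)
next
  case (mult f g)
  then show ?case by (simp add: dd_plus dd_mult polyfun_dd polyfun_intros)
qed simp_all

lemma polyfun_line:
  assumes "polyfun f"
  shows "\<exists>p. \<forall>t. f (z + t *s w) = poly p t \<and> dd f (z + t *s w) w = poly (pderiv p) t"
  using assms
proof induction
  case (const c)
  show ?case by (rule exI[of _ "[:c:]"]) (simp add: pderiv_pCons)
next
  case (coord i)
  show ?case by (rule exI[of _ "[:z $ i, w $ i:]"]) (simp add: pderiv_pCons)
next
  case (add f g)
  then obtain p q where "\<forall>t. f (z + t *s w) = poly p t \<and> dd f (z + t *s w) w = poly (pderiv p) t"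
    "\<forall>t. g (z + t *s w) = poly q t \<and> dd g (z + t *s w) w = poly (pderiv q) t" by blast
  then show ?case using add
    by (intro exI[of _ "p + q"]) (simp add: dd_plus pderiv_add)
next
  case (mult f g)
  then obtain p q where "\<forall>t. f (z + t *s w) = poly p t \<and> dd f (z + t *s w) w = poly (pderiv p) t"
    "\<forall>t. g (z + t *s w) = poly q t \<and> dd g (z + t *s w) w = poly (pderiv q) t" by blast
  then show ?case using mult
    by (intro exI[of _ "p * q"]) (simp add: dd_mult pderiv_mult algebra_simps)
qed

text \<open>Along the line through z in direction w the function is a polynomial in one variable
  whose n-th coefficient is the n-th derivative at z divided by n!; the claim concerns its value at
  parameter 1.\<close>

lemma polyfun_zero_of_line_derivatives:
  assumes f: "polyfun f" and z: "\<And>n. ((\<lambda>g x. dd g x w) ^^ n) f z = 0"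
  shows "f (z + w) = 0"
proof -
  define D where "D = (\<lambda>g x. dd g x w)"
  have pD: "polyfun ((D ^^ n) f)" for n
    by (induction n) (use f in \<open>auto simp: D_def intro: polyfun_dd\<close>)
  obtain p where p: "\<And>t. f (z + t *s w) = poly p t" using polyfun_line[OF f] by blast
  have "\<forall>t. (D ^^ n) f (z + t *s w) = poly ((pderiv ^^ n) p) t" for n
  proof (induction n)
    case (Suc n)
    obtain q where q: "\<forall>t. (D ^^ n) f (z + t *s w) = poly q t \<and> dd ((D ^^ n) f) (z + t *s w) w = poly (pderiv q) t"
      using polyfun_line[OF pD[of n], of z w] by blast
    with Suc have "poly q = poly ((pderiv ^^ n) p)" by (auto simp: fun_eq_iff)
    then have "q = (pderiv ^^ n) p" by (simp only: poly_eq_poly_eq_iff)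
    with q show ?case by (simp add: D_def)
  qed (use p in simp)
  from this[THEN spec, of _ 0] z have "poly ((pderiv ^^ n) p) 0 = 0" for n by (simp add: D_def)
  then have "coeff p n = 0" for n
    by (simp add: poly_0_coeff_0 coeff_higher_pderiv pochhammer_fact[symmetric])
  then have "p = 0" by (simp add: poly_eq_iff)
  with p[of 1] show ?thesis by simp
qed


section \<open>Vanishing ideals and irreducibility\<close>

definition vanishing :: "(complex^'n) set \<Rightarrow> (complex^'n \<Rightarrow> complex) set" where
  "vanishing X = {f. polyfun f \<and> (\<forall>x\<in>X. f x = 0)}"

text \<open>Primeness of the vanishing ideal, phrased for arbitrary subsets so that it passes to
  images under polynomial maps (\<open>irr_image\<close>), which may fail to be closed.\<close>

definition irr :: "(complex^'n) set \<Rightarrow> bool" where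
  "irr X \<longleftrightarrow> X \<noteq> {} \<and> (\<forall>f g. polyfun f \<and> polyfun g \<and> (\<forall>x\<in>X. f x * g x = 0) \<longrightarrow>
      (\<forall>x\<in>X. f x = 0) \<or> (\<forall>x\<in>X. g x = 0))"

text \<open>Density of the nonempty open set where g does not vanish. Many identities below are
  checked only on such a set.\<close>

lemma irr_mult:
  assumes "irr X" "polyfun f" "polyfun g" "\<And>x. x \<in> X \<Longrightarrow> g x \<noteq> 0 \<Longrightarrow> f x = 0" "x0 \<in> X" "g x0 \<noteq> 0" "x \<in> X"
  shows "f x = 0"
proof -
  have "\<forall>x\<in>X. f x * g x = 0" using assms(4) by auto
  with assms show ?thesis unfolding irr_def by blast
qed

lemma irr_nonzero_mult:
  assumes "irr X" "polyfun f" "polyfun g" "x0 \<in> X" "f x0 \<noteq> 0" "x1 \<in> X" "g x1 \<noteq> 0"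
  obtains x where "x \<in> X" "f x \<noteq> 0" "g x \<noteq> 0"
  using assms irr_mult by blast

lemma zariski_closed_vanishing:
  assumes "zariski_closed X" "\<And>f. f \<in> vanishing X \<Longrightarrow> f x = 0"
  shows "x \<in> X"
proof -
  obtain S where S: "\<forall>f\<in>S. polyfun f" "X = {x. \<forall>f\<in>S. f x = 0}"
    using assms(1) unfolding zariski_closed_def by blast
  then have "S \<subseteq> vanishing X" unfolding vanishing_def by auto
  with assms(2) S show ?thesis by auto
qed

lemma zariski_closed_Int: 
  assumes "zariski_closed X" "polyfun f" shows "zariski_closed {x\<in>X. f x = 0}"
proof -
  obtain S where S: "\<forall>f\<in>S. polyfun f" "X = {x. \<forall>f\<in>S. f x = 0}"
    using assms(1) unfolding zariski_closed_def by blast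
  with assms(2) show ?thesis unfolding zariski_closed_def
    by (intro exI[of _ "insert f S"]) auto
qed

lemma affine_variety_irr:
  assumes "affine_variety X" shows "irr X"
  unfolding irr_def
proof (intro conjI allI impI)
  show "X \<noteq> {}" using assms by (simp add: affine_variety_def)
  fix f g :: "complex^'a \<Rightarrow> complex" assume *: "polyfun f \<and> polyfun g \<and> (\<forall>x\<in>X. f x * g x = 0)"
  then have "X = {x\<in>X. f x = 0} \<union> {x\<in>X. g x = 0}" by auto
  moreover have "zariski_closed {x\<in>X. f x = 0}" "zariski_closed {x\<in>X. g x = 0}"
    using * assms by (auto simp: affine_variety_def intro: zariski_closed_Int)
  ultimately have "X = {x\<in>X. f x = 0} \<or> X = {x\<in>X. g x = 0}"
    using assms unfolding affine_variety_def by blast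
  then show "(\<forall>x\<in>X. f x = 0) \<or> (\<forall>x\<in>X. g x = 0)" by blast
qed

lemma tangent_space_iff: "v \<in> tangent_space X p \<longleftrightarrow> (\<forall>f\<in>vanishing X. dd f p v = 0)"
  by (auto simp: tangent_space_def vanishing_def polyfun_frechet)

lemma tangent_space_subspace: "vec.subspace (tangent_space X p)"
  by (auto simp: vec.subspace_def tangent_space_iff dd_vadd dd_vscale)

lemma vanishing_pointwise_dd:
  assumes "polyfun f" "polyfun g" "\<And>x. x \<in> X \<Longrightarrow> f x = g x" "v \<in> tangent_space X p"
  shows "dd f p v = dd g p v"
proof -
  have "(\<lambda>x. f x - g x) \<in> vanishing X" using assms by (auto simp: vanishing_def intro: polyfun_intros)
  then have "dd (\<lambda>x. f x - g x) p v = 0" using assms(4) unfolding tangent_space_iff by blast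
  then show ?thesis by (simp add: dd_minus[OF assms(1,2)])
qed

section \<open>Noetherian subrings\<close>

definition subring :: "'a::comm_ring_1 set \<Rightarrow> bool" where
  "subring A \<longleftrightarrow> 0 \<in> A \<and> 1 \<in> A \<and> (\<forall>a\<in>A. \<forall>b\<in>A. a + b \<in> A \<and> a * b \<in> A \<and> - a \<in> A)"

inductive_set idl :: "'a::comm_ring_1 set \<Rightarrow> 'a set \<Rightarrow> 'a set" for A S where
  zero: "0 \<in> idl A S"
| step: "r \<in> A \<Longrightarrow> s \<in> S \<Longrightarrow> y \<in> idl A S \<Longrightarrow> r * s + y \<in> idl A S"

text \<open>The ascending chain condition as a statement on sequences. Subrings are sets inside one
  type, so that polynomials in different sets of coordinates can be compared.\<close>

definition noeth :: "'a::comm_ring_1 set \<Rightarrow> bool" where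
  "noeth A \<longleftrightarrow> (\<forall>a::nat\<Rightarrow>'a. range a \<subseteq> A \<longrightarrow> (\<exists>N. a N \<in> idl A (a ` {..<N})))"

definition adjoin :: "'a::comm_ring_1 set \<Rightarrow> 'a \<Rightarrow> 'a set" where
  "adjoin A x = {poly p x | p. \<forall>k. coeff p k \<in> A}"

lemma idl_mono: "y \<in> idl A S \<Longrightarrow> S \<subseteq> T \<Longrightarrow> y \<in> idl A T"
  by (induction rule: idl.induct) (auto intro: idl.intros)

lemma idl_base: "subring A \<Longrightarrow> s \<in> S \<Longrightarrow> s \<in> idl A S"
  using idl.step[of 1 A s S 0] idl.zero by (auto simp: subring_def)

lemma idl_add: "y \<in> idl A S \<Longrightarrow> z \<in> idl A S \<Longrightarrow> y + z \<in> idl A S"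
  by (induction rule: idl.induct) (auto simp: add.assoc intro: idl.intros)

lemma idl_mult:
  assumes "subring A" "r \<in> A" "y \<in> idl A S" shows "r * y \<in> idl A S"
  using assms(3)
proof induction
  case (step q s y)
  have "r * (q * s + y) = (r * q) * s + r * y" by (simp add: algebra_simps)
  with step assms show ?case by (auto simp: subring_def intro: idl.step)
qed (auto intro: idl.zero)

lemma idl_trans:
  assumes "subring A" "y \<in> idl A S" "S \<subseteq> idl A T" shows "y \<in> idl A T"
  using assms(2) by induction (use assms in \<open>auto intro: idl.zero idl_add idl_mult\<close>)

lemma idl_sum:
  assumes "subring A" "finite T" "y \<in> idl A T"
  shows "\<exists>c. range c \<subseteq> A \<and> y = (\<Sum>t\<in>T. c t * t)"
  using assms(3)
proof induction
  case zero
  show ?case using assms by (intro exI[of _ "\<lambda>_. 0"]) (auto simp: subring_def)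
next
  case (step r s y)
  then obtain c where c: "range c \<subseteq> A" "y = (\<Sum>t\<in>T. c t * t)" by blast
  define d where "d = (\<lambda>t. c t + (if t = s then r else 0))"
  have "range d \<subseteq> A" using c step assms by (auto simp: d_def subring_def)
  moreover have "r * s + y = (\<Sum>t\<in>T. d t * t)"
    using c step assms by (simp add: d_def distrib_right sum.distrib if_distrib[where f="\<lambda>z. z * _"] cong: if_cong)
  ultimately show ?case by blast
qed

lemma idl_finite_support:
  assumes "y \<in> idl A (range P)" shows "\<exists>n::nat. y \<in> idl A (P ` {..<n})"
  using assms
proof induction
  case zero
  show ?case by (auto intro: idl.zero)
next
  case (step r s y)
  then obtain n m where "y \<in> idl A (P ` {..<n})" "s = P m" by blast
  then have "r * s + y \<in> idl A (P ` {..<max n (Suc m)})"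
    using step by (intro idl.step) (auto intro: idl_mono)
  then show ?case by blast
qed

lemma idl_finite_support':
  assumes "\<And>i::nat. i < k \<Longrightarrow> f i \<in> idl A (range P)" shows "\<exists>n::nat. f ` {..<k} \<subseteq> idl A (P ` {..<n})"
  using assms
proof (induction k)
  case (Suc k)
  then obtain n m where "f ` {..<k} \<subseteq> idl A (P ` {..<n})" "f k \<in> idl A (P ` {..<m})"
    using idl_finite_support[of "f k"] by (metis less_Suc_eq lessI)
  then have "f ` {..<Suc k} \<subseteq> idl A (P ` {..<max n m})"
    using idl_mono[of _ A "P ` {..<n}" "P ` {..<max n m}"] idl_mono[of _ A "P ` {..<m}" "P ` {..<max n m}"]
    by (force simp: less_Suc_eq)
  then show ?case by blast
qed auto

text \<open>Dependent choice with memory: the state is the set chosen so far together with the next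
  element, and only afterwards is that set recognised as the image of an initial segment.\<close>

lemma finite_subset_choice:
  assumes "\<And>S. finite S \<Longrightarrow> S \<subseteq> J \<Longrightarrow> \<exists>r\<in>J. R S r"
  shows "\<exists>f. \<forall>k::nat. f k \<in> J \<and> R (f ` {..<k}) (f k)"
proof -
  have "\<exists>F. \<forall>k::nat. (finite (fst (F k)) \<and> fst (F k) \<subseteq> J \<and> snd (F k) \<in> J \<and> R (fst (F k)) (snd (F k)) \<and> (k = 0 \<longrightarrow> fst (F k) = {}))
      \<and> fst (F (Suc k)) = insert (snd (F k)) (fst (F k))"
  proof (rule dependent_nat_choice)
    show "\<exists>x. finite (fst x) \<and> fst x \<subseteq> J \<and> snd x \<in> J \<and> R (fst x) (snd x) \<and> ((0::nat) = 0 \<longrightarrow> fst x = {})"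
      using assms[of "{}"] by auto
  next
    fix x and n :: nat assume x: "finite (fst x) \<and> fst x \<subseteq> J \<and> snd x \<in> J \<and> R (fst x) (snd x) \<and> (n = 0 \<longrightarrow> fst x = {})"
    then obtain r where "r \<in> J" "R (insert (snd x) (fst x)) r"
      using assms[of "insert (snd x) (fst x)"] by blast
    with x show "\<exists>y. (finite (fst y) \<and> fst y \<subseteq> J \<and> snd y \<in> J \<and> R (fst y) (snd y) \<and> (Suc n = 0 \<longrightarrow> fst y = {})) \<and>
        fst y = insert (snd x) (fst x)"
      by (intro exI[of _ "(insert (snd x) (fst x), r)"]) simp
  qed
  then obtain F where F0: "\<forall>k::nat. (finite (fst (F k)) \<and> fst (F k) \<subseteq> J \<and> snd (F k) \<in> J \<and> R (fst (F k)) (snd (F k)) \<and> (k = 0 \<longrightarrow> fst (F k) = {}))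
      \<and> fst (F (Suc k)) = insert (snd (F k)) (fst (F k))" by (rule exE)
  have F: "snd (F k) \<in> J \<and> R (fst (F k)) (snd (F k))"
    "fst (F 0) = {}" "fst (F (Suc k)) = insert (snd (F k)) (fst (F k))" for k :: nat
    using F0[THEN spec, of k] F0[THEN spec, of 0] by simp_all
  have "fst (F k) = (\<lambda>k. snd (F k)) ` {..<k}" for k
    by (induction k) (use F in \<open>auto simp: lessThan_Suc\<close>)
  with F(1) show ?thesis by (intro exI[of _ "\<lambda>k. snd (F k)"]) metis
qed

lemma subring_sum: "subring A \<Longrightarrow> (\<And>i. i \<in> I \<Longrightarrow> f i \<in> A) \<Longrightarrow> sum f I \<in> A"
  by (induction I rule: infinite_finite_induct) (auto simp: subring_def)

lemma subring_polys:
  assumes "subring A" shows "subring {p. \<forall>k. coeff p k \<in> A}"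
  using assms by (auto simp: subring_def coeff_mult intro!: subring_sum[OF assms])

lemma subring_adjoin:
  assumes "subring A" shows "subring (adjoin A x)"
proof -
  have P: "subring {p. \<forall>k. coeff p k \<in> A}" by (rule subring_polys[OF assms])
  have "adjoin A x = (\<lambda>p. poly p x) ` {p. \<forall>k. coeff p k \<in> A}" by (auto simp: adjoin_def)
  moreover have "subring ((\<lambda>p. poly p x) ` {p. \<forall>k. coeff p k \<in> A})"
    unfolding subring_def
  proof (intro conjI ballI)
    let ?P = "{p. \<forall>k. coeff p k \<in> A}"
    show "0 \<in> (\<lambda>p. poly p x) ` ?P" "1 \<in> (\<lambda>p. poly p x) ` ?P"
      using P imageI[of 0 ?P "\<lambda>p. poly p x"] imageI[of 1 ?P "\<lambda>p. poly p x"] unfolding subring_def by simp_all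
    fix a b assume "a \<in> (\<lambda>p. poly p x) ` ?P" "b \<in> (\<lambda>p. poly p x) ` ?P"
    then obtain p q where pq: "p \<in> ?P" "q \<in> ?P" "a = poly p x" "b = poly q x" by blast
    then have "p + q \<in> ?P" "p * q \<in> ?P" "- p \<in> ?P" using P unfolding subring_def by blast+
    then show "a + b \<in> (\<lambda>p. poly p x) ` ?P" "a * b \<in> (\<lambda>p. poly p x) ` ?P" "- a \<in> (\<lambda>p. poly p x) ` ?P"
      unfolding pq(3,4) poly_add[symmetric] poly_mult[symmetric] poly_minus[symmetric] by blast+
  qed
  ultimately show ?thesis by simp
qed

text \<open>Hilbert's basis theorem: choose elements of least degree outside the ideal of their
  predecessors. A relation among the leading coefficients lets an element of that ideal cancel the
  leading term of one of them, against the minimality of its degree.\<close>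

lemma noeth_polys:
  assumes A: "subring (A::'a::comm_ring_1 set)" "noeth A"
  shows "noeth {p. \<forall>k. coeff p k \<in> A}" (is "noeth ?P")
  unfolding noeth_def
proof (intro allI impI, rule ccontr)
  fix P :: "nat \<Rightarrow> 'a poly" assume P: "range P \<subseteq> ?P" and no: "\<nexists>N. P N \<in> idl ?P (P ` {..<N})"
  have S: "subring ?P" by (rule subring_polys[OF A(1)])
  define J where "J = idl ?P (range P)"
  have JP: "J \<subseteq> ?P"
  proof
    fix y assume "y \<in> J"
    then show "y \<in> ?P" unfolding J_def
    proof induction
      case (step r s y)
      then have "s \<in> ?P" using P by auto
      with step S show ?case unfolding subring_def by blast
    qed (use A in \<open>auto simp: subring_def\<close>)
  qed
  \<comment> \<open>A finite T inside J lies in the ideal of finitely many terms of P, so the next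
    term escapes the ideal of T; among the elements that escape, one of least degree is
    taken.\<close>
  have "\<exists>r\<in>J. r \<notin> idl ?P T \<and> (\<forall>g\<in>J. g \<notin> idl ?P T \<longrightarrow> degree r \<le> degree g)"
    if T: "finite T" "T \<subseteq> J" for T
  proof -
    obtain f and k :: nat where fk: "T = f ` {..<k}"
      using finite_imp_nat_seg_image_inj_on[OF T(1)] by (auto simp: lessThan_def)
    obtain n where n: "f ` {..<k} \<subseteq> idl ?P (P ` {..<n})"
      using idl_finite_support'[of k f ?P P] T fk unfolding J_def by blast
    have "P n \<notin> idl ?P T" using no idl_trans[OF S _ n] fk by blast
    moreover have "P n \<in> J" unfolding J_def by (rule idl_base[OF S]) auto
    ultimately show ?thesis
      using ex_has_least_nat[of "\<lambda>r. r \<in> J \<and> r \<notin> idl ?P T" "P n" degree] by blast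
  qed
  from finite_subset_choice[of J "\<lambda>T r. r \<notin> idl ?P T \<and> (\<forall>g\<in>J. g \<notin> idl ?P T \<longrightarrow> degree r \<le> degree g)", OF this]
  obtain f where f0: "\<forall>k::nat. f k \<in> J \<and> f k \<notin> idl ?P (f ` {..<k}) \<and>
      (\<forall>g\<in>J. g \<notin> idl ?P (f ` {..<k}) \<longrightarrow> degree (f k) \<le> degree g)" by (rule exE)
  have f: "f k \<in> J" "f k \<notin> idl ?P (f ` {..<k})" for k using f0[THEN spec, of k] by simp_all
  have fmin: "degree (f k) \<le> degree g" if "g \<in> J" "g \<notin> idl ?P (f ` {..<k})" for k g
    using f0[THEN spec, of k] that by blast
  have deg: "degree (f i) \<le> degree (f k)" if "i < k" for i k
  proof (rule fmin[OF f(1)])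
    have "f ` {..<i} \<subseteq> f ` {..<k}" using that by (intro image_mono) auto
    then show "f k \<notin> idl ?P (f ` {..<i})" using f(2)[of k] idl_mono[of "f k" ?P "f ` {..<i}" "f ` {..<k}"] by blast
  qed
  define b where "b k = coeff (f k) (degree (f k))" for k
  have "range b \<subseteq> A" using f(1) JP by (auto simp: b_def)
  then obtain N where N: "b N \<in> idl A (b ` {..<N})" using A(2) unfolding noeth_def by blast
  \<comment> \<open>Degrees are nondecreasing along f, so each f i with i < N can be shifted up to
    the degree of f N by a monomial.\<close>
  have key: "\<exists>h \<in> idl ?P (f ` {..<N}). h \<in> J \<and> degree h \<le> degree (f N) \<and> coeff h (degree (f N)) = y"
    if "y \<in> idl A (b ` {..<N})" for y
    using that
  proof induction
    case zero
    show ?case by (rule bexI[of _ 0]) (auto simp: J_def intro: idl.zero)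
  next
    case (step r s y)
    then obtain h i where h: "h \<in> idl ?P (f ` {..<N})" "h \<in> J" "degree h \<le> degree (f N)" "coeff h (degree (f N)) = y"
      and i: "i < N" "s = b i" by blast
    define m where "m = monom r (degree (f N) - degree (f i))"
    have m: "m \<in> ?P" using step A by (auto simp: m_def subring_def)
    have "degree (m * f i + h) \<le> degree (f N)"
      using h(3) deg[OF i(1)] degree_mult_le[of m "f i"] degree_monom_le[of r "degree (f N) - degree (f i)"]
      by (intro degree_add_le) (auto simp: m_def)
    moreover have "coeff (m * f i + h) (degree (f N)) = r * s + y"
      using h i deg[OF i(1)] by (simp add: m_def coeff_monom_mult b_def)
    moreover have "m * f i + h \<in> idl ?P (f ` {..<N})" using m h i by (intro idl.step) auto
    moreover have "m * f i + h \<in> J" using m h f(1) S unfolding J_def by (intro idl_add idl_mult) auto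
    ultimately show ?case by blast
  qed
  obtain h where h: "h \<in> idl ?P (f ` {..<N})" "h \<in> J" "degree h \<le> degree (f N)" "coeff h (degree (f N)) = b N"
    using key[OF N] by blast
  define g where "g = f N - h"
  have n1: "- 1 \<in> ?P" using S unfolding subring_def by blast
  have "(-1) * h \<in> J" using h(2) unfolding J_def by (rule idl_mult[OF S n1])
  then have "f N + (-1) * h \<in> J" using f(1)[of N] unfolding J_def by (intro idl_add)
  then have gJ: "g \<in> J" by (simp add: g_def)
  have gn: "g \<notin> idl ?P (f ` {..<N})"
  proof
    assume "g \<in> idl ?P (f ` {..<N})"
    from idl_add[OF this h(1)] f(2)[of N] show False by (simp add: g_def)
  qed
  have "degree g \<le> degree (f N)" unfolding g_def using h(3) by (intro degree_diff_le) auto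
  moreover have "coeff g (degree (f N)) = 0" using h(4) by (simp add: g_def b_def)
  ultimately have "degree g < degree (f N) \<or> g = 0"
    using leading_coeff_0_iff[of g] le_neq_implies_less by metis
  moreover have "g \<noteq> 0" using gn idl.zero by metis
  ultimately show False using fmin[OF gJ gn] by linarith
qed

text \<open>Evaluation at x maps the polynomials over A onto \<open>adjoin A x\<close> and carries
  ideal relations to ideal relations.\<close>

theorem noeth_adjoin:
  assumes A: "subring (A::'a::comm_ring_1 set)" "noeth A"
  shows "noeth (adjoin A x)"
  unfolding noeth_def
proof (intro allI impI)
  fix a :: "nat \<Rightarrow> 'a" assume "range a \<subseteq> adjoin A x"
  then have "\<forall>i. \<exists>p. (\<forall>k. coeff p k \<in> A) \<and> a i = poly p x" by (fastforce simp: adjoin_def)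
  then obtain p where p: "\<And>i k. coeff (p i) k \<in> A" "\<And>i. a i = poly (p i) x" by metis
  then obtain N where N: "p N \<in> idl {p. \<forall>k. coeff p k \<in> A} (p ` {..<N})"
    using noeth_polys[OF A] unfolding noeth_def by blast
  have "poly q x \<in> idl (adjoin A x) (a ` {..<N})" if "q \<in> idl {p. \<forall>k. coeff p k \<in> A} (p ` {..<N})" for q
    using that
  proof induction
    case (step r s y)
    then have "poly r x \<in> adjoin A x" "poly s x \<in> a ` {..<N}" using p by (auto simp: adjoin_def)
    with step show ?case by (auto intro: idl.step)
  qed (auto intro: idl.zero)
  from this[OF N] show "\<exists>N. a N \<in> idl (adjoin A x) (a ` {..<N})" unfolding p(2)[symmetric] by blast
qed

lemma noeth_finite_generators:
  assumes A: "subring A" "noeth A" and S: "S \<subseteq> A"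
  shows "\<exists>S0. finite S0 \<and> S0 \<subseteq> S \<and> S \<subseteq> idl A S0"
proof (rule ccontr)
  assume no: "\<nexists>S0. finite S0 \<and> S0 \<subseteq> S \<and> S \<subseteq> idl A S0"
  have "\<exists>r\<in>S. r \<notin> idl A T" if "finite T" "T \<subseteq> S" for T
    using no that by blast
  from finite_subset_choice[of S "\<lambda>T r. r \<notin> idl A T", OF this]
  obtain f where f0: "\<forall>k::nat. f k \<in> S \<and> f k \<notin> idl A (f ` {..<k})" by (rule exE)
  then have "range f \<subseteq> A" using S by blast
  then obtain N where "f N \<in> idl A (f ` {..<N})" using A(2) unfolding noeth_def by blast
  with f0 show False by blast
qed


section \<open>The basis theorem for polynomial functions\<close>

lemma subring_polyfun_in: "subring {f. polyfun_in S f}"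
  unfolding subring_def func_plus func_times func_zero func_one
proof (auto intro: polyfun_in.const polyfun_in.add polyfun_in.mult)
  fix a assume "polyfun_in S a"
  from polyfun_in.mult[OF polyfun_in.const[of _ "-1"] this] show "polyfun_in S (- a)"
    by (simp add: fun_Compl_def)
qed

lemma subring_add: "subring A \<Longrightarrow> a \<in> A \<Longrightarrow> b \<in> A \<Longrightarrow> a + b \<in> A"
  and subring_mult: "subring A \<Longrightarrow> a \<in> A \<Longrightarrow> b \<in> A \<Longrightarrow> a * b \<in> A"
  by (simp_all add: subring_def)

lemma adjoin_base: "subring A \<Longrightarrow> a \<in> A \<Longrightarrow> a \<in> adjoin A x"
  unfolding adjoin_def by (rule CollectI, rule exI[of _ "[:a:]"]) (simp add: coeff_pCons subring_def split: nat.split)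

lemma adjoin_gen: "subring A \<Longrightarrow> x \<in> adjoin A x"
  unfolding adjoin_def by (rule CollectI, rule exI[of _ "[:0, 1:]"]) (simp add: coeff_pCons subring_def split: nat.split)

lemma polyfun_in_insert: "polyfun_in (insert j S) f \<Longrightarrow> f \<in> adjoin {f. polyfun_in S f} (\<lambda>x. x $ j)"
proof (induction rule: polyfun_in.induct)
  case (const c)
  show ?case by (rule adjoin_base[OF subring_polyfun_in]) (simp add: polyfun_in.const)
next
  case (coord i)
  show ?case
  proof (cases "i = j")
    case True
    then show ?thesis using adjoin_gen[OF subring_polyfun_in] by simp
  next
    case False
    with coord show ?thesis by (intro adjoin_base[OF subring_polyfun_in]) (simp add: polyfun_in.coord)
  qed
next
  case (add f g)
  show ?case using subring_add[OF subring_adjoin[OF subring_polyfun_in] add.IH] by (simp add: func_plus)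
next
  case (mult f g)
  show ?case using subring_mult[OF subring_adjoin[OF subring_polyfun_in] mult.IH] by (simp add: func_times)
qed

lemma polyfun_in_mono: "polyfun_in S f \<Longrightarrow> S \<subseteq> T \<Longrightarrow> polyfun_in T f"
  by (induction rule: polyfun_in.induct) (auto intro: polyfun_in.intros)

lemma poly_polyfun_in:
  assumes "\<forall>k. polyfun_in S (coeff p k)"
  shows "polyfun_in (insert j S) (poly p (\<lambda>x. x $ j))"
  using assms
proof (induction p)
  case 0
  show ?case by (simp add: func_zero polyfun_in.const)
next
  case (pCons a p)
  have "polyfun_in S a" "\<forall>k. polyfun_in S (coeff p k)"
    using pCons.prems by (metis coeff_pCons_0, metis coeff_pCons_Suc)
  with pCons.IH show ?case
    by (auto simp: func_plus func_times intro!: polyfun_in.add polyfun_in.mult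
        intro: polyfun_in.coord polyfun_in_mono)
qed

lemma adjoin_polyfun_in: "adjoin {f. polyfun_in S f} (\<lambda>x. x $ j) = {f. polyfun_in (insert j S) f}"
  using polyfun_in_insert poly_polyfun_in by (fastforce simp: adjoin_def)

lemma noeth_polyfun_in: "noeth {f. polyfun_in (S::'n::finite set) f}"
proof -
  have "finite S" by simp
  then show ?thesis
  proof induction
    case empty
    have c: "\<exists>c. f = (\<lambda>x. c)" if "polyfun_in {} f" for f :: "complex^'n \<Rightarrow> complex"
      using that by induction auto
    show ?case unfolding noeth_def
    proof (intro allI impI)
      fix a :: "nat \<Rightarrow> complex^'n \<Rightarrow> complex" assume a: "range a \<subseteq> {f. polyfun_in {} f}"
      then have "\<exists>c. a i = (\<lambda>x. c)" for i using c by blast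
      then obtain c where c: "\<And>i. a i = (\<lambda>x. c i)" by metis
      \<comment> \<open>The constants form a field: either a 0 is zero and lies in the zero ideal (N
        = 0), or a 1 is a multiple of a 0 (N = 1).\<close>
      show "\<exists>N. a N \<in> idl {f. polyfun_in {} f} (a ` {..<N})"
      proof (cases "c 0 = 0")
        case True
        then have "a 0 = 0" by (simp add: c func_zero)
        then show ?thesis by (metis idl.zero)
      next
        case False
        have "a 1 = (\<lambda>x. c 1 / c 0) * a 0 + 0" using False by (simp add: c func_times func_plus func_zero)
        also have "\<dots> \<in> idl {f. polyfun_in {} f} (a ` {..<1})"
          by (rule idl.step) (auto intro: idl.zero polyfun_in.const)
        finally show ?thesis by blast
      qed
    qed
  next
    case (insert j S)
    then show ?case using noeth_adjoin[OF subring_polyfun_in] adjoin_polyfun_in by metis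
  qed
qed

lemma polyfun_in_UNIV_eq: "{f. polyfun_in UNIV f} = {f. polyfun f}"
  using polyfun_in_UNIV polyfun_in_imp by blast

text \<open>That S0 is a subset of S matters: generators of the ideal spanned by the functions of
  one weight again have that weight (\<open>hom_finite_dimensional\<close>).\<close>

theorem polyfun_finite_generators:
  assumes "\<And>f. f \<in> S \<Longrightarrow> polyfun f"
  obtains S0 where "finite S0" "S0 \<subseteq> S"
    "\<And>f. f \<in> S \<Longrightarrow> \<exists>c. (\<forall>g. polyfun (c g)) \<and> f = (\<lambda>x. \<Sum>g\<in>S0. c g x * g x)"
proof -
  let ?A = "{f::complex^'a\<Rightarrow>complex. polyfun f}"
  have A: "subring ?A" "noeth ?A"
    using subring_polyfun_in[of UNIV] noeth_polyfun_in[of UNIV] by (simp_all add: polyfun_in_UNIV_eq)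
  obtain S0 where S0: "finite S0" "S0 \<subseteq> S" "S \<subseteq> idl ?A S0"
    using noeth_finite_generators[OF A, of S] assms by blast
  show ?thesis
  proof (rule that[OF S0(1,2)])
    fix f assume "f \<in> S"
    then obtain c where c: "range c \<subseteq> ?A" "f = (\<Sum>t\<in>S0. c t * t)"
      using idl_sum[OF A(1) S0(1)] S0(3) by blast
    have "(\<Sum>t\<in>S0. c t * t) x = (\<Sum>t\<in>S0. c t x * t x)" for x
      using S0(1) by (induction S0) auto
    with c show "\<exists>c. (\<forall>g. polyfun (c g)) \<and> f = (\<lambda>x. \<Sum>g\<in>S0. c g x * g x)"
      by (intro exI[of _ c]) auto
  qed
qed

text \<open>The coefficients are indexed by position rather than by function, which suits ascending
  chains of ideals and integral equations.\<close>

lemma polyfun_sequence_dependent: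
  fixes a :: "nat \<Rightarrow> complex^'n \<Rightarrow> complex"
  assumes "\<And>i. polyfun (a i)"
  obtains N c where "\<And>i. polyfun (c i)" "\<And>x. a N x = (\<Sum>i<N. c i x * a i x)"
proof -
  let ?A = "{f::complex^'n\<Rightarrow>complex. polyfun f}"
  have A: "subring ?A" "noeth ?A"
    using subring_polyfun_in[of UNIV] noeth_polyfun_in[of UNIV] by (simp_all add: polyfun_in_UNIV_eq)
  obtain N where N: "a N \<in> idl ?A (a ` {..<N})" using A(2) assms unfolding noeth_def by blast
  have "\<exists>c. (\<forall>i. polyfun (c i)) \<and> (\<forall>x. y x = (\<Sum>i<N. c i x * a i x))" if "y \<in> idl ?A (a ` {..<N})" for y
    using that
  proof induction
    case zero
    show ?case by (rule exI[of _ "\<lambda>_ _. 0"]) (auto intro: polyfun_intros)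
  next
    case (step r s y)
    then obtain c i where c: "\<And>i. polyfun (c i)" "\<And>x. y x = (\<Sum>i<N. c i x * a i x)" and i: "i < N" "s = a i" by blast
    have "(r * s + y) x = (\<Sum>j<N. (c j x + (if j = i then r x else 0)) * a j x)" for x
      using i c by (simp add: distrib_right sum.distrib if_distrib[where f="\<lambda>z. z * _"] cong: if_cong)
    moreover have "polyfun (\<lambda>x. c j x + (if j = i then r x else 0))" for j
      using c step by (cases "j = i") (auto intro: polyfun_intros)
    ultimately show ?case by (intro exI[of _ "\<lambda>j x. c j x + (if j = i then r x else 0)"]) auto
  qed
  from this[OF N] that show ?thesis by blast
qed

section \<open>Ideals of polynomial functions and maximal members of families\<close>

definition pideal :: "(complex^'n \<Rightarrow> complex) set \<Rightarrow> bool" where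
  "pideal I \<longleftrightarrow> (\<forall>f\<in>I. polyfun f) \<and> (\<lambda>x. 0) \<in> I \<and> (\<forall>f\<in>I. \<forall>g\<in>I. (\<lambda>x. f x + g x) \<in> I) \<and>
     (\<forall>f\<in>I. \<forall>g. polyfun g \<longrightarrow> (\<lambda>x. g x * f x) \<in> I)"

lemma pideal_add: "pideal I \<Longrightarrow> f \<in> I \<Longrightarrow> g \<in> I \<Longrightarrow> (\<lambda>x. f x + g x) \<in> I"
  and pideal_mult: "pideal I \<Longrightarrow> f \<in> I \<Longrightarrow> polyfun g \<Longrightarrow> (\<lambda>x. g x * f x) \<in> I"
  and pideal_polyfun: "pideal I \<Longrightarrow> f \<in> I \<Longrightarrow> polyfun f"
  by (auto simp: pideal_def)

lemma pideal_diff: "pideal I \<Longrightarrow> f \<in> I \<Longrightarrow> g \<in> I \<Longrightarrow> (\<lambda>x. f x - g x) \<in> I"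
  using pideal_add[of I f "\<lambda>x. (-1) * g x"] pideal_mult[of I g "\<lambda>_. -1"] by (auto intro: polyfun_intros)

lemma pideal_sum: "pideal I \<Longrightarrow> (\<And>i. i \<in> J \<Longrightarrow> f i \<in> I) \<Longrightarrow> (\<lambda>x. \<Sum>i\<in>J. f i x) \<in> I"
  by (induction J rule: infinite_finite_induct) (auto simp: pideal_add, auto simp: pideal_def)

text \<open>In a strictly increasing chain pick an element gained at each stage; by the basis
  theorem one of them is a combination of earlier ones and so was not gained.\<close>

lemma pideal_maximal:
  assumes C: "\<And>I. I \<in> C \<Longrightarrow> pideal I" and ne: "C \<noteq> {}"
  obtains M where "M \<in> C" "\<And>I. I \<in> C \<Longrightarrow> M \<subseteq> I \<Longrightarrow> I = M"
proof (rule ccontr)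
  assume "\<not> thesis"
  then have no: "\<And>M. M \<in> C \<Longrightarrow> \<exists>I\<in>C. M \<subset> I" using that by blast
  have "\<exists>F. \<forall>k::nat. F k \<in> C \<and> F k \<subset> F (Suc k)"
    by (rule dependent_nat_choice) (use ne no in blast)+
  then obtain F where F0: "\<forall>k::nat. F k \<in> C \<and> F k \<subset> F (Suc k)" by (rule exE)
  then have F: "F k \<in> C" "F k \<subset> F (Suc k)" for k by blast+
  define f where "f k = (SOME f. f \<in> F (Suc k) - F k)" for k
  have f: "f k \<in> F (Suc k)" "f k \<notin> F k" for k
    using someI_ex[of "\<lambda>f. f \<in> F (Suc k) - F k"] F(2)[of k] unfolding f_def by blast+
  have pf: "polyfun (f k)" for k using pideal_polyfun[OF C[OF F(1)] f(1)] .
  obtain N c where c: "\<And>i. polyfun (c i)" "\<And>x. f N x = (\<Sum>i<N. c i x * f i x)"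
    by (rule polyfun_sequence_dependent[of f, OF pf], rule that)
  have mono: "F i \<subseteq> F j" if "i \<le> j" for i j
    by (rule lift_Suc_mono_le[of F, OF _ that]) (rule psubset_imp_subset[OF F(2)])
  have "f i \<in> F N" if "i < N" for i using mono[of "Suc i" N] that f(1)[of i] by auto
  then have "(\<lambda>x. \<Sum>i<N. c i x * f i x) \<in> F N"
    using C[OF F(1)] c by (intro pideal_sum pideal_mult) auto
  then have "f N \<in> F N" using c(2) by presburger
  with f(2) show False by blast
qed

section \<open>The Nullstellensatz for prime ideals\<close>

text \<open>Gaussian elimination, removing one equation and one unknown at a time: d is the system
  left after elimination of a pivot k of equation b.\<close>

lemma homogeneous_system_nontrivial:
  fixes c :: "'i \<Rightarrow> 'b \<Rightarrow> 'a::field"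
  assumes "finite B" "finite I" "card B < card I"
  shows "\<exists>a. (\<exists>i\<in>I. a i \<noteq> 0) \<and> (\<forall>b\<in>B. (\<Sum>i\<in>I. a i * c i b) = 0)"
  using assms
proof (induction B arbitrary: I c rule: finite_induct)
  case empty
  then obtain i where "i \<in> I" by fastforce
  then show ?case by (intro exI[of _ "\<lambda>_. 1"]) auto
next
  case (insert b B)
  show ?case
  proof (cases "\<forall>i\<in>I. c i b = 0")
    case True
    have "card B < card I" using insert by simp
    from insert.IH[OF insert.prems(1) this, of c]
    obtain a where "\<exists>i\<in>I. a i \<noteq> 0" "\<forall>b\<in>B. (\<Sum>i\<in>I. a i * c i b) = 0" by blast
    with True show ?thesis by (intro exI[of _ a]) auto
  next
    case False
    then obtain k where k: "k \<in> I" "c k b \<noteq> 0" by blast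
    define d where "d i x = c i x - c i b / c k b * c k x" for i x
    have "finite (I - {k})" "card B < card (I - {k})" using insert k by auto
    from insert.IH[OF this, of d]
    obtain a where a: "\<exists>i\<in>I - {k}. a i \<noteq> 0" "\<forall>x\<in>B. (\<Sum>i\<in>I - {k}. a i * d i x) = 0" by blast
    \<comment> \<open>The pivot variable takes the value that solves equation b.\<close>
    define a' where "a' = a(k := - (\<Sum>i\<in>I - {k}. a i * c i b) / c k b)"
    have s: "(\<Sum>i\<in>I. a' i * c i x) = (\<Sum>i\<in>I - {k}. a i * d i x)" for x
    proof -
      have "(\<Sum>i\<in>I. a' i * c i x) = a' k * c k x + (\<Sum>i\<in>I - {k}. a' i * c i x)"
        using insert.prems(1) k(1) by (rule sum.remove)
      also have "(\<Sum>i\<in>I - {k}. a' i * c i x) = (\<Sum>i\<in>I - {k}. a i * c i x)"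
        by (rule sum.cong) (auto simp: a'_def)
      finally show ?thesis
        by (simp add: a'_def d_def algebra_simps sum_subtractf sum_distrib_left sum_divide_distrib)
    qed
    have "d i b = 0" for i using k by (simp add: d_def)
    then have "\<forall>x\<in>insert b B. (\<Sum>i\<in>I. a' i * c i x) = 0" using a(2) by (auto simp: s)
    moreover have "\<exists>i\<in>I. a' i \<noteq> 0" using a(1) by (auto simp: a'_def)
    ultimately show ?thesis by blast
  qed
qed

text \<open>Monomials are indexed by words in the coordinates, so the same monomial may occur
  several times. What counts is that each bound on the length leaves finitely many words:
  polynomials form a countable union of finite-dimensional spaces.\<close>

lemma polyfun_monomials:
  assumes "polyfun (f :: complex^'n \<Rightarrow> complex)"
  shows "\<exists>d c. f = (\<lambda>x. \<Sum>L | length L \<le> d. c L * (\<Prod>i\<leftarrow>L. x $ i))"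
proof -
  define m where "m L x = (\<Prod>i\<leftarrow>L. x $ i)" for L :: "'n list" and x :: "complex^'n"
  have fin: "finite {L :: 'n list. length L \<le> d}" for d
    using finite_lists_length_le[of "UNIV :: 'n set" d] by simp
  define P where "P f \<longleftrightarrow> (\<exists>S c. finite S \<and> f = (\<lambda>x. \<Sum>L\<in>S. c L * m L x))" for f
  have single: "P (\<lambda>x. a * m L x)" for a L
    unfolding P_def by (intro exI[of _ "{L}"] exI[of _ "\<lambda>_. a"]) auto
  have Padd: "P (\<lambda>x. f x + g x)" if fg: "P f" "P g" for f g
  proof -
    obtain S c T e where *: "finite S" "f = (\<lambda>x. \<Sum>L\<in>S. c L * m L x)" "finite T" "g = (\<lambda>x. \<Sum>L\<in>T. e L * m L x)"
      using fg unfolding P_def by blast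
    have "f x = (\<Sum>L\<in>S \<union> T. (if L \<in> S then c L else 0) * m L x)" for x
      unfolding *(2) using * by (intro sum.mono_neutral_cong_left) auto
    moreover have "g x = (\<Sum>L\<in>S \<union> T. (if L \<in> T then e L else 0) * m L x)" for x
      unfolding *(4) using * by (intro sum.mono_neutral_cong_left) auto
    ultimately have "(\<lambda>x. f x + g x) = (\<lambda>x. \<Sum>L\<in>S \<union> T. ((if L \<in> S then c L else 0) + (if L \<in> T then e L else 0)) * m L x)"
      by (simp add: distrib_right sum.distrib)
    with * show ?thesis unfolding P_def
      by (intro exI[of _ "S \<union> T"] exI[of _ "\<lambda>L. (if L \<in> S then c L else 0) + (if L \<in> T then e L else 0)"]) simp
  qed
  have Psum: "P (\<lambda>x. \<Sum>i\<in>I. h i x)" if "\<And>i. i \<in> I \<Longrightarrow> P (h i)" "finite I" for h :: "'n list \<Rightarrow> _" and I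
    using that(2,1)
  proof induction
    case empty
    then show ?case using single[of 0] by simp
  qed (auto intro: Padd)
  have Pmult: "P (\<lambda>x. f x * g x)" if fg: "P f" "P g" for f g
  proof -
    obtain S c T e where *: "finite S" "f = (\<lambda>x. \<Sum>L\<in>S. c L * m L x)" "finite T" "g = (\<lambda>x. \<Sum>L\<in>T. e L * m L x)"
      using fg unfolding P_def by blast
    have "f x * g x = (\<Sum>L\<in>S. \<Sum>M\<in>T. (c L * e M) * m (L @ M) x)" for x
      by (simp add: * sum_product m_def algebra_simps)
    then have "(\<lambda>x. f x * g x) = (\<lambda>x. \<Sum>L\<in>S. \<Sum>M\<in>T. (c L * e M) * m (L @ M) x)" by blast
    then show ?thesis using *(1,3) by (auto intro!: Psum single)
  qed
  have "P f" using assms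
  proof induction
    case (const c)
    show ?case using single[of c "[]"] by (simp add: m_def)
  next
    case (coord i)
    show ?case using single[of 1 "[i]"] by (simp add: m_def)
  qed (auto intro: Padd Pmult)
  then obtain S c where S: "finite S" "f = (\<lambda>x. \<Sum>L\<in>S. c L * m L x)" unfolding P_def by blast
  define d where "d = Max (insert 0 (length ` S))"
  have "S \<subseteq> {L. length L \<le> d}" using S by (auto simp: d_def)
  then have "f = (\<lambda>x. \<Sum>L | length L \<le> d. (if L \<in> S then c L else 0) * m L x)"
    unfolding S(2) using fin by (intro ext sum.mono_neutral_cong_left) auto
  then show ?thesis unfolding m_def
    by (intro exI[of _ d] exI[of _ "\<lambda>L. if L \<in> S then c L else 0"]) simp
qed

definition prime_ideal :: "(complex^'n \<Rightarrow> complex) set \<Rightarrow> bool" where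
  "prime_ideal P \<longleftrightarrow> pideal P \<and> (\<forall>f g. polyfun f \<and> polyfun g \<and> (\<lambda>x. f x * g x) \<in> P \<longrightarrow> f \<in> P \<or> g \<in> P)"

lemma polyfun_poly: "polyfun (\<lambda>x. poly Q (x $ i))"
proof (induction Q)
  case (pCons a Q)
  from polyfun.add[OF polyfun.const polyfun.mult[OF polyfun.coord this(2)]] show ?case by simp
qed (simp add: polyfun.const)

lemma prime_idealD:
  "prime_ideal P \<Longrightarrow> (\<lambda>x. f x * g x) \<in> P \<Longrightarrow> polyfun f \<Longrightarrow> polyfun g \<Longrightarrow> f \<in> P \<or> g \<in> P"
  by (simp add: prime_ideal_def)

lemma pideal_extend:
  assumes "pideal M" "polyfun f"
  shows "pideal {h. \<exists>m\<in>M. \<exists>u. polyfun u \<and> h = (\<lambda>x. m x + u x * f x)}" (is "pideal ?I")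
  unfolding pideal_def
proof (intro conjI ballI allI impI)
  fix h assume "h \<in> ?I"
  then obtain m u where h: "m \<in> M" "polyfun u" "h = (\<lambda>x. m x + u x * f x)" by blast
  show "polyfun h" unfolding h(3) using h assms by (intro polyfun_intros) (auto intro: pideal_polyfun)
  fix g assume "g \<in> ?I"
  then obtain n v where g: "n \<in> M" "polyfun v" "g = (\<lambda>x. n x + v x * f x)" by blast
  have "(\<lambda>x. h x + g x) = (\<lambda>x. (m x + n x) + (u x + v x) * f x)" by (simp add: h g algebra_simps)
  with h g assms show "(\<lambda>x. h x + g x) \<in> ?I"
    by (intro CollectI bexI[of _ "\<lambda>x. m x + n x"] exI[of _ "\<lambda>x. u x + v x"]) (auto intro: pideal_add polyfun_intros)
next
  fix h g :: "complex^'a \<Rightarrow> complex" assume "h \<in> ?I" and g: "polyfun g"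
  then obtain m u where h: "m \<in> M" "polyfun u" "h = (\<lambda>x. m x + u x * f x)" by blast
  have "(\<lambda>x. g x * h x) = (\<lambda>x. g x * m x + (g x * u x) * f x)" by (simp add: h algebra_simps)
  with h g assms show "(\<lambda>x. g x * h x) \<in> ?I"
    by (intro CollectI bexI[of _ "\<lambda>x. g x * m x"] exI[of _ "\<lambda>x. g x * u x"]) (auto intro: pideal_mult polyfun_intros)
next
  have "(\<lambda>x. 0) \<in> M" using assms by (simp add: pideal_def)
  then show "(\<lambda>x. 0) \<in> ?I" by (intro CollectI bexI[of _ "\<lambda>x. 0"] exI[of _ "\<lambda>x. 0"]) (auto intro: polyfun_intros)
qed

text \<open>Over the complex numbers Q splits into linear factors, and a prime ideal contains a
  factor of every product that it contains.\<close>

lemma prime_ideal_univariate: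
  assumes M: "prime_ideal M" "(\<lambda>x. 1) \<notin> M" and "Q \<noteq> 0" "(\<lambda>x. poly Q (x $ i)) \<in> M"
  shows "\<exists>z. (\<lambda>x. x $ i - z) \<in> M"
  using assms(3,4)
proof (induction "degree Q" arbitrary: Q)
  case 0
  then obtain c where c: "Q = [:c:]" using degree_eq_zeroE by metis
  with 0 have "(\<lambda>x. c) \<in> M" "c \<noteq> 0" by auto
  then have "(\<lambda>x. 1) \<in> M"
    using M(1) pideal_mult[of M "\<lambda>x. c" "\<lambda>x. 1 / c"] by (auto simp: prime_ideal_def intro: polyfun_intros)
  with M show ?case by blast
next
  case (Suc n)
  then obtain z where "poly Q z = 0"
    using fundamental_theorem_of_algebra[of Q] by (metis Zero_not_Suc constant_degree)
  then obtain R where R: "Q = [:- z, 1:] * R" by (auto simp: poly_eq_0_iff_dvd)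
  with Suc.prems(1) have R0: "R \<noteq> 0" by auto
  then have "degree Q = Suc (degree R)" unfolding R by (subst degree_mult_eq) auto
  with Suc.hyps(2) have R1: "n = degree R" by simp
  have "(\<lambda>x. (x $ i - z) * poly R (x $ i)) \<in> M"
  proof -
    have "(\<lambda>x. (x $ i - z) * poly R (x $ i)) = (\<lambda>x. poly Q (x $ i))" by (simp add: R algebra_simps)
    with Suc show ?thesis by simp
  qed
  then have "(\<lambda>x. x $ i - z) \<in> M \<or> (\<lambda>x. poly R (x $ i)) \<in> M"
    by (rule prime_idealD[OF M(1)]) (intro polyfun_intros polyfun_poly)+
  with Suc.hyps(1)[OF R1 R0] show ?case by blast
qed

text \<open>Countably many finite fibres cannot cover the uncountable set of complex
  numbers.\<close>

lemma uncountable_fibre: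
  fixes k d :: "complex \<Rightarrow> nat"
  obtains m n where "infinite {z. k z = m \<and> d z = n}"
proof (rule ccontr)
  assume "\<not> thesis"
  then have "finite {z. k z = m \<and> d z = n}" for m n using that by blast
  then have "countable (\<Union>m. \<Union>n. {z. k z = m \<and> d z = n})" by (intro countable_UN) (auto intro: countable_finite)
  moreover have "(\<Union>m. \<Union>n. {z. k z = m \<and> d z = n}) = UNIV" by auto
  ultimately have "countable (UNIV :: complex set)" by simp
  then have "countable (range complex_of_real)" by (rule countable_subset[rotated]) simp
  then have "countable (UNIV :: real set)" by (rule countable_image_inj_on) (simp add: inj_def)
  then show False using uncountable_UNIV_real by blast
qed

text \<open>Take \<open>M\<close> maximal among the ideals containing \<open>P\<close> and no power of \<open>g\<close>. If no \<open>x\<^sub>i - z\<close> were in \<open>M\<close>,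
  then all \<open>x\<^sub>i - z\<close> would be invertible up to powers of \<open>g\<close>; but these uncountably many
  inverses live in a space of countable dimension, so they satisfy a linear relation.\<close>

theorem nullstellensatz_prime:
  fixes P :: "(complex^'n \<Rightarrow> complex) set"
  assumes P: "prime_ideal P" and g: "polyfun g" "g \<notin> P"
  obtains z where "\<And>f. f \<in> P \<Longrightarrow> f z = 0" "g z \<noteq> 0"
proof -
  define C where "C = {I. pideal I \<and> P \<subseteq> I \<and> (\<forall>k. (\<lambda>x. g x ^ k) \<notin> I)}"
  have one: "(\<lambda>x. 1) \<notin> P"
  proof
    assume "(\<lambda>x. 1) \<in> P"
    from pideal_mult[OF _ this g(1)] P g(2) show False by (auto simp: prime_ideal_def)
  qed
  have gk: "(\<lambda>x. g x ^ k) \<notin> P" for k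
  proof (induction k)
    case (Suc k)
    then show ?case using P g polyfun_power[OF g(1), of k] unfolding prime_ideal_def by auto
  qed (use one in simp)
  have "P \<in> C" using P gk by (auto simp: C_def prime_ideal_def)
  then obtain M where M: "M \<in> C" and max: "\<And>I. I \<in> C \<Longrightarrow> M \<subseteq> I \<Longrightarrow> I = M"
    using pideal_maximal[of C] by (auto simp: C_def)
  have id: "pideal M" and PM: "P \<subseteq> M" and gM: "\<And>k. (\<lambda>x. g x ^ k) \<notin> M" using M by (auto simp: C_def)
  have inv: "\<exists>u k. polyfun u \<and> (\<lambda>x. g x ^ k - u x * f x) \<in> M" if f: "polyfun f" "f \<notin> M" for f
  proof -
    \<comment> \<open>The ideal generated by M and f is strictly larger than M, so by maximality it
      contains a power of g.\<close>
    define I where "I = {h. \<exists>m\<in>M. \<exists>u. polyfun u \<and> h = (\<lambda>x. m x + u x * f x)}"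
    have I: "pideal I" unfolding I_def by (rule pideal_extend[OF id f(1)])
    have "m \<in> I" if "m \<in> M" for m unfolding I_def
      using that by (intro CollectI bexI[of _ m] exI[of _ "\<lambda>x. 0"]) (auto intro: polyfun_intros)
    then have MI: "M \<subseteq> I" by blast
    have "(\<lambda>x. 0) \<in> M" using id by (simp add: pideal_def)
    then have "f \<in> I" unfolding I_def
      by (intro CollectI bexI[of _ "\<lambda>x. 0"] exI[of _ "\<lambda>x. 1"]) (auto intro: polyfun_intros)
    then have "I \<notin> C" using max[OF _ MI] f(2) by blast
    then obtain k where "(\<lambda>x. g x ^ k) \<in> I" using I MI PM by (auto simp: C_def)
    then obtain m u where mu: "m \<in> M" "polyfun u" "(\<lambda>x. g x ^ k) = (\<lambda>x. m x + u x * f x)" unfolding I_def by blast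
    have "(\<lambda>x. g x ^ k - u x * f x) = m" using fun_cong[OF mu(3)] by (auto simp: fun_eq_iff)
    with mu show ?thesis by blast
  qed
  have prime: "prime_ideal M"
    unfolding prime_ideal_def
  proof (intro conjI allI impI id)
    fix f h assume *: "polyfun f \<and> polyfun h \<and> (\<lambda>x. f x * h x) \<in> M"
    show "f \<in> M \<or> h \<in> M"
    proof (rule ccontr)
      assume "\<not> (f \<in> M \<or> h \<in> M)"
      with * inv[of f] inv[of h] obtain u k v l where
        u: "polyfun u" "(\<lambda>x. g x ^ k - u x * f x) \<in> M" and v: "polyfun v" "(\<lambda>x. g x ^ l - v x * h x) \<in> M" by blast
      \<comment> \<open>If f and h were both invertible up to powers of g, then multiplying the two
        relations and using that the product of f and h lies in M would put g ^ (l + k) into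
        M.\<close>
      have "(\<lambda>x. g x ^ l * (g x ^ k - u x * f x) + ((u x * f x) * (g x ^ l - v x * h x) + (u x * v x) * (f x * h x))) \<in> M"
        using * u v g(1)
        by (intro pideal_add[OF id] pideal_mult[OF id u(2)] pideal_mult[OF id v(2)] pideal_mult[OF id, of "\<lambda>x. f x * h x"])
           (auto intro!: polyfun_intros)
      moreover have "(\<lambda>x. g x ^ l * (g x ^ k - u x * f x) + ((u x * f x) * (g x ^ l - v x * h x) + (u x * v x) * (f x * h x)))
          = (\<lambda>x. g x ^ (l + k))" by (rule ext) (simp add: algebra_simps power_add)
      ultimately show False using gM by simp
    qed
  qed
  have M1: "(\<lambda>x. 1) \<notin> M" using gM[of 0] by simp
  have "\<exists>z. (\<lambda>x. x $ i - z) \<in> M" for i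
  proof (rule ccontr)
    assume no: "\<nexists>z. (\<lambda>x. x $ i - z) \<in> M"
    have "\<exists>u k. polyfun u \<and> (\<lambda>x. g x ^ k - u x * (x $ i - z)) \<in> M" for z
      by (rule inv) (use no in \<open>auto intro: polyfun_intros\<close>)
    then obtain u k where u: "\<And>z. polyfun (u z)" "\<And>z. (\<lambda>x. g x ^ k z - u z x * (x $ i - z)) \<in> M" by metis
    have "\<forall>z. \<exists>d c. u z = (\<lambda>x. \<Sum>L | length L \<le> d. c L * (\<Prod>i\<leftarrow>L. x $ i))" using polyfun_monomials[OF u(1)] by blast
    then obtain d c where dc: "\<And>z. u z = (\<lambda>x. \<Sum>L | length L \<le> d z. c z L * (\<Prod>i\<leftarrow>L. x $ i))" by metis
    obtain m n where inf: "infinite {z. k z = m \<and> d z = n}" using uncountable_fibre[of k d] by blast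
    define B where "B = {L :: 'n list. length L \<le> n}"
    have B: "finite B" using finite_lists_length_le[of "UNIV :: 'n set" n] by (simp add: B_def)
    obtain I where I: "I \<subseteq> {z. k z = m \<and> d z = n}" "finite I" "card I = Suc (card B)"
      using infinite_arbitrarily_large[OF inf, of "Suc (card B)"] by blast
    obtain a where a: "\<exists>z\<in>I. a z \<noteq> 0" "\<And>L. L \<in> B \<Longrightarrow> (\<Sum>z\<in>I. a z * c z L) = 0"
      using homogeneous_system_nontrivial[OF B I(2), of c] I(3) by auto
    have rel: "(\<Sum>z\<in>I. a z * u z x) = 0" for x
    proof -
      have "(\<Sum>z\<in>I. a z * u z x) = (\<Sum>z\<in>I. \<Sum>L\<in>B. a z * c z L * (\<Prod>i\<leftarrow>L. x $ i))"
        using I(1) by (intro sum.cong) (auto simp: dc B_def sum_distrib_left mult.assoc)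
      also have "\<dots> = (\<Sum>L\<in>B. (\<Sum>z\<in>I. a z * c z L) * (\<Prod>i\<leftarrow>L. x $ i))"
        by (subst sum.swap) (simp add: sum_distrib_right)
      finally show ?thesis using a(2) by simp
    qed
    \<comment> \<open>Modulo M each u z is g ^ m divided by x_i - z. Clearing denominators in the
      relation \<open>rel\<close> by the product of all x_i - y yields g ^ m times Q, evaluated at
      x_i.\<close>
    define Q where "Q = (\<Sum>z\<in>I. smult (a z) (\<Prod>y\<in>I - {z}. [:- y, 1:]))"
    have Qx: "poly Q t = (\<Sum>z\<in>I. a z * (\<Prod>y\<in>I - {z}. t - y))" for t
      by (simp add: Q_def poly_sum poly_prod)
    have "(\<lambda>x. \<Sum>z\<in>I. (a z * (\<Prod>y\<in>I - {z}. x $ i - y)) * (g x ^ m - u z x * (x $ i - z))) \<in> M"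
      using u(2) I(1) by (intro pideal_sum[OF id] pideal_mult[OF id]) (auto intro!: polyfun_intros)
    moreover have "(\<Sum>z\<in>I. (a z * (\<Prod>y\<in>I - {z}. x $ i - y)) * (g x ^ m - u z x * (x $ i - z))) = g x ^ m * poly Q (x $ i)" for x
    proof -
      have "(\<Sum>z\<in>I. (a z * (\<Prod>y\<in>I - {z}. x $ i - y)) * (g x ^ m - u z x * (x $ i - z)))
        = (\<Sum>z\<in>I. (a z * (\<Prod>y\<in>I - {z}. x $ i - y)) * g x ^ m - (a z * u z x) * (\<Prod>y\<in>I. x $ i - y))"
      proof (rule sum.cong)
        fix z assume "z \<in> I"
        then have "(\<Prod>y\<in>I. x $ i - y) = (x $ i - z) * (\<Prod>y\<in>I - {z}. x $ i - y)"
          using I(2) by (rule prod.remove[rotated])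
        moreover have "(a z * p) * (g x ^ m - u z x * (x $ i - z)) = (a z * p) * g x ^ m - (a z * u z x) * ((x $ i - z) * p)" for p
          by (simp add: algebra_simps)
        ultimately show "(a z * (\<Prod>y\<in>I - {z}. x $ i - y)) * (g x ^ m - u z x * (x $ i - z)) =
            (a z * (\<Prod>y\<in>I - {z}. x $ i - y)) * g x ^ m - (a z * u z x) * (\<Prod>y\<in>I. x $ i - y)"
          by simp
      qed simp
      also have "\<dots> = poly Q (x $ i) * g x ^ m - (\<Sum>z\<in>I. a z * u z x) * (\<Prod>y\<in>I. x $ i - y)"
        by (simp add: Qx sum_subtractf sum_distrib_right)
      finally show ?thesis by (simp add: rel)
    qed
    ultimately have "(\<lambda>x. g x ^ m * poly Q (x $ i)) \<in> M" by simp
    then have QM: "(\<lambda>x. poly Q (x $ i)) \<in> M"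
      using prime_idealD[OF prime, of "\<lambda>x. g x ^ m" "\<lambda>x. poly Q (x $ i)"] gM[of m] polyfun_power[OF g(1), of m] polyfun_poly[of Q i] by blast
    \<comment> \<open>At a node z only the summand belonging to z survives, as in Lagrange
      interpolation.\<close>
    obtain z where z: "z \<in> I" "a z \<noteq> 0" using a(1) by blast
    have "poly Q z = (\<Sum>w\<in>{z}. a w * (\<Prod>y\<in>I - {w}. z - y))"
      unfolding Qx using z I(2) by (intro sum.mono_neutral_right) auto
    also have "\<dots> \<noteq> 0" using z I(2) by simp
    finally have "Q \<noteq> 0" by auto
    with prime_ideal_univariate[OF prime M1 _ QM] no show False by blast
  qed
  then obtain w where w: "\<And>i. (\<lambda>x. x $ i - w i) \<in> M" by metis
  define z where "z = (\<chi> i. w i)"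
  \<comment> \<open>M contains all x_i - z_i, so modulo M every polynomial equals its value at
    z.\<close>
  have ev: "(\<lambda>x. f x - f z) \<in> M" if "polyfun f" for f
    using that
  proof induction
    case (const c)
    show ?case using id by (simp add: pideal_def)
  next
    case (coord i)
    show ?case using w[of i] by (simp add: z_def)
  next
    case (add f h)
    show ?case using pideal_add[OF id add.IH] by (simp add: algebra_simps)
  next
    case (mult f h)
    have "(\<lambda>x. h x * (f x - f z) + f z * (h x - h z)) \<in> M"
      using mult by (intro pideal_add[OF id] pideal_mult[OF id]) (auto intro: polyfun_intros)
    moreover have "(\<lambda>x. h x * (f x - f z) + f z * (h x - h z)) = (\<lambda>x. f x * h x - f z * h z)"
      by (rule ext) (simp add: algebra_simps)
    ultimately show ?case by simp
  qed
  show ?thesis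
  proof
    fix f assume f: "f \<in> P"
    then have pf: "polyfun f" using P by (auto simp: prime_ideal_def intro: pideal_polyfun)
    show "f z = 0"
    proof (rule ccontr)
      assume nz: "f z \<noteq> 0"
      have "f \<in> M" using f PM by blast
      from pideal_mult[OF id pideal_diff[OF id this ev[OF pf]], of "\<lambda>x. 1 / f z"]
      have "(\<lambda>x. (1 / f z) * (f x - (f x - f z))) \<in> M" by (simp add: polyfun.const)
      then show False using M1 nz by simp
    qed
  next
    show "g z \<noteq> 0"
    proof
      assume "g z = 0"
      then have "g \<in> M" using ev[OF g(1)] by simp
      then show False using gM[of 1] by simp
    qed
  qed
qed

section \<open>Frames of tangent spaces\<close>

definition ker_rows :: "'n set \<Rightarrow> complex^'n^'n \<Rightarrow> (complex^'n) set" where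
  "ker_rows J H = {v. \<forall>i. i \<notin> J \<longrightarrow> (H *v v) $ i = 0}"

definition perp :: "(complex^'n) set \<Rightarrow> (complex^'n) set" where
  "perp G = {v. \<forall>g\<in>G. (\<Sum>i\<in>UNIV. g $ i * v $ i) = 0}"

lemma invertible_matrix_inv:
  fixes H :: "complex^'n^'n"
  assumes "invertible H"
  shows "H *v (matrix_inv H *v v) = v" "matrix_inv H *v (H *v v) = v"
proof -
  have "H ** matrix_inv H = mat 1 \<and> matrix_inv H ** H = mat 1"
    unfolding matrix_inv_def using assms unfolding invertible_def by (rule someI_ex)
  then show "H *v (matrix_inv H *v v) = v" "matrix_inv H *v (H *v v) = v"
    by (simp_all add: matrix_vector_mul_assoc)
qed

lemma ker_rows_subspace: "vec.subspace (ker_rows J H)"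
  by (auto simp: vec.subspace_def ker_rows_def matrix_vector_right_distrib vec.scale)

lemma dim_ker_rows:
  assumes H: "invertible H" shows "vec.dim (ker_rows J H) = card J"
proof -
  let ?E = "{v :: complex^'a. \<forall>i. i \<notin> J \<longrightarrow> v $ i = 0}"
  have "ker_rows J H = (*v) (matrix_inv H) ` ?E"
  proof (intro equalityI subsetI)
    fix v assume "v \<in> ker_rows J H"
    then have "H *v v \<in> ?E" by (simp add: ker_rows_def)
    then have "matrix_inv H *v (H *v v) \<in> (*v) (matrix_inv H) ` ?E" by (rule imageI)
    then show "v \<in> (*v) (matrix_inv H) ` ?E" by (simp add: invertible_matrix_inv[OF H])
  qed (auto simp: ker_rows_def invertible_matrix_inv[OF H])
  moreover have "vec.dim ((*v) (matrix_inv H) ` ?E) = vec.dim ?E"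
  proof (rule vec.dim_image_eq)
    show "inj_on ((*v) (matrix_inv H)) (vec.span ?E)"
      by (rule inj_onI) (metis invertible_matrix_inv(1)[OF H])
  qed simp
  ultimately show ?thesis using dim_substandard_cart[of J] by simp
qed

text \<open>The rows of H form a basis of the whole space extending a basis of the span of G: the
  rows outside J are taken from G, those in J are any completion.\<close>

lemma frame_exists:
  fixes G :: "(complex^'n) set"
  assumes "card J = CARD('n) - vec.dim G"
  obtains H where "invertible H" "\<And>i. i \<notin> J \<Longrightarrow> H $ i \<in> G" "perp G = ker_rows J H"
proof -
  obtain B where B: "B \<subseteq> G" "vec.independent B" "G \<subseteq> vec.span B" "card B = vec.dim G"
    using vec.basis_exists[of G] by blast
  define B' where "B' = vec.extend_basis B"
  have B': "B \<subseteq> B'" "vec.independent B'" "vec.span B' = UNIV"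
    using vec.extend_basis_superset[OF B(2)] vec.independent_extend_basis[OF B(2)] vec.span_extend_basis[OF B(2)]
    by (auto simp: B'_def)
  have fB': "finite B'" using B'(2) vec.finiteI_independent by blast
  have cB': "card B' = CARD('n)"
    using vec.dim_eq_card[of B' UNIV] B' by (simp add: vec.dim_UNIV card_cart_basis)
  have fB: "finite B" using B'(1) fB' finite_subset by blast
  have "card B \<le> CARD('n)" using card_mono[OF fB' B'(1)] cB' by simp
  then have "card (- J) = card B"
    using assms B(4) card_mono[of UNIV J] by (simp add: Compl_eq_Diff_UNIV card_Diff_subset)
  then obtain f1 where f1: "bij_betw f1 (- J) B" using finite_same_card_bij[of "- J" B] fB by auto
  have "card J = card (B' - B)" using assms B(4) cB' fB B'(1) by (simp add: card_Diff_subset)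
  then obtain f2 where f2: "bij_betw f2 J (B' - B)" using finite_same_card_bij[of J "B' - B"] fB' by auto
  define f where "f i = (if i \<in> J then f2 i else f1 i)" for i
  have "bij_betw f (- J) B" "bij_betw f J (B' - B)"
    using f1 f2 bij_betw_cong[of "- J" f f1] bij_betw_cong[of J f f2] by (simp_all add: f_def)
  then have "bij_betw f (- J \<union> J) (B \<union> (B' - B))" by (rule bij_betw_combine) auto
  moreover have "- J \<union> J = UNIV" "B \<union> (B' - B) = B'" using B'(1) by auto
  ultimately have f: "bij_betw f UNIV B'" by simp
  define H where "H = (\<chi> i. f i)"
  have "\<forall>c. (\<Sum>i\<in>UNIV. c i *s row i H) = 0 \<longrightarrow> (\<forall>i. c i = 0)"
  proof (intro allI impI)
    fix c :: "'n \<Rightarrow> complex" and i assume "(\<Sum>i\<in>UNIV. c i *s row i H) = 0"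
    then have "(\<Sum>i\<in>UNIV. c i *s f i) = 0" by (simp add: row_def H_def vec_lambda_eta)
    then have "(\<Sum>b\<in>B'. c (inv f b) *s b) = 0"
      using sum.reindex_bij_betw[OF f, of "\<lambda>b. c (inv f b) *s b"] bij_betw_imp_inj_on[OF f] by (simp add: inv_f_f)
    then have "\<forall>b\<in>B'. c (inv f b) = 0"
      using vec.independentD[OF B'(2) fB' order_refl, of "\<lambda>b. c (inv f b)"] by simp
    moreover have "f i \<in> B'" using f by (auto simp: bij_betw_def)
    ultimately show "c i = 0" using bij_betw_imp_inj_on[OF f] by (auto simp: inv_f_f)
  qed
  then have inv: "invertible H" unfolding invertible_right_inverse matrix_right_invertible_independent_rows .
  have Hi: "H $ i \<in> B" if "i \<notin> J" for i using that f1 by (auto simp: H_def f_def bij_betw_def)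
  have "perp G = ker_rows J H"
  proof (intro equalityI subsetI)
    fix v assume "v \<in> perp G"
    then show "v \<in> ker_rows J H" using Hi B(1)
      by (auto simp: perp_def ker_rows_def matrix_vector_mult_def)
  next
    fix v assume v: "v \<in> ker_rows J H"
    have sub: "vec.subspace {g. (\<Sum>i\<in>UNIV. g $ i * v $ i) = 0}"
      by (auto simp: vec.subspace_def distrib_right sum.distrib mult.assoc simp flip: sum_distrib_left)
    have "B \<subseteq> {g. (\<Sum>i\<in>UNIV. g $ i * v $ i) = 0}"
    proof
      fix g assume "g \<in> B"
      then obtain i where "i \<notin> J" "g = f1 i" using f1 by (auto simp: bij_betw_def)
      with v show "g \<in> {g. (\<Sum>i\<in>UNIV. g $ i * v $ i) = 0}"
        by (auto simp: ker_rows_def matrix_vector_mult_def H_def f_def)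
    qed
    then have "vec.span B \<subseteq> {g. (\<Sum>i\<in>UNIV. g $ i * v $ i) = 0}" using sub by (rule vec.span_minimal)
    then show "v \<in> perp G" using B(3) by (auto simp: perp_def)
  qed
  with that[OF inv] Hi B(1) show ?thesis by blast
qed

lemma dim_perp:
  fixes G :: "(complex^'n) set" shows "vec.dim (perp G) = CARD('n) - vec.dim G"
proof -
  obtain J :: "'n set" where J: "card J = CARD('n) - vec.dim G"
    using obtain_subset_with_card_n[of "CARD('n) - vec.dim G" "UNIV :: 'n set"] by auto
  obtain H where "invertible H" "perp G = ker_rows J H" by (rule frame_exists[OF J]) blast
  with J show ?thesis by (simp add: dim_ker_rows)
qed

definition gradv :: "(complex^'n \<Rightarrow> complex) \<Rightarrow> complex^'n \<Rightarrow> complex^'n" where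
  "gradv f x = (\<chi> i. pd i f x)"

lemma tangent_space_perp: "tangent_space X p = perp ((\<lambda>f. gradv f p) ` vanishing X)"
  by (auto simp: tangent_space_iff perp_def dd_def gradv_def mult.commute)

text \<open>Used with equations \<open>F i\<close> of \<open>X\<close>: at regular points the rows outside \<open>J\<close> cut out the tangent
  space, and the constant rows in \<open>J\<close> complete them to an invertible matrix.\<close>

definition frame :: "'n set \<Rightarrow> ('n \<Rightarrow> complex^'n \<Rightarrow> complex) \<Rightarrow> complex^'n^'n \<Rightarrow> complex^'n \<Rightarrow> complex^'n^'n" where
  "frame J F H0 x = (\<chi> i. if i \<in> J then H0 $ i else gradv (F i) x)"

lemma frame_mult: "(frame J F H0 x *v v) $ i = (if i \<in> J then (H0 *v v) $ i else dd (F i) x v)"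
  by (simp add: frame_def matrix_vector_mult_def dd_def gradv_def mult.commute)

lemma tangent_frame:
  fixes X :: "(complex^'n) set"
  assumes "card J = vec.dim (tangent_space X p)"
  obtains F H0 where "\<And>i. F i \<in> vanishing X" "invertible (frame J F H0 p)"
proof -
  let ?G = "(\<lambda>f. gradv f p) ` vanishing X"
  have "card J = CARD('n) - vec.dim ?G" using assms by (simp add: tangent_space_perp dim_perp)
  then obtain H where H: "invertible H" "\<And>i. i \<notin> J \<Longrightarrow> H $ i \<in> ?G" by (rule frame_exists) blast
  have "\<forall>i. \<exists>f. f \<in> vanishing X \<and> (i \<notin> J \<longrightarrow> H $ i = gradv f p)"
  proof
    fix i
    have "(\<lambda>x. 0) \<in> vanishing X" by (auto simp: vanishing_def intro: polyfun.const)
    then show "\<exists>f. f \<in> vanishing X \<and> (i \<notin> J \<longrightarrow> H $ i = gradv f p)" using H(2)[of i] by blast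
  qed
  then obtain F where F: "\<And>i. F i \<in> vanishing X" "\<And>i. i \<notin> J \<Longrightarrow> H $ i = gradv (F i) p" by metis
  have "frame J F H p = H" using F(2) by (simp add: frame_def vec_eq_iff)
  with F H that show ?thesis by metis
qed

lemma polyfun_det:
  assumes "\<And>i j. polyfun (\<lambda>x. A x $ i $ j)" shows "polyfun (\<lambda>x. det (A x))"
  unfolding det_def by (intro polyfun_sum polyfun.mult polyfun.const polyfun_prod assms)

lemma polyfun_frame:
  assumes "\<And>i. F i \<in> vanishing X" shows "polyfun (\<lambda>x. frame J F H0 x $ i $ j)"
proof -
  have "polyfun (F i)" using assms by (simp add: vanishing_def)
  then show ?thesis by (cases "i \<in> J") (auto simp: frame_def gradv_def polyfun.const polyfun_pd)
qed

lemma polyfun_det_frame: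
  assumes "\<And>i. F i \<in> vanishing X" shows "polyfun (\<lambda>x. det (frame J F H0 x))"
  by (rule polyfun_det[OF polyfun_frame[where F=F, OF assms]])

lemma tangent_space_le_ker_rows:
  assumes "\<And>i. F i \<in> vanishing X" shows "tangent_space X x \<subseteq> ker_rows J (frame J F H0 x)"
  using assms by (auto simp: ker_rows_def frame_mult tangent_space_iff)

lemma dim_tangent_space_le:
  assumes "\<And>i. F i \<in> vanishing X" "invertible (frame J F H0 x)"
  shows "vec.dim (tangent_space X x) \<le> card J"
  using vec.dim_subset[OF tangent_space_le_ker_rows[where F=F and X=X and J=J and ?H0.0=H0 and x=x, OF assms(1)]]
    dim_ker_rows[OF assms(2), of J] by simp

lemma tangent_space_eq_ker_rows:
  assumes "\<And>i. F i \<in> vanishing X" "invertible (frame J F H0 x)" "card J \<le> vec.dim (tangent_space X x)"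
  shows "tangent_space X x = ker_rows J (frame J F H0 x)"
  by (rule vec.subspace_dim_equal[OF tangent_space_subspace ker_rows_subspace tangent_space_le_ker_rows[where F=F, OF assms(1)]])
     (simp add: dim_ker_rows[OF assms(2)] assms(3))

lemma exists_index_set:
  fixes X :: "(complex^'n) set"
  obtains J :: "'n set" where "card J = vec.dim (tangent_space X p)"
  using obtain_subset_with_card_n[of "vec.dim (tangent_space X p)" "UNIV :: 'n set"]
  by (auto simp: tangent_space_perp dim_perp)

text \<open>A frame invertible at p stays so wherever its determinant does not vanish, and there its
  rows outside J are still gradients of equations, hence bound the tangent space.\<close>

lemma tangent_dim_semicontinuous:
  fixes X :: "(complex^'n) set"
  obtains g where "polyfun g" "g p \<noteq> 0"
    "\<And>x. g x \<noteq> 0 \<Longrightarrow> vec.dim (tangent_space X x) \<le> vec.dim (tangent_space X p)"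
proof -
  obtain J :: "'n set" where J: "card J = vec.dim (tangent_space X p)" by (rule exists_index_set)
  obtain F H0 where F: "\<And>i. F i \<in> vanishing X" "invertible (frame J F H0 p)" by (rule tangent_frame[OF J]) blast
  show ?thesis
  proof (rule that[of "\<lambda>x. det (frame J F H0 x)"])
    show "polyfun (\<lambda>x. det (frame J F H0 x))" by (rule polyfun_det_frame[where F=F, OF F(1)])
    show "det (frame J F H0 p) \<noteq> 0" using F(2) by (simp add: invertible_det_nz)
    fix x assume "det (frame J F H0 x) \<noteq> 0"
    then have "invertible (frame J F H0 x)" by (simp add: invertible_det_nz)
    from dim_tangent_space_le[where F=F, OF F(1) this] J
    show "vec.dim (tangent_space X x) \<le> vec.dim (tangent_space X p)" by simp
  qed
qed


section \<open>Dimension\<close>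

lemma polyfun_in_dd: "polyfun_in S f \<Longrightarrow> polyfun_in S (\<lambda>x. dd f x w)"
  unfolding dd_def by (intro polyfun_in_sum polyfun_in.mult polyfun_in.const polyfun_in_pd)

text \<open>At a generic point of V every vector supported in J is the J-part of
  \<open>L *v v\<close> for some tangent vector v. A relation P therefore stays a relation when
  differentiated in directions of J, so its Taylor expansion at one point vanishes.\<close>

lemma generic_coordinates_independent:
  fixes V :: "(complex^'n) set"
  assumes V: "irr V" and min: "\<And>q. q \<in> V \<Longrightarrow> card J \<le> vec.dim (tangent_space V q)"
    and F: "\<And>i. F i \<in> vanishing V" and q0: "q0 \<in> V" "invertible (frame J F H0 q0)"
    and P: "polyfun_in J P" "\<And>x. x \<in> V \<Longrightarrow> P (frame J F H0 q0 *v x) = 0"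
  shows "P z = 0"
proof -
  define L where "L = frame J F H0 q0"
  have pL: "polyfun (\<lambda>x. (L *v x) $ i)" for i
    unfolding matrix_vector_mult_def by (auto intro!: polyfun_sum polyfun.mult polyfun.const polyfun.coord)
  have ddL: "(\<chi> i. dd (\<lambda>x. (L *v x) $ i) x v) = L *v v" for x v
  proof -
    have "dd (\<lambda>x. \<Sum>j\<in>UNIV. L $ i $ j * x $ j) x v = (\<Sum>j\<in>UNIV. L $ i $ j * v $ j)" for i
      by (subst dd_sum) (auto intro!: sum.cong polyfun.mult polyfun.const polyfun.coord simp: dd_cmult polyfun.coord)
    then show ?thesis by (simp add: matrix_vector_mult_def)
  qed
  have step: "dd Q (L *v q) w = 0"
    if Q: "polyfun_in J Q" "\<And>x. x \<in> V \<Longrightarrow> Q (L *v x) = 0" and w: "\<And>i. i \<notin> J \<Longrightarrow> w $ i = 0" and q: "q \<in> V" for Q w q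
  proof (rule irr_mult[where f="\<lambda>q. dd Q (L *v q) w", OF V _ polyfun_det_frame[where F=F, OF F] _ q0(1) _ q])
    have pQ: "polyfun Q" by (rule polyfun_in_imp[OF Q(1)])
    show "polyfun (\<lambda>q. dd Q (L *v q) w)" by (rule polyfun_compose[OF polyfun_dd[OF pQ] pL])
    show "det (frame J F H0 q0) \<noteq> 0" using q0(2) by (simp add: invertible_det_nz)
    fix x assume x: "x \<in> V" "det (frame J F H0 x) \<noteq> 0"
    then have inv: "invertible (frame J F H0 x)" by (simp add: invertible_det_nz)
    define v where "v = matrix_inv (frame J F H0 x) *v w"
    have Hv: "frame J F H0 x *v v = w" by (simp add: v_def invertible_matrix_inv[OF inv])
    then have "v \<in> ker_rows J (frame J F H0 x)" by (simp add: ker_rows_def w)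
    then have v: "v \<in> tangent_space V x" using tangent_space_eq_ker_rows[where F=F, OF F inv min[OF x(1)]] by simp
    have "(\<lambda>x. Q (L *v x)) \<in> vanishing V" using Q(2) polyfun_compose[OF pQ pL] by (simp add: vanishing_def)
    then have "dd (\<lambda>x. Q (L *v x)) x v = 0" using v by (simp add: tangent_space_iff)
    then have 0: "dd Q (L *v x) (L *v v) = 0" using dd_compose[OF pQ pL, of x v] ddL by simp
    \<comment> \<open>L and the frame at x share the constant rows in J, and the derivative of Q
      sees only the coordinates in J.\<close>
    have "(L *v v) $ i = w $ i" if "i \<in> J" for i
      using arg_cong[OF Hv, of "\<lambda>u. u $ i"] that by (simp add: L_def frame_mult)
    then have "dd Q (L *v x) (L *v v) = dd Q (L *v x) w"
      unfolding dd_def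
    proof (intro sum.cong refl)
      fix i show "(L *v v) $ i * pd i Q (L *v x) = w $ i * pd i Q (L *v x)"
        using \<open>\<And>i. i \<in> J \<Longrightarrow> (L *v v) $ i = w $ i\<close> polyfun_in_pd(2)[OF Q(1), of i] by (cases "i \<in> J") auto
    qed
    with 0 show "dd Q (L *v x) w = 0" by simp
  qed
  \<comment> \<open>The step from the base point \<open>L *v q0\<close> to z, as far as the
    coordinates in J can see it.\<close>
  define w where "w = (\<chi> i. if i \<in> J then z $ i - (L *v q0) $ i else 0)"
  have D: "polyfun_in J (((\<lambda>g x. dd g x w) ^^ n) P) \<and> (\<forall>x\<in>V. ((\<lambda>g x. dd g x w) ^^ n) P (L *v x) = 0)" for n
  proof (induction n)
    case 0
    then show ?case using P by (simp add: L_def)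
  next
    case (Suc n)
    let ?Q = "((\<lambda>g x. dd g x w) ^^ n) P"
    have "polyfun_in J (\<lambda>x. dd ?Q x w)" using Suc by (intro polyfun_in_dd) simp
    moreover have "dd ?Q (L *v x) w = 0" if "x \<in> V" for x
      by (rule step) (use Suc that in \<open>auto simp: w_def\<close>)
    ultimately show ?case by simp
  qed
  have "P (L *v q0 + w) = 0"
    by (rule polyfun_zero_of_line_derivatives[OF polyfun_in_imp[OF P(1)]]) (use D q0(1) in blast)
  moreover have "P z = P (L *v q0 + w)" by (rule polyfun_in_cong[OF P(1)]) (simp add: w_def)
  ultimately show ?thesis by simp
qed

section \<open>Elimination of coordinates and the generic rank of the equations\<close>

lemma gradv_add: "polyfun f \<Longrightarrow> polyfun g \<Longrightarrow> gradv (\<lambda>x. f x + g x) y = gradv f y + gradv g y"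
  by (simp add: gradv_def vec_eq_iff dd_plus flip: dd_axis)

lemma gradv_mult: "polyfun f \<Longrightarrow> polyfun g \<Longrightarrow> gradv (\<lambda>x. f x * g x) y = f y *s gradv g y + g y *s gradv f y"
  by (simp add: gradv_def vec_eq_iff dd_mult mult.commute flip: dd_axis)

lemma gradv_zero: "gradv (\<lambda>x. 0) y = 0"
  by (simp add: gradv_def vec_eq_iff flip: dd_axis)

text \<open>An infinitesimal count of relations: over a nonempty open part of Y the gradients of the
  equations in the coordinates S span at most d dimensions. It takes the place of the number of
  coordinates minus a transcendence degree.\<close>

definition elim_bound :: "(complex^'m) set \<Rightarrow> 'm set \<Rightarrow> nat \<Rightarrow> bool" where
  "elim_bound Y S d \<longleftrightarrow> (\<exists>b. polyfun b \<and> (\<exists>y\<in>Y. b y \<noteq> 0) \<and> (\<forall>y\<in>Y. b y \<noteq> 0 \<longrightarrow>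
     (\<exists>B. finite B \<and> card B \<le> d \<and> (\<forall>F\<in>vanishing Y. polyfun_in S F \<longrightarrow> gradv F y \<in> vec.span B))))"

lemma polyfun_eval:
  assumes "\<forall>k. polyfun_in S (coeff p k)" shows "polyfun (poly p (\<lambda>x. x $ j))"
  using poly_polyfun_in[OF assms] polyfun_in_imp by blast

lemma poly_pCons_fun: "poly (pCons a p) (\<lambda>x. x $ j) = (\<lambda>x. a x + x $ j * poly p (\<lambda>x. x $ j) x)"
  by (simp add: func_plus func_times)

lemma eval_vanishing_coeffs:
  assumes "\<forall>k. \<forall>y\<in>Y. coeff p k y = 0" "y \<in> Y" shows "poly p (\<lambda>x. x $ j) y = 0"
  using assms(1)
proof (induction p)
  case 0
  show ?case by simp
next
  case (pCons a p)
  have "\<forall>k. \<forall>y\<in>Y. coeff p k y = 0" using pCons.prems by (metis coeff_pCons_Suc)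
  moreover have "a y = 0" using pCons.prems assms(2) by (metis coeff_pCons_0)
  ultimately show ?case using pCons.IH unfolding poly_pCons_fun by simp
qed

text \<open>By the product rule, every term in which the power of coordinate j is differentiated
  carries a coefficient that vanishes at y; only gradients of coefficients remain.\<close>

lemma gradv_eval_vanishing_coeffs:
  assumes "\<forall>k. polyfun_in S (coeff p k)" "\<forall>k. \<forall>y\<in>Y. coeff p k y = 0" "y \<in> Y"
    "\<And>F. F \<in> vanishing Y \<Longrightarrow> polyfun_in S F \<Longrightarrow> gradv F y \<in> vec.span B"
  shows "gradv (poly p (\<lambda>x. x $ j)) y \<in> vec.span B"
  using assms(1,2)
proof (induction p)
  case 0
  show ?case by (simp add: func_zero gradv_zero vec.span_zero)
next
  case (pCons a p)
  have p: "\<forall>k. polyfun_in S (coeff p k)" "\<forall>k. \<forall>y\<in>Y. coeff p k y = 0"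
    using pCons.prems by (metis coeff_pCons_Suc)+
  have a: "polyfun_in S a" "\<forall>y\<in>Y. a y = 0" using pCons.prems by (metis coeff_pCons_0)+
  have "gradv a y \<in> vec.span B" using a assms(4)[of a] polyfun_in_imp[OF a(1)] by (simp add: vanishing_def)
  moreover have "gradv (\<lambda>x. x $ j * poly p (\<lambda>x. x $ j) x) y = y $ j *s gradv (poly p (\<lambda>x. x $ j)) y"
    using eval_vanishing_coeffs[OF p(2) assms(3)] polyfun_eval[OF p(1)] by (subst gradv_mult) (auto intro: polyfun.coord)
  moreover have "gradv (\<lambda>x. a x + x $ j * poly p (\<lambda>x. x $ j) x) y = gradv a y + gradv (\<lambda>x. x $ j * poly p (\<lambda>x. x $ j) x) y"
    by (intro gradv_add polyfun_in_imp[OF a(1)] polyfun.mult polyfun.coord polyfun_eval[OF p(1)])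
  ultimately show ?case unfolding poly_pCons_fun
    using pCons.IH[OF p] by (simp add: vec.span_add vec.span_scale)
qed

text \<open>Division by p after multiplication with powers of its leading coefficient. The remainder
  is a relation of smaller degree than p, so by \<open>min\<close> all its coefficients vanish on
  Y.\<close>

lemma pseudo_division:
  fixes Y :: "(complex^'m) set" and S :: "'m set"
  defines "A \<equiv> {f. polyfun_in S f}"
  assumes p: "\<forall>k. coeff p k \<in> A" "\<forall>y\<in>Y. poly p (\<lambda>x. x $ j) y = 0" "degree p > 0"
    and min: "\<And>q. \<forall>k. coeff q k \<in> A \<Longrightarrow> \<forall>y\<in>Y. poly q (\<lambda>x. x $ j) y = 0 \<Longrightarrow> degree q < degree p \<Longrightarrow>
        \<forall>k. \<forall>y\<in>Y. coeff q k y = 0"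
    and q: "\<forall>k. coeff q k \<in> A" "\<forall>y\<in>Y. poly q (\<lambda>x. x $ j) y = 0"
  shows "\<exists>M s r. polyfun s \<and> (\<forall>k. coeff r k \<in> A) \<and> (\<forall>k. \<forall>y\<in>Y. coeff r k y = 0) \<and>
      (\<forall>x. lead_coeff p x ^ M * poly q (\<lambda>x. x $ j) x = s x * poly p (\<lambda>x. x $ j) x + poly r (\<lambda>x. x $ j) x)"
  using q
proof (induction "degree q" arbitrary: q rule: less_induct)
  case less
  let ?ev = "\<lambda>p. poly p (\<lambda>x. x $ j)"
  have sub: "subring {p. \<forall>k. coeff p k \<in> A}" unfolding A_def by (rule subring_polys[OF subring_polyfun_in])
  show ?case
  proof (cases "degree q < degree p")
    case True
    show ?thesis
      by (rule exI[of _ 0], rule exI[of _ "\<lambda>x. 0"], rule exI[of _ q])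
         (use less.prems min[OF less.prems True] in \<open>auto intro: polyfun.const\<close>)
  next
    case False
    define c where "c = lead_coeff p"
    define m where "m = monom (lead_coeff q) (degree q - degree p)"
    define q' where "q' = [:c:] * q - m * p"
    have cA: "c \<in> A" and lA: "lead_coeff q \<in> A" using p less.prems by (auto simp: c_def)
    have zA: "0 \<in> A" using subring_polyfun_in unfolding subring_def A_def by blast
    have cP: "[:c:] \<in> {p. \<forall>k. coeff p k \<in> A}" using cA zA by (auto simp: coeff_pCons split: nat.splits)
    have mP: "m \<in> {p. \<forall>k. coeff p k \<in> A}" using lA zA by (auto simp: m_def)
    have mpP: "- (m * p) \<in> {p. \<forall>k. coeff p k \<in> A}"
      using sub subring_mult[OF sub mP] p(1) unfolding subring_def by blast
    have "q' \<in> {p. \<forall>k. coeff p k \<in> A}"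
      using subring_add[OF sub subring_mult[OF sub cP] mpP] less.prems(1) by (simp add: q'_def)
    then have q'A: "\<forall>k. coeff q' k \<in> A" by simp
    have ev: "?ev q' x = c x * ?ev q x - lead_coeff q x * (x $ j) ^ (degree q - degree p) * ?ev p x" for x
    proof -
      have pw: "((\<lambda>x::complex^'m. x $ j) ^ n) x = (x $ j) ^ n" for n
        by (induction n) (simp_all add: func_times func_one)
      show ?thesis by (simp add: q'_def m_def poly_monom pw)
    qed
    have q'Y: "\<forall>y\<in>Y. ?ev q' y = 0" using ev p(2) less.prems(2) by simp
    have "degree (m * p) \<le> degree q"
      using degree_mult_le[of m p] degree_monom_le[of "lead_coeff q" "degree q - degree p"] False by (simp add: m_def)
    moreover have "degree ([:c:] * q) \<le> degree q" by (simp add: degree_smult_le)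
    ultimately have "degree q' \<le> degree q" unfolding q'_def by (intro degree_diff_le)
    moreover have "coeff q' (degree q) = 0"
      using False by (simp add: q'_def m_def c_def coeff_monom_mult)
    ultimately have "degree q' < degree q"
      using False p(3) by (metis degree_0 leading_coeff_0_iff le_neq_implies_less less_le_trans not_less)
    from less.hyps[OF this q'A q'Y] obtain M s r where IH: "polyfun s" "\<forall>k. coeff r k \<in> A" "\<forall>k. \<forall>y\<in>Y. coeff r k y = 0"
      "\<And>x. c x ^ M * ?ev q' x = s x * ?ev p x + ?ev r x" unfolding c_def by blast
    define s' where "s' x = s x + c x ^ M * (lead_coeff q x * (x $ j) ^ (degree q - degree p))" for x
    have "polyfun c" "polyfun (lead_coeff q)" using cA lA polyfun_in_imp unfolding A_def by blast+
    then have "polyfun s'" unfolding s'_def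
      by (intro polyfun.add polyfun.mult polyfun_power polyfun.coord IH(1))
    moreover have "c x ^ Suc M * ?ev q x = s' x * ?ev p x + ?ev r x" for x
      using IH(4)[of x] by (simp add: ev s'_def algebra_simps)
    ultimately show ?thesis using IH(2,3) unfolding c_def by blast
  qed
qed

text \<open>If all relations involving coordinate j have coefficients vanishing on Y, no new
  direction arises. Otherwise a nontrivial relation p of least degree divides all others up to such
  trivial ones, and its gradient is the single new direction.\<close>

lemma elim_bound_insert:
  fixes Y :: "(complex^'m) set"
  assumes Y: "irr Y" and E: "elim_bound Y S d"
  shows "elim_bound Y (insert j S) (Suc d)"
proof -
  let ?ev = "\<lambda>p. poly p (\<lambda>x. x $ j)"
  define A where "A = {f :: complex^'m \<Rightarrow> complex. polyfun_in S f}"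
  have rep: "\<exists>p. (\<forall>k. coeff p k \<in> A) \<and> F = ?ev p" if "polyfun_in (insert j S) F" for F
    using polyfun_in_insert[OF that] unfolding adjoin_def A_def by blast
  obtain b where b: "polyfun b" "\<exists>y\<in>Y. b y \<noteq> 0" "\<And>y. y \<in> Y \<Longrightarrow> b y \<noteq> 0 \<Longrightarrow>
     \<exists>B. finite B \<and> card B \<le> d \<and> (\<forall>F\<in>vanishing Y. polyfun_in S F \<longrightarrow> gradv F y \<in> vec.span B)"
    using E unfolding elim_bound_def by blast
  define bad where "bad p \<longleftrightarrow> (\<forall>k. coeff p k \<in> A) \<and> (\<forall>y\<in>Y. ?ev p y = 0) \<and> \<not> (\<forall>k. \<forall>y\<in>Y. coeff p k y = 0)" for p
  show ?thesis
  proof (cases "\<exists>p. bad p")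
    case False
    show ?thesis unfolding elim_bound_def
    proof (intro exI[of _ b] conjI b ballI impI)
      fix y assume y: "y \<in> Y" "b y \<noteq> 0"
      obtain B where B: "finite B" "card B \<le> d" "\<And>F. F \<in> vanishing Y \<Longrightarrow> polyfun_in S F \<Longrightarrow> gradv F y \<in> vec.span B"
        using b(3)[OF y] by blast
      have "gradv F y \<in> vec.span B" if F: "F \<in> vanishing Y" "polyfun_in (insert j S) F" for F
      proof -
        obtain p where p: "\<forall>k. coeff p k \<in> A" "F = ?ev p" using rep[OF F(2)] by blast
        then have "\<forall>k. \<forall>y\<in>Y. coeff p k y = 0" using False F(1) unfolding bad_def vanishing_def by blast
        with p show ?thesis unfolding p(2) A_def
          by (intro gradv_eval_vanishing_coeffs[OF _ _ y(1) B(3)]) auto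
      qed
      with B show "\<exists>B. finite B \<and> card B \<le> Suc d \<and> (\<forall>F\<in>vanishing Y. polyfun_in (insert j S) F \<longrightarrow> gradv F y \<in> vec.span B)"
        by (intro exI[of _ B]) auto
    qed
  next
    case True
    then obtain p where p: "bad p" "\<And>q. bad q \<Longrightarrow> degree p \<le> degree q"
      using ex_has_least_nat[of bad _ degree] by blast
    define c where "c = lead_coeff p"
    have cA: "c \<in> A" using p(1) by (simp add: bad_def c_def)
    then have pc: "polyfun c" unfolding A_def using polyfun_in_imp by blast
    have sub: "subring {p. \<forall>k. coeff p k \<in> A}" unfolding A_def by (rule subring_polys[OF subring_polyfun_in])
    have zA: "0 \<in> A" using subring_polyfun_in unfolding subring_def A_def by blast
    \<comment> \<open>If the leading coefficient vanished on Y, dropping the leading term would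
      leave a nontrivial relation of smaller degree.\<close>
    have c: "\<exists>y\<in>Y. c y \<noteq> 0"
    proof (rule ccontr)
      assume no: "\<not> (\<exists>y\<in>Y. c y \<noteq> 0)"
      define p' where "p' = p - monom c (degree p)"
      have co: "coeff p' k = (if k = degree p then 0 else coeff p k)" for k by (simp add: p'_def c_def)
      have "\<exists>k. \<exists>y\<in>Y. coeff p k y \<noteq> 0" using p(1) unfolding bad_def by blast
      then obtain k y where ky: "y \<in> Y" "coeff p k y \<noteq> 0" by blast
      with no have kd: "k \<noteq> degree p" by (auto simp: c_def)
      have "coeff p' k y \<noteq> 0" using ky kd by (simp add: co)
      moreover have "\<forall>k. coeff p' k \<in> A" using p(1) zA by (auto simp: co bad_def)
      moreover have "?ev p' y = 0" if "y \<in> Y" for y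
        using that no p(1) by (simp add: p'_def poly_monom bad_def)
      ultimately have "bad p'" using ky(1) unfolding bad_def by blast
      then have "degree p \<le> degree p'" by (rule p(2))
      moreover have "degree p' \<le> degree p" unfolding p'_def
        by (intro degree_diff_le degree_monom_le order_refl)
      ultimately have "p' = 0" using co[of "degree p"] by (metis leading_coeff_0_iff order_antisym)
      with \<open>coeff p' k y \<noteq> 0\<close> show False by simp
    qed
    have dp: "degree p > 0"
    proof (rule ccontr)
      assume "\<not> degree p > 0"
      then obtain a where a: "p = [:a:]" using degree_eq_zeroE[of p] by blast
      then have "c = a" "?ev p = a" by (simp_all add: c_def func_plus func_times func_zero)
      with c p(1) show False by (auto simp: bad_def)
    qed
    have pp: "polyfun (?ev p)" using p(1) by (intro polyfun_eval[of S]) (simp add: bad_def A_def)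
    obtain y0 where "y0 \<in> Y" "b y0 \<noteq> 0" using b(2) by blast
    moreover obtain y1 where "y1 \<in> Y" "c y1 \<noteq> 0" using c by blast
    ultimately obtain y2 where y2: "y2 \<in> Y" "b y2 \<noteq> 0" "c y2 \<noteq> 0"
      using irr_nonzero_mult[OF Y b(1) pc] by metis
    show ?thesis unfolding elim_bound_def
    proof (intro exI[of _ "\<lambda>x. b x * c x"] conjI polyfun.mult b(1) pc ballI impI)
      show "\<exists>y\<in>Y. b y * c y \<noteq> 0" using y2 by auto
      fix y assume y: "y \<in> Y" "b y * c y \<noteq> 0"
      then have y': "b y \<noteq> 0" "c y \<noteq> 0" by auto
      obtain B where B: "finite B" "card B \<le> d" "\<And>F. F \<in> vanishing Y \<Longrightarrow> polyfun_in S F \<Longrightarrow> gradv F y \<in> vec.span B"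
        using b(3)[OF y(1) y'(1)] by blast
      let ?g = "gradv (?ev p) y"
      have "gradv F y \<in> vec.span (insert ?g B)" if F: "F \<in> vanishing Y" "polyfun_in (insert j S) F" for F
      proof -
        obtain q where q: "\<forall>k. coeff q k \<in> A" "F = ?ev q" using rep[OF F(2)] by blast
        have qY: "\<forall>y\<in>Y. ?ev q y = 0" using F(1) q(2) by (simp add: vanishing_def)
        have "\<exists>M s r. polyfun s \<and> (\<forall>k. coeff r k \<in> {f. polyfun_in S f}) \<and> (\<forall>k. \<forall>y\<in>Y. coeff r k y = 0) \<and>
          (\<forall>x. lead_coeff p x ^ M * ?ev q x = s x * ?ev p x + ?ev r x)"
        proof (rule pseudo_division[OF _ _ dp])
          fix q' assume "\<forall>k. coeff q' k \<in> {f. polyfun_in S f}" "\<forall>y\<in>Y. ?ev q' y = 0" "degree q' < degree p"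
          then show "\<forall>k. \<forall>y\<in>Y. coeff q' k y = 0" using p(2)[of q'] unfolding bad_def A_def by force
        qed (use p(1) q(1) qY in \<open>auto simp: bad_def A_def\<close>)
        then obtain M s r where r: "polyfun s" "\<forall>k. coeff r k \<in> A" "\<forall>k. \<forall>y\<in>Y. coeff r k y = 0"
          "\<And>x. c x ^ M * ?ev q x = s x * ?ev p x + ?ev r x" unfolding c_def A_def by blast
        have pr: "polyfun (?ev r)" using r(2) by (intro polyfun_eval[of S]) (simp add: A_def)
        have pq: "polyfun (?ev q)" using q(1) by (intro polyfun_eval[of S]) (simp add: A_def)
        have gr: "gradv (?ev r) y \<in> vec.span B"
          by (rule gradv_eval_vanishing_coeffs[OF _ r(3) y(1) B(3)]) (use r(2) in \<open>auto simp: A_def\<close>)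
        \<comment> \<open>Gradients of the division identity at y: the relations themselves vanish
          there, so derivatives of the multipliers drop out, and c y is invertible.\<close>
        have "gradv (\<lambda>x. c x ^ M * ?ev q x) y = gradv (\<lambda>x. s x * ?ev p x + ?ev r x) y" using r(4) by simp
        moreover have "gradv (\<lambda>x. c x ^ M * ?ev q x) y = c y ^ M *s gradv (?ev q) y"
          using qY y(1) by (subst gradv_mult[OF polyfun_power[OF pc] pq]) simp
        moreover have "gradv (\<lambda>x. s x * ?ev p x + ?ev r x) y = s y *s ?g + gradv (?ev r) y"
          using p(1) y(1) by (subst gradv_add[OF polyfun.mult[OF r(1) pp] pr], subst gradv_mult[OF r(1) pp]) (simp add: bad_def)
        ultimately have "c y ^ M *s gradv F y = s y *s ?g + gradv (?ev r) y" by (simp add: q(2))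
        then have "(1 / c y ^ M) *s (c y ^ M *s gradv F y) = (1 / c y ^ M) *s (s y *s ?g + gradv (?ev r) y)" by simp
        then have "gradv F y = (1 / c y ^ M) *s (s y *s ?g + gradv (?ev r) y)" using y'(2) by simp
        also have "\<dots> \<in> vec.span (insert ?g B)"
        proof (intro vec.span_scale vec.span_add)
          show "?g \<in> vec.span (insert ?g B)" by (rule vec.span_base) simp
          show "gradv (?ev r) y \<in> vec.span (insert ?g B)" using gr vec.span_mono[of B "insert ?g B"] by blast
        qed
        finally show ?thesis .
      qed
      with B show "\<exists>B. finite B \<and> card B \<le> Suc d \<and> (\<forall>F\<in>vanishing Y. polyfun_in (insert j S) F \<longrightarrow> gradv F y \<in> vec.span B)"
        by (intro exI[of _ "insert ?g B"]) (auto intro: le_trans[OF card_insert_le_m1] simp: card_insert_if)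
    qed
  qed
qed

text \<open>Start from S, where the zero polynomial is the only relation and the bound is 0, and add
  the remaining coordinates one at a time.\<close>

lemma elim_bound_UNIV:
  fixes Y :: "(complex^'m) set"
  assumes Y: "irr Y" and S: "\<And>F z. polyfun_in S F \<Longrightarrow> F \<in> vanishing Y \<Longrightarrow> F z = 0"
  shows "elim_bound Y UNIV (CARD('m) - card S)"
proof -
  have "elim_bound Y (S \<union> D) (card D)" if "D \<subseteq> - S" for D
  proof -
    have "finite D" by simp
    then show ?thesis using that
    proof induction
      case empty
      obtain y where y: "y \<in> Y" using Y by (auto simp: irr_def)
      have "gradv F y = 0" if "F \<in> vanishing Y" "polyfun_in S F" for F y
      proof -
        have "F = (\<lambda>x. 0)" using S[OF that(2,1)] by auto
        then show ?thesis by (simp add: gradv_zero)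
      qed
      then show ?case unfolding elim_bound_def
        by (intro exI[of _ "\<lambda>x. 1"] conjI polyfun.const bexI[OF _ y] ballI impI exI[of _ "{}"]) (auto simp: vec.span_zero)
    next
      case (insert j D)
      then show ?case using elim_bound_insert[OF Y, of "S \<union> D" "card D" j] by simp
    qed
  qed
  from this[of "- S"] show ?thesis by (simp add: Compl_eq_Diff_UNIV card_Diff_subset)
qed

lemma elim_bound_tangent_dim:
  fixes Y :: "(complex^'m) set"
  assumes "elim_bound Y UNIV d"
  obtains b where "polyfun b" "\<exists>y\<in>Y. b y \<noteq> 0"
    "\<And>y. y \<in> Y \<Longrightarrow> b y \<noteq> 0 \<Longrightarrow> CARD('m) - d \<le> vec.dim (tangent_space Y y)"
proof -
  obtain b where b: "polyfun b" "\<exists>y\<in>Y. b y \<noteq> 0" "\<And>y. y \<in> Y \<Longrightarrow> b y \<noteq> 0 \<Longrightarrow>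
     \<exists>B. finite B \<and> card B \<le> d \<and> (\<forall>F\<in>vanishing Y. polyfun_in UNIV F \<longrightarrow> gradv F y \<in> vec.span B)"
    using assms unfolding elim_bound_def by blast
  show ?thesis
  proof (rule that[OF b(1,2)])
    fix y assume "y \<in> Y" "b y \<noteq> 0"
    then obtain B where B: "finite B" "card B \<le> d" "\<forall>F\<in>vanishing Y. polyfun_in UNIV F \<longrightarrow> gradv F y \<in> vec.span B"
      using b(3) by blast
    have "(\<lambda>f. gradv f y) ` vanishing Y \<subseteq> vec.span B"
      using B(3) by (auto simp: vanishing_def polyfun_in_UNIV)
    then have "vec.dim ((\<lambda>f. gradv f y) ` vanishing Y) \<le> d"
      using vec.dim_le_card[of _ B] B(1,2) le_trans by blast
    then show "CARD('m) - d \<le> vec.dim (tangent_space Y y)" by (simp add: tangent_space_perp dim_perp diff_le_mono2)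
  qed
qed

text \<open>The graph of s over X in the linear coordinates L: the extra index \<open>None\<close>
  turns the function s into a coordinate, so that the elimination bound can count it.\<close>

definition graph_coords :: "complex^'n^'n \<Rightarrow> (complex^'n \<Rightarrow> complex) \<Rightarrow> complex^'n \<Rightarrow> complex^('n option)" where
  "graph_coords L s x = (\<chi> k. case k of None \<Rightarrow> s x | Some i \<Rightarrow> (L *v x) $ i)"

lemma polyfun_matrix_mult: "polyfun (\<lambda>x. (L *v x) $ i)"
  unfolding matrix_vector_mult_def by (auto intro!: polyfun_sum polyfun.mult polyfun.const polyfun.coord)

lemma polyfun_graph_coords: "polyfun s \<Longrightarrow> polyfun (\<lambda>x. graph_coords L s x $ k)"
  by (cases k) (simp_all add: graph_coords_def polyfun_matrix_mult)

lemma irr_image: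
  assumes X: "irr X" and y: "\<And>k. polyfun (\<lambda>x. y x $ k)" shows "irr (y ` X)"
  unfolding irr_def
proof (intro conjI allI impI)
  show "y ` X \<noteq> {}" using X by (simp add: irr_def)
  fix f g assume *: "polyfun f \<and> polyfun g \<and> (\<forall>z\<in>y ` X. f z * g z = 0)"
  then have "polyfun (\<lambda>x. f (y x))" "polyfun (\<lambda>x. g (y x))" using polyfun_compose[OF _ y] by auto
  with * X show "(\<forall>z\<in>y ` X. f z = 0) \<or> (\<forall>z\<in>y ` X. g z = 0)" unfolding irr_def by auto
qed

lemma linear_proj_Some: 
  "Vector_Spaces.linear (*s) (*s) (\<lambda>w :: complex^('n option). (A :: complex^'n^'n) *v (\<chi> i. w $ Some i))"
proof unfold_locales
  fix x y :: "complex^('n option)" and c :: complex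
  have 1: "(\<chi> i. (x + y) $ Some i) = (\<chi> i. x $ Some i) + ((\<chi> i. y $ Some i) :: complex^'n)"
    and 2: "(\<chi> i. (c *s x) $ Some i) = c *s ((\<chi> i. x $ Some i) :: complex^'n)" by (simp_all add: vec_eq_iff)
  show "A *v (\<chi> i. (x + y) $ Some i) = A *v (\<chi> i. x $ Some i) + A *v (\<chi> i. y $ Some i)"
    unfolding 1 by (rule matrix_vector_right_distrib)
  show "A *v (\<chi> i. (c *s x) $ Some i) = c *s (A *v (\<chi> i. x $ Some i))"
    unfolding 2 by (rule vec.scale)
qed

text \<open>The projection p back to X is polynomial. On tangent vectors of the graph it is
  injective, since the \<open>None\<close> component is determined by the equation
  \<open>w $ None = s (p w)\<close>.\<close>

lemma graph_tangent_dim: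
  fixes X :: "(complex^'n) set"
  assumes L: "invertible L" and s: "polyfun s"
  shows "vec.dim (tangent_space (graph_coords L s ` X) (graph_coords L s x)) \<le> vec.dim (tangent_space X x)"
proof -
  let ?y = "graph_coords L s" 
  define p where "p w = matrix_inv L *v (\<chi> i. w $ Some i)" for w :: "complex^('n option)"
  have py: "p (?y x) = x" for x
  proof -
    have "(\<chi> i. ?y x $ Some i) = L *v x" by (simp add: graph_coords_def vec_eq_iff)
    then show ?thesis by (simp add: p_def invertible_matrix_inv[OF L])
  qed
  have pp: "polyfun (\<lambda>w. p w $ i)" for i
    unfolding p_def matrix_vector_mult_def by (auto intro!: polyfun_sum polyfun.mult polyfun.const polyfun.coord)
  have dp: "(\<chi> i. dd (\<lambda>w. p w $ i) z w) = p w" for z w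
  proof -
    have "dd (\<lambda>w. \<Sum>j\<in>UNIV. matrix_inv L $ i $ j * w $ Some j) z w = (\<Sum>j\<in>UNIV. matrix_inv L $ i $ j * w $ Some j)" for i
      by (subst dd_sum) (auto intro!: sum.cong polyfun.mult polyfun.const polyfun.coord simp: dd_cmult polyfun.coord)
    then show ?thesis by (simp add: p_def matrix_vector_mult_def)
  qed
  let ?T = "tangent_space (?y ` X) (?y x)"
  have img: "p ` ?T \<subseteq> tangent_space X x"
  proof (intro subsetI, unfold tangent_space_iff, intro ballI)
    fix v f assume "v \<in> p ` ?T" and f: "f \<in> vanishing X"
    then obtain w where w: "w \<in> ?T" "v = p w" by blast
    have pf: "polyfun f" using f by (simp add: vanishing_def)
    have "(\<lambda>w. f (p w)) \<in> vanishing (?y ` X)"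
      using f polyfun_compose[OF pf pp] by (auto simp: vanishing_def py)
    then have "dd (\<lambda>w. f (p w)) (?y x) w = 0" using w(1) by (simp add: tangent_space_iff)
    then show "dd f x v = 0" using dd_compose[OF pf pp, of "?y x" w] by (simp add: dp py w(2))
  qed
  have "inj_on p ?T"
  proof (rule inj_onI)
    fix w w' assume w: "w \<in> ?T" "w' \<in> ?T" "p w = p w'"
    define u where "u = w - w'"
    have u: "u \<in> ?T" unfolding u_def by (rule vec.subspace_diff[OF tangent_space_subspace w(1,2)])
    have "(\<chi> i. w $ Some i) = (\<chi> i. w' $ Some i)"
      using w(3) invertible_matrix_inv(1)[OF L] unfolding p_def by metis
    then have S: "u $ Some i = 0" for i by (simp add: u_def vec_eq_iff)
    then have pu: "p u = 0" by (simp add: p_def zero_vec_def[symmetric])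
    have ps: "polyfun (\<lambda>w. s (p w))" by (rule polyfun_compose[OF s pp])
    have "(\<lambda>w. w $ None - s (p w)) \<in> vanishing (?y ` X)"
      unfolding vanishing_def
    proof (intro CollectI conjI ballI polyfun_diff polyfun.coord ps)
      fix z assume "z \<in> ?y ` X"
      then obtain x where "z = ?y x" by blast
      moreover have "?y x $ None = s x" by (simp add: graph_coords_def)
      ultimately show "z $ None - s (p z) = 0" by (simp add: py)
    qed
    then have "dd (\<lambda>w. w $ None - s (p w)) (?y x) u = 0" using u by (simp add: tangent_space_iff)
    then have "u $ None = dd (\<lambda>w. s (p w)) (?y x) u" by (simp add: dd_minus[OF polyfun.coord ps])
    also have "\<dots> = 0" using dd_compose[OF s pp, of "?y x" u] by (simp add: dp pu)
    finally have "u $ k = 0" for k using S by (cases k) auto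
    then show "w = w'" by (simp add: u_def vec_eq_iff)
  qed
  then have "inj_on p (vec.span ?T)" by (simp add: vec.span_eq_iff[THEN iffD2, OF tangent_space_subspace])
  moreover have "Vector_Spaces.linear (*s) (*s) p"
    using linear_proj_Some[of "matrix_inv L"] unfolding p_def[abs_def] .
  ultimately have "vec.dim (p ` ?T) = vec.dim ?T" by (intro vec.dim_image_eq)
  then show ?thesis using vec.dim_subset[OF img] by simp
qed

text \<open>View F as a polynomial in s with coefficients in the coordinates J. On V the function s
  vanishes, so the constant coefficient is a relation on V and hence zero; the rest is divisible by
  s, which can be cancelled on the irreducible X.\<close>

lemma graph_coords_independent:
  fixes V X :: "(complex^'n) set"
  assumes V: "irr V" "V \<subseteq> X" and X: "irr X" and s: "s \<in> vanishing V" "x0 \<in> X" "s x0 \<noteq> 0"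
    and ind: "\<And>P z. polyfun_in J P \<Longrightarrow> (\<And>x. x \<in> V \<Longrightarrow> P (L *v x) = 0) \<Longrightarrow> P z = 0"
    and F: "polyfun_in (insert None (Some ` J)) F" "F \<in> vanishing (graph_coords L s ` X)"
  shows "F z = 0"
proof -
  let ?y = "graph_coords L s"
  let ?ev = "\<lambda>p. poly p (\<lambda>w :: complex^('n option). w $ None)"
  have ps: "polyfun s" using s by (simp add: vanishing_def)
  have main: "?ev p = (\<lambda>z. 0)" if "\<forall>k. polyfun_in (Some ` J) (coeff p k)" "\<And>x. x \<in> X \<Longrightarrow> ?ev p (?y x) = 0" for p
    using that
  proof (induction p)
    case 0
    show ?case by (simp add: func_zero)
  next
    case (pCons a q)
    have q: "\<forall>k. polyfun_in (Some ` J) (coeff q k)" using pCons.prems(1) by (metis coeff_pCons_Suc)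
    have a: "polyfun_in (Some ` J) a" using pCons.prems(1) by (metis coeff_pCons_0)
    have eq: "a (?y x) + s x * ?ev q (?y x) = 0" if "x \<in> X" for x
      using pCons.prems(2)[OF that] unfolding poly_pCons_fun by (simp add: graph_coords_def)
    define h where "h z = (\<chi> k. case k of None \<Rightarrow> 0 | Some i \<Rightarrow> z $ i)" for z :: "complex^'n"
    have ah: "polyfun_in J (\<lambda>z. a (h z))" using a
      by induction (auto simp: h_def intro: polyfun_in.intros)
    have "a (h (L *v x)) = 0" if x: "x \<in> V" for x
    proof -
      have "a (h (L *v x)) = a (?y x)"
        by (rule polyfun_in_cong[OF a]) (auto simp: h_def graph_coords_def)
      moreover have "s x = 0" using s x by (simp add: vanishing_def)
      ultimately show ?thesis using eq[of x] V(2) x by auto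
    qed
    then have ah0: "a (h z) = 0" for z using ind[OF ah] by blast
    have a0: "a z = 0" for z
    proof -
      have "a z = a (h (\<chi> i. z $ Some i))" by (rule polyfun_in_cong[OF a]) (auto simp: h_def)
      with ah0 show ?thesis by simp
    qed
    have "polyfun (\<lambda>x. ?ev q (?y x))"
      by (rule polyfun_compose[OF polyfun_eval[OF q] polyfun_graph_coords[OF ps]])
    then have "?ev q (?y x) = 0" if "x \<in> X" for x
    proof (rule irr_mult[OF X _ ps _ s(2,3) that])
      show "?ev q (?y x) = 0" if "x \<in> X" "s x \<noteq> 0" for x using eq[OF that(1)] that(2) a0 by simp
    qed
    from pCons.IH[OF q this] show ?case unfolding poly_pCons_fun by (simp add: a0)
  qed
  have "F \<in> adjoin {f. polyfun_in (Some ` J) f} (\<lambda>x. x $ None)" by (rule polyfun_in_insert[OF F(1)])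
  then obtain p where p: "\<forall>k. polyfun_in (Some ` J) (coeff p k)" "F = ?ev p" by (auto simp: adjoin_def)
  have "?ev p (?y x) = 0" if "x \<in> X" for x using F(2) that by (auto simp: vanishing_def p(2))
  from fun_cong[OF main[OF p(1) this]] show ?thesis by (simp add: p(2))
qed

text \<open>The coordinates J independent on V, together with a function s that vanishes on V but
  not on X, are independent on X. They bound the rank of the equations of the graph, and so force
  one more tangent dimension.\<close>

theorem tangent_dim_proper_subvariety:
  fixes V X :: "(complex^'n) set"
  assumes V: "irr V" "zariski_closed V" "V \<subset> X" and X: "irr X"
    and k: "\<And>q. q \<in> V \<Longrightarrow> k \<le> vec.dim (tangent_space V q)" and x: "x \<in> X"
  shows "Suc k \<le> vec.dim (tangent_space X x)"
proof -
  obtain x1 where x1: "x1 \<in> X" "x1 \<notin> V" using V by blast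
  then obtain s where s: "s \<in> vanishing V" "s x1 \<noteq> 0" using zariski_closed_vanishing[OF V(2)] by blast
  have ps: "polyfun s" using s by (simp add: vanishing_def)
  obtain v where "v \<in> V" using V(1) by (auto simp: irr_def)
  \<comment> \<open>A point of least tangent dimension: the index set J chosen there satisfies the
    minimality that \<open>generic_coordinates_independent\<close> asks for.\<close>
  then obtain q0 where q0: "q0 \<in> V" "\<And>q. q \<in> V \<Longrightarrow> vec.dim (tangent_space V q0) \<le> vec.dim (tangent_space V q)"
    using ex_has_least_nat[of "\<lambda>q. q \<in> V" v "\<lambda>q. vec.dim (tangent_space V q)"] by blast
  obtain J :: "'n set" where J: "card J = vec.dim (tangent_space V q0)" by (rule exists_index_set)
  obtain F H0 where F: "\<And>i. F i \<in> vanishing V" "invertible (frame J F H0 q0)" by (rule tangent_frame[OF J]) blast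
  define L where "L = frame J F H0 q0"
  have L: "invertible L" using F(2) by (simp add: L_def)
  have ind: "P z = 0" if P: "polyfun_in J P" "\<And>x. x \<in> V \<Longrightarrow> P (L *v x) = 0" for P z
    by (rule generic_coordinates_independent[OF V(1) _ F(1) q0(1) F(2) P(1)]) (use q0(2) J P(2) in \<open>auto simp: L_def\<close>)
  let ?y = "graph_coords L s"
  have irrY: "irr (?y ` X)" by (rule irr_image[OF X polyfun_graph_coords[OF ps]])
  have "elim_bound (?y ` X) UNIV (CARD('n option) - card (insert None (Some ` J)))"
  proof (rule elim_bound_UNIV[OF irrY])
    fix F z assume "polyfun_in (insert None (Some ` J)) F" "F \<in> vanishing (?y ` X)"
    moreover have "V \<subseteq> X" using V(3) by blast
    ultimately show "F z = 0" using graph_coords_independent[OF V(1) _ X s(1) x1(1) s(2), of J L F z] ind by blast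
  qed
  moreover have "card (insert None (Some ` J)) = Suc (card J)" by (simp add: card_image)
  ultimately have "elim_bound (?y ` X) UNIV (CARD('n) - card J)" by simp
  then obtain b where b: "polyfun b" "\<exists>y\<in>?y ` X. b y \<noteq> 0"
    "\<And>y. y \<in> ?y ` X \<Longrightarrow> b y \<noteq> 0 \<Longrightarrow> CARD('n option) - (CARD('n) - card J) \<le> vec.dim (tangent_space (?y ` X) y)"
    by (rule elim_bound_tangent_dim) blast
  \<comment> \<open>The count is valid at generic points only; semicontinuity at x carries it to the
    given point.\<close>
  obtain g where g: "polyfun g" "g x \<noteq> 0" "\<And>z. g z \<noteq> 0 \<Longrightarrow> vec.dim (tangent_space X z) \<le> vec.dim (tangent_space X x)"
    using tangent_dim_semicontinuous[of x X] by blast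
  obtain x2 where "x2 \<in> X" "b (?y x2) \<noteq> 0" using b(2) by blast
  then obtain z where z: "z \<in> X" "b (?y z) \<noteq> 0" "g z \<noteq> 0"
    using irr_nonzero_mult[OF X polyfun_compose[OF b(1) polyfun_graph_coords[OF ps]] g(1), of x2 L x] g(2) x by blast
  have cJ: "card J \<le> CARD('n)" by (rule card_mono) auto
  have "Suc k \<le> Suc (card J)" using k[OF q0(1)] J by simp
  also have "\<dots> \<le> vec.dim (tangent_space (?y ` X) (?y z))" using b(3)[of "?y z"] z cJ by (simp add: Suc_diff_le)
  also have "\<dots> \<le> vec.dim (tangent_space X z)" by (rule graph_tangent_dim[OF L ps])
  also have "\<dots> \<le> vec.dim (tangent_space X x)" by (rule g(3)[OF z(3)])
  finally show ?thesis .
qed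

section \<open>Regular points, minimality of their tangent dimension, openness and density\<close>

lemma tangent_dim_proper_affine_subvariety:
  assumes V: "affine_variety V" and X: "affine_variety X" and VX: "V \<subset> X"
    and k: "\<And>q. q \<in> V \<Longrightarrow> k \<le> vec.dim (tangent_space V q)" and x: "x \<in> X"
  shows "Suc k \<le> vec.dim (tangent_space X x)"
proof -
  have "zariski_closed V" using V by (simp add: affine_variety_def)
  from tangent_dim_proper_subvariety[OF affine_variety_irr[OF V] this VX affine_variety_irr[OF X] k x]
  show ?thesis .
qed

text \<open>Along a chain of subvarieties the least tangent dimension grows at every step. If the
  tangent space at q has dimension d + 1, some chain has length k > d, so that every point of its
  top member, and then every point of X, has tangent dimension at least k.\<close>

lemma regular_tangent_dim_minimal:
  fixes X :: "(complex^'n) set"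
  assumes X: "affine_variety X" and q: "q \<in> regular_locus X" and x: "x \<in> X"
  shows "vec.dim (tangent_space X q) \<le> vec.dim (tangent_space X x)"
proof (cases "vec.dim (tangent_space X q)")
  case 0
  show ?thesis unfolding 0 by (rule le0)
next
  case (Suc d)
  have "enat (vec.dim (tangent_space X q)) = variety_dim X" using q unfolding regular_locus_def by blast
  then have "enat d < variety_dim X" unfolding Suc by (metis enat_ord_simps(2) lessI)
  then obtain k Z where kZ: "d < k" "\<forall>i\<le>k. affine_variety (Z i) \<and> Z i \<subseteq> X" "\<forall>i<k. Z i \<subset> Z (Suc i)"
    unfolding variety_dim_def less_Sup_iff by auto
  have "\<forall>z\<in>Z i. i \<le> vec.dim (tangent_space (Z i) z)" if "i \<le> k" for i
    using that
  proof (induction i)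
    case (Suc i)
    show ?case
    proof
      fix z assume z: "z \<in> Z (Suc i)"
      have "affine_variety (Z i)" "affine_variety (Z (Suc i))" "Z i \<subset> Z (Suc i)" using kZ Suc.prems by auto
      from tangent_dim_proper_affine_subvariety[OF this _ z] show "Suc i \<le> vec.dim (tangent_space (Z (Suc i)) z)"
        using Suc.IH Suc.prems by simp
    qed
  qed simp
  then have Zk: "\<And>z. z \<in> Z k \<Longrightarrow> k \<le> vec.dim (tangent_space (Z k) z)" by blast
  have "affine_variety (Z k)" "Z k \<subseteq> X" using kZ(2) by auto
  have "k \<le> vec.dim (tangent_space X x)"
  proof (cases "Z k = X")
    case True
    then show ?thesis using Zk x by simp
  next
    case False
    then have "Z k \<subset> X" using \<open>Z k \<subseteq> X\<close> by blast
    from tangent_dim_proper_affine_subvariety[OF \<open>affine_variety (Z k)\<close> X this Zk x] show ?thesis by simp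
  qed
  then show ?thesis using Suc kZ(1) by simp
qed

lemma regular_locusI:
  assumes X: "affine_variety X" and q: "q \<in> regular_locus X" and x: "x \<in> X"
    and le: "vec.dim (tangent_space X x) \<le> vec.dim (tangent_space X q)"
  shows "x \<in> regular_locus X"
proof -
  have "vec.dim (tangent_space X x) = vec.dim (tangent_space X q)"
    using regular_tangent_dim_minimal[OF X q x] le by simp
  then show ?thesis using q x by (simp add: regular_locus_def)
qed

lemma regular_locus_open:
  assumes X: "affine_variety X" and q: "q \<in> regular_locus X"
  obtains g where "polyfun g" "g q \<noteq> 0" "\<And>x. x \<in> X \<Longrightarrow> g x \<noteq> 0 \<Longrightarrow> x \<in> regular_locus X"
proof -
  obtain g where g: "polyfun g" "g q \<noteq> 0" "\<And>z. g z \<noteq> 0 \<Longrightarrow> vec.dim (tangent_space X z) \<le> vec.dim (tangent_space X q)"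
    using tangent_dim_semicontinuous[of q X] by blast
  show ?thesis by (rule that[OF g(1,2)]) (use regular_locusI[OF X q] g(3) in blast)
qed

lemma regular_locus_subset: "regular_locus X \<subseteq> X"
  by (auto simp: regular_locus_def)

lemma regular_locus_dense:
  assumes X: "affine_variety X" and q: "q \<in> regular_locus X"
    and f: "polyfun f" and h: "polyfun h" "x0 \<in> X" "h x0 \<noteq> 0"
    and 0: "\<And>x. x \<in> regular_locus X \<Longrightarrow> h x \<noteq> 0 \<Longrightarrow> f x = 0" and x: "x \<in> X"
  shows "f x = 0"
proof -
  obtain g where g: "polyfun g" "g q \<noteq> 0" "\<And>x. x \<in> X \<Longrightarrow> g x \<noteq> 0 \<Longrightarrow> x \<in> regular_locus X"
    using regular_locus_open[OF X q] by blast
  have irr: "irr X" by (rule affine_variety_irr[OF X])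
  have qX: "q \<in> X" using q regular_locus_subset by blast
  obtain z where z: "z \<in> X" "g z \<noteq> 0" "h z \<noteq> 0" using irr_nonzero_mult[OF irr g(1) h(1) qX g(2) h(2,3)] by blast
  show ?thesis
    by (rule irr_mult[OF irr f polyfun.mult[OF g(1) h(1)] _ z(1) _ x]) (use 0 g(3) z in auto)
qed

section \<open>Extension of regular functions across the singular locus\<close>

definition regfun :: "(complex^'n) set \<Rightarrow> (complex^'n \<Rightarrow> complex) \<Rightarrow> bool" where
  "regfun X h \<longleftrightarrow> (\<forall>q\<in>regular_locus X. \<exists>a g. polyfun a \<and> polyfun g \<and> g q \<noteq> 0 \<and>
     (\<forall>x\<in>regular_locus X. g x \<noteq> 0 \<longrightarrow> h x = a x / g x))"

text \<open>Two local fractions agree on a dense open set, so their cross products agree on all of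
  X. The cleared identity thus holds even where g vanishes, which makes g a member of
  \<open>den\<close>.\<close>

lemma regfun_fraction:
  assumes X: "affine_variety X" and h: "regfun X h" and q: "q \<in> regular_locus X"
  obtains a g where "polyfun a" "polyfun g" "g q \<noteq> 0" "\<And>x. x \<in> regular_locus X \<Longrightarrow> g x * h x = a x"
proof -
  obtain a g where ag: "polyfun a" "polyfun g" "g q \<noteq> 0" "\<And>x. x \<in> regular_locus X \<Longrightarrow> g x \<noteq> 0 \<Longrightarrow> h x = a x / g x"
    using h q unfolding regfun_def by blast
  have "g x * h x = a x" if x: "x \<in> regular_locus X" for x
  proof -
    obtain b k where bk: "polyfun b" "polyfun k" "k x \<noteq> 0" "\<And>y. y \<in> regular_locus X \<Longrightarrow> k y \<noteq> 0 \<Longrightarrow> h y = b y / k y"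
      using h x unfolding regfun_def by blast
    have xX: "x \<in> X" and qX: "q \<in> X" using x q regular_locus_subset by blast+
    obtain z where z: "z \<in> X" "g z \<noteq> 0" "k z \<noteq> 0"
      using irr_nonzero_mult[OF affine_variety_irr[OF X] ag(2) bk(2) qX ag(3) xX bk(3)] by blast
    have "a x * k x - b x * g x = 0"
    proof (rule regular_locus_dense[where f="\<lambda>x. a x * k x - b x * g x" and h="\<lambda>x. g x * k x", OF X q _ _ z(1) _ _ xX])
      fix y assume "y \<in> regular_locus X" "g y * k y \<noteq> 0"
      then show "a y * k y - b y * g y = 0" using ag(4)[of y] bk(4)[of y] by (auto simp: field_simps)
    qed (use ag bk z in \<open>auto intro!: polyfun_diff polyfun.mult\<close>)
    then have "a x * k x = g x * b x" by (simp add: mult.commute)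
    moreover have "h x = b x / k x" by (rule bk(4)[OF x bk(3)])
    ultimately have "(g x * h x) * k x = a x * k x" using bk(3) by simp
    then show ?thesis using bk(3) by simp
  qed
  with that ag show ?thesis by blast
qed

lemma dim_kernel_functional:
  assumes T: "vec.subspace T"
  shows "vec.dim T \<le> Suc (vec.dim {v\<in>T. dd s z v = 0})"
proof (cases "\<forall>v\<in>T. dd s z v = 0")
  case True
  then have "{v\<in>T. dd s z v = 0} = T" by blast
  then show ?thesis by simp
next
  case False
  then obtain v0 where v0: "v0 \<in> T" "dd s z v0 \<noteq> 0" by blast
  let ?K = "{v\<in>T. dd s z v = 0}"
  obtain B where B: "B \<subseteq> ?K" "vec.independent B" "?K \<subseteq> vec.span B" "card B = vec.dim ?K"
    using vec.basis_exists[of ?K] by blast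
  have fB: "finite B" using B(2) vec.finiteI_independent by blast
  have "T \<subseteq> vec.span (insert v0 B)"
  proof
    fix v assume v: "v \<in> T"
    define c where "c = dd s z v / dd s z v0"
    have "v - c *s v0 \<in> ?K"
      using v v0 T by (auto simp: dd_vdiff dd_vscale c_def vec.subspace_diff vec.subspace_scale)
    then have "v - c *s v0 \<in> vec.span (insert v0 B)" using B(3) vec.span_mono[of B "insert v0 B"] by blast
    moreover have "c *s v0 \<in> vec.span (insert v0 B)" by (intro vec.span_scale vec.span_base) simp
    ultimately show "v \<in> vec.span (insert v0 B)" using vec.span_add by fastforce
  qed
  then have "vec.dim T \<le> card (insert v0 B)" using fB by (intro vec.dim_le_card) auto
  also have "\<dots> \<le> Suc (card B)" using fB by (simp add: card_insert_if)
  finally show ?thesis using B(4) by simp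
qed

text \<open>The ideal of denominators of \<open>c h\<close>. If a maximal such ideal \<open>P\<close> is stable under multiplication by
  \<open>c h\<close>, then \<open>c h\<close> is integral over the coordinate ring. Otherwise \<open>P\<close> is generically principal, hence a
  generic point of its zero set is a regular point of \<open>X\<close>, where \<open>h\<close> has a denominator outside \<open>P\<close>.\<close>

definition den :: "(complex^'n) set \<Rightarrow> (complex^'n \<Rightarrow> complex) \<Rightarrow> (complex^'n \<Rightarrow> complex) \<Rightarrow> (complex^'n \<Rightarrow> complex) set" where
  "den X h c = {g. polyfun g \<and> (\<exists>a. polyfun a \<and> (\<forall>x\<in>regular_locus X. g x * (c x * h x) = a x))}"

lemma denI: "polyfun g \<Longrightarrow> polyfun a \<Longrightarrow> (\<And>x. x \<in> regular_locus X \<Longrightarrow> g x * (c x * h x) = a x) \<Longrightarrow> g \<in> den X h c"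
  unfolding den_def by blast

lemma pideal_den: "pideal (den X h c)"
  unfolding pideal_def
proof (intro conjI ballI allI impI)
  show "(\<lambda>x. 0) \<in> den X h c" by (rule denI[of _ "\<lambda>x. 0"]) (auto intro: polyfun.const)
  fix f assume f: "f \<in> den X h c"
  then show "polyfun f" by (simp add: den_def)
  obtain a where a: "polyfun f" "polyfun a" "\<And>x. x \<in> regular_locus X \<Longrightarrow> f x * (c x * h x) = a x" using f unfolding den_def by blast
  {
    fix g assume "g \<in> den X h c"
    then obtain b where b: "polyfun g" "polyfun b" "\<And>x. x \<in> regular_locus X \<Longrightarrow> g x * (c x * h x) = b x" unfolding den_def by blast
    show "(\<lambda>x. f x + g x) \<in> den X h c"
      by (rule denI[of _ "\<lambda>x. a x + b x"]) (use a b in \<open>auto intro: polyfun.add simp: distrib_right\<close>)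
  next
    fix g :: "complex^'a \<Rightarrow> complex" assume g: "polyfun g"
    show "(\<lambda>x. g x * f x) \<in> den X h c"
    proof (rule denI[of _ "\<lambda>x. g x * a x"])
      show "polyfun (\<lambda>x. g x * f x)" "polyfun (\<lambda>x. g x * a x)" using a g by (auto intro: polyfun.mult)
      fix x assume "x \<in> regular_locus X"
      from a(3)[OF this] show "g x * f x * (c x * h x) = g x * a x" by (simp add: mult.assoc)
    qed
  }
qed

text \<open>With u = c h, stability keeps all b u^k polynomial. By the basis theorem some b u^M is a
  combination of the earlier ones; cancelling b gives a monic equation for u over the coordinate
  ring, and normality applies.\<close>

lemma den_stable_integral:
  assumes N: "normal_variety X" and h: "regfun X h" and c: "polyfun c"
    and b: "b \<in> den X h c" "x0 \<in> X" "b x0 \<noteq> 0" and q: "q \<in> regular_locus X"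
    and stable: "\<And>g a. g \<in> den X h c \<Longrightarrow> polyfun a \<Longrightarrow> (\<And>x. x \<in> regular_locus X \<Longrightarrow> g x * (c x * h x) = a x) \<Longrightarrow> a \<in> den X h c"
  shows "(\<lambda>x. 1) \<in> den X h c"
proof -
  have X: "affine_variety X" using N by (simp add: normal_variety_def)
  have "\<exists>A. \<forall>k::nat. (A k \<in> den X h c \<and> (k = 0 \<longrightarrow> A k = b)) \<and> (\<forall>x\<in>regular_locus X. A (Suc k) x = A k x * (c x * h x))"
  proof (rule dependent_nat_choice)
    show "\<exists>x. x \<in> den X h c \<and> ((0::nat) = 0 \<longrightarrow> x = b)" using b(1) by blast
    fix g and n :: nat assume "g \<in> den X h c \<and> (n = 0 \<longrightarrow> g = b)"
    then have g: "g \<in> den X h c" by blast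
    then obtain a where a: "polyfun a" "\<And>x. x \<in> regular_locus X \<Longrightarrow> g x * (c x * h x) = a x" unfolding den_def by blast
    from stable[OF g a] a(2)
    show "\<exists>y. (y \<in> den X h c \<and> (Suc n = 0 \<longrightarrow> y = b)) \<and> (\<forall>x\<in>regular_locus X. y x = g x * (c x * h x))"
      by (intro exI[of _ a]) auto
  qed
  then obtain A where A0: "\<forall>k::nat. (A k \<in> den X h c \<and> (k = 0 \<longrightarrow> A k = b)) \<and> (\<forall>x\<in>regular_locus X. A (Suc k) x = A k x * (c x * h x))"
    by (rule exE)
  have pA: "polyfun (A k)" for k using A0[THEN spec, of k] by (simp add: den_def)
  have pb: "polyfun b" using b(1) by (simp add: den_def)
  have Ak: "A k x = b x * (c x * h x) ^ k" if "x \<in> regular_locus X" for k x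
  proof (induction k)
    case 0
    then show ?case using A0[THEN spec, of 0] by simp
  next
    case (Suc k)
    then show ?case using A0[THEN spec, of k] that by simp
  qed
  obtain M e where e: "\<And>i. polyfun (e i)" "\<And>x. A M x = (\<Sum>i<M. e i x * A i x)"
    by (rule polyfun_sequence_dependent[of A, OF pA], rule that)
  define a where "a = A 1"
  have pa: "polyfun a" by (simp add: a_def pA)
  have ab: "a x = b x * (c x * h x)" if "x \<in> regular_locus X" for x using Ak[OF that, of 1] by (simp add: a_def)
  have root: "(a x / b x) ^ M + (\<Sum>k<M. (- e k x) * (a x / b x) ^ k) = 0" if x: "x \<in> X" "b x \<noteq> 0" for x
  proof -
    \<comment> \<open>The monic equation of a / b with denominators cleared: as a polynomial
      identity it extends from regular points to X by density.\<close>
    have "a x ^ M - (\<Sum>k<M. e k x * (a x ^ k * b x ^ (M - k))) = 0"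
    proof (rule regular_locus_dense[where f="\<lambda>x. a x ^ M - (\<Sum>k<M. e k x * (a x ^ k * b x ^ (M - k)))" and h=b, OF X q _ pb b(2,3) _ x(1)])
      show "polyfun (\<lambda>x. a x ^ M - (\<Sum>k<M. e k x * (a x ^ k * b x ^ (M - k))))"
        by (intro polyfun_diff polyfun_power polyfun_sum polyfun.mult pa pb e(1))
      fix y assume y: "y \<in> regular_locus X" "b y \<noteq> 0"
      let ?u = "c y * h y"
      have "b y * ?u ^ M = b y * (\<Sum>i<M. e i y * ?u ^ i)"
        using e(2)[of y] by (simp add: Ak[OF y(1)] sum_distrib_left algebra_simps)
      then have u: "?u ^ M = (\<Sum>i<M. e i y * ?u ^ i)" using y(2) by simp
      have "e i y * (a y ^ i * b y ^ (M - i)) = b y ^ M * (e i y * ?u ^ i)" if "i < M" for i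
      proof -
        have "b y ^ M = b y ^ i * b y ^ (M - i)" using that by (simp flip: power_add)
        then show ?thesis by (simp add: ab[OF y(1)] power_mult_distrib algebra_simps)
      qed
      then have "(\<Sum>i<M. e i y * (a y ^ i * b y ^ (M - i))) = b y ^ M * (\<Sum>i<M. e i y * ?u ^ i)"
        unfolding sum_distrib_left by (intro sum.cong) auto
      also have "\<dots> = b y ^ M * ?u ^ M" by (simp only: u)
      also have "\<dots> = a y ^ M" by (simp add: ab[OF y(1)] power_mult_distrib)
      finally show "a y ^ M - (\<Sum>k<M. e k y * (a y ^ k * b y ^ (M - k))) = 0" by simp
    qed
    then have eq: "a x ^ M = (\<Sum>k<M. e k x * (a x ^ k * b x ^ (M - k)))" by simp
    have "(a x / b x) ^ M = (\<Sum>k<M. e k x * (a x / b x) ^ k)"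
    proof -
      have "(a x / b x) ^ M = (\<Sum>k<M. e k x * (a x ^ k * b x ^ (M - k))) / b x ^ M"
        by (simp add: power_divide eq)
      also have "\<dots> = (\<Sum>k<M. e k x * (a x / b x) ^ k)"
        unfolding sum_divide_distrib
      proof (rule sum.cong)
        fix k assume "k \<in> {..<M}"
        then have "b x ^ M = b x ^ k * b x ^ (M - k)" by (simp flip: power_add)
        then show "e k x * (a x ^ k * b x ^ (M - k)) / b x ^ M = e k x * (a x / b x) ^ k"
          using x(2) by (simp add: power_divide)
      qed simp
      finally show ?thesis .
    qed
    then show ?thesis by (simp add: sum_negf)
  qed
  have cr: "f \<in> coord_ring X" if "polyfun f" for f using that unfolding coord_ring_def by blast
  have "\<exists>f\<in>coord_ring X. \<forall>x\<in>X. b x \<noteq> 0 \<longrightarrow> a x / b x = f x"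
  proof -
    have "(\<exists>x\<in>X. b x \<noteq> 0) \<and> (\<exists>m c. (\<forall>k<m. c k \<in> coord_ring X) \<and>
               (\<forall>x\<in>X. b x \<noteq> 0 \<longrightarrow> (a x / b x) ^ m + (\<Sum>k<m. c k x * (a x / b x) ^ k) = 0))"
    proof (intro conjI exI[of _ M] exI[of _ "\<lambda>k x. - e k x"] allI impI ballI)
      show "\<exists>x\<in>X. b x \<noteq> 0" using b by blast
      show "(\<lambda>x. - e k x) \<in> coord_ring X" for k by (intro cr polyfun_uminus e(1))
    qed (use root in auto)
    then show ?thesis using N cr[OF pa] cr[OF pb] unfolding normal_variety_def by blast
  qed
  then obtain f where f: "f \<in> coord_ring X" "\<And>x. x \<in> X \<Longrightarrow> b x \<noteq> 0 \<Longrightarrow> a x / b x = f x" by blast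
  then obtain F where F: "polyfun F" "\<And>x. x \<in> X \<Longrightarrow> f x = F x" unfolding coord_ring_def by blast
  show ?thesis
  proof (rule denI[of _ F])
    fix x assume x: "x \<in> regular_locus X"
    then have xX: "x \<in> X" using regular_locus_subset by blast
    \<comment> \<open>At points where b vanishes the value of h is reached through a local
      denominator g that is nonzero there.\<close>
    obtain a' g where ag: "polyfun a'" "polyfun g" "g x \<noteq> 0" "\<And>x. x \<in> regular_locus X \<Longrightarrow> g x * h x = a' x"
      using regfun_fraction[OF X h x] by blast
    have "c x * a' x - F x * g x = 0"
    proof (rule regular_locus_dense[where f="\<lambda>x. c x * a' x - F x * g x" and h=b, OF X q _ pb b(2,3) _ xX])
      show "polyfun (\<lambda>x. c x * a' x - F x * g x)" by (intro polyfun_diff polyfun.mult c ag F)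
      fix y assume y: "y \<in> regular_locus X" "b y \<noteq> 0"
      then have yX: "y \<in> X" using regular_locus_subset by blast
      have "F y = c y * h y" using f(2)[OF yX y(2)] F(2)[OF yX] ab[OF y(1)] y(2) by simp
      then show "c y * a' y - F y * g y = 0" using ag(4)[OF y(1)] by (simp add: algebra_simps)
    qed
    then have "g x * (c x * h x) = g x * F x" using ag(4)[OF x] by (simp add: algebra_simps)
    then show "1 * (c x * h x) = F x" using ag(3) by simp
  qed (auto intro: polyfun.const F)
qed

lemma nullstellensatz_prime_ex:
  assumes "prime_ideal P" "polyfun g" "g \<notin> P" shows "\<exists>z. (\<forall>f\<in>P. f z = 0) \<and> g z \<noteq> 0"
  by (rule nullstellensatz_prime[OF assms]) auto

theorem hartogs:
  assumes N: "normal_variety X" and h: "regfun X h" and q: "q \<in> regular_locus X"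
  obtains F where "polyfun F" "\<And>x. x \<in> regular_locus X \<Longrightarrow> h x = F x"
proof (rule ccontr)
  assume contra: "\<not> thesis"
  have X: "affine_variety X" using N by (simp add: normal_variety_def)
  have irrX: "irr X" by (rule affine_variety_irr[OF X])
  have qX: "q \<in> X" using q regular_locus_subset by blast
  have "(\<lambda>x. 1) \<notin> den X h (\<lambda>x. 1)"
  proof
    assume "(\<lambda>x. 1) \<in> den X h (\<lambda>x. 1)"
    then obtain a where a: "polyfun a" "\<And>x. x \<in> regular_locus X \<Longrightarrow> 1 * (1 * h x) = a x" unfolding den_def by blast
    have thesis by (rule that[OF a(1)]) (use a(2) in simp)
    with contra show False by blast
  qed
  \<comment> \<open>Proper denominator ideals of the multiples of h. As in the construction of
    associated primes, a maximal one is prime.\<close>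
  define C where "C = {den X h c | c. polyfun c \<and> (\<lambda>x. 1) \<notin> den X h c}"
  have "den X h (\<lambda>x. 1) \<in> C" using \<open>(\<lambda>x. 1) \<notin> den X h (\<lambda>x. 1)\<close> unfolding C_def by (blast intro: polyfun.const)
  then have Cne: "C \<noteq> {}" by blast
  have Cid: "pideal I" if "I \<in> C" for I using that pideal_den unfolding C_def by blast
  have "\<exists>M\<in>C. \<forall>I\<in>C. M \<subseteq> I \<longrightarrow> I = M"
  proof (rule pideal_maximal[of C, OF Cid Cne])
    fix M assume "M \<in> C" and max: "\<And>I. I \<in> C \<Longrightarrow> M \<subseteq> I \<Longrightarrow> I = M"
    then show "\<exists>M\<in>C. \<forall>I\<in>C. M \<subseteq> I \<longrightarrow> I = M" by (intro bexI[of _ M] ballI impI max)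
  qed
  then obtain P where P: "P \<in> C" "\<And>I. I \<in> C \<Longrightarrow> P \<subseteq> I \<Longrightarrow> I = P" by blast
  then obtain c where c: "polyfun c" "(\<lambda>x. 1) \<notin> P" "P = den X h c" unfolding C_def by blast
  have idP: "pideal P" unfolding c(3) by (rule pideal_den)
  have prime: "prime_ideal P"
    unfolding prime_ideal_def
  proof (intro conjI allI impI idP)
    fix f g assume *: "polyfun f \<and> polyfun g \<and> (\<lambda>x. f x * g x) \<in> P"
    show "f \<in> P \<or> g \<in> P"
    proof (cases "f \<in> P")
      case False
      \<comment> \<open>Passing from c to f c enlarges the ideal of denominators, and it stays
        proper because f is outside P; maximality forces equality.\<close>
      let ?Q = "den X h (\<lambda>x. f x * c x)"
      have "P \<subseteq> ?Q"
      proof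
        fix k assume "k \<in> P"
        then obtain a where a: "polyfun k" "polyfun a" "\<And>x. x \<in> regular_locus X \<Longrightarrow> k x * (c x * h x) = a x"
          unfolding c(3) den_def by blast
        show "k \<in> ?Q"
        proof (rule denI[of _ "\<lambda>x. f x * a x"])
          fix x assume "x \<in> regular_locus X"
          from a(3)[OF this] show "k x * (f x * c x * h x) = f x * a x" by (simp add: algebra_simps)
        qed (use a * in \<open>auto intro: polyfun.mult\<close>)
      qed
      moreover have "(\<lambda>x. 1) \<notin> ?Q"
      proof
        assume "(\<lambda>x. 1) \<in> ?Q"
        then obtain a where "polyfun a" "\<And>x. x \<in> regular_locus X \<Longrightarrow> 1 * (f x * c x * h x) = a x" unfolding den_def by blast
        then have "f \<in> P" unfolding c(3) using * by (intro denI[of _ a]) (auto simp: mult.assoc)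
        with False show False by blast
      qed
      then have "?Q \<in> C" using * c(1) unfolding C_def by (blast intro: polyfun.mult)
      ultimately have QP: "?Q = P" using P(2) by blast
      obtain a where a: "polyfun a" "\<And>x. x \<in> regular_locus X \<Longrightarrow> f x * g x * (c x * h x) = a x"
        using * unfolding c(3) den_def by blast
      have "g \<in> ?Q"
      proof (rule denI[OF _ a(1)])
        fix x assume "x \<in> regular_locus X"
        from a(2)[OF this] show "g x * (f x * c x * h x) = a x" by (simp add: algebra_simps)
      qed (use * in simp)
      with QP show ?thesis by blast
    qed simp
  qed
  have mem: "g \<in> P" if "polyfun a" "polyfun g" "\<And>x. x \<in> regular_locus X \<Longrightarrow> g x * h x = a x" for a g
    unfolding c(3)
  proof (rule denI[of _ "\<lambda>x. c x * a x"])
    fix x assume "x \<in> regular_locus X"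
    from that(3)[OF this] show "g x * (c x * h x) = c x * a x" by (simp add: algebra_simps)
  qed (use that c in \<open>auto intro: polyfun.mult\<close>)
  obtain a b where b: "polyfun a" "polyfun b" "b q \<noteq> 0" "\<And>x. x \<in> regular_locus X \<Longrightarrow> b x * h x = a x"
    using regfun_fraction[OF X h q] by blast
  have bP: "b \<in> P" by (rule mem[OF b(1,2,4)])
  \<comment> \<open>If P were stable under multiplication by c h, then
    \<open>den_stable_integral\<close> would put 1 into P.\<close>
  have "\<exists>s u. s \<in> P \<and> polyfun u \<and> u \<notin> P \<and> (\<forall>x\<in>regular_locus X. s x * (c x * h x) = u x)"
  proof (rule ccontr)
    assume no: "\<not> ?thesis"
    have st: "a \<in> den X h c" if "g \<in> den X h c" "polyfun a" "\<And>x. x \<in> regular_locus X \<Longrightarrow> g x * (c x * h x) = a x" for g a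
      using no that unfolding c(3) by blast
    have bd: "b \<in> den X h c" using bP c(3) by simp
    have "(\<lambda>x. 1) \<in> den X h c" by (rule den_stable_integral[OF N h c(1) bd qX b(3) q st])
    with c(2,3) show False by simp
  qed
  then obtain s u where s: "s \<in> P" "polyfun u" "u \<notin> P" "\<And>x. x \<in> regular_locus X \<Longrightarrow> s x * (c x * h x) = u x" by blast
  define V where "V = {z. \<forall>f\<in>P. f z = 0}"
  have pP: "polyfun f" if "f \<in> P" for f using idP that by (rule pideal_polyfun)
  have ps: "polyfun s" using pP s(1) by blast
  have closed: "zariski_closed V" unfolding zariski_closed_def V_def using pP by blast
  have vanV: "f \<in> P" if "f \<in> vanishing V" for f
  proof (rule ccontr)
    assume no: "f \<notin> P"
    have "polyfun f" using that by (simp add: vanishing_def)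
    from nullstellensatz_prime_ex[OF prime this no]
    obtain z where "\<forall>g\<in>P. g z = 0" "f z \<noteq> 0" by blast
    with that show False by (auto simp: vanishing_def V_def)
  qed
  have Pvan: "f \<in> vanishing V" if "f \<in> P" for f using that pP by (auto simp: vanishing_def V_def)
  have irrV: "irr V" unfolding irr_def
  proof (intro conjI allI impI)
    show "V \<noteq> {}" using nullstellensatz_prime_ex[OF prime polyfun.const c(2)] unfolding V_def by blast
    fix f g :: "complex^'a \<Rightarrow> complex" assume *: "polyfun f \<and> polyfun g \<and> (\<forall>x\<in>V. f x * g x = 0)"
    then have "(\<lambda>x. f x * g x) \<in> P" by (intro vanV) (auto simp: vanishing_def intro: polyfun.mult)
    then have "f \<in> P \<or> g \<in> P" using prime_idealD[OF prime, of f g] * by blast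
    then show "(\<forall>x\<in>V. f x = 0) \<or> (\<forall>x\<in>V. g x = 0)" by (auto simp: V_def)
  qed
  have VX: "V \<subset> X"
  proof
    show "V \<subseteq> X"
    proof
      fix z assume z: "z \<in> V"
      show "z \<in> X"
      proof (rule zariski_closed_vanishing)
        show "zariski_closed X" using X by (simp add: affine_variety_def)
        fix f assume f: "f \<in> vanishing X"
        have "f \<in> P" unfolding c(3)
          by (rule denI[of _ "\<lambda>x. 0"]) (use f regular_locus_subset in \<open>auto simp: vanishing_def intro: polyfun.const\<close>)
        with z show "f z = 0" by (simp add: V_def)
      qed
    qed
    show "V \<noteq> X" using bP b(3) qX by (auto simp: V_def)
  qed
  let ?r = "vec.dim (tangent_space X q)"
  \<comment> \<open>V is a proper subvariety, so somewhere its tangent dimension falls below that of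
    X at a regular point.\<close>
  have "\<exists>q1\<in>V. vec.dim (tangent_space V q1) < ?r"
  proof (rule ccontr)
    assume "\<not> ?thesis"
    then have k: "?r \<le> vec.dim (tangent_space V y)" if "y \<in> V" for y using that by (simp add: not_less)
    from tangent_dim_proper_subvariety[OF irrV closed VX irrX k qX] show False by simp
  qed
  then obtain q1 where q1: "q1 \<in> V" "vec.dim (tangent_space V q1) < ?r" by blast
  obtain g where g: "polyfun g" "g q1 \<noteq> 0" "\<And>x. g x \<noteq> 0 \<Longrightarrow> vec.dim (tangent_space V x) \<le> vec.dim (tangent_space V q1)"
    using tangent_dim_semicontinuous[of q1 V] by blast
  obtain z0 where z0: "z0 \<in> V" "u z0 \<noteq> 0" using nullstellensatz_prime_ex[OF prime s(2,3)] unfolding V_def by blast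
  obtain z where z: "z \<in> V" "g z \<noteq> 0" "u z \<noteq> 0" using irr_nonzero_mult[OF irrV g(1) s(2) q1(1) g(2) z0] by blast
  have zX: "z \<in> X" using z VX by blast
  \<comment> \<open>For f in P the relation u f = s a holds on X with u nonzero at z: near z the
    ideal P is generated by s, so s alone cuts out the tangent space of V.\<close>
  have "{v\<in>tangent_space X z. dd s z v = 0} \<subseteq> tangent_space V z"
  proof (intro subsetI, unfold tangent_space_iff[of _ V], intro ballI)
    fix v f assume v: "v \<in> {v\<in>tangent_space X z. dd s z v = 0}" and "f \<in> vanishing V"
    then have fP: "f \<in> P" by (intro vanV)
    then obtain a where a: "polyfun a" "\<And>x. x \<in> regular_locus X \<Longrightarrow> f x * (c x * h x) = a x"
      unfolding c(3) den_def by blast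
    have pf: "polyfun f" using pP[OF fP] .
    have eq: "u x * f x = s x * a x" if x: "x \<in> X" for x
    proof -
      have "u x * f x - s x * a x = 0"
      proof (rule regular_locus_dense[where f="\<lambda>x. u x * f x - s x * a x" and h="\<lambda>x. 1", OF X q _ _ qX _ _ x])
        show "polyfun (\<lambda>x. u x * f x - s x * a x)" by (intro polyfun_diff polyfun.mult pf ps s a)
        fix y assume y: "y \<in> regular_locus X"
        show "u y * f y - s y * a y = 0" by (simp add: s(4)[OF y, symmetric] a(2)[OF y, symmetric])
      qed (auto intro: polyfun.const)
      then show ?thesis by simp
    qed
    have "dd (\<lambda>x. u x * f x) z v = dd (\<lambda>x. s x * a x) z v"
      by (rule vanishing_pointwise_dd[OF polyfun.mult[OF s(2) pf] polyfun.mult[OF ps a(1)] eq]) (use v in auto)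
    moreover have "f z = 0" "s z = 0" using z(1) fP s(1) by (auto simp: V_def)
    ultimately have "u z * dd f z v = 0" using v by (simp add: dd_mult[OF s(2) pf] dd_mult[OF ps a(1)])
    with z(3) show "dd f z v = 0" by simp
  qed
  then have "vec.dim {v\<in>tangent_space X z. dd s z v = 0} \<le> vec.dim (tangent_space V z)" by (rule vec.dim_subset)
  \<comment> \<open>One equation lowers the dimension by at most one, and the strict drop at q1
    leaves room for it. Hence z is regular, and the denominator of h found there must lie in P and
    yet not vanish at z.\<close>
  then have "vec.dim (tangent_space X z) \<le> ?r"
    using dim_kernel_functional[OF tangent_space_subspace, of X z s z] g(3)[OF z(2)] q1(2) by linarith
  then have zr: "z \<in> regular_locus X" by (rule regular_locusI[OF X q zX])
  obtain a' g' where g': "polyfun a'" "polyfun g'" "g' z \<noteq> 0" "\<And>x. x \<in> regular_locus X \<Longrightarrow> g' x * h x = a' x"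
    using regfun_fraction[OF X h zr] by blast
  have "g' \<in> P" by (rule mem[OF g'(1,2,4)])
  with z(1) g'(3) show False by (simp add: V_def)
qed

section \<open>Gradings of coordinate rings\<close>

text \<open>Multiplication by a power of t with exponent - N, where N is the least exponent, leaves
  a polynomial with infinitely many zeros.\<close>

lemma laurent_unique:
  fixes a :: "int \<Rightarrow> complex"
  assumes J: "finite J" and 0: "\<And>t. t \<noteq> 0 \<Longrightarrow> (\<Sum>j\<in>J. t powi j * a j) = 0" and k: "k \<in> J"
  shows "a k = 0"
proof -
  define N where "N = Min J"
  have N: "N \<le> j" if "j \<in> J" for j using that J by (simp add: N_def)
  define p where "p = (\<Sum>j\<in>J. monom (a j) (nat (j - N)))"
  have "poly p t = 0" if t: "t \<noteq> 0" for t
  proof -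
    have eqj: "t powi (- N) * (t powi j * a j) = a j * t ^ nat (j - N)" if "j \<in> J" for j
    proof -
      have "t powi (- N + j) = t powi (- N) * t powi j" by (rule power_int_add) (simp add: t)
      moreover have "t powi (- N + j) = t ^ nat (j - N)" using N[OF that] by (simp add: power_int_def)
      ultimately show ?thesis by (simp add: mult.assoc[symmetric])
    qed
    then have "poly p t = t powi (- N) * (\<Sum>j\<in>J. t powi j * a j)"
      unfolding p_def poly_sum poly_monom sum_distrib_left by (intro sum.cong refl eqj[symmetric])
    with 0[OF t] show ?thesis by simp
  qed
  then have "UNIV - {0} \<subseteq> {t. poly p t = 0}" by auto
  moreover have "infinite (UNIV - {0 :: complex})" by (simp add: infinite_UNIV_char_0)
  ultimately have "p = 0" using poly_roots_finite[of p] finite_subset by blast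
  moreover have "coeff p (nat (k - N)) = a k"
  proof -
    have "coeff p (nat (k - N)) = (\<Sum>j\<in>J. if j = k then a j else 0)"
      unfolding p_def coeff_sum using N k by (intro sum.cong) (auto simp: nat_eq_iff)
    then show ?thesis using J k by simp
  qed
  ultimately show ?thesis by simp
qed

lemma laurent_grouped_unique:
  fixes F :: "'i \<Rightarrow> complex"
  assumes I: "finite I" and eq: "\<And>t. t \<noteq> 0 \<Longrightarrow> t powi k * f = (\<Sum>i\<in>I. t powi (w i) * F i)"
  shows "f = (\<Sum>i | i \<in> I \<and> w i = k. F i)"
proof -
  define a where "a j = (\<Sum>i | i \<in> I \<and> w i = j. F i) - (if j = k then f else 0)" for j
  let ?J = "insert k (w ` I)"
  have fin: "finite ?J" using I by simp
  have "(\<Sum>j\<in>?J. t powi j * a j) = 0" if t: "t \<noteq> 0" for t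
  proof -
    have "(\<Sum>i\<in>I. t powi (w i) * F i) = (\<Sum>j\<in>?J. \<Sum>i | i \<in> I \<and> w i = j. t powi (w i) * F i)"
      using I fin by (intro sum.group[symmetric]) auto
    also have "\<dots> = (\<Sum>j\<in>?J. t powi j * (\<Sum>i | i \<in> I \<and> w i = j. F i))"
      by (intro sum.cong refl) (simp add: sum_distrib_left)
    finally have "(\<Sum>j\<in>?J. t powi j * (\<Sum>i | i \<in> I \<and> w i = j. F i)) = t powi k * f" using eq[OF t] by simp
    moreover have "(\<Sum>j\<in>?J. t powi j * (if j = k then f else 0)) = t powi k * f"
      using fin by (simp add: if_distrib[where f="\<lambda>z. _ * z"] cong: if_cong)
    ultimately show ?thesis unfolding a_def right_diff_distrib sum_subtractf by simp
  qed
  from laurent_unique[OF fin this, of k] show ?thesis by (simp add: a_def)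
qed

text \<open>Nakayama's lemma by elimination: the coefficient D of h in its own equation is nonzero
  at p, so h can be solved for and substituted, and the smaller system has the same shape at p.
  Irreducibility turns vanishing where D is nonzero into vanishing on X.\<close>

lemma nakayama_elimination:
  assumes X: "irr X" and p: "p \<in> X" and "finite S"
    and "\<And>g. g \<in> S \<Longrightarrow> polyfun g" "polyfun d" "d p \<noteq> 0" "\<And>f g. polyfun (e f g)" "\<And>f g. e f g p = 0"
    and "\<And>f x. f \<in> S \<Longrightarrow> x \<in> X \<Longrightarrow> d x * f x = (\<Sum>g\<in>S. e f g x * g x)"
  shows "\<forall>f\<in>S. \<forall>x\<in>X. f x = 0"
  using assms(3-)
proof (induction S arbitrary: d e rule: finite_induct)
  case (insert h S)
  define D where "D x = d x - e h h x" for x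
  have D: "polyfun D" "D p \<noteq> 0" unfolding D_def using insert.prems by (auto intro!: polyfun_diff)
  have Dh: "D x * h x = (\<Sum>g\<in>S. e h g x * g x)" if "x \<in> X" for x
    using insert.prems(6)[of h x] that insert.hyps by (simp add: D_def algebra_simps)
  have "\<forall>f\<in>S. \<forall>x\<in>X. f x = 0"
  proof (rule insert.IH[of "\<lambda>x. D x * d x" "\<lambda>f g x. D x * e f g x + e f h x * e h g x"])
    fix f x assume f: "f \<in> S" and x: "x \<in> X"
    have "D x * d x * f x = D x * (d x * f x)" by simp
    also have "\<dots> = D x * (e f h x * h x + (\<Sum>g\<in>S. e f g x * g x))"
      using insert.prems(6)[of f x] f x insert.hyps by simp
    also have "\<dots> = e f h x * (D x * h x) + D x * (\<Sum>g\<in>S. e f g x * g x)" by (simp add: algebra_simps)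
    also have "\<dots> = (\<Sum>g\<in>S. (D x * e f g x + e f h x * e h g x) * g x)"
      unfolding Dh[OF x] by (simp add: sum_distrib_left sum.distrib algebra_simps)
    finally show "D x * d x * f x = (\<Sum>g\<in>S. (D x * e f g x + e f h x * e h g x) * g x)" .
  qed (use insert.prems D in \<open>auto intro!: polyfun.mult polyfun.add\<close>)
  moreover have "h x = 0" if x: "x \<in> X" for x
  proof (rule irr_mult[OF X _ D(1) _ p D(2) x])
    show "polyfun h" using insert.prems(1) by simp
    fix y assume "y \<in> X" "D y \<noteq> 0"
    moreover have "(\<Sum>g\<in>S. e h g y * g y) = 0"
      using \<open>\<forall>f\<in>S. \<forall>x\<in>X. f x = 0\<close> \<open>y \<in> X\<close> by (intro sum.neutral) auto
    ultimately show "h y = 0" using Dh[of y] by simp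
  qed
  ultimately show ?case by blast
qed simp

section \<open>Finite-dimensional spaces of functions and interpolation\<close>

definition lin :: "('a \<Rightarrow> complex) set \<Rightarrow> ('a \<Rightarrow> complex) set" where
  "lin S = {w. \<exists>c. w = (\<lambda>x. \<Sum>g\<in>S. c g * g x)}"

lemma lin_add: "f \<in> lin S \<Longrightarrow> g \<in> lin S \<Longrightarrow> (\<lambda>x. f x + g x) \<in> lin S"
proof -
  assume "f \<in> lin S" "g \<in> lin S"
  then obtain c d where "f = (\<lambda>x. \<Sum>g\<in>S. c g * g x)" "g = (\<lambda>x. \<Sum>g\<in>S. d g * g x)" by (auto simp: lin_def)
  then show ?thesis unfolding lin_def by (intro CollectI exI[of _ "\<lambda>g. c g + d g"]) (simp add: distrib_right sum.distrib)
qed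

lemma lin_scale: "f \<in> lin S \<Longrightarrow> (\<lambda>x. a * f x) \<in> lin S"
proof -
  assume "f \<in> lin S"
  then obtain c where "f = (\<lambda>x. \<Sum>g\<in>S. c g * g x)" by (auto simp: lin_def)
  then show ?thesis unfolding lin_def by (intro CollectI exI[of _ "\<lambda>g. a * c g"]) (simp add: sum_distrib_left mult.assoc)
qed

lemma lin_zero: "(\<lambda>x. 0) \<in> lin S"
  unfolding lin_def by (intro CollectI exI[of _ "\<lambda>_. 0"]) simp

lemma lin_sum: "(\<And>i. i \<in> I \<Longrightarrow> f i \<in> lin S) \<Longrightarrow> (\<lambda>x. \<Sum>i\<in>I. c i * f i x) \<in> lin S"
  by (induction I rule: infinite_finite_induct) (auto simp: lin_zero intro!: lin_add lin_scale)

lemma lin_base: "finite S \<Longrightarrow> g \<in> S \<Longrightarrow> g \<in> lin S"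
  unfolding lin_def by (intro CollectI exI[of _ "\<lambda>h. if h = g then 1 else 0"])
    (simp add: if_distrib[where f="\<lambda>z. z * _"] cong: if_cong)

lemma lin_mono: assumes "S \<subseteq> T" "finite T" "f \<in> lin S" shows "f \<in> lin T"
proof -
  obtain c where c: "f = (\<lambda>x. \<Sum>g\<in>S. c g * g x)" using assms(3) by (auto simp: lin_def)
  have "f = (\<lambda>x. \<Sum>g\<in>T. (if g \<in> S then c g else 0) * g x)"
    unfolding c using assms by (intro ext sum.mono_neutral_cong_left) auto
  then show ?thesis unfolding lin_def by (intro CollectI exI[of _ "\<lambda>g. if g \<in> S then c g else 0"])
qed

text \<open>A basis dual to evaluation at finitely many points of U. Coefficients become values at
  points; this is how transport equations turn into ordinary differential equations and how matrix
  entries are seen to be continuous in time.\<close>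

lemma interpolation_basis:
  assumes "finite S"
  shows "\<exists>(m::nat) x d. (\<forall>i<m. x i \<in> U \<and> d i \<in> lin S) \<and> (\<forall>i<m. \<forall>j<m. d j (x i) = (if i = j then 1 else 0)) \<and>
      (\<forall>w\<in>lin S. \<forall>y\<in>U. w y = (\<Sum>i<m. w (x i) * d i y))"
  using assms
proof induction
  case empty
  show ?case by (rule exI[of _ 0]) (auto simp: lin_def)
next
  case (insert h S)
  then obtain m :: nat and x d where
    xd: "\<And>i. i < m \<Longrightarrow> x i \<in> U" "\<And>i. i < m \<Longrightarrow> d i \<in> lin S"
    and dual: "\<And>i j. i < m \<Longrightarrow> j < m \<Longrightarrow> d j (x i) = (if i = j then 1 else 0)"
    and rep: "\<And>w y. w \<in> lin S \<Longrightarrow> y \<in> U \<Longrightarrow> w y = (\<Sum>i<m. w (x i) * d i y)" by blast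
  let ?T = "insert h S"
  have fin: "finite ?T" using insert by simp
  have dT: "d i \<in> lin ?T" if "i < m" for i using lin_mono[OF _ fin xd(2)[OF that]] by blast
  define g where "g y = h y - (\<Sum>i<m. h (x i) * d i y)" for y
  have gT: "g \<in> lin ?T"
  proof -
    have "(\<lambda>y. h y + (-1) * (\<Sum>i<m. h (x i) * d i y)) \<in> lin ?T"
      by (rule lin_add[OF lin_base[OF fin insertI1] lin_scale[OF lin_sum[OF dT]]]) simp
    then show ?thesis by (simp add: g_def[abs_def])
  qed
  have gx: "g (x i) = 0" if "i < m" for i
  proof -
    have "(\<Sum>j<m. h (x j) * d j (x i)) = (\<Sum>j<m. if j = i then h (x j) else 0)"
      using that by (intro sum.cong) (auto simp: dual)
    then show ?thesis using that by (simp add: g_def)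
  qed
  have split: "\<exists>c. \<forall>y\<in>U. w y = (\<Sum>i<m. w (x i) * d i y) + c * g y" if w: "w \<in> lin ?T" for w
  proof -
    obtain c where c: "w = (\<lambda>x. \<Sum>g\<in>?T. c g * g x)" using w by (auto simp: lin_def)
    define w' where "w' = (\<lambda>x. \<Sum>g\<in>S. c g * g x)"
    have w'S: "w' \<in> lin S" unfolding lin_def w'_def by blast
    have ww: "w y = c h * h y + w' y" for y using insert by (simp add: c w'_def)
    have "w y = (\<Sum>i<m. w (x i) * d i y) + c h * g y" if "y \<in> U" for y
      using rep[OF w'S that] by (simp add: ww g_def algebra_simps sum.distrib sum_distrib_left)
    then show ?thesis by blast
  qed
  show ?case
  proof (cases "\<exists>y\<in>U. g y \<noteq> 0")
    case False
    then have "w y = (\<Sum>i<m. w (x i) * d i y)" if "w \<in> lin ?T" "y \<in> U" for w y using split[OF that(1)] that(2) by auto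
    with xd dT dual show ?thesis by (intro exI[of _ m] exI[of _ x] exI[of _ d]) auto
  next
    case True
    then obtain z where z: "z \<in> U" "g z \<noteq> 0" by blast
    define dm where "dm y = 1 / g z * g y" for y
    have dmT: "dm \<in> lin ?T" using lin_scale[OF gT, of "1 / g z"] by (simp add: dm_def[abs_def])
    have dmz: "dm z = 1" using z by (simp add: dm_def)
    have dmx: "dm (x i) = 0" if "i < m" for i using gx[OF that] by (simp add: dm_def)
    define x' where "x' i = (if i = m then z else x i)" for i
    \<comment> \<open>The old functions are corrected by multiples of dm so as to vanish at the new
      node z.\<close>
    define d' where "d' i = (if i = m then dm else (\<lambda>y. d i y - d i z * dm y))" for i
    have d'T: "d' i \<in> lin ?T" if "i < Suc m" for i
    proof (cases "i = m")
      case False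
      then have "(\<lambda>y. d i y + (- d i z) * dm y) \<in> lin ?T" using that by (intro lin_add lin_scale dT dmT) auto
      then show ?thesis using False by (simp add: d'_def)
    qed (simp add: d'_def dmT)
    have dual': "d' j (x' i) = (if i = j then 1 else 0)" if "i < Suc m" "j < Suc m" for i j
      using that by (auto simp: d'_def x'_def dmz dmx dual less_Suc_eq)
    have "w y = (\<Sum>i<Suc m. w (x' i) * d' i y)" if w: "w \<in> lin ?T" and y: "y \<in> U" for w y
    proof -
      obtain c where c: "\<And>y. y \<in> U \<Longrightarrow> w y = (\<Sum>i<m. w (x i) * d i y) + c * g y" using split[OF w] by blast
      have "(\<Sum>i<m. w (x' i) * d' i y) = (\<Sum>i<m. w (x i) * d i y) - (\<Sum>i<m. w (x i) * d i z) * dm y"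
        by (simp add: x'_def d'_def algebra_simps sum_subtractf sum_distrib_left sum_distrib_right)
      moreover have "w z = (\<Sum>i<m. w (x i) * d i z) + c * g z" by (rule c[OF z(1)])
      moreover have "g z * dm y = g y" using z(2) by (simp add: dm_def)
      ultimately show ?thesis using c[OF y] by (simp add: x'_def d'_def algebra_simps)
    qed
    then show ?thesis using xd z d'T dual'
      by (intro exI[of _ "Suc m"] exI[of _ x'] exI[of _ d']) (auto simp: x'_def)
  qed
qed

text \<open>The vertex of the cone is p. The point q witnesses that the regular locus is nonempty
  and serves later as the base point at which constants are evaluated.\<close>

locale cone =
  fixes X :: "(complex^'n) set" and \<sigma> :: "complex \<Rightarrow> complex^'n \<Rightarrow> complex^'n" and p q :: "complex^'n"
  assumes normal: "normal_variety X" and act: "Cstar_action X \<sigma>"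
    and fixp: "fixed_points X \<sigma> = {p}" and pos: "\<And>k. cotangent_weight X \<sigma> p k \<Longrightarrow> k > 0"
    and regq: "q \<in> regular_locus X"
begin

lemma affX: "affine_variety X" using normal by (simp add: normal_variety_def)
lemma irrX: "irr X" by (rule affine_variety_irr[OF affX])
lemma \<sigma>_in: "t \<noteq> 0 \<Longrightarrow> x \<in> X \<Longrightarrow> \<sigma> t x \<in> X" using act by (auto simp: Cstar_action_def)
lemma \<sigma>_one: "x \<in> X \<Longrightarrow> \<sigma> 1 x = x" using act by (simp add: Cstar_action_def)
lemma \<sigma>_mult: "s \<noteq> 0 \<Longrightarrow> t \<noteq> 0 \<Longrightarrow> x \<in> X \<Longrightarrow> \<sigma> (s * t) x = \<sigma> s (\<sigma> t x)" using act by (simp add: Cstar_action_def)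
lemma pX: "p \<in> X" and \<sigma>_p: "t \<noteq> 0 \<Longrightarrow> \<sigma> t p = p" using fixp by (auto simp: fixed_points_def)
lemma qX: "q \<in> X" using regq regular_locus_subset by blast
lemma reg_in: "x \<in> regular_locus X \<Longrightarrow> x \<in> X" using regular_locus_subset by blast

definition hom :: "int \<Rightarrow> (complex^'n \<Rightarrow> complex) \<Rightarrow> bool" where
  "hom k f \<longleftrightarrow> polyfun f \<and> (\<forall>x\<in>X. \<forall>t. t \<noteq> 0 \<longrightarrow> f (\<sigma> t x) = t powi k * f x)"

lemma hom_polyfun: "hom k f \<Longrightarrow> polyfun f"
  and homD: "hom k f \<Longrightarrow> x \<in> X \<Longrightarrow> t \<noteq> 0 \<Longrightarrow> f (\<sigma> t x) = t powi k * f x"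
  by (auto simp: hom_def)

lemma hom_add: "hom k f \<Longrightarrow> hom k g \<Longrightarrow> hom k (\<lambda>x. f x + g x)"
  by (auto simp: hom_def distrib_left intro: polyfun.add)
lemma hom_scale: "hom k f \<Longrightarrow> hom k (\<lambda>x. c * f x)"
  by (auto simp: hom_def intro: polyfun.mult polyfun.const)
lemma hom_zero: "hom k (\<lambda>x. 0)"
  by (auto simp: hom_def intro: polyfun.const)
lemma hom_const: "hom 0 (\<lambda>x. c)"
  by (auto simp: hom_def intro: polyfun.const)
lemma hom_mult: "hom k f \<Longrightarrow> hom l g \<Longrightarrow> hom (k + l) (\<lambda>x. f x * g x)"
  by (auto simp: hom_def power_int_add intro: polyfun.mult)
lemma hom_sum: "(\<And>i. i \<in> I \<Longrightarrow> hom k (f i)) \<Longrightarrow> hom k (\<lambda>x. \<Sum>i\<in>I. f i x)"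
  by (induction I rule: infinite_finite_induct) (auto simp: hom_zero hom_add)
lemma hom_lin: assumes "\<And>g. g \<in> S \<Longrightarrow> hom k g" "f \<in> lin S" shows "hom k f"
  using assms unfolding lin_def by (auto intro!: hom_sum hom_scale)

lemma hom_part:
  assumes f: "hom k f" and I: "finite I" and F: "\<And>i. i \<in> I \<Longrightarrow> hom (w i) (F i)"
    and eq: "\<And>x. x \<in> X \<Longrightarrow> f x = (\<Sum>i\<in>I. F i x)" and x: "x \<in> X"
  shows "f x = (\<Sum>i | i \<in> I \<and> w i = k. F i x)"
proof (rule laurent_grouped_unique[OF I])
  fix t :: complex assume t: "t \<noteq> 0"
  have "t powi k * f x = f (\<sigma> t x)" using homD[OF f x t] by simp
  also have "\<dots> = (\<Sum>i\<in>I. F i (\<sigma> t x))" by (rule eq[OF \<sigma>_in[OF t x]])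
  also have "\<dots> = (\<Sum>i\<in>I. t powi w i * F i x)" using homD[OF F x t] by simp
  finally show "t powi k * f x = (\<Sum>i\<in>I. t powi w i * F i x)" .
qed

text \<open>Comparing \<open>\<sigma> (s * t) x\<close> with
  \<open>\<sigma> s (\<sigma> t x)\<close> as Laurent polynomials in s shows that the coefficient of
  the j-th power has weight j. A common N for all coordinates is reached by padding with zero
  coefficients.\<close>

lemma action_coordinates:
  obtains C and N :: nat where "\<And>i j. hom j (C i j)"
    "\<And>t x i. t \<noteq> 0 \<Longrightarrow> x \<in> X \<Longrightarrow> \<sigma> t x $ i = (\<Sum>j = - int N..int N. t powi j * C i j x)"
proof -
  have "\<forall>i. \<exists>(N::nat) c. (\<forall>j. c j \<in> coord_ring X) \<and>
        (\<forall>t x. t \<noteq> 0 \<and> x \<in> X \<longrightarrow> \<sigma> t x $ i = (\<Sum>j = - int N..int N. t powi j * c j x))"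
    using act unfolding Cstar_action_def by blast
  then obtain M c where c: "\<And>i j. c i j \<in> coord_ring X"
    "\<And>i t x. t \<noteq> 0 \<Longrightarrow> x \<in> X \<Longrightarrow> \<sigma> t x $ i = (\<Sum>j = - int (M i)..int (M i). t powi j * c i j x)" by metis
  have "\<forall>i j. \<exists>F. polyfun F \<and> (\<forall>x\<in>X. c i j x = F x)" using c(1) unfolding coord_ring_def by blast
  then obtain F where F: "\<And>i j. polyfun (F i j)" "\<And>i j x. x \<in> X \<Longrightarrow> c i j x = F i j x" by metis
  define N where "N = Max (range M)"
  have MN: "M i \<le> N" for i by (simp add: N_def)
  define C where "C i j = (if \<bar>j\<bar> \<le> int (M i) then F i j else (\<lambda>x. 0))" for i j
  have exp: "\<sigma> t x $ i = (\<Sum>j = - int N..int N. t powi j * C i j x)" if "t \<noteq> 0" "x \<in> X" for t x i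
  proof -
    have "\<sigma> t x $ i = (\<Sum>j = - int (M i)..int (M i). t powi j * C i j x)"
      unfolding c(2)[OF that] by (intro sum.cong) (auto simp: C_def F(2)[OF that(2)])
    also have "\<dots> = (\<Sum>j = - int N..int N. t powi j * C i j x)"
      using MN[of i] by (intro sum.mono_neutral_left) (auto simp: C_def)
    finally show ?thesis .
  qed
  have "hom j (C i j)" for i j
  proof (cases "\<bar>j\<bar> \<le> int N")
    case False
    then have "C i j = (\<lambda>x. 0)" using MN[of i] by (auto simp: C_def)
    then show ?thesis by (simp add: hom_zero)
  next
    case True
    have "C i j (\<sigma> t x) = t powi j * C i j x" if tx: "t \<noteq> 0" "x \<in> X" for t x
    proof -
      have "C i j (\<sigma> t x) - t powi j * C i j x = 0"
      proof (rule laurent_unique[of "{- int N..int N}" "\<lambda>j. C i j (\<sigma> t x) - t powi j * C i j x"])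
        fix s :: complex assume s: "s \<noteq> 0"
        have "(\<Sum>j = - int N..int N. s powi j * C i j (\<sigma> t x)) = \<sigma> (s * t) x $ i"
          using exp[OF s \<sigma>_in[OF tx]] \<sigma>_mult[OF s tx] by simp
        also have "\<dots> = (\<Sum>j = - int N..int N. s powi j * (t powi j * C i j x))"
          using exp[of "s * t" x i] s tx by (simp add: power_int_mult_distrib mult.assoc)
        finally show "(\<Sum>j = - int N..int N. s powi j * (C i j (\<sigma> t x) - t powi j * C i j x)) = 0"
          by (simp add: right_diff_distrib sum_subtractf)
      qed (use True in auto)
      then show ?thesis by simp
    qed
    moreover have "polyfun (C i j)" by (simp add: C_def F polyfun.const)
    ultimately show ?thesis by (simp add: hom_def)
  qed
  with exp that show ?thesis by blast
qed

section \<open>Decomposition of polynomial functions on X into homogeneous parts\<close>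

definition graded :: "(complex^'n \<Rightarrow> complex) \<Rightarrow> bool" where
  "graded F \<longleftrightarrow> (\<exists>J G. finite J \<and> (\<forall>j. hom j (G j)) \<and> (\<forall>x\<in>X. F x = (\<Sum>j\<in>J. G j x)))"

lemma graded_hom: "hom k f \<Longrightarrow> graded f"
  unfolding graded_def by (intro exI[of _ "{k}"] exI[of _ "\<lambda>j. if j = k then f else (\<lambda>x. 0)"]) (auto simp: hom_zero)

lemma graded_add:
  assumes "graded f" "graded g" shows "graded (\<lambda>x. f x + g x)"
proof -
  obtain J G K H where *: "finite J" "\<And>j. hom j (G j)" "\<And>x. x \<in> X \<Longrightarrow> f x = (\<Sum>j\<in>J. G j x)"
    "finite K" "\<And>j. hom j (H j)" "\<And>x. x \<in> X \<Longrightarrow> g x = (\<Sum>j\<in>K. H j x)"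
    using assms unfolding graded_def by blast
  define G' where "G' j = (if j \<in> J then G j else (\<lambda>x. 0))" for j
  define H' where "H' j = (if j \<in> K then H j else (\<lambda>x. 0))" for j
  have "f x = (\<Sum>j\<in>J \<union> K. G' j x)" if "x \<in> X" for x
    unfolding *(3)[OF that] using * by (intro sum.mono_neutral_cong_left) (auto simp: G'_def)
  moreover have "g x = (\<Sum>j\<in>J \<union> K. H' j x)" if "x \<in> X" for x
    unfolding *(6)[OF that] using * by (intro sum.mono_neutral_cong_left) (auto simp: H'_def)
  moreover have "hom j (\<lambda>x. G' j x + H' j x)" for j using * by (auto simp: G'_def H'_def hom_zero hom_add)
  ultimately show ?thesis unfolding graded_def using *
    by (intro exI[of _ "J \<union> K"] exI[of _ "\<lambda>j x. G' j x + H' j x"]) (auto simp: sum.distrib)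
qed

lemma graded_cong: "graded f \<Longrightarrow> (\<And>x. x \<in> X \<Longrightarrow> g x = f x) \<Longrightarrow> graded g"
  unfolding graded_def by simp

lemma graded_sum: "(\<And>i. i \<in> I \<Longrightarrow> graded (f i)) \<Longrightarrow> graded (\<lambda>x. \<Sum>i\<in>I. f i x)"
  by (induction I rule: infinite_finite_induct) (auto intro: graded_add graded_hom[OF hom_zero])

lemma graded_mult:
  assumes "graded f" "graded g" shows "graded (\<lambda>x. f x * g x)"
proof -
  obtain J G K H where *: "finite J" "\<And>j. hom j (G j)" "\<And>x. x \<in> X \<Longrightarrow> f x = (\<Sum>j\<in>J. G j x)"
    "finite K" "\<And>j. hom j (H j)" "\<And>x. x \<in> X \<Longrightarrow> g x = (\<Sum>j\<in>K. H j x)"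
    using assms unfolding graded_def by blast
  have "graded (\<lambda>x. \<Sum>a\<in>J. \<Sum>b\<in>K. G a x * H b x)"
    by (intro graded_sum graded_hom[OF hom_mult[OF *(2) *(5)]])
  then show ?thesis by (rule graded_cong) (simp add: *(3,6) sum_product)
qed

lemma polyfun_graded: "polyfun F \<Longrightarrow> graded F"
proof (induction rule: polyfun.induct)
  case (coord i)
  obtain C and N :: nat where C: "\<And>i j. hom j (C i j)"
    "\<And>t x i. t \<noteq> 0 \<Longrightarrow> x \<in> X \<Longrightarrow> \<sigma> t x $ i = (\<Sum>j = - int N..int N. t powi j * C i j x)"
    using action_coordinates by blast
  have "graded (\<lambda>x. \<Sum>j = - int N..int N. C i j x)" by (intro graded_sum graded_hom[OF C(1)])
  then show ?case
  proof (rule graded_cong)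
    fix x assume "x \<in> X"
    then show "x $ i = (\<Sum>j = - int N..int N. C i j x)" using C(2)[of 1 x i] \<sigma>_one by simp
  qed
qed (auto intro: graded_hom[OF hom_const] graded_add graded_mult)

section \<open>Consequences of positive cotangent weights\<close>

lemma hom_at_p: "hom k f \<Longrightarrow> k \<noteq> 0 \<Longrightarrow> f p = 0"
proof -
  assume f: "hom k f" and k: "k \<noteq> 0"
  have "f p = 2 powi k * f p" using homD[OF f pX, of 2] \<sigma>_p[of 2] by simp
  moreover have "(2::complex) powi k \<noteq> 1"
  proof
    assume "(2::complex) powi k = 1"
    then have "norm ((2::complex) powi k) = 1" by simp
    then have "(2::real) powi k = 1" by (simp add: norm_power_int)
    then show False using k power_int_strict_increasing[of 0 k "2::real"] power_int_strict_increasing[of k 0 "2::real"] by (cases "k > 0") auto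
  qed
  ultimately show "f p = 0" by (metis mult_cancel_right1)
qed

lemma graded_vanishing_at_p:
  assumes "polyfun F" "F p = 0"
  obtains J G where "finite J" "\<And>j. hom j (G j)" "\<And>j. j \<in> J \<Longrightarrow> G j p = 0" "\<And>x. x \<in> X \<Longrightarrow> F x = (\<Sum>j\<in>J. G j x)"
proof -
  obtain J G where G: "finite J" "\<And>j. hom j (G j)" "\<And>x. x \<in> X \<Longrightarrow> F x = (\<Sum>j\<in>J. G j x)"
    using polyfun_graded[OF assms(1)] unfolding graded_def by blast
  have "G j p = 0" if "j \<in> J" for j
  proof (cases "j = 0")
    case True
    have "F p = G 0 p + (\<Sum>j\<in>J - {0}. G j p)" using G(1,3) pX that True by (simp add: sum.remove)
    also have "(\<Sum>j\<in>J - {0}. G j p) = 0" using hom_at_p[OF G(2)] by (intro sum.neutral) auto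
    finally show ?thesis using assms(2) True by simp
  next
    case False
    then show ?thesis by (rule hom_at_p[OF G(2)])
  qed
  with G that show ?thesis by blast
qed

text \<open>A weight k \<le> 0 does not occur in the cotangent space, so f is a sum of products of
  functions vanishing at p. Split the factors into homogeneous parts and keep the products of total
  weight k: each has a factor of nonpositive weight, and that factor is called v.\<close>

lemma nonpositive_weight_in_square:
  assumes f: "hom k f" "f p = 0" and k: "k \<le> 0"
  obtains I :: "(nat \<times> int \<times> int) set" and u v where "finite I" "\<And>i. i \<in> I \<Longrightarrow> polyfun (u i) \<and> u i p = 0"
    "\<And>i. i \<in> I \<Longrightarrow> v i p = 0 \<and> (\<exists>l\<le>0. hom l (v i))" "\<And>x. x \<in> X \<Longrightarrow> f x = (\<Sum>i\<in>I. u i x * v i x)"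
proof -
  have pf: "polyfun f" using f by (simp add: hom_def)
  have "f \<in> max_ideal X p" using pf f(2) unfolding max_ideal_def coord_ring_def by blast
  moreover have "(\<lambda>x. f (\<sigma> t x) - t powi k * f x) \<in> max_ideal_sq X p" if "t \<noteq> 0" for t
    unfolding max_ideal_sq_def using homD[OF f(1) _ that] by (intro CollectI exI[of _ 0]) auto
  ultimately have "f \<in> max_ideal_sq X p" using pos[of k] k unfolding cotangent_weight_def by force
  then obtain m :: nat and a b where ab: "\<And>i. i < m \<Longrightarrow> a i \<in> max_ideal X p \<and> b i \<in> max_ideal X p"
    "\<And>x. x \<in> X \<Longrightarrow> f x = (\<Sum>i<m. a i x * b i x)" unfolding max_ideal_sq_def by blast
  have ex: "\<exists>J G. finite J \<and> (\<forall>j. hom j (G j)) \<and> (\<forall>j\<in>J. G j p = 0) \<and> (\<forall>x\<in>X. c x = (\<Sum>j\<in>J. G j x))"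
    if "c \<in> max_ideal X p" for c
  proof -
    obtain F where F: "polyfun F" "\<And>x. x \<in> X \<Longrightarrow> c x = F x" "c p = 0"
      using \<open>c \<in> max_ideal X p\<close> unfolding max_ideal_def coord_ring_def by blast
    then have "F p = 0" using pX by simp
    show ?thesis
    proof (rule graded_vanishing_at_p[OF F(1) \<open>F p = 0\<close>])
      fix J G assume "finite J" "\<And>j. hom j (G j)" "\<And>j. j \<in> J \<Longrightarrow> G j p = 0" "\<And>x. x \<in> X \<Longrightarrow> F x = (\<Sum>j\<in>J. G j x)"
      with F(2) show ?thesis by (intro exI[of _ J] exI[of _ G]) auto
    qed
  qed
  define dec where "dec c J G \<longleftrightarrow> finite J \<and> (\<forall>j. hom j (G j)) \<and> (\<forall>j\<in>J. G j p = 0) \<and> (\<forall>x\<in>X. c x = (\<Sum>j\<in>J. G j x))" for c J G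
  have ex': "\<exists>J G. dec c J G" if "c \<in> max_ideal X p" for c using ex[OF that] unfolding dec_def .
  have "\<forall>i. \<exists>J G. i < m \<longrightarrow> dec (a i) J G" using ex' ab(1) by blast
  then obtain J G where "\<And>i. i < m \<Longrightarrow> dec (a i) (J i) (G i)" by metis
  note G = this[unfolded dec_def]
  have "\<forall>i. \<exists>J G. i < m \<longrightarrow> dec (b i) J G" using ex' ab(1) by blast
  then obtain K H where "\<And>i. i < m \<Longrightarrow> dec (b i) (K i) (H i)" by metis
  note H = this[unfolded dec_def]
  define I0 where "I0 = (SIGMA i:{..<m}. J i \<times> K i)"
  define T where "T = (\<lambda>(i, j, l) x. G i j x * H i l x)"
  define w where "w = (\<lambda>(i::nat, j::int, l::int). j + l)"
  have fI0: "finite I0" unfolding I0_def using G H by (intro finite_SigmaI) auto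
  have sum: "f x = (\<Sum>s\<in>I0. T s x)" if x: "x \<in> X" for x
  proof -
    have "f x = (\<Sum>i<m. \<Sum>(j, l)\<in>J i \<times> K i. G i j x * H i l x)"
      unfolding ab(2)[OF x] using G H x by (intro sum.cong refl) (simp add: sum_product sum.cartesian_product)
    also have "\<dots> = (\<Sum>s\<in>I0. T s x)"
      unfolding I0_def T_def using G H by (subst sum.Sigma) (auto simp: split_def)
    finally show ?thesis .
  qed
  have hT: "hom (w s) (T s)" if "s \<in> I0" for s
    using that G H by (auto simp: I0_def T_def w_def intro!: hom_mult)
  define I where "I = {s. s \<in> I0 \<and> w s = k}"
  define u where "u = (\<lambda>(i, j, l). if j \<le> 0 then H i l else G i j)"
  define v where "v = (\<lambda>(i, j, l). if j \<le> 0 then G i j else H i l)"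
  show ?thesis
  proof (rule that[of I u v])
    show "finite I" using fI0 by (simp add: I_def)
    fix s assume s: "s \<in> I"
    then obtain i j l where ijl: "s = (i, j, l)" "i < m" "j \<in> J i" "l \<in> K i" "j + l = k" by (auto simp: I_def I0_def w_def)
    then show "polyfun (u s) \<and> u s p = 0" using G[of i] H[of i] by (auto simp: u_def intro: hom_polyfun)
    show "v s p = 0 \<and> (\<exists>l\<le>0. hom l (v s))"
    proof (cases "j \<le> 0")
      case True
      then show ?thesis using G[of i] ijl by (auto simp: v_def)
    next
      case False
      then have "l \<le> 0" using ijl k by simp
      then show ?thesis using H[of i] ijl False by (auto simp: v_def)
    qed
  next
    fix x assume x: "x \<in> X"
    have "f x = (\<Sum>s\<in>I. T s x)" unfolding I_def by (rule hom_part[OF f(1) fI0 hT sum x])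
    also have "\<dots> = (\<Sum>s\<in>I. u s x * v s x)"
      by (intro sum.cong) (auto simp: T_def u_def v_def mult.commute split: prod.splits)
    finally show "f x = (\<Sum>s\<in>I. u s x * v s x)" .
  qed
qed

text \<open>By \<open>nonpositive_weight_in_square\<close> the ideal generated by N is, on X,
  contained in its product with the ideal of p. Nakayama's argument then shows that it
  vanishes.\<close>

lemma nonpositive_weight_vanishes:
  assumes f: "hom k f" "f p = 0" "k \<le> 0" and x: "x \<in> X"
  shows "f x = 0"
proof -
  define N where "N = {f. f p = 0 \<and> (\<exists>k\<le>0. hom k f)}"
  have Np: "polyfun g" if "g \<in> N" for g using that by (auto simp: N_def hom_polyfun)
  obtain S0 where S0: "finite S0" "S0 \<subseteq> N"
    "\<And>f. f \<in> N \<Longrightarrow> \<exists>c. (\<forall>g. polyfun (c g)) \<and> f = (\<lambda>x. \<Sum>g\<in>S0. c g x * g x)"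
    using polyfun_finite_generators[of N] Np by blast
  have main: "\<exists>e. (\<forall>g. polyfun (e g) \<and> e g p = 0) \<and> (\<forall>x\<in>X. h x = (\<Sum>g\<in>S0. e g x * g x))" if h: "h \<in> N" for h
  proof -
    obtain k where k: "hom k h" "h p = 0" "k \<le> 0" using h by (auto simp: N_def)
    have "\<exists>(I :: (nat \<times> int \<times> int) set) u v. finite I \<and> (\<forall>i\<in>I. polyfun (u i) \<and> u i p = 0) \<and>
      (\<forall>i\<in>I. v i p = 0 \<and> (\<exists>l\<le>0. hom l (v i))) \<and> (\<forall>x\<in>X. h x = (\<Sum>i\<in>I. u i x * v i x))"
    proof (rule nonpositive_weight_in_square[OF k])
      fix I :: "(nat \<times> int \<times> int) set" and u v
      assume "finite I" "\<And>i. i \<in> I \<Longrightarrow> polyfun (u i) \<and> u i p = 0"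
        "\<And>i. i \<in> I \<Longrightarrow> v i p = 0 \<and> (\<exists>l\<le>0. hom l (v i))" "\<And>x. x \<in> X \<Longrightarrow> h x = (\<Sum>i\<in>I. u i x * v i x)"
      then show ?thesis by (intro exI[of _ I] exI[of _ u] exI[of _ v]) auto
    qed
    then obtain I :: "(nat \<times> int \<times> int) set" and u v where uv: "finite I" "\<And>i. i \<in> I \<Longrightarrow> polyfun (u i) \<and> u i p = 0"
      "\<And>i. i \<in> I \<Longrightarrow> v i p = 0 \<and> (\<exists>l\<le>0. hom l (v i))" "\<And>x. x \<in> X \<Longrightarrow> h x = (\<Sum>i\<in>I. u i x * v i x)" by blast
    define gen where "gen f c \<longleftrightarrow> (\<forall>g. polyfun (c g)) \<and> f = (\<lambda>x. \<Sum>g\<in>S0. c g x * g x)" for f c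
    have "v i \<in> N" if "i \<in> I" for i using uv(3)[OF that] by (auto simp: N_def)
    then have "\<forall>i. \<exists>c. i \<in> I \<longrightarrow> gen (v i) c" using S0(3) unfolding gen_def by blast
    then obtain c where "\<And>i. i \<in> I \<Longrightarrow> gen (v i) (c i)" by metis
    note c = this[unfolded gen_def]
    define e where "e g x = (\<Sum>i\<in>I. u i x * c i g x)" for g x
    have "polyfun (e g) \<and> e g p = 0" for g
      unfolding e_def using uv(2) c by (auto intro!: polyfun_sum polyfun.mult sum.neutral)
    moreover have "h x = (\<Sum>g\<in>S0. e g x * g x)" if x: "x \<in> X" for x
    proof -
      have "h x = (\<Sum>i\<in>I. u i x * (\<Sum>g\<in>S0. c i g x * g x))"
        unfolding uv(4)[OF x] using c by (intro sum.cong refl) simp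
      also have "\<dots> = (\<Sum>g\<in>S0. e g x * g x)"
        unfolding e_def sum_distrib_left sum_distrib_right by (subst sum.swap) (simp add: mult.assoc)
      finally show ?thesis .
    qed
    ultimately show ?thesis by blast
  qed
  define rep where "rep h e \<longleftrightarrow> (\<forall>g. polyfun (e g) \<and> e g p = 0) \<and> (\<forall>x\<in>X. h x = (\<Sum>g\<in>S0. e g x * g x))" for h e
  have "\<forall>h. \<exists>e. h \<in> N \<longrightarrow> rep h e" using main unfolding rep_def by blast
  then obtain e where "\<And>h. h \<in> N \<Longrightarrow> rep h (e h)" by metis
  note e = this[unfolded rep_def]
  define e' where "e' h g = (if h \<in> N then e h g else (\<lambda>x. 0))" for h g
  have "\<forall>f\<in>S0. \<forall>x\<in>X. f x = 0"
  proof (rule nakayama_elimination[OF irrX pX S0(1), of "\<lambda>x. 1" e'])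
    show "polyfun (e' f g)" "e' f g p = 0" for f g using e[of f] by (auto simp: e'_def polyfun.const)
    show "1 * f x = (\<Sum>g\<in>S0. e' f g x * g x)" if "f \<in> S0" "x \<in> X" for f x
      using e[of f] that S0(2) by (auto simp: e'_def)
  qed (use S0(2) Np in \<open>auto intro: polyfun.const\<close>)
  moreover have "f \<in> N" using f by (auto simp: N_def)
  then obtain c where c: "f = (\<lambda>x. \<Sum>g\<in>S0. c g x * g x)" using S0(3) by blast
  ultimately show ?thesis using x unfolding c by (intro sum.neutral) auto
qed

lemma hom_negative: "hom k f \<Longrightarrow> k < 0 \<Longrightarrow> x \<in> X \<Longrightarrow> f x = 0"
  using nonpositive_weight_vanishes[of k f x] hom_at_p[of k f] by auto

text \<open>Subtracting the value at p gives a function of weight 0 that vanishes at p. This is the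
  statement that the degree 0 part of the coordinate ring consists of constants.\<close>

lemma hom_weight_zero: assumes "hom 0 f" "x \<in> X" shows "f x = f p"
proof -
  have "hom 0 (\<lambda>x. f x + - f p)" by (rule hom_add[OF assms(1) hom_const])
  from nonpositive_weight_vanishes[OF this _ _ assms(2)] show ?thesis by simp
qed

text \<open>Finitely many functions of weight k generate the ideal of all of them; in a combination
  of weight k only the weight 0 parts of the coefficients contribute, and these are
  constants.\<close>

lemma hom_finite_dimensional:
  obtains S where "finite S" "\<And>g. g \<in> S \<Longrightarrow> hom k g" "\<And>f. hom k f \<Longrightarrow> \<exists>w\<in>lin S. \<forall>x\<in>X. f x = w x"
proof -
  obtain S where S: "finite S" "S \<subseteq> {f. hom k f}"
    "\<And>f. f \<in> {f. hom k f} \<Longrightarrow> \<exists>c. (\<forall>g. polyfun (c g)) \<and> f = (\<lambda>x. \<Sum>g\<in>S. c g x * g x)"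
    using polyfun_finite_generators[of "{f. hom k f}"] hom_polyfun by blast
  have rep: "\<exists>w\<in>lin S. \<forall>x\<in>X. f x = w x" if f: "hom k f" for f
  proof -
    obtain c where c: "\<And>g. polyfun (c g)" "f = (\<lambda>x. \<Sum>g\<in>S. c g x * g x)" using S(3) f by blast
    define dec where "dec f J G \<longleftrightarrow> finite J \<and> (\<forall>j. hom j (G j)) \<and> (\<forall>x\<in>X. f x = (\<Sum>j\<in>J. G j x))" for f J G
    have "\<forall>g. \<exists>J G. dec (c g) J G" using polyfun_graded[OF c(1)] unfolding graded_def dec_def by simp
    then obtain J G where dec: "\<And>g. dec (c g) (J g) (G g)" by metis
    have G: "finite (J g)" "hom j (G g j)" "x \<in> X \<Longrightarrow> c g x = (\<Sum>j\<in>J g. G g j x)" for g j x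
      using dec[of g] unfolding dec_def by auto
    define I where "I = (SIGMA g:S. J g)"
    define T where "T = (\<lambda>(g, j) x. G g j x * g x)"
    have fI: "finite I" unfolding I_def using S(1) G(1) by auto
    have hT: "hom (snd s + k) (T s)" if "s \<in> I" for s
      using that S(2) G(2) by (auto simp: I_def T_def intro!: hom_mult)
    have sum: "f x = (\<Sum>s\<in>I. T s x)" if x: "x \<in> X" for x
    proof -
      have "f x = (\<Sum>g\<in>S. \<Sum>j\<in>J g. G g j x * g x)" by (simp add: c(2) G(3)[OF x] sum_distrib_right)
      also have "\<dots> = (\<Sum>s\<in>I. T s x)" unfolding I_def T_def using S(1) G(1) by (subst sum.Sigma) (auto simp: split_def)
      finally show ?thesis .
    qed
    \<comment> \<open>The constant value of the weight 0 part of the coefficient of g, or 0 if the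
      chosen decomposition has no such part.\<close>
    define d where "d g = (if 0 \<in> J g then G g 0 p else 0)" for g
    have "f x = (\<Sum>g\<in>S. d g * g x)" if x: "x \<in> X" for x
    proof -
      have "f x = (\<Sum>s | s \<in> I \<and> snd s + k = k. T s x)" by (rule hom_part[OF f fI hT sum x])
      also have "{s. s \<in> I \<and> snd s + k = k} = (SIGMA g:S. J g \<inter> {0})" by (auto simp: I_def)
      also have "(\<Sum>s\<in>(SIGMA g:S. J g \<inter> {0}). T s x) = (\<Sum>g\<in>S. \<Sum>j\<in>J g \<inter> {0}. G g j x * g x)"
        unfolding T_def using S(1) G(1) by (subst sum.Sigma) (auto simp: split_def)
      also have "\<dots> = (\<Sum>g\<in>S. d g * g x)"
        using hom_weight_zero[OF G(2) x] by (intro sum.cong refl) (auto simp: d_def)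
      finally show ?thesis .
    qed
    then have eq: "\<forall>x\<in>X. f x = (\<Sum>g\<in>S. d g * g x)" by simp
    have "(\<lambda>x. \<Sum>g\<in>S. d g * g x) \<in> lin S" unfolding lin_def by (rule CollectI, rule exI[of _ d], rule refl)
    with eq show ?thesis by (rule bexI)
  qed
  show ?thesis
  proof (rule that[OF S(1)])
    show "hom k g" if "g \<in> S" for g using S(2) that by blast
  qed (rule rep)
qed

end

section \<open>Linear ordinary differential equations\<close>

text \<open>E times exp (- c t) is nonincreasing and E times exp (c t) is nondecreasing, so
  vanishing spreads from t0 in both directions of time. The backward direction later makes pullback
  along the flow injective.\<close>

lemma gronwall_zero:
  fixes E E' :: "real \<Rightarrow> real"
  assumes E: "\<And>t. t \<in> {0..1} \<Longrightarrow> (E has_real_derivative E' t) (at t within {0..1})"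
    and bd: "\<And>t. t \<in> {0..1} \<Longrightarrow> \<bar>E' t\<bar> \<le> c * E t" and nn: "\<And>t. t \<in> {0..1} \<Longrightarrow> 0 \<le> E t"
    and 0: "t0 \<in> {0..1}" "E t0 = 0" and t: "t \<in> {0..1}"
  shows "E t = 0"
proof -
  have mono: "exp (s * b) * E b \<le> exp (s * a) * E a"
    if ab: "a \<in> {0..1}" "b \<in> {0..1}" and sgn: "(a \<le> b \<and> s = - c) \<or> (b \<le> a \<and> s = c)" for a b s
  proof -
    define g where "g t = exp (s * t) * E t" for t
    have D: "(g has_real_derivative exp (s * t) * (E' t + s * E t)) (at t within {0..1})" if "t \<in> {0..1}" for t
      unfolding g_def by (auto intro!: derivative_eq_intros E[OF that] simp: algebra_simps)
    have Dd: "(g has_derivative (\<lambda>h. h * (exp (s * t) * (E' t + s * E t)))) (at t within {0..1})" if "t \<in> {0..1}" for t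
      using D[OF that] by (simp add: has_field_derivative_def mult_commute_abs)
    show ?thesis
    proof (cases "a \<le> b \<and> s = - c")
      case True
      have "exp (s * t) * (E' t + s * E t) \<le> 0" if "t \<in> {0..1}" for t
        using bd[OF that] True by (intro mult_nonneg_nonpos) auto
      moreover have "\<exists>x\<in>{a..b}. g b - g a = (\<lambda>h. h * (exp (s * x) * (E' x + s * E x))) (b - a)"
        using True ab by (intro mvt_very_simple has_derivative_subset[OF Dd]) auto
      then obtain x where x: "x \<in> {a..b}" "g b - g a = (b - a) * (exp (s * x) * (E' x + s * E x))" by blast
      moreover have "x \<in> {0..1}" using x ab by auto
      ultimately have "g b - g a \<le> 0" using True by (auto simp: mult_le_0_iff)
      then have "g b \<le> g a" by simp
      then show ?thesis by (simp add: g_def)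
    next
      case False
      with sgn have ba: "b \<le> a" "s = c" by auto
      have "exp (s * t) * (E' t + s * E t) \<ge> 0" if "t \<in> {0..1}" for t
        using bd[OF that] ba by (intro mult_nonneg_nonneg) auto
      moreover have "\<exists>x\<in>{b..a}. g a - g b = (\<lambda>h. h * (exp (s * x) * (E' x + s * E x))) (a - b)"
        using ba ab by (intro mvt_very_simple has_derivative_subset[OF Dd]) auto
      then obtain x where x: "x \<in> {b..a}" "g a - g b = (a - b) * (exp (s * x) * (E' x + s * E x))" by blast
      moreover have "x \<in> {0..1}" using x ab by auto
      ultimately have "g a - g b \<ge> 0" using ba by (auto simp: zero_le_mult_iff)
      then have "g b \<le> g a" by simp
      then show ?thesis by (simp add: g_def)
    qed
  qed
  have "\<exists>s. exp (s * t) * E t \<le> exp (s * t0) * E t0"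
  proof (cases "t0 \<le> t")
    case True
    show ?thesis by (rule exI[of _ "- c"], rule mono[OF 0(1) t]) (use True in simp)
  next
    case False
    show ?thesis by (rule exI[of _ c], rule mono[OF 0(1) t]) (use False in simp)
  qed
  then obtain s where "exp (s * t) * E t \<le> 0" using 0(2) by auto
  then have "E t \<le> 0" by (simp add: mult_le_0_iff)
  with nn[OF t] show ?thesis by simp
qed


text \<open>Energy estimate for the sum E of the squared norms. The constant 2 C card I arises by
  summing 2 |v_i| |v_j| \<le> |v_i|^2 + |v_j|^2 over all pairs.\<close>

lemma linear_ode_zero:
  fixes v :: "real \<Rightarrow> 'a \<Rightarrow> complex"
  assumes I: "finite I"
    and D: "\<And>t i. t \<in> {0..1} \<Longrightarrow> i \<in> I \<Longrightarrow>
      ((\<lambda>t. v t i) has_vector_derivative (\<Sum>j\<in>I. K t i j * v t j)) (at t within {0..1})"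
    and B: "\<And>t i j. t \<in> {0..1} \<Longrightarrow> i \<in> I \<Longrightarrow> j \<in> I \<Longrightarrow> norm (K t i j) \<le> B"
    and 0: "t0 \<in> {0..1}" "\<And>i. i \<in> I \<Longrightarrow> v t0 i = 0"
    and t: "t \<in> {0..1}" and i: "i \<in> I"
  shows "v t i = 0"
proof -
  define C where "C = max B 0"
  have C: "norm (K t i j) \<le> C" "0 \<le> C" if "t \<in> {0..1}" "i \<in> I" "j \<in> I" for t i j
    using B[OF that] by (auto simp: C_def)
  have C0: "0 \<le> C" by (simp add: C_def)
  let ?d = "\<lambda>t i. \<Sum>j\<in>I. K t i j * v t j"
  define E where "E t = (\<Sum>i\<in>I. v t i \<bullet> v t i)" for t
  define E' where "E' t = (\<Sum>i\<in>I. 2 * (v t i \<bullet> ?d t i))" for t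
  have sq: "2 * (norm (v t i) * norm (v t j)) \<le> v t i \<bullet> v t i + v t j \<bullet> v t j" for t i j
    using sum_squares_bound[of "norm (v t i)" "norm (v t j)"] by (simp add: power2_norm_eq_inner)
  have "E t = 0"
  proof (rule gronwall_zero[where E'=E' and c="2 * C * card I", OF _ _ _ 0(1) _ t])
    fix t :: real assume t: "t \<in> {0..1}"
    have "((\<lambda>t. v t i \<bullet> v t i) has_real_derivative 2 * (v t i \<bullet> ?d t i)) (at t within {0..1})" if "i \<in> I" for i
    proof -
      define w where "w = ?d t i"
      have d: "((\<lambda>t. v t i) has_derivative (\<lambda>h. h *\<^sub>R w)) (at t within {0..1})"
        using D[OF t that] unfolding has_vector_derivative_def w_def .
      have "(\<lambda>h. v t i \<bullet> (h *\<^sub>R w) + (h *\<^sub>R w) \<bullet> v t i) = (*) (2 * (v t i \<bullet> w))"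
        by (rule ext) (simp add: inner_commute[of w])
      with has_derivative_inner[OF d d] show ?thesis unfolding has_field_derivative_def w_def by simp
    qed
    then show "(E has_real_derivative E' t) (at t within {0..1})"
      unfolding E_def E'_def by (intro DERIV_sum)
    have "\<bar>E' t\<bar> \<le> (\<Sum>i\<in>I. \<bar>2 * (v t i \<bullet> ?d t i)\<bar>)" unfolding E'_def by (rule sum_abs)
    also have "\<dots> \<le> (\<Sum>i\<in>I. \<Sum>j\<in>I. C * (v t i \<bullet> v t i + v t j \<bullet> v t j))"
    proof (rule sum_mono)
      fix i assume i: "i \<in> I"
      have "\<bar>2 * (v t i \<bullet> ?d t i)\<bar> \<le> 2 * (norm (v t i) * norm (?d t i))"
        using Cauchy_Schwarz_ineq2[of "v t i" "?d t i"] by simp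
      also have "\<dots> \<le> 2 * (norm (v t i) * (\<Sum>j\<in>I. C * norm (v t j)))"
        using C(1)[OF t i] by (intro mult_left_mono order_trans[OF norm_sum] sum_mono)
          (auto simp: norm_mult intro!: mult_right_mono)
      also have "\<dots> = (\<Sum>j\<in>I. C * (2 * (norm (v t i) * norm (v t j))))"
        by (simp add: sum_distrib_left algebra_simps)
      also have "\<dots> \<le> (\<Sum>j\<in>I. C * (v t i \<bullet> v t i + v t j \<bullet> v t j))"
        by (intro sum_mono mult_left_mono sq C0)
      finally show "\<bar>2 * (v t i \<bullet> ?d t i)\<bar> \<le> (\<Sum>j\<in>I. C * (v t i \<bullet> v t i + v t j \<bullet> v t j))" .
    qed
    also have "\<dots> = 2 * C * card I * E t"
      by (simp add: E_def sum_distrib_left sum.distrib distrib_left algebra_simps)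
    finally show "\<bar>E' t\<bar> \<le> 2 * C * card I * E t" .
    show "0 \<le> E t" unfolding E_def by (intro sum_nonneg) simp
  next
    show "E t0 = 0" by (simp add: E_def 0(2))
  qed
  then have "v t i \<bullet> v t i = 0" unfolding E_def using I i by (subst (asm) sum_nonneg_eq_0_iff) auto
  then show ?thesis by simp
qed

lemma continuous_family_bounded:
  fixes K :: "real \<Rightarrow> 'a \<Rightarrow> 'a \<Rightarrow> complex"
  assumes I: "finite I"
    and cont: "\<And>i j. i \<in> I \<Longrightarrow> j \<in> I \<Longrightarrow> continuous_on {0..1} (\<lambda>t. K t i j)"
  shows "\<exists>B\<ge>0. \<forall>i\<in>I. \<forall>j\<in>I. \<forall>t\<in>{0..1}. norm (K t i j) \<le> B"
proof -
  have "\<exists>b. \<forall>t\<in>{0..1}. norm (K t i j) \<le> b" if "i \<in> I" "j \<in> I" for i j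
    using compact_imp_bounded[OF compact_continuous_image[OF cont[OF that] compact_Icc]] by (auto simp: bounded_iff)
  then obtain b where b: "\<And>i j t. i \<in> I \<Longrightarrow> j \<in> I \<Longrightarrow> t \<in> {0..1} \<Longrightarrow> norm (K t i j) \<le> b i j" by metis
  define B where "B = (\<Sum>i\<in>I. \<Sum>j\<in>I. \<bar>b i j\<bar>)"
  have B: "norm (K t i j) \<le> B" if "i \<in> I" "j \<in> I" "t \<in> {0..1}" for i j t
  proof -
    have "norm (K t i j) \<le> \<bar>b i j\<bar>" using b[OF that] by simp
    also have "\<dots> \<le> (\<Sum>j\<in>I. \<bar>b i j\<bar>)" using I that by (intro member_le_sum) auto
    also have "\<dots> \<le> B" unfolding B_def using I that by (intro member_le_sum[where f="\<lambda>i. \<Sum>j\<in>I. \<bar>b i j\<bar>"]) (auto intro: sum_nonneg)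
    finally show ?thesis .
  qed
  have B0: "0 \<le> B" unfolding B_def by (intro sum_nonneg) simp
  with B show ?thesis by blast
qed

text \<open>Picard iteration written as a series: y n is the n-th increment, bounded by V (M t)^n /
  n!, so the termwise derivatives converge uniformly on the unit interval.\<close>

lemma linear_ode_exists:
  fixes K :: "real \<Rightarrow> 'a \<Rightarrow> 'a \<Rightarrow> complex" and v0 :: "'a \<Rightarrow> complex"
  assumes I: "finite I"
    and cont: "\<And>i j. i \<in> I \<Longrightarrow> j \<in> I \<Longrightarrow> continuous_on {0..1} (\<lambda>t. K t i j)"
  shows "\<exists>v. (\<forall>i\<in>I. v 0 i = v0 i) \<and> (\<forall>t\<in>{0..1}. \<forall>i\<in>I.
      ((\<lambda>t. v t i) has_vector_derivative (\<Sum>j\<in>I. K t i j * v t j)) (at t within {0..1}))"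
proof -
  obtain B where B: "\<And>i j t. i \<in> I \<Longrightarrow> j \<in> I \<Longrightarrow> t \<in> {0..1} \<Longrightarrow> norm (K t i j) \<le> B" and B0: "0 \<le> B"
    using continuous_family_bounded[of I K, OF I cont] by blast
  define M where "M = B * card I"
  define V where "V = (\<Sum>i\<in>I. norm (v0 i))"
  have M0: "0 \<le> M" and V0: "0 \<le> V" using B0 by (auto simp: M_def V_def intro: sum_nonneg)
  define y where "y = rec_nat (\<lambda>t i. v0 i) (\<lambda>n f t i. integral {0..t} (\<lambda>s. \<Sum>j\<in>I. K s i j * f s j))"
  have y0: "y 0 t i = v0 i" and ySuc: "y (Suc n) t i = integral {0..t} (\<lambda>s. \<Sum>j\<in>I. K s i j * y n s j)" for n t i
    by (simp_all add: y_def)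
  define G where "G n t i = (\<Sum>j\<in>I. K t i j * y n t j)" for n t i
  have contG: "continuous_on {0..1} (\<lambda>t. G n t i)" if "i \<in> I" "\<And>j. j \<in> I \<Longrightarrow> continuous_on {0..1} (\<lambda>t. y n t j)" for n i
    unfolding G_def using that cont by (intro continuous_intros) auto
  have derG: "((\<lambda>t. y (Suc n) t i) has_vector_derivative G n t i) (at t within {0..1})"
    if "i \<in> I" "\<And>j. j \<in> I \<Longrightarrow> continuous_on {0..1} (\<lambda>t. y n t j)" "t \<in> {0..1}" for n i t
    using integral_has_vector_derivative[OF contG[OF that(1,2)] that(3)] by (simp add: ySuc G_def)
  have conty: "\<forall>i\<in>I. continuous_on {0..1} (\<lambda>t. y n t i)" for n
  proof (induction n)
    case 0
    show ?case by (simp add: y0)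
  next
    case (Suc n)
    show ?case
    proof
      fix i assume i: "i \<in> I"
      show "continuous_on {0..1} (\<lambda>t. y (Suc n) t i)"
        by (rule continuous_on_vector_derivative[OF derG[OF i]]) (use Suc in auto)
    qed
  qed
  have bound: "norm (y n t i) \<le> V * (M * t) ^ n / fact n" if "t \<in> {0..1}" "i \<in> I" for n t i
    using that
  proof (induction n arbitrary: t i)
    case 0
    then have "norm (v0 i) \<le> V" unfolding V_def using I by (intro member_le_sum[where f="\<lambda>i. norm (v0 i)"]) auto
    then show ?case by (simp add: y0)
  next
    case (Suc n)
    define h where "h s = V * M ^ Suc n * s ^ n / fact n" for s :: real
    have hi: "(h has_integral (V * M ^ Suc n * t ^ Suc n / fact (Suc n) - V * M ^ Suc n * 0 ^ Suc n / fact (Suc n))) {0..t}"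
    proof (rule fundamental_theorem_of_calculus)
      show "0 \<le> t" using Suc by simp
      fix s :: real
      have "((\<lambda>s. V * M ^ Suc n * s ^ Suc n / fact (Suc n)) has_real_derivative V * M ^ Suc n * (real (Suc n) * s ^ n) / fact (Suc n)) (at s within {0..t})"
        by (auto intro!: derivative_eq_intros simp del: power_Suc fact_Suc)
      moreover have "V * M ^ Suc n * (real (Suc n) * s ^ n) / fact (Suc n) = h s"
      proof -
        have "a * (r * b) / (r * f) = a * b / f" if "r \<noteq> 0" for a b r f :: real using that by simp
        from this[of "real (Suc n)" "V * M ^ Suc n" "s ^ n" "fact n"] show ?thesis
          unfolding h_def fact_Suc by simp
      qed
      ultimately show "((\<lambda>s. V * M ^ Suc n * s ^ Suc n / fact (Suc n)) has_vector_derivative h s) (at s within {0..t})"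
        by (simp add: has_real_derivative_iff_has_vector_derivative)
    qed
    have sub: "{0..t} \<subseteq> {0..1}" using Suc by auto
    have int: "(\<lambda>s. G n s i) integrable_on {0..t}"
      by (rule integrable_continuous_real, rule continuous_on_subset[OF contG[OF Suc.prems(2)] sub]) (use conty in auto)
    have "norm (y (Suc n) t i) \<le> integral {0..t} h"
      unfolding ySuc G_def[symmetric]
    proof (rule integral_norm_bound_integral[OF int])
      show "h integrable_on {0..t}" using hi by (rule has_integral_integrable)
      fix s assume s: "s \<in> {0..t}"
      then have s1: "s \<in> {0..1}" using sub by blast
      have "norm (G n s i) \<le> (\<Sum>j\<in>I. B * (V * (M * s) ^ n / fact n))"
        unfolding G_def
      proof (intro order_trans[OF norm_sum] sum_mono)
        fix j assume j: "j \<in> I"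
        show "norm (K s i j * y n s j) \<le> B * (V * (M * s) ^ n / fact n)"
          unfolding norm_mult by (rule mult_mono[OF B[OF Suc.prems(2) j s1] Suc.IH[OF s1 j] B0 norm_ge_zero])
      qed
      also have "\<dots> = h s" by (simp add: h_def M_def power_mult_distrib)
      finally show "norm (G n s i) \<le> h s" .
    qed
    also have "integral {0..t} h = V * (M * t) ^ Suc n / fact (Suc n)"
      using integral_unique[OF hi] by (simp add: power_mult_distrib mult.assoc)
    finally show ?case .
  qed
  have bound1: "norm (y n t i) \<le> V * M ^ n / fact n" if "t \<in> {0..1}" "i \<in> I" for n t i
  proof -
    have "(M * t) ^ n \<le> M ^ n" using that M0 by (intro power_mono) (auto simp: mult_left_le)
    then have "V * (M * t) ^ n / fact n \<le> V * M ^ n / fact n" using V0 by (intro divide_right_mono mult_left_mono) auto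
    with bound[OF that, of n] show ?thesis by linarith
  qed
  have sumV: "summable (\<lambda>n. V * M ^ n / fact n)"
    using summable_mult[OF summable_exp[of M], of V] by (simp add: field_simps)
  have sumy: "summable (\<lambda>n. y n t i)" if "t \<in> {0..1}" "i \<in> I" for t i
    by (rule summable_comparison_test'[OF sumV, of 0]) (use bound1[OF that] in auto)
  define v where "v t i = (\<Sum>n. y n t i)" for t i
  have vs: "(\<lambda>n. y n t i) sums v t i" if "t \<in> {0..1}" "i \<in> I" for t i
    unfolding v_def by (rule summable_sums[OF sumy[OF that]])
  \<comment> \<open>Termwise derivatives, shifted by one because y 0 is constant and y (Suc n) has
    derivative G n.\<close>
  define y' where "y' n t i = (case n of 0 \<Rightarrow> 0 | Suc k \<Rightarrow> G k t i)" for n t i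
  have y's: "(\<lambda>n. y' n t i) sums (\<Sum>j\<in>I. K t i j * v t j)" if "t \<in> {0..1}" "i \<in> I" for t i
  proof -
    have "(\<lambda>n. G n t i) sums (\<Sum>j\<in>I. K t i j * v t j)"
      unfolding G_def by (intro sums_sum sums_mult vs that)
    then have "(\<lambda>n. y' (Suc n) t i) sums (\<Sum>j\<in>I. K t i j * v t j)" by (simp add: y'_def)
    from sums_Suc[OF this] show ?thesis by (simp add: y'_def)
  qed
  have y'b: "norm (y' n t i) \<le> (case n of 0 \<Rightarrow> 0 | Suc k \<Rightarrow> M * (V * M ^ k / fact k))" if "t \<in> {0..1}" "i \<in> I" for n t i
  proof (cases n)
    case (Suc k)
    have "norm (G k t i) \<le> (\<Sum>j\<in>I. B * (V * M ^ k / fact k))"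
      unfolding G_def
    proof (intro order_trans[OF norm_sum] sum_mono)
      fix j assume j: "j \<in> I"
      show "norm (K t i j * y k t j) \<le> B * (V * M ^ k / fact k)"
        unfolding norm_mult by (rule mult_mono[OF B[OF that(2) j that(1)] bound1[OF that(1) j] B0 norm_ge_zero])
    qed
    then show ?thesis by (simp add: Suc y'_def M_def mult_ac)
  qed (simp add: y'_def)
  have sumb: "summable (\<lambda>n. case n of 0 \<Rightarrow> 0 | Suc k \<Rightarrow> M * (V * M ^ k / fact k))"
    using summable_mult[OF sumV, of M] by (subst summable_Suc_iff[symmetric]) simp
  have der: "((\<lambda>t. v t i) has_vector_derivative (\<Sum>j\<in>I. K t i j * v t j)) (at t within {0..1})"
    if t: "t \<in> {0..1}" and i: "i \<in> I" for t i
  proof -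
    have ul: "uniform_limit {0..1} (\<lambda>n t. \<Sum>k<n. y' k t i) (\<lambda>t. \<Sum>k. y' k t i) sequentially"
      by (rule Weierstrass_m_test[OF y'b[OF _ i] sumb])
    have "\<exists>g. \<forall>x\<in>{0..1}. (\<lambda>n. y n x i) sums g x \<and>
        (g has_derivative (\<lambda>h. h *\<^sub>R (\<Sum>j\<in>I. K x i j * v x j))) (at x within {0..1})"
    proof (rule has_derivative_series[where f="\<lambda>n x. y n x i" and f'="\<lambda>n x h. h *\<^sub>R y' n x i" and x=t and l="v t i"])
      show "t \<in> {0..1}" "(\<lambda>n. y n t i) sums v t i" using t vs[OF t i] by simp_all
      show "convex {0..1::real}" by simp
      show "((\<lambda>x. y n x i) has_derivative (\<lambda>h. h *\<^sub>R y' n x i)) (at x within {0..1})" if x: "x \<in> {0..1}" for n x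
      proof (cases n)
        case 0
        then show ?thesis by (simp add: y0 y'_def)
      next
        case (Suc k)
        then show ?thesis using derG[OF i _ x, of k] conty[of k] by (simp add: y'_def has_vector_derivative_def)
      qed
      fix e :: real assume "e > 0"
      then have "\<forall>\<^sub>F n in sequentially. \<forall>x\<in>{0..1}. dist (\<Sum>k<n. y' k x i) (\<Sum>k. y' k x i) < e"
        using ul unfolding uniform_limit_iff by blast
      then show "\<forall>\<^sub>F n in sequentially. \<forall>x\<in>{0..1}. \<forall>h. norm ((\<Sum>k<n. h *\<^sub>R y' k x i) - h *\<^sub>R (\<Sum>j\<in>I. K x i j * v x j)) \<le> e * norm h"
      proof (rule eventually_mono, intro ballI allI)
        fix n x h assume *: "\<forall>x\<in>{0..1}. dist (\<Sum>k<n. y' k x i) (\<Sum>k. y' k x i) < e" and x: "x \<in> {0..1::real}"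
        have "norm ((\<Sum>k<n. h *\<^sub>R y' k x i) - h *\<^sub>R (\<Sum>j\<in>I. K x i j * v x j)) = \<bar>h\<bar> * dist (\<Sum>k<n. y' k x i) (\<Sum>k. y' k x i)"
          unfolding sums_unique[OF y's[OF x i]] dist_norm by (simp flip: scaleR_sum_right scaleR_diff_right)
        also have "\<dots> \<le> \<bar>h\<bar> * e" using * x by (intro mult_left_mono) (auto intro: less_imp_le)
        finally show "norm ((\<Sum>k<n. h *\<^sub>R y' k x i) - h *\<^sub>R (\<Sum>j\<in>I. K x i j * v x j)) \<le> e * norm h" by (simp add: mult.commute)
      qed
    qed
    then obtain g where g: "\<And>x. x \<in> {0..1} \<Longrightarrow> (\<lambda>n. y n x i) sums g x"
      "\<And>x. x \<in> {0..1} \<Longrightarrow> (g has_vector_derivative (\<Sum>j\<in>I. K x i j * v x j)) (at x within {0..1})"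
      unfolding has_vector_derivative_def by blast
    have "v x i = g x" if "x \<in> {0..1}" for x using sums_unique2[OF vs[OF that i] g(1)[OF that]] .
    then show ?thesis using has_vector_derivative_transform[OF t _ g(2)[OF t], of "\<lambda>t. v t i"] by simp
  qed
  moreover have "v 0 i = v0 i" if "i \<in> I" for i
  proof -
    have "y n 0 i = 0" if "n \<notin> {0}" for n using that by (cases n) (auto simp: ySuc)
    then have "v 0 i = (\<Sum>n\<in>{0}. y n 0 i)" unfolding v_def by (intro suminf_finite) auto
    then show ?thesis by (simp add: y0)
  qed
  ultimately show ?thesis by blast
qed

section \<open>Germs of rational functions\<close>

text \<open>In contrast to \<open>regfun\<close>, equality with the fraction is required in the
  ambient space, so that f can be differentiated at p in every direction.\<close>

definition regat :: "complex^'n \<Rightarrow> (complex^'n \<Rightarrow> complex) \<Rightarrow> bool" where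
  "regat p f \<longleftrightarrow> (\<exists>a g. polyfun a \<and> polyfun g \<and> g p \<noteq> 0 \<and> (\<forall>x. g x \<noteq> 0 \<longrightarrow> f x = a x / g x))"

lemma regatI: "polyfun a \<Longrightarrow> polyfun g \<Longrightarrow> g p \<noteq> 0 \<Longrightarrow> (\<And>x. g x \<noteq> 0 \<Longrightarrow> f x = a x / g x) \<Longrightarrow> regat p f"
  unfolding regat_def by blast

lemma regat_polyfun: "polyfun f \<Longrightarrow> regat p f"
  by (rule regatI[of f "\<lambda>x. 1"]) (auto intro: polyfun.const)

lemma regat_add:
  assumes "regat p f" "regat p h" shows "regat p (\<lambda>x. f x + h x)"
proof -
  obtain a g b k where *: "polyfun a" "polyfun g" "g p \<noteq> 0" "\<And>x. g x \<noteq> 0 \<Longrightarrow> f x = a x / g x"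
    "polyfun b" "polyfun k" "k p \<noteq> 0" "\<And>x. k x \<noteq> 0 \<Longrightarrow> h x = b x / k x" using assms unfolding regat_def by blast
  show ?thesis
  proof (rule regatI[of "\<lambda>x. a x * k x + b x * g x" "\<lambda>x. g x * k x"])
    fix x assume "g x * k x \<noteq> 0"
    then show "f x + h x = (a x * k x + b x * g x) / (g x * k x)" using *(4,8)[of x] by (simp add: add_frac_eq)
  qed (use * in \<open>auto intro: polyfun.add polyfun.mult\<close>)
qed

lemma regat_mult:
  assumes "regat p f" "regat p h" shows "regat p (\<lambda>x. f x * h x)"
proof -
  obtain a g b k where *: "polyfun a" "polyfun g" "g p \<noteq> 0" "\<And>x. g x \<noteq> 0 \<Longrightarrow> f x = a x / g x"
    "polyfun b" "polyfun k" "k p \<noteq> 0" "\<And>x. k x \<noteq> 0 \<Longrightarrow> h x = b x / k x" using assms unfolding regat_def by blast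
  show ?thesis
    by (rule regatI[of "\<lambda>x. a x * b x" "\<lambda>x. g x * k x"]) (use * in \<open>auto intro: polyfun.mult\<close>)
qed

lemma regat_const: "regat p (\<lambda>x. c)" by (intro regat_polyfun polyfun.const)

lemma regat_uminus: "regat p f \<Longrightarrow> regat p (\<lambda>x. - f x)"
  using regat_mult[OF regat_const[of p "-1"]] by simp

lemma regat_diff: "regat p f \<Longrightarrow> regat p h \<Longrightarrow> regat p (\<lambda>x. f x - h x)"
  using regat_add[OF _ regat_uminus] by simp

lemma regat_sum: "(\<And>i. i \<in> I \<Longrightarrow> regat p (f i)) \<Longrightarrow> regat p (\<lambda>x. \<Sum>i\<in>I. f i x)"
  by (induction I rule: infinite_finite_induct) (auto intro: regat_const regat_add)

lemma regat_prod: "(\<And>i. i \<in> I \<Longrightarrow> regat p (f i)) \<Longrightarrow> regat p (\<lambda>x. \<Prod>i\<in>I. f i x)"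
  by (induction I rule: infinite_finite_induct) (auto intro: regat_const regat_mult)

lemma regat_divide:
  assumes "regat p f" "regat p h" "h p \<noteq> 0" shows "regat p (\<lambda>x. f x / h x)"
proof -
  obtain a g b k where *: "polyfun a" "polyfun g" "g p \<noteq> 0" "\<And>x. g x \<noteq> 0 \<Longrightarrow> f x = a x / g x"
    "polyfun b" "polyfun k" "k p \<noteq> 0" "\<And>x. k x \<noteq> 0 \<Longrightarrow> h x = b x / k x" using assms unfolding regat_def by blast
  have bp: "b p \<noteq> 0" using assms(3) *(8)[OF *(7)] by auto
  show ?thesis
  proof (rule regatI[of "\<lambda>x. a x * (k x * k x)" "\<lambda>x. g x * (b x * k x)"])
    fix x assume "g x * (b x * k x) \<noteq> 0"
    then show "f x / h x = a x * (k x * k x) / (g x * (b x * k x))" using *(4,8)[of x] by simp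
  qed (use * bp in \<open>auto intro: polyfun.mult\<close>)
qed

lemma regat_det: "(\<And>i j. regat p (\<lambda>x. A x $ i $ j)) \<Longrightarrow> regat p (\<lambda>x. det (A x))"
  unfolding det_def by (intro regat_sum regat_mult regat_const regat_prod)

section \<open>Derivatives of germs and their restriction to X\<close>

definition drv :: "(complex^'n \<Rightarrow> complex) \<Rightarrow> complex^'n \<Rightarrow> complex^'n \<Rightarrow> complex" where
  "drv f p = frechet_derivative f (at p)"

lemma polyfun_eventually_nonzero:
  assumes "polyfun g" "g p \<noteq> 0" shows "eventually (\<lambda>x. g x \<noteq> 0) (nhds p)"
proof -
  have "isCont g p" using polyfun_has_derivative[OF assms(1)] has_derivative_continuous by blast
  then have "g \<midarrow>p\<rightarrow> g p" by (simp add: isCont_def)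
  then have "eventually (\<lambda>x. g x \<noteq> 0) (at p)" using assms(2) by (rule tendsto_imp_eventually_ne)
  with assms(2) show ?thesis by (simp add: eventually_nhds_conv_at)
qed

lemma has_derivative_eventually_eq:
  assumes "(f has_derivative f') (at p)" "eventually (\<lambda>x. f x = g x) (nhds p)"
  shows "(g has_derivative f') (at p)"
  using has_derivative_transform_eventually[OF assms(1), of g]
    assms(2) eventually_nhds_x_imp_x[OF assms(2)] by (simp add: eventually_nhds_conv_at)

lemma regat_has_derivative:
  assumes "regat p f" shows "(f has_derivative drv f p) (at p)"
proof -
  obtain a g where *: "polyfun a" "polyfun g" "g p \<noteq> 0" "\<And>x. g x \<noteq> 0 \<Longrightarrow> f x = a x / g x"
    using assms unfolding regat_def by blast
  have "((\<lambda>x. a x / g x) has_derivative (\<lambda>h. - a p * (inverse (g p) * dd g p h * inverse (g p)) + dd a p h / g p)) (at p)"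
    by (rule has_derivative_divide[OF polyfun_has_derivative[OF *(1)] polyfun_has_derivative[OF *(2)] *(3)])
  moreover have "eventually (\<lambda>x. a x / g x = f x) (nhds p)"
    using polyfun_eventually_nonzero[OF *(2,3)] by eventually_elim (simp add: *(4))
  ultimately have "f differentiable (at p)" using has_derivative_eventually_eq unfolding differentiable_def by blast
  then show ?thesis by (simp add: drv_def frechet_derivative_works)
qed

lemma drvI: "(f has_derivative f') (at p) \<Longrightarrow> drv f p v = f' v"
  unfolding drv_def using frechet_derivative_at by metis

lemma drv_polyfun: "polyfun f \<Longrightarrow> drv f p v = dd f p v"
  by (rule drvI[OF polyfun_has_derivative])

lemma drv_const: "drv (\<lambda>x. c) p v = 0"
  by (rule drvI) simp

lemma drv_add: "regat p f \<Longrightarrow> regat p g \<Longrightarrow> drv (\<lambda>x. f x + g x) p v = drv f p v + drv g p v"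
  by (rule drvI[OF has_derivative_add[OF regat_has_derivative regat_has_derivative]])

lemma drv_diff: "regat p f \<Longrightarrow> regat p g \<Longrightarrow> drv (\<lambda>x. f x - g x) p v = drv f p v - drv g p v"
  by (rule drvI[OF has_derivative_diff[OF regat_has_derivative regat_has_derivative]])

lemma drv_mult: "regat p f \<Longrightarrow> regat p g \<Longrightarrow> drv (\<lambda>x. f x * g x) p v = f p * drv g p v + drv f p v * g p"
  by (rule drvI[OF has_derivative_mult[OF regat_has_derivative regat_has_derivative]])

lemma drv_cmult: "regat p f \<Longrightarrow> drv (\<lambda>x. c * f x) p v = c * drv f p v"
  by (simp add: drv_mult regat_const drv_const)

lemma drv_sum: "(\<And>i. i \<in> I \<Longrightarrow> regat p (f i)) \<Longrightarrow> drv (\<lambda>x. \<Sum>i\<in>I. f i x) p v = (\<Sum>i\<in>I. drv (f i) p v)"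
proof (induction I rule: infinite_finite_induct)
  case (insert i I)
  then show ?case by (simp add: drv_add regat_sum)
qed (simp_all add: drv_const)

lemma drv_cong:
  assumes "regat p f" "eventually (\<lambda>x. f x = g x) (nhds p)" shows "drv g p v = drv f p v"
  by (rule drvI[OF has_derivative_eventually_eq[OF regat_has_derivative[OF assms(1)] assms(2)]])

text \<open>Clearing the denominator gives a polynomial a that vanishes on X by density; since f
  vanishes at p, the differential of a at p is that of f times g p.\<close>

lemma drv_vanishing:
  assumes X: "affine_variety X" and p: "p \<in> regular_locus X" and f: "regat p f"
    and h: "polyfun h" "h p \<noteq> 0" and 0: "\<And>x. x \<in> regular_locus X \<Longrightarrow> h x \<noteq> 0 \<Longrightarrow> f x = 0"
    and v: "v \<in> tangent_space X p"
  shows "drv f p v = 0"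
proof -
  have pX: "p \<in> X" using p regular_locus_subset by blast
  obtain a g where *: "polyfun a" "polyfun g" "g p \<noteq> 0" "\<And>x. g x \<noteq> 0 \<Longrightarrow> f x = a x / g x"
    using f unfolding regat_def by blast
  have aX: "a x = 0" if "x \<in> X" for x
  proof (rule regular_locus_dense[where f=a and h="\<lambda>x. g x * h x", OF X p *(1) polyfun.mult[OF *(2) h(1)] pX _ _ that])
    show "g p * h p \<noteq> 0" using * h by simp
    fix y assume y: "y \<in> regular_locus X" "g y * h y \<noteq> 0"
    then have "f y = 0" "g y \<noteq> 0" using 0 by auto
    then show "a y = 0" using *(4)[of y] by simp
  qed
  then have "a \<in> vanishing X" using *(1) by (simp add: vanishing_def)
  then have da: "dd a p v = 0" using v by (simp add: tangent_space_iff)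
  have f0: "f p = 0" using 0[OF p h(2)] .
  have "drv a p v = drv (\<lambda>x. f x * g x) p v"
  proof (rule drv_cong[OF regat_mult[OF f regat_polyfun[OF *(2)]]])
    show "eventually (\<lambda>x. f x * g x = a x) (nhds p)"
      using polyfun_eventually_nonzero[OF *(2,3)] by eventually_elim (simp add: *(4))
  qed
  also have "\<dots> = drv f p v * g p" by (simp add: drv_mult[OF f regat_polyfun[OF *(2)]] f0)
  finally show ?thesis using da *(3) drv_polyfun[OF *(1)] by simp
qed

text \<open>Entry (i, j) of the inverse matrix by Cramer's rule: an explicit quotient, hence a germ
  wherever the entries of H are germs and the determinant is nonzero.\<close>

definition inv_entry :: "complex^'n^'n \<Rightarrow> 'n \<Rightarrow> 'n \<Rightarrow> complex" where
  "inv_entry H i j = det (\<chi> k l. if l = i then (if k = j then 1 else 0) else H $ k $ l) / det H"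

lemma inv_entry_right:
  assumes "det H \<noteq> 0" shows "H *v (\<chi> i. inv_entry H i j) = axis j 1"
proof -
  have "(\<chi> i. inv_entry H i j) = (\<chi> k. det (\<chi> i l. if l = k then axis j 1 $ i else H $ i $ l) / det H)"
    by (simp add: inv_entry_def axis_def vec_eq_iff cong: if_cong)
  then show ?thesis using cramer[OF assms, of "\<chi> i. inv_entry H i j" "axis j 1"] by simp
qed

lemma inv_entry_left:
  assumes "det H \<noteq> 0" shows "(\<Sum>j\<in>UNIV. inv_entry H i j * H $ j $ k) = (if i = k then 1 else 0)"
proof -
  let ?B = "\<chi> i j. inv_entry H i j"
  have "H ** ?B = mat 1"
  proof (simp add: vec_eq_iff, intro allI)
    fix k j
    have "(H ** ?B) $ k $ j = (H *v (\<chi> i. inv_entry H i j)) $ k"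
      by (simp add: matrix_matrix_mult_def matrix_vector_mult_def)
    also have "\<dots> = mat 1 $ k $ j" by (simp add: inv_entry_right[OF assms] axis_def mat_def)
    finally show "(H ** ?B) $ k $ j = mat 1 $ k $ j" .
  qed
  then have "?B ** H = mat 1" by (simp add: matrix_left_right_inverse)
  then have "(?B ** H) $ i $ k = mat 1 $ i $ k" by simp
  then show ?thesis by (simp add: matrix_matrix_mult_def mat_def)
qed

lemma regat_inv_entry:
  assumes "\<And>i j. regat p (\<lambda>x. H x $ i $ j)" "det (H p) \<noteq> 0"
  shows "regat p (\<lambda>x. inv_entry (H x) i j)"
  unfolding inv_entry_def
proof (intro regat_divide regat_det assms)
  fix k l show "regat p (\<lambda>x. (\<chi> k l. if l = i then (if k = j then 1 else 0) else H x $ k $ l) $ k $ l)"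
    by (cases "l = i") (simp_all add: assms regat_const)
qed

text \<open>A 1-form vanishing on the tangent spaces of \<open>X\<close> is locally a combination of differentials of
  equations of \<open>X\<close>, up to forms with coefficients vanishing on \<open>X\<close>; so its exterior derivative
  vanishes on pairs of tangent vectors.\<close>

lemma vanishing_one_form_closed:
  fixes X :: "(complex^'n) set"
  assumes X: "affine_variety X" and p: "p \<in> regular_locus X" and \<theta>: "\<And>i. regat p (\<theta> i)"
    and h: "polyfun h" "h p \<noteq> 0"
    and 0: "\<And>x v. x \<in> regular_locus X \<Longrightarrow> h x \<noteq> 0 \<Longrightarrow> v \<in> tangent_space X x \<Longrightarrow> (\<Sum>i\<in>UNIV. \<theta> i x * v $ i) = 0"
    and u: "u \<in> tangent_space X p" and v: "v \<in> tangent_space X p"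
  shows "(\<Sum>i\<in>UNIV. drv (\<theta> i) p u * v $ i) = (\<Sum>i\<in>UNIV. drv (\<theta> i) p v * u $ i)"
proof -
  have pX: "p \<in> X" using p regular_locus_subset by blast
  obtain J :: "'n set" where J: "card J = vec.dim (tangent_space X p)" by (rule exists_index_set)
  obtain F H0 where F: "\<And>i. F i \<in> vanishing X" "invertible (frame J F H0 p)" by (rule tangent_frame[OF J]) blast
  let ?H = "frame J F H0"
  have pF: "polyfun (F i)" for i using F(1) by (simp add: vanishing_def)
  have dH: "det (?H p) \<noteq> 0" using F(2) by (simp add: invertible_det_nz)
  have pH: "polyfun (\<lambda>x. ?H x $ i $ j)" for i j by (rule polyfun_frame[where F=F, OF F(1)])
  have rH: "regat p (\<lambda>x. ?H x $ i $ j)" for i j by (rule regat_polyfun[OF pH])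
  have pdH: "polyfun (\<lambda>x. det (?H x))" by (rule polyfun_det[OF pH])
  define w where "w j x = (\<chi> i. inv_entry (?H x) i j)" for j x
  have wT: "w j x \<in> tangent_space X x" if x: "x \<in> regular_locus X" "det (?H x) \<noteq> 0" and j: "j \<in> J" for x j
  proof -
    have "x \<in> X" using x regular_locus_subset by blast
    then have "card J \<le> vec.dim (tangent_space X x)" using J regular_tangent_dim_minimal[OF X p] by simp
    moreover have "invertible (?H x)" using x(2) by (simp add: invertible_det_nz)
    ultimately have "tangent_space X x = ker_rows J (?H x)"
      using tangent_space_eq_ker_rows[where F=F, OF F(1)] by blast
    then show ?thesis using j inv_entry_right[OF x(2), of j] by (auto simp: ker_rows_def w_def axis_def)
  qed
  \<comment> \<open>Coefficients of \<theta> in the coframe formed by the rows of the frame; b j is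
    \<theta> applied to the field w j, which is tangent to X for j in J.\<close>
  define b where "b j x = (\<Sum>i\<in>UNIV. \<theta> i x * inv_entry (?H x) i j)" for j x
  have rb: "regat p (b j)" for j unfolding b_def by (intro regat_sum regat_mult \<theta> regat_inv_entry rH dH)
  have \<theta>_eq: "\<theta> i x = (\<Sum>j\<in>UNIV. b j x * ?H x $ j $ i)" if "det (?H x) \<noteq> 0" for i x
  proof -
    have "(\<Sum>j\<in>UNIV. b j x * ?H x $ j $ i) = (\<Sum>k\<in>UNIV. \<theta> k x * (\<Sum>j\<in>UNIV. inv_entry (?H x) k j * ?H x $ j $ i))"
      unfolding b_def sum_distrib_right sum_distrib_left by (subst sum.swap) (simp add: mult.assoc)
    also have "\<dots> = \<theta> i x"
      by (simp add: inv_entry_left[OF that] if_distrib[where f="\<lambda>z. _ * z"] cong: if_cong)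
    finally show ?thesis by simp
  qed
  have drv\<theta>: "drv (\<theta> i) p s = (\<Sum>j\<in>UNIV. b j p * dd (\<lambda>x. ?H x $ j $ i) p s + drv (b j) p s * ?H p $ j $ i)" for i s
  proof -
    have "drv (\<theta> i) p s = drv (\<lambda>x. \<Sum>j\<in>UNIV. b j x * ?H x $ j $ i) p s"
    proof (rule drv_cong)
      show "regat p (\<lambda>x. \<Sum>j\<in>UNIV. b j x * ?H x $ j $ i)" by (intro regat_sum regat_mult rb rH)
      show "eventually (\<lambda>x. (\<Sum>j\<in>UNIV. b j x * ?H x $ j $ i) = \<theta> i x) (nhds p)"
        using polyfun_eventually_nonzero[OF pdH dH] by eventually_elim (simp add: \<theta>_eq)
    qed
    then show ?thesis by (simp add: drv_sum drv_mult rb rH regat_mult drv_polyfun[OF pH])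
  qed
  have db: "drv (b j) p s = 0" if j: "j \<in> J" and s: "s \<in> tangent_space X p" for j s
  proof (rule drv_vanishing[OF X p rb polyfun.mult[OF h(1) pdH] _ _ s])
    show "h p * det (?H p) \<noteq> 0" using h(2) dH by simp
    fix x assume "x \<in> regular_locus X" "h x * det (?H x) \<noteq> 0"
    then show "b j x = 0" using 0[of x "w j x"] wT[of x j] j by (simp add: b_def w_def)
  qed
  \<comment> \<open>For j in J the row is constant and the tangential derivative of b j vanishes;
    for the other j the row annihilates r and its derivative is a Hessian. What remains is symmetric
    in s and r.\<close>
  have main: "(\<Sum>i\<in>UNIV. drv (\<theta> i) p s * r $ i) = (\<Sum>j\<in>- J. b j p * dd (\<lambda>x. dd (F j) x r) p s)"
    if s: "s \<in> tangent_space X p" and r: "r \<in> tangent_space X p" for s r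
  proof -
    have "(\<Sum>i\<in>UNIV. drv (\<theta> i) p s * r $ i)
        = (\<Sum>j\<in>UNIV. b j p * (\<Sum>i\<in>UNIV. dd (\<lambda>x. ?H x $ j $ i) p s * r $ i) + drv (b j) p s * (?H p *v r) $ j)"
      unfolding drv\<theta> sum_distrib_right
      by (subst sum.swap) (simp add: matrix_vector_mult_def sum.distrib sum_distrib_left distrib_right mult.assoc)
    also have "\<dots> = (\<Sum>j\<in>UNIV. if j \<in> - J then b j p * dd (\<lambda>x. dd (F j) x r) p s else 0)"
    proof (rule sum.cong)
      fix j
      show "b j p * (\<Sum>i\<in>UNIV. dd (\<lambda>x. ?H x $ j $ i) p s * r $ i) + drv (b j) p s * (?H p *v r) $ j =
          (if j \<in> - J then b j p * dd (\<lambda>x. dd (F j) x r) p s else 0)"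
      proof (cases "j \<in> J")
        case True
        then show ?thesis using db[OF True s] by (simp add: frame_def)
      next
        case False
        have "(?H p *v r) $ j = 0" using False r F(1)[of j] by (simp add: frame_mult tangent_space_iff)
        moreover have "dd (\<lambda>x. dd (F j) x r) p s = (\<Sum>i\<in>UNIV. dd (\<lambda>x. ?H x $ j $ i) p s * r $ i)"
        proof -
          have "dd (\<lambda>x. dd (F j) x r) p s = dd (\<lambda>x. \<Sum>i\<in>UNIV. r $ i * pd i (F j) x) p s" by (simp add: dd_def[of "F j"])
          also have "\<dots> = (\<Sum>i\<in>UNIV. r $ i * dd (pd i (F j)) p s)"
            by (subst dd_sum) (auto intro!: polyfun.mult polyfun.const polyfun_pd pF simp: dd_cmult polyfun_pd pF)
          finally show ?thesis using False by (simp add: frame_def gradv_def mult.commute)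
        qed
        ultimately show ?thesis using False by simp
      qed
    qed simp
    also have "\<dots> = (\<Sum>j\<in>- J. b j p * dd (\<lambda>x. dd (F j) x r) p s)"
      by (subst sum.inter_restrict[symmetric]) auto
    finally show ?thesis .
  qed
  show ?thesis unfolding main[OF u v] main[OF v u]
    by (intro sum.cong refl) (simp add: dd_commute[OF pF])
qed


section \<open>Lie derivatives of rational forms\<close>

lemma rational_form_bilinear:
  "rational_form a g x (u + u') v = rational_form a g x u v + rational_form a g x u' v"
  "rational_form a g x u (v + v') = rational_form a g x u v + rational_form a g x u v'"
  "rational_form a g x (c *s u) v = c * rational_form a g x u v"
  "rational_form a g x u (c *s v) = c * rational_form a g x u v"
  by (simp_all add: rational_form_def algebra_simps sum.distrib sum_distrib_left sum_subtractf)

lemma rational_form_swap: "rational_form a g x u v = - rational_form a g x v u"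
  by (simp add: rational_form_def algebra_simps flip: sum_negf)

lemma rational_form_sum_left: "rational_form a g x (\<Sum>i\<in>I. c i *s u i) v = (\<Sum>i\<in>I. c i * rational_form a g x (u i) v)"
proof (induction I rule: infinite_finite_induct)
  case empty
  then show ?case using rational_form_bilinear(3)[of a g x 0 0 v] by simp
next
  case (infinite I)
  then show ?case using rational_form_bilinear(3)[of a g x 0 0 v] by simp
qed (simp add: rational_form_bilinear)

lemma vec_basis_expansion: "(\<Sum>i\<in>UNIV. v $ i *s axis i 1) = (v :: complex^'n)"
  by (simp add: vec_eq_iff axis_def if_distrib[where f="\<lambda>z. _ * z"] cong: if_cong)

lemma rational_form_expand_left: "rational_form a g x u v = (\<Sum>i\<in>UNIV. u $ i * rational_form a g x (axis i 1) v)"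
  using rational_form_sum_left[of a g x "\<lambda>i. u $ i" "\<lambda>i. axis i 1" UNIV v] by (simp add: vec_basis_expansion)

lemma rational_form_expand_right: "rational_form a g x u v = (\<Sum>i\<in>UNIV. rational_form a g x u (axis i 1) * v $ i)"
  using rational_form_expand_left[of a g x v u] rational_form_swap[of a g x u] by (simp add: sum_negf[symmetric] mult.commute)

lemma regat_rational_form:
  assumes a: "\<And>i j. polyfun (a i j)" and g: "polyfun g" "g p \<noteq> 0"
    and u: "\<And>i. regat p (\<lambda>x. u x $ i)" and v: "\<And>i. regat p (\<lambda>x. v x $ i)"
  shows "regat p (\<lambda>x. rational_form a g x (u x) (v x))"
  unfolding rational_form_def
  by (intro regat_sum regat_mult regat_diff regat_divide regat_polyfun a g u v)

lemma regat_rational_form_const: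
  assumes "\<And>i j. polyfun (a i j)" "polyfun g" "g p \<noteq> 0"
  shows "regat p (\<lambda>x. rational_form a g x u v)"
  by (rule regat_rational_form[OF assms]) (auto intro: regat_const)

lemma drv_rational_form_left:
  assumes a: "\<And>i j. polyfun (a i j)" and g: "polyfun g" "g p \<noteq> 0" and V: "\<And>i. polyfun (\<lambda>x. V x $ i)"
  shows "drv (\<lambda>x. rational_form a g x (V x) v) p s
    = drv (\<lambda>x. rational_form a g x (V p) v) p s + rational_form a g p (\<chi> i. dd (\<lambda>x. V x $ i) p s) v"
proof -
  have r: "regat p (\<lambda>x. rational_form a g x (axis i 1) v)" for i by (rule regat_rational_form_const[OF a g])
  have V': "regat p (\<lambda>x. V x $ i)" for i by (rule regat_polyfun[OF V])
  have "drv (\<lambda>x. rational_form a g x (V x) v) p s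
      = (\<Sum>i\<in>UNIV. V p $ i * drv (\<lambda>x. rational_form a g x (axis i 1) v) p s + dd (\<lambda>x. V x $ i) p s * rational_form a g p (axis i 1) v)"
    by (subst rational_form_expand_left) (simp add: drv_sum drv_mult r V' regat_mult drv_polyfun[OF V])
  also have "\<dots> = (\<Sum>i\<in>UNIV. V p $ i * drv (\<lambda>x. rational_form a g x (axis i 1) v) p s)
      + (\<Sum>i\<in>UNIV. dd (\<lambda>x. V x $ i) p s * rational_form a g p (axis i 1) v)" by (rule sum.distrib)
  also have "(\<Sum>i\<in>UNIV. V p $ i * drv (\<lambda>x. rational_form a g x (axis i 1) v) p s) = drv (\<lambda>x. rational_form a g x (V p) v) p s"
    by (subst (2) rational_form_expand_left) (simp add: drv_sum drv_cmult r regat_mult regat_const)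
  also have "(\<Sum>i\<in>UNIV. dd (\<lambda>x. V x $ i) p s * rational_form a g p (axis i 1) v) = rational_form a g p (\<chi> i. dd (\<lambda>x. V x $ i) p s) v"
    by (subst (2) rational_form_expand_left) simp
  finally show ?thesis .
qed

text \<open>The Lie derivative of \<Omega> along V in ambient coordinates, evaluated on constant
  fields u and v: the coefficients are differentiated along V, and the Jacobian of V is inserted
  into each slot.\<close>

definition lie :: "'n two_form \<Rightarrow> (complex^'n \<Rightarrow> complex^'n) \<Rightarrow> complex^'n::finite \<Rightarrow> complex^'n \<Rightarrow> complex^'n \<Rightarrow> complex" where
  "lie \<Omega> V p u v = drv (\<lambda>x. \<Omega> x u v) p (V p) + \<Omega> p (\<chi> i. dd (\<lambda>x. V x $ i) p u) v + \<Omega> p u (\<chi> i. dd (\<lambda>x. V x $ i) p v)"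

text \<open>The contraction of V with the exterior derivative is assumed to vanish only on the given
  u and v at p, because closedness is known on tangent vectors of X alone.\<close>

lemma cartan:
  assumes a: "\<And>i j. polyfun (a i j)" and g: "polyfun g" "g p \<noteq> 0" and V: "\<And>i. polyfun (\<lambda>x. V x $ i)"
    and closed: "ext_deriv (rational_form a g) p (V p) u v = 0"
  shows "lie (rational_form a g) V p u v
    = drv (\<lambda>x. rational_form a g x (V x) v) p u - drv (\<lambda>x. rational_form a g x (V x) u) p v"
proof -
  have "drv (\<lambda>x. rational_form a g x u v) p (V p)
      = drv (\<lambda>x. rational_form a g x (V p) v) p u - drv (\<lambda>x. rational_form a g x (V p) u) p v"
    using closed by (simp add: ext_deriv_def drv_def algebra_simps)
  then show ?thesis
    using rational_form_swap[of a g p u "\<chi> i. dd (\<lambda>x. V x $ i) p v"]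
    by (simp add: lie_def drv_rational_form_left[OF a g V])
qed

lemma has_vector_derivative_mult_complex:
  fixes f g :: "real \<Rightarrow> complex"
  assumes "(f has_vector_derivative f') (at t within S)" "(g has_vector_derivative g') (at t within S)"
  shows "((\<lambda>t. f t * g t) has_vector_derivative f t * g' + f' * g t) (at t within S)"
  using has_vector_derivative_mult[OF assms] by simp

lemma drv_double_sum:
  assumes "\<And>i j. regat p (f i j)"
  shows "drv (\<lambda>x. \<Sum>i\<in>A. \<Sum>j\<in>B. f i j x * c i j) p v = (\<Sum>i\<in>A. \<Sum>j\<in>B. drv (f i j) p v * c i j)"
  using assms by (simp add: drv_sum drv_mult regat_const regat_mult regat_sum drv_const)

lemma form_along_curve:
  fixes \<gamma> u v :: "real \<Rightarrow> complex^'n"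
  assumes a: "\<And>i j. polyfun (a i j)" and g: "polyfun g" "g (\<gamma> t) \<noteq> 0"
    and \<gamma>: "(\<gamma> has_vector_derivative \<gamma>') (at t within S)"
    and u: "\<And>i. ((\<lambda>t. u t $ i) has_vector_derivative u' $ i) (at t within S)"
    and v: "\<And>i. ((\<lambda>t. v t $ i) has_vector_derivative v' $ i) (at t within S)"
  shows "((\<lambda>t. rational_form a g (\<gamma> t) (u t) (v t)) has_vector_derivative
    drv (\<lambda>x. rational_form a g x (u t) (v t)) (\<gamma> t) \<gamma>' + rational_form a g (\<gamma> t) u' (v t) + rational_form a g (\<gamma> t) (u t) v')
    (at t within S)"
proof -
  let ?q = "\<gamma> t"
  have r: "regat ?q (\<lambda>x. a i j x / g x)" for i j by (intro regat_divide regat_polyfun a g)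
  have f: "((\<lambda>t. a i j (\<gamma> t) / g (\<gamma> t)) has_vector_derivative drv (\<lambda>x. a i j x / g x) ?q \<gamma>') (at t within S)" for i j
    using vector_derivative_diff_chain_within[OF \<gamma>, of "\<lambda>x. a i j x / g x" "drv (\<lambda>x. a i j x / g x) ?q"]
      has_derivative_at_withinI[OF regat_has_derivative[OF r[of i j]]] by (simp add: o_def)
  have "((\<lambda>t. rational_form a g (\<gamma> t) (u t) (v t)) has_vector_derivative
     (\<Sum>i\<in>UNIV. \<Sum>j\<in>UNIV. (a i j ?q / g ?q) * ((u t $ i * v' $ j + u' $ i * v t $ j) - (u t $ j * v' $ i + u' $ j * v t $ i))
        + drv (\<lambda>x. a i j x / g x) ?q \<gamma>' * (u t $ i * v t $ j - u t $ j * v t $ i))) (at t within S)"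
    unfolding rational_form_def
    by (intro has_vector_derivative_sum has_vector_derivative_mult_complex f has_vector_derivative_diff u v)
  moreover have "drv (\<lambda>x. rational_form a g x (u t) (v t)) ?q \<gamma>'
      = (\<Sum>i\<in>UNIV. \<Sum>j\<in>UNIV. drv (\<lambda>x. a i j x / g x) ?q \<gamma>' * (u t $ i * v t $ j - u t $ j * v t $ i))"
    unfolding rational_form_def by (rule drv_double_sum[OF r])
  ultimately show ?thesis
    by (simp add: rational_form_def sum.distrib[symmetric] algebra_simps sum_subtractf[symmetric])
qed

section \<open>Polynomial self-maps\<close>

lemma has_vector_derivative_eventually_eq:
  assumes "(f has_vector_derivative f') (at t)" "eventually (\<lambda>s. f s = g s) (nhds t)"
  shows "(g has_vector_derivative f') (at t)"
  using has_derivative_transform_eventually[OF assms(1)[unfolded has_vector_derivative_def], of g]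
    assms(2) eventually_nhds_x_imp_x[OF assms(2)]
  by (simp add: eventually_nhds_conv_at has_vector_derivative_def)

lemma has_vector_derivative_vecI:
  fixes \<gamma> :: "real \<Rightarrow> complex^'n"
  assumes "\<And>i. ((\<lambda>t. \<gamma> t $ i) has_vector_derivative \<gamma>' $ i) F"
  shows "(\<gamma> has_vector_derivative \<gamma>') F"
proof -
  have "((\<lambda>t. \<gamma> t $ i) has_derivative (\<lambda>h. (h *\<^sub>R \<gamma>') $ i)) F" for i
    using assms[of i] unfolding has_vector_derivative_def by simp
  then have D: "((\<lambda>t. (\<gamma> t $ i) \<bullet> b) has_derivative (\<lambda>h. ((h *\<^sub>R \<gamma>') $ i) \<bullet> b)) F" for i b
    by (rule has_derivative_inner_left)
  have 1: "((\<lambda>t. \<Sum>i\<in>Basis. (\<gamma> t \<bullet> i) *\<^sub>R i) has_derivative (\<lambda>h. \<Sum>i\<in>Basis. ((h *\<^sub>R \<gamma>') \<bullet> i) *\<^sub>R i)) F"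
    by (intro has_derivative_sum has_derivative_scaleR_left) (use D in \<open>auto simp: Basis_vec_def inner_axis\<close>)
  show ?thesis unfolding has_vector_derivative_def using 1 by (simp only: euclidean_representation)
qed

lemma polyfun_along_curve:
  assumes "polyfun f" "(\<gamma> has_vector_derivative \<gamma>') (at t within A)"
  shows "((\<lambda>t. f (\<gamma> t)) has_vector_derivative dd f (\<gamma> t) \<gamma>') (at t within A)"
  using vector_derivative_diff_chain_within[OF assms(2), of f "dd f (\<gamma> t)"]
    has_derivative_at_withinI[OF polyfun_has_derivative[OF assms(1)]] by (simp add: o_def)

definition pmap :: "(complex^'n \<Rightarrow> complex^'n) \<Rightarrow> bool" where
  "pmap F \<longleftrightarrow> (\<forall>i. polyfun (\<lambda>x. F x $ i))"

definition jac :: "(complex^'n \<Rightarrow> complex^'n) \<Rightarrow> complex^'n \<Rightarrow> complex^'n \<Rightarrow> complex^'n" where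
  "jac F x v = (\<chi> i. dd (\<lambda>x. F x $ i) x v)"

lemma pmapD: "pmap F \<Longrightarrow> polyfun (\<lambda>x. F x $ i)" by (simp add: pmap_def)

lemma pmap_compose: "pmap F \<Longrightarrow> pmap G \<Longrightarrow> pmap (\<lambda>x. F (G x))"
  unfolding pmap_def using polyfun_compose by blast

lemma jac_compose:
  assumes "pmap F" "pmap G" shows "jac (\<lambda>x. F (G x)) x v = jac F (G x) (jac G x v)"
  using dd_compose[of "\<lambda>x. F x $ i" G x v for i, OF pmapD[OF assms(1)] pmapD[OF assms(2)]]
  by (simp add: jac_def vec_eq_iff)

lemma dd_compose_pmap: "polyfun f \<Longrightarrow> pmap F \<Longrightarrow> dd (\<lambda>x. f (F x)) x v = dd f (F x) (jac F x v)"
  by (simp add: jac_def dd_compose pmapD)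

lemma differential_jac:
  assumes "pmap F" "\<And>x. x \<in> X \<Longrightarrow> F x = f x" "v \<in> tangent_space X x"
  shows "differential X f x v = jac F x v"
proof -
  have "differential X f x v = frechet_derivative F (at x) v"
    by (rule differential_eq) (use assms pmapD in auto)
  also have "\<dots> = (\<chi> i. frechet_derivative (\<lambda>x. F x $ i) (at x) v)"
    using frechet_derivative_at[OF polymap_has_derivative[of F x], OF pmapD[OF assms(1)]] by metis
  also have "\<dots> = jac F x v" by (simp add: jac_def vec_eq_iff polyfun_frechet[OF pmapD[OF assms(1)]])
  finally show ?thesis .
qed

lemma jac_cong:
  assumes "pmap F" "pmap G" "\<And>x. x \<in> X \<Longrightarrow> F x = G x" "v \<in> tangent_space X x"
  shows "jac F x v = jac G x v"
  unfolding jac_def vec_eq_iff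
  using vanishing_pointwise_dd[OF pmapD[OF assms(1)] pmapD[OF assms(2)] _ assms(4)] assms(3) by simp

lemma pmap_id: "pmap (\<lambda>x. x)" by (simp add: pmap_def polyfun.coord)
lemma jac_id: "jac (\<lambda>x. x) x v = v" by (simp add: jac_def vec_eq_iff)

lemma jac_tangent:
  assumes F: "pmap F" "\<And>x. x \<in> X \<Longrightarrow> F x \<in> X" and v: "v \<in> tangent_space X x"
  shows "jac F x v \<in> tangent_space X (F x)"
  unfolding tangent_space_iff
proof
  fix f assume f: "f \<in> vanishing X"
  then have pf: "polyfun f" by (simp add: vanishing_def)
  have "(\<lambda>x. f (F x)) \<in> vanishing X"
    using f F polyfun_compose[OF pf pmapD[OF F(1)]] by (simp add: vanishing_def)
  then show "dd f (F x) (jac F x v) = 0" using v dd_compose_pmap[OF pf F(1), of x v] by (simp add: tangent_space_iff)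
qed

lemma jac_add: "jac F x (u + v) = jac F x u + jac F x v"
  and jac_scale: "jac F x (c *s v) = c *s jac F x v"
  by (simp_all add: jac_def vec_eq_iff dd_vadd dd_vscale)

lemma jac_sum: "jac F x (\<Sum>i\<in>I. c i *s v i) = (\<Sum>i\<in>I. c i *s jac F x (v i))"
proof (induction I rule: infinite_finite_induct)
  case (insert i I)
  then show ?case by (simp add: jac_add jac_scale)
qed (simp_all add: jac_def vec_eq_iff)

lemma jac_left_inverse:
  assumes "pmap F" "pmap G" "\<And>x. x \<in> X \<Longrightarrow> G (F x) = x" "v \<in> tangent_space X x"
  shows "jac G (F x) (jac F x v) = v"
  using jac_cong[OF pmap_compose[OF assms(2,1)] pmap_id, OF assms(3,4)] jac_compose[OF assms(2,1)] by (simp add: jac_id)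

text \<open>The Jacobian of F has a left inverse on tangent spaces, and the same holds for G; the
  two inequalities between tangent dimensions give equality.\<close>

lemma automorphism_regular_locus:
  assumes F: "pmap F" "\<And>x. x \<in> X \<Longrightarrow> F x \<in> X" and G: "pmap G" "\<And>x. x \<in> X \<Longrightarrow> G x \<in> X"
    and inv: "\<And>x. x \<in> X \<Longrightarrow> G (F x) = x" "\<And>x. x \<in> X \<Longrightarrow> F (G x) = x" and x: "x \<in> regular_locus X"
  shows "F x \<in> regular_locus X"
proof -
  have dim_le: "vec.dim (tangent_space X x) \<le> vec.dim (tangent_space X (F x))"
    if F: "pmap F" "\<And>x. x \<in> X \<Longrightarrow> F x \<in> X" and G: "pmap G" "\<And>x. x \<in> X \<Longrightarrow> G (F x) = x" for F G x
  proof -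
    have "inj_on (jac F x) (tangent_space X x)"
      by (rule inj_on_inverseI[of _ "jac G (F x)"]) (rule jac_left_inverse[OF F(1) G])
    then have "inj_on (jac F x) (vec.span (tangent_space X x))"
      by (simp add: vec.span_eq_iff[THEN iffD2, OF tangent_space_subspace])
    moreover have "Vector_Spaces.linear (*s) (*s) (jac F x)"
      by unfold_locales (simp_all add: jac_add jac_scale)
    ultimately have "vec.dim (jac F x ` tangent_space X x) = vec.dim (tangent_space X x)" by (intro vec.dim_image_eq)
    moreover have "jac F x ` tangent_space X x \<subseteq> tangent_space X (F x)" using jac_tangent[OF F] by blast
    ultimately show ?thesis using vec.dim_subset by metis
  qed
  have xX: "x \<in> X" using x regular_locus_subset by blast
  have "vec.dim (tangent_space X (F x)) \<le> vec.dim (tangent_space X (G (F x)))" by (rule dim_le[OF G F(1) inv(2)])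
  then have "vec.dim (tangent_space X (F x)) = vec.dim (tangent_space X x)"
    using dim_le[OF F G(1) inv(1), of x] inv(1)[OF xX] by simp
  then show ?thesis using x F(2)[OF xX] by (simp add: regular_locus_def)
qed


section \<open>Closed 2-forms on the regular locus\<close>

text \<open>Asks for one closed local expression at each point, where \<open>d_closed\<close> speaks
  of all of them; this existential form passes directly to linear combinations.\<close>

definition closed_two_form :: "(complex^'n::finite) set \<Rightarrow> 'n two_form \<Rightarrow> bool" where
  "closed_two_form X \<eta> \<longleftrightarrow> (\<forall>x\<in>regular_locus X. \<exists>a g. local_expression X \<eta> x a g \<and>
     (\<forall>u\<in>tangent_space X x. \<forall>v\<in>tangent_space X x. \<forall>w\<in>tangent_space X x. ext_deriv (rational_form a g) x u v w = 0))"

lemma symplectic_closed: "symplectic_form X \<omega> \<Longrightarrow> closed_two_form X \<omega>"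
  unfolding symplectic_form_def closed_two_form_def regular_two_form_def d_closed_def by meson

lemma local_expressionD:
  assumes "local_expression X \<eta> x a g"
  shows "polyfun (a i j)" "polyfun g" "g x \<noteq> 0"
    "y \<in> regular_locus X \<Longrightarrow> g y \<noteq> 0 \<Longrightarrow> u \<in> tangent_space X y \<Longrightarrow> v \<in> tangent_space X y \<Longrightarrow> \<eta> y u v = rational_form a g y u v"
  using assms by (auto simp: local_expression_def)

lemma closed_two_form_comb:
  assumes "closed_two_form X \<omega>" "closed_two_form X \<omega>'"
  shows "closed_two_form X (\<lambda>x u v. c * \<omega> x u v + d * \<omega>' x u v)"
  unfolding closed_two_form_def
proof
  fix x assume x: "x \<in> regular_locus X"
  obtain a g where a: "local_expression X \<omega> x a g"
    "\<And>u v w. u \<in> tangent_space X x \<Longrightarrow> v \<in> tangent_space X x \<Longrightarrow> w \<in> tangent_space X x \<Longrightarrow> ext_deriv (rational_form a g) x u v w = 0"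
    using assms(1) x unfolding closed_two_form_def by blast
  obtain b k where b: "local_expression X \<omega>' x b k"
    "\<And>u v w. u \<in> tangent_space X x \<Longrightarrow> v \<in> tangent_space X x \<Longrightarrow> w \<in> tangent_space X x \<Longrightarrow> ext_deriv (rational_form b k) x u v w = 0"
    using assms(2) x unfolding closed_two_form_def by blast
  note aD = local_expressionD[OF a(1)] and bD = local_expressionD[OF b(1)]
  define A where "A i j x = c * (a i j x * k x) + d * (b i j x * g x)" for i j x
  define G where "G x = g x * k x" for x
  have AG: "rational_form A G y u v = c * rational_form a g y u v + d * rational_form b k y u v"
    if "g y \<noteq> 0" "k y \<noteq> 0" for y u v
  proof -
    have "A i j y / G y = c * (a i j y / g y) + d * (b i j y / k y)" for i j
      using that by (simp add: A_def G_def field_simps)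
    then show ?thesis
      by (simp add: rational_form_def sum_distrib_left sum.distrib[symmetric] algebra_simps)
  qed
  have drv: "drv (\<lambda>y. rational_form A G y u v) x w
      = c * drv (\<lambda>y. rational_form a g y u v) x w + d * drv (\<lambda>y. rational_form b k y u v) x w" for u v w
  proof -
    have r: "regat x (\<lambda>y. rational_form a g y u v)" "regat x (\<lambda>y. rational_form b k y u v)"
      using regat_rational_form_const[OF aD(1-3)] regat_rational_form_const[OF bD(1-3)] by auto
    have "drv (\<lambda>y. rational_form A G y u v) x w = drv (\<lambda>y. c * rational_form a g y u v + d * rational_form b k y u v) x w"
    proof (rule drv_cong)
      show "regat x (\<lambda>y. c * rational_form a g y u v + d * rational_form b k y u v)"
        by (intro regat_add regat_mult regat_const r)
      show "eventually (\<lambda>y. c * rational_form a g y u v + d * rational_form b k y u v = rational_form A G y u v) (nhds x)"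
        using polyfun_eventually_nonzero[OF aD(2,3)] polyfun_eventually_nonzero[OF bD(2,3)]
        by eventually_elim (simp add: AG)
    qed
    then show ?thesis by (simp add: drv_add drv_cmult r regat_mult regat_const)
  qed
  have loc: "local_expression X (\<lambda>x u v. c * \<omega> x u v + d * \<omega>' x u v) x A G"
    unfolding local_expression_def
  proof (intro conjI allI ballI impI)
    show "polyfun (A i j)" for i j
      unfolding A_def by (intro polyfun.add polyfun.mult polyfun.const aD bD)
    show "polyfun G" unfolding G_def by (intro polyfun.mult aD bD)
    show "G x \<noteq> 0" using aD(3) bD(3) by (simp add: G_def)
    fix y u v assume y: "y \<in> regular_locus X" "G y \<noteq> 0" "u \<in> tangent_space X y" "v \<in> tangent_space X y"
    then have "g y \<noteq> 0" "k y \<noteq> 0" by (auto simp: G_def)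
    then show "c * \<omega> y u v + d * \<omega>' y u v = rational_form A G y u v"
      using aD(4) bD(4) y by (simp add: AG)
  qed
  have "ext_deriv (rational_form A G) x u v w = 0"
    if "u \<in> tangent_space X x" "v \<in> tangent_space X x" "w \<in> tangent_space X x" for u v w
  proof -
    have "ext_deriv (rational_form A G) x u v w = c * ext_deriv (rational_form a g) x u v w + d * ext_deriv (rational_form b k) x u v w"
      unfolding ext_deriv_def drv_def[symmetric] drv by (simp add: algebra_simps)
    then show ?thesis using a(2)[OF that] b(2)[OF that] by simp
  qed
  with loc show "\<exists>a g. local_expression X (\<lambda>x u v. c * \<omega> x u v + d * \<omega>' x u v) x a g \<and>
     (\<forall>u\<in>tangent_space X x. \<forall>v\<in>tangent_space X x. \<forall>w\<in>tangent_space X x. ext_deriv (rational_form a g) x u v w = 0)" by blast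
qed

text \<open>J fixes the common dimension of the tangent spaces at regular points: their bases and
  the Gram matrices are indexed by it. C and N are the expansion from
  \<open>action_coordinates\<close>.\<close>

locale moser = cone X \<sigma> p q for X :: "(complex^'n::finite) set" and \<sigma> p q +
  fixes C :: "'n \<Rightarrow> int \<Rightarrow> complex^'n \<Rightarrow> complex" and N :: nat and J :: "'n set"
    and \<omega> \<omega>' :: "'n two_form" and l :: int
  assumes C_hom: "\<And>i j. hom j (C i j)"
    and C_exp: "\<And>t x i. t \<noteq> 0 \<Longrightarrow> x \<in> X \<Longrightarrow> \<sigma> t x $ i = (\<Sum>j = - int N..int N. t powi j * C i j x)"
    and cardJ: "card J = vec.dim (tangent_space X q)"
    and symp: "symplectic_form X \<omega>" "symplectic_form X \<omega>'"
    and weight: "form_weight X \<sigma> \<omega> l" "form_weight X \<sigma> \<omega>' l" and l0: "l \<noteq> 0"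
begin

abbreviation T where "T x \<equiv> tangent_space X x"
abbreviation R where "R \<equiv> regular_locus X"

text \<open>A polynomial map of the ambient space agreeing with \<open>\<sigma> t\<close> on X, so
  that its Jacobian is available.\<close>

definition S :: "complex \<Rightarrow> complex^'n \<Rightarrow> complex^'n" where
  "S t x = (\<chi> i. \<Sum>j = - int N..int N. t powi j * C i j x)"

text \<open>The derivative of \<open>S t\<close> at t = 1; a function of weight j is an
  eigenfunction with eigenvalue j (\<open>euler\<close>).\<close>

definition E :: "complex^'n \<Rightarrow> complex^'n" where
  "E x = (\<chi> i. \<Sum>j = - int N..int N. of_int j * C i j x)"

lemma C_poly: "polyfun (C i j)" by (rule hom_polyfun[OF C_hom])
lemma S_pmap: "pmap (S t)"
  unfolding pmap_def S_def by (auto intro!: polyfun_sum polyfun.mult polyfun.const C_poly)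
lemma E_pmap: "pmap E"
  unfolding pmap_def E_def by (auto intro!: polyfun_sum polyfun.mult polyfun.const C_poly)
lemma S_eq: "t \<noteq> 0 \<Longrightarrow> x \<in> X \<Longrightarrow> S t x = \<sigma> t x" by (simp add: S_def vec_eq_iff C_exp)
lemma S_in: "t \<noteq> 0 \<Longrightarrow> x \<in> X \<Longrightarrow> S t x \<in> X" by (simp add: S_eq \<sigma>_in)
lemma S_one: "x \<in> X \<Longrightarrow> S 1 x = x" by (simp add: S_eq \<sigma>_one)
lemma S_mult: "s \<noteq> 0 \<Longrightarrow> t \<noteq> 0 \<Longrightarrow> x \<in> X \<Longrightarrow> S s (S t x) = S (s * t) x"
  by (simp add: S_eq \<sigma>_in \<sigma>_mult)
lemma S_inv: "t \<noteq> 0 \<Longrightarrow> x \<in> X \<Longrightarrow> S (inverse t) (S t x) = x" by (simp add: S_mult S_one)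
lemma S_reg: "t \<noteq> 0 \<Longrightarrow> x \<in> R \<Longrightarrow> S t x \<in> R"
proof (rule automorphism_regular_locus[OF S_pmap _ S_pmap[of "inverse t"]])
  assume t: "t \<noteq> 0"
  then show "S t (S (inverse t) x) = x" if "x \<in> X" for x using S_inv[of "inverse t" x] that by simp
qed (simp_all add: S_in S_inv)

lemma jac_S_tangent: "t \<noteq> 0 \<Longrightarrow> v \<in> T x \<Longrightarrow> jac (S t) x v \<in> T (S t x)"
  by (rule jac_tangent[OF S_pmap S_in])

lemma jac_S_inv: "t \<noteq> 0 \<Longrightarrow> v \<in> T x \<Longrightarrow> jac (S (inverse t)) (S t x) (jac (S t) x v) = v"
  by (rule jac_left_inverse[OF S_pmap S_pmap S_inv])

lemma jac_S_surj:
  assumes "t \<noteq> 0" "x \<in> X" "w \<in> T (S t x)"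
  obtains v where "v \<in> T x" "w = jac (S t) x v"
proof (rule that)
  have "jac (S (inverse t)) (S t x) w \<in> T (S (inverse t) (S t x))"
    using assms by (intro jac_S_tangent) auto
  then show "jac (S (inverse t)) (S t x) w \<in> T x" using assms by (simp add: S_inv)
  have "jac (S (inverse (inverse t))) (S (inverse t) (S t x)) (jac (S (inverse t)) (S t x) w) = w"
    using assms by (intro jac_S_inv) auto
  then show "w = jac (S t) x (jac (S (inverse t)) (S t x) w)" using assms by (simp add: S_inv)
qed

section \<open>Weights of forms and Lie derivatives along the Euler field\<close>

definition wt :: "'n two_form \<Rightarrow> bool" where
  "wt \<eta> \<longleftrightarrow> (\<forall>t x u v. t \<noteq> 0 \<longrightarrow> x \<in> R \<longrightarrow> u \<in> T x \<longrightarrow> v \<in> T x \<longrightarrow>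
     \<eta> (S t x) (jac (S t) x u) (jac (S t) x v) = t powi l * \<eta> x u v)"

lemma form_weight_wt: assumes "form_weight X \<sigma> \<eta> l" shows "wt \<eta>"
  unfolding wt_def
proof (intro allI impI)
  fix t :: complex and x u v assume t: "t \<noteq> 0" and x: "x \<in> R" and u: "u \<in> T x" and v: "v \<in> T x"
  have "pullback X (\<sigma> t) \<eta> x u v = t powi l * \<eta> x u v"
    using assms t x u v unfolding form_weight_def form_eq_def by blast
  then show "\<eta> (S t x) (jac (S t) x u) (jac (S t) x v) = t powi l * \<eta> x u v"
    using differential_jac[OF S_pmap S_eq[OF t] u] differential_jac[OF S_pmap S_eq[OF t] v] S_eq[OF t reg_in[OF x]]
    by (simp add: pullback_def)
qed

lemma wt_comb: "wt \<eta> \<Longrightarrow> wt \<eta>' \<Longrightarrow> wt (\<lambda>x u v. c * \<eta> x u v + d * \<eta>' x u v)"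
  by (simp add: wt_def algebra_simps)

lemma powi_derivative: "((\<lambda>t. complex_of_real t powi j) has_vector_derivative of_int j) (at 1)"
proof -
  have "((\<lambda>z::complex. z powi j) has_field_derivative of_int j) (at (of_real 1))"
    by (auto intro!: derivative_eq_intros)
  from has_vector_derivative_real_field[OF this] show ?thesis by simp
qed

lemma laurent_derivative:
  "((\<lambda>t. \<Sum>j = - int N..int N. complex_of_real t powi j * c j) has_vector_derivative (\<Sum>j = - int N..int N. of_int j * c j)) (at 1)"
  using powi_derivative has_vector_derivative_mult_complex[OF powi_derivative has_vector_derivative_const]
  by (intro has_vector_derivative_sum) simp

lemma S_derivative: "((\<lambda>t. S (complex_of_real t) x) has_vector_derivative E x) (at 1)"
proof -
  have "((\<lambda>t. S (complex_of_real t) x $ i) has_vector_derivative E x $ i) (at 1)" for i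
    unfolding S_def E_def using laurent_derivative[of "\<lambda>j. C i j x"] by simp
  then show ?thesis by (rule has_vector_derivative_vecI)
qed

lemma eventually_pos_1: "eventually (\<lambda>t::real. complex_of_real t \<noteq> 0) (nhds 1)"
proof -
  have "eventually (\<lambda>t::real. t \<in> {0<..}) (nhds 1)" by (rule eventually_nhds_in_open) auto
  then show ?thesis by eventually_elim auto
qed

lemma derivative_along_S:
  assumes "polyfun f"
  shows "((\<lambda>t. f (S (complex_of_real t) x)) has_vector_derivative dd f (S 1 x) (E x)) (at 1)"
  using polyfun_along_curve[OF assms S_derivative] by simp

lemma euler:
  assumes f: "hom j f" and x: "x \<in> X" shows "dd f x (E x) = of_int j * f x"
proof -
  have "((\<lambda>t. f (S (complex_of_real t) x)) has_vector_derivative dd f x (E x)) (at 1)"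
    using derivative_along_S[OF hom_polyfun[OF f], of x] S_one[OF x] by simp
  moreover have "((\<lambda>t. f (S (complex_of_real t) x)) has_vector_derivative of_int j * f x) (at 1)"
  proof -
    have "((\<lambda>t. complex_of_real t powi j * f x) has_vector_derivative of_int j * f x) (at 1)"
      using has_vector_derivative_mult_complex[OF powi_derivative has_vector_derivative_const, of j "f x"] by simp
    moreover have "eventually (\<lambda>t. complex_of_real t powi j * f x = f (S (complex_of_real t) x)) (nhds 1)"
      using eventually_pos_1 by eventually_elim (simp add: S_eq[OF _ x] homD[OF f x])
    ultimately show ?thesis by (rule has_vector_derivative_eventually_eq)
  qed
  ultimately show ?thesis by (rule vector_derivative_unique_at)
qed

lemma E_tangent: assumes x: "x \<in> X" shows "E x \<in> T x"
  unfolding tangent_space_iff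
proof
  fix f assume f: "f \<in> vanishing X"
  then have "polyfun f" by (simp add: vanishing_def)
  then have "hom 0 f" using f by (simp add: hom_def vanishing_def \<sigma>_in)
  from euler[OF this x] show "dd f x (E x) = 0" by simp
qed

text \<open>The multiplicative group is commutative, so its infinitesimal generator is invariant;
  here this is read off from Euler's relation for the weight components C i j.\<close>

lemma E_invariant: assumes t: "t \<noteq> 0" and x: "x \<in> X" shows "jac (S t) x (E x) = E (S t x)"
proof -
  have "dd (\<lambda>x. \<Sum>j = - int N..int N. t powi j * C i j x) x (E x) = (\<Sum>j = - int N..int N. of_int j * C i j (S t x))" for i
  proof -
    have "dd (\<lambda>x. \<Sum>j = - int N..int N. t powi j * C i j x) x (E x) = (\<Sum>j = - int N..int N. t powi j * dd (C i j) x (E x))"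
      by (subst dd_sum) (auto intro!: polyfun.mult polyfun.const C_poly simp: dd_cmult C_poly)
    then show ?thesis by (simp add: euler[OF C_hom x] S_eq[OF t x] homD[OF C_hom x t] mult.left_commute)
  qed
  then show ?thesis by (simp add: jac_def S_def E_def vec_eq_iff)
qed

text \<open>Differentiate the weight identity of \<eta> at t = 1 along real t, once as a power of t
  and once through the local expression.\<close>

lemma weight_lie:
  assumes \<eta>: "wt \<eta>" and loc: "local_expression X \<eta> x a g" and x: "x \<in> R" and u: "u \<in> T x" and v: "v \<in> T x"
  shows "lie (rational_form a g) E x u v = of_int l * \<eta> x u v"
proof -
  note D = local_expressionD[OF loc]
  have xX: "x \<in> X" by (rule reg_in[OF x])
  let ?S = "\<lambda>t::real. S (complex_of_real t)"
  have jacS: "((\<lambda>t. jac (?S t) x w $ i) has_vector_derivative jac E x w $ i) (at 1)" for w i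
  proof -
    have 1: "jac (?S t) x w $ i = (\<Sum>j = - int N..int N. complex_of_real t powi j * dd (C i j) x w)" for t
      unfolding jac_def S_def by (simp, subst dd_sum) (auto intro!: polyfun.mult polyfun.const C_poly simp: dd_cmult C_poly)
    have 2: "jac E x w $ i = (\<Sum>j = - int N..int N. of_int j * dd (C i j) x w)"
      unfolding jac_def E_def by (simp, subst dd_sum) (auto intro!: polyfun.mult polyfun.const C_poly simp: dd_cmult C_poly)
    show ?thesis unfolding 1 2 by (rule laurent_derivative)
  qed
  have j1: "jac (S 1) x w = w" if "w \<in> T x" for w
    using jac_cong[OF S_pmap pmap_id S_one that] by (simp add: jac_id)
  have lie_eq: "lie (rational_form a g) E x u v = drv (\<lambda>y. rational_form a g y u v) x (E x)
      + rational_form a g x (jac E x u) v + rational_form a g x u (jac E x v)" by (simp add: lie_def jac_def)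
  have "((\<lambda>t. rational_form a g (?S t x) (jac (?S t) x u) (jac (?S t) x v)) has_vector_derivative
      drv (\<lambda>y. rational_form a g y (jac (?S 1) x u) (jac (?S 1) x v)) (?S 1 x) (E x)
      + rational_form a g (?S 1 x) (jac E x u) (jac (?S 1) x v) + rational_form a g (?S 1 x) (jac (?S 1) x u) (jac E x v)) (at 1)"
    by (rule form_along_curve[OF D(1,2) _ S_derivative jacS jacS]) (simp add: S_one[OF xX] D(3))
  then have "((\<lambda>t. rational_form a g (?S t x) (jac (?S t) x u) (jac (?S t) x v)) has_vector_derivative lie (rational_form a g) E x u v) (at 1)"
    by (simp add: S_one[OF xX] j1 u v lie_eq)
  moreover have "((\<lambda>t. rational_form a g (?S t x) (jac (?S t) x u) (jac (?S t) x v)) has_vector_derivative of_int l * \<eta> x u v) (at 1)"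
  proof -
    have 1: "((\<lambda>t. complex_of_real t powi l * \<eta> x u v) has_vector_derivative of_int l * \<eta> x u v) (at 1)"
      using has_vector_derivative_mult_complex[OF powi_derivative has_vector_derivative_const, of l "\<eta> x u v"] by simp
    have "((\<lambda>t. g (?S t x)) \<longlongrightarrow> g (?S 1 x)) (at 1)"
      using has_vector_derivative_continuous[OF derivative_along_S[OF D(2)]] by (simp add: isCont_def)
    then have "eventually (\<lambda>t. g (?S t x) \<noteq> 0) (at 1)"
      by (rule tendsto_imp_eventually_ne) (simp add: S_one[OF xX] D(3))
    then have "eventually (\<lambda>t. g (?S t x) \<noteq> 0) (nhds 1)"
      by (simp add: eventually_nhds_conv_at S_one[OF xX] D(3))
    then have 2: "eventually (\<lambda>t. complex_of_real t powi l * \<eta> x u v = rational_form a g (?S t x) (jac (?S t) x u) (jac (?S t) x v)) (nhds 1)"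
      using eventually_pos_1
    proof eventually_elim
      case (elim t)
      have "\<eta> (?S t x) (jac (?S t) x u) (jac (?S t) x v) = rational_form a g (?S t x) (jac (?S t) x u) (jac (?S t) x v)"
        by (rule D(4)[OF S_reg[OF elim(2) x] elim(1) jac_S_tangent[OF elim(2) u] jac_S_tangent[OF elim(2) v]])
      moreover have "\<eta> (?S t x) (jac (?S t) x u) (jac (?S t) x v) = complex_of_real t powi l * \<eta> x u v"
        using \<eta> elim(2) x u v unfolding wt_def by blast
      ultimately show ?case by simp
    qed
    show ?thesis by (rule has_vector_derivative_eventually_eq[OF 1 2])
  qed
  ultimately show ?thesis by (rule vector_derivative_unique_at)
qed

text \<open>Moser's equation: if \<open>\<iota>\<^sub>V \<eta> = c \<iota>\<^sub>E \<delta>\<close>, then \<open>L\<^sub>V \<eta> = d \<iota>\<^sub>V \<eta> = c d \<iota>\<^sub>E \<delta> = c L\<^sub>E \<delta> = c l \<delta>\<close>.\<close>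

lemma moser_lie:
  assumes \<eta>: "local_expression X \<eta> x a g" "\<And>u v w. u \<in> T x \<Longrightarrow> v \<in> T x \<Longrightarrow> w \<in> T x \<Longrightarrow> ext_deriv (rational_form a g) x u v w = 0"
    and \<delta>: "wt \<delta>" "local_expression X \<delta> x b k" "\<And>u v w. u \<in> T x \<Longrightarrow> v \<in> T x \<Longrightarrow> w \<in> T x \<Longrightarrow> ext_deriv (rational_form b k) x u v w = 0"
    and V: "pmap V" "\<And>y. y \<in> X \<Longrightarrow> V y \<in> T y"
    and eq: "\<And>y v. y \<in> R \<Longrightarrow> v \<in> T y \<Longrightarrow> \<eta> y (V y) v = c * \<delta> y (E y) v"
    and x: "x \<in> R" and u: "u \<in> T x" and v: "v \<in> T x"
  shows "lie (rational_form a g) V x u v = c * of_int l * \<delta> x u v"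
proof -
  note aD = local_expressionD[OF \<eta>(1)] and bD = local_expressionD[OF \<delta>(2)]
  have xX: "x \<in> X" by (rule reg_in[OF x])
  let ?A = "\<lambda>w y. rational_form a g y (V y) w" and ?B = "\<lambda>w y. rational_form b k y (E y) w"
  have rA: "regat x (?A w)" for w
    by (rule regat_rational_form[OF aD(1-3)]) (auto intro: regat_const regat_polyfun pmapD[OF V(1)])
  have rB: "regat x (?B w)" for w
    by (rule regat_rational_form[OF bD(1-3)]) (auto intro: regat_const regat_polyfun pmapD[OF E_pmap])
  define \<theta> where "\<theta> i y = ?A (axis i 1) y - c * ?B (axis i 1) y" for i y
  have r\<theta>: "regat x (\<theta> i)" for i unfolding \<theta>_def by (intro regat_diff regat_mult regat_const rA rB)
  have expand: "(\<Sum>i\<in>UNIV. \<theta> i y * w $ i) = ?A w y - c * ?B w y" for y w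
    using rational_form_expand_right[of a g y "V y" w] rational_form_expand_right[of b k y "E y" w]
    by (simp add: \<theta>_def left_diff_distrib sum_subtractf sum_distrib_left mult.assoc)
  have drv_expand: "(\<Sum>i\<in>UNIV. drv (\<theta> i) x s * w $ i) = drv (?A w) x s - c * drv (?B w) x s" for s w
  proof -
    have "(\<Sum>i\<in>UNIV. drv (\<theta> i) x s * w $ i) = drv (\<lambda>y. \<Sum>i\<in>UNIV. \<theta> i y * w $ i) x s"
      by (simp add: drv_sum drv_mult r\<theta> regat_const regat_mult drv_const)
    also have "\<dots> = drv (?A w) x s - c * drv (?B w) x s"
      unfolding expand by (simp add: drv_diff drv_cmult rA rB regat_mult regat_const)
    finally show ?thesis .
  qed
  have "(\<Sum>i\<in>UNIV. drv (\<theta> i) x u * v $ i) = (\<Sum>i\<in>UNIV. drv (\<theta> i) x v * u $ i)"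
  proof (rule vanishing_one_form_closed[OF affX x r\<theta> polyfun.mult[OF aD(2) bD(2)] _ _ u v])
    show "g x * k x \<noteq> 0" using aD(3) bD(3) by simp
    fix y w assume y: "y \<in> R" "g y * k y \<noteq> 0" "w \<in> T y"
    then have nz: "g y \<noteq> 0" "k y \<noteq> 0" by auto
    have yX: "y \<in> X" by (rule reg_in[OF y(1)])
    show "(\<Sum>i\<in>UNIV. \<theta> i y * w $ i) = 0"
      unfolding expand using eq[OF y(1,3)] aD(4)[OF y(1) nz(1) V(2)[OF yX] y(3)] bD(4)[OF y(1) nz(2) E_tangent[OF yX] y(3)] by simp
  qed
  then have "drv (?A v) x u - drv (?A u) x v = c * (drv (?B v) x u - drv (?B u) x v)"
    unfolding drv_expand by (simp add: algebra_simps)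
  moreover have "lie (rational_form a g) V x u v = drv (?A v) x u - drv (?A u) x v"
    by (rule cartan[OF aD(1-3) pmapD[OF V(1)] \<eta>(2)[OF V(2)[OF xX] u v]])
  moreover have "lie (rational_form b k) E x u v = drv (?B v) x u - drv (?B u) x v"
    by (rule cartan[OF bD(1-3) pmapD[OF E_pmap] \<delta>(3)[OF E_tangent[OF xX] u v]])
  moreover have "lie (rational_form b k) E x u v = of_int l * \<delta> x u v" by (rule weight_lie[OF \<delta>(1,2) x u v])
  ultimately show ?thesis by simp
qed

end

section \<open>Gram matrices\<close>

text \<open>Padding by the identity outside J turns the Gram matrix of a basis indexed by J into a
  square matrix over the whole index type, with the same determinant.\<close>

definition gram_mat :: "'n set \<Rightarrow> (complex^'n \<Rightarrow> complex^'n \<Rightarrow> complex) \<Rightarrow> ('n \<Rightarrow> complex^'n) \<Rightarrow> complex^'n^'n" where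
  "gram_mat J B Q = (\<chi> j k. if j \<in> J \<and> k \<in> J then B (Q j) (Q k) else if j = k then 1 else 0)"

definition tbasis :: "'n set \<Rightarrow> (complex^'n) set \<Rightarrow> ('n \<Rightarrow> complex^'n) \<Rightarrow> bool" where
  "tbasis J V Q \<longleftrightarrow> (\<forall>j\<in>J. Q j \<in> V) \<and> (\<forall>v\<in>V. \<exists>c. v = (\<Sum>j\<in>J. c j *s Q j)) \<and>
     (\<forall>c. (\<Sum>j\<in>J. c j *s Q j) = 0 \<longrightarrow> (\<forall>j\<in>J. c j = 0))"

definition altform :: "(complex^'n) set \<Rightarrow> (complex^'n \<Rightarrow> complex^'n \<Rightarrow> complex) \<Rightarrow> bool" where
  "altform V B \<longleftrightarrow> (\<forall>u\<in>V. \<forall>u'\<in>V. \<forall>v\<in>V. \<forall>c. B (u + u') v = B u v + B u' v \<and> B (c *s u) v = c * B u v \<and> B u v = - B v u)"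

lemma altform_swap: "altform V B \<Longrightarrow> u \<in> V \<Longrightarrow> v \<in> V \<Longrightarrow> B u v = - B v u"
  and altform_add: "altform V B \<Longrightarrow> u \<in> V \<Longrightarrow> u' \<in> V \<Longrightarrow> v \<in> V \<Longrightarrow> B (u + u') v = B u v + B u' v"
  and altform_scale: "altform V B \<Longrightarrow> u \<in> V \<Longrightarrow> v \<in> V \<Longrightarrow> B (c *s u) v = c * B u v"
  unfolding altform_def by blast+

lemma altform_sum_left:
  assumes V: "vec.subspace V" and B: "altform V B" and Q: "\<And>j. j \<in> I \<Longrightarrow> Q j \<in> V" and v: "v \<in> V"
  shows "B (\<Sum>j\<in>I. c j *s Q j) v = (\<Sum>j\<in>I. c j * B (Q j) v)"
  using Q
proof (induction I rule: infinite_finite_induct)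
  case (insert i I)
  have "Q i \<in> V" "(\<Sum>j\<in>I. c j *s Q j) \<in> V" "c i *s Q i \<in> V"
    using insert.prems V by (auto intro!: vec.subspace_sum vec.subspace_scale)
  then show ?case using insert by (simp add: altform_add[OF B _ _ v] altform_scale[OF B _ v])
next
  case empty
  have "B (0 *s 0) v = 0 * B 0 v" using B v vec.subspace_0[OF V] unfolding altform_def by blast
  then show ?case by simp
next
  case (infinite I)
  have "B (0 *s 0) v = 0 * B 0 v" using B v vec.subspace_0[OF V] unfolding altform_def by blast
  with infinite show ?case by simp
qed

lemma altform_sum_right:
  assumes "vec.subspace V" "altform V B" "\<And>j. j \<in> I \<Longrightarrow> Q j \<in> V" "v \<in> V"
  shows "B v (\<Sum>j\<in>I. c j *s Q j) = (\<Sum>j\<in>I. c j * B v (Q j))"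
proof -
  have "(\<Sum>j\<in>I. c j *s Q j) \<in> V" using assms by (auto intro!: vec.subspace_sum vec.subspace_scale)
  then have "B v (\<Sum>j\<in>I. c j *s Q j) = - B (\<Sum>j\<in>I. c j *s Q j) v" using altform_swap[OF assms(2) assms(4)] by simp
  also have "\<dots> = (\<Sum>j\<in>I. c j * - B (Q j) v)" by (simp add: altform_sum_left[OF assms] sum_negf)
  also have "\<dots> = (\<Sum>j\<in>I. c j * B v (Q j))"
    using altform_swap[OF assms(2,4) assms(3)] by (intro sum.cong) auto
  finally show ?thesis .
qed

lemma gram_mat_change:
  assumes V: "vec.subspace V" and B: "altform V B" and Q: "\<And>j. j \<in> J \<Longrightarrow> Q j \<in> V"
    and Q': "\<And>j. j \<in> J \<Longrightarrow> Q' j = (\<Sum>k\<in>J. D j k *s Q k)"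
  shows "gram_mat J B Q' = (\<chi> j k. if j \<in> J \<and> k \<in> J then D j k else if j = k then 1 else 0) ** gram_mat J B Q **
    transpose (\<chi> j k. if j \<in> J \<and> k \<in> J then D j k else if j = k then 1 else 0)" (is "_ = ?D ** ?G ** transpose ?D")
proof -
  have mult: "(\<Sum>b\<in>UNIV. ?D $ k $ b * f b) = (if k \<in> J then \<Sum>b\<in>J. D k b * f b else f k)" for k f
  proof (cases "k \<in> J")
    case True
    have "(\<Sum>b\<in>UNIV. ?D $ k $ b * f b) = (\<Sum>b\<in>UNIV. if b \<in> J then D k b * f b else 0)"
      using True by (intro sum.cong) auto
    also have "\<dots> = (\<Sum>b\<in>J. D k b * f b)" by (subst sum.inter_restrict[symmetric]) auto
    finally show ?thesis using True by simp
  next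
    case False
    then show ?thesis by (simp add: if_distrib[where f="\<lambda>z. z * _"] cong: if_cong)
  qed
  have Q'V: "Q' j \<in> V" if "j \<in> J" for j
    unfolding Q'[OF that] using Q V by (auto intro!: vec.subspace_sum vec.subspace_scale)
  have "(?D ** ?G ** transpose ?D) $ j $ k = gram_mat J B Q' $ j $ k" for j k
  proof -
    have "(?D ** ?G ** transpose ?D) $ j $ k = (\<Sum>b\<in>UNIV. ?D $ k $ b * (\<Sum>a\<in>UNIV. ?D $ j $ a * ?G $ a $ b))"
      by (simp add: matrix_matrix_mult_def transpose_def mult.commute)
    also have "\<dots> = (if k \<in> J then \<Sum>b\<in>J. D k b * (if j \<in> J then \<Sum>a\<in>J. D j a * ?G $ a $ b else ?G $ j $ b)
        else (if j \<in> J then \<Sum>a\<in>J. D j a * ?G $ a $ k else ?G $ j $ k))"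
      unfolding mult ..
    also have "\<dots> = gram_mat J B Q' $ j $ k"
    proof (cases "j \<in> J \<and> k \<in> J")
      case True
      have "B (Q' j) (Q' k) = (\<Sum>a\<in>J. D j a * B (Q a) (Q' k))"
        unfolding Q'[of j, OF conjunct1[OF True]] using True Q Q'V by (intro altform_sum_left[OF V B]) auto
      also have "\<dots> = (\<Sum>a\<in>J. D j a * (\<Sum>b\<in>J. D k b * B (Q a) (Q b)))"
        unfolding Q'[of k, OF conjunct2[OF True]] using Q by (intro sum.cong refl arg_cong2[where f="(*)"] altform_sum_right[OF V B]) auto
      also have "\<dots> = (\<Sum>b\<in>J. D k b * (\<Sum>a\<in>J. D j a * B (Q a) (Q b)))"
        unfolding sum_distrib_left by (subst sum.swap) (simp add: mult.left_commute)
      finally show ?thesis using True by (simp add: gram_mat_def)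
    next
      case False
      then show ?thesis by (auto simp: gram_mat_def intro!: sum.neutral)
    qed
    finally show ?thesis .
  qed
  then show ?thesis by (simp add: vec_eq_iff)
qed

lemma tbasis_sum_in:
  assumes "vec.subspace V" "tbasis J V Q" shows "(\<Sum>j\<in>J. c j *s Q j) \<in> V"
  using assms by (auto simp: tbasis_def intro!: vec.subspace_sum vec.subspace_scale)

lemma gram_mat_nondegenerate:
  assumes V: "vec.subspace V" and B: "altform V B" and Q: "tbasis J V Q"
    and nd: "\<And>u. u \<in> V \<Longrightarrow> (\<And>v. v \<in> V \<Longrightarrow> B u v = 0) \<Longrightarrow> u = 0"
  shows "det (gram_mat J B Q) \<noteq> 0"
proof
  assume "det (gram_mat J B Q) = 0"
  then have "\<not> invertible (gram_mat J B Q)" by (simp add: invertible_det_nz)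
  then obtain z where z: "gram_mat J B Q *v z = 0" "z \<noteq> 0"
    unfolding invertible_left_inverse matrix_left_invertible_ker by blast
  have QV: "\<And>j. j \<in> J \<Longrightarrow> Q j \<in> V" using Q by (simp add: tbasis_def)
  have comp: "(\<Sum>k\<in>UNIV. gram_mat J B Q $ j $ k * z $ k) = 0" for j
    using arg_cong[OF z(1), of "\<lambda>w. w $ j"] by (simp add: matrix_vector_mult_def)
  have off: "z $ j = 0" if "j \<notin> J" for j
    using comp[of j] that by (simp add: gram_mat_def if_distrib[where f="\<lambda>z. z * _"] cong: if_cong)
  define w where "w = (\<Sum>k\<in>J. z $ k *s Q k)"
  have wV: "w \<in> V" unfolding w_def by (rule tbasis_sum_in[OF V Q])
  have Qw: "B (Q j) w = 0" if j: "j \<in> J" for j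
  proof -
    have "B (Q j) w = (\<Sum>k\<in>J. z $ k * B (Q j) (Q k))"
      unfolding w_def by (rule altform_sum_right[OF V B QV QV[OF j]])
    also have "\<dots> = (\<Sum>k\<in>UNIV. gram_mat J B Q $ j $ k * z $ k)"
      using j off by (intro sum.mono_neutral_cong_left) (auto simp: gram_mat_def)
    finally show ?thesis using comp by simp
  qed
  have "w = 0"
  proof (rule nd[OF wV])
    fix v assume v: "v \<in> V"
    then obtain c where c: "v = (\<Sum>j\<in>J. c j *s Q j)" using Q by (auto simp: tbasis_def)
    have "B v w = (\<Sum>j\<in>J. c j * B (Q j) w)" unfolding c by (rule altform_sum_left[OF V B QV wV])
    then show "B w v = 0" using Qw altform_swap[OF B wV v] by simp
  qed
  then have "\<forall>j\<in>J. z $ j = 0" using Q unfolding tbasis_def w_def by blast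
  with off have "z = 0" by (auto simp: vec_eq_iff)
  with z(2) show False by blast
qed

text \<open>Cramer's rule for the transposed system. The explicit quotient makes solutions regular
  in the point and continuous in the time parameter.\<close>

definition solv :: "complex^'n^'n \<Rightarrow> ('n \<Rightarrow> complex) \<Rightarrow> 'n \<Rightarrow> complex" where
  "solv G b j = det (\<chi> i k. if k = j then b i else G $ k $ i) / det G"

lemma solv_solves:
  assumes "det G \<noteq> 0" shows "(\<Sum>j\<in>UNIV. solv G b j * G $ j $ k) = b k"
proof -
  have d: "det (transpose G) \<noteq> 0" using assms by (simp add: det_transpose)
  have te: "transpose G $ i $ j = G $ j $ i" for i j by (simp add: transpose_def)
  have "(\<chi> j. solv G b j) = (\<chi> k. det (\<chi> i j. if j = k then (\<chi> i. b i) $ i else transpose G $ i $ j) / det (transpose G))"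
    by (simp add: solv_def vec_eq_iff det_transpose te cong: if_cong)
  then have "transpose G *v (\<chi> j. solv G b j) = (\<chi> i. b i)" using cramer[OF d] by blast
  from arg_cong[OF this, of "\<lambda>v. v $ k"] show ?thesis
    by (simp add: matrix_vector_mult_def transpose_def mult.commute)
qed

definition dual_vector :: "'n set \<Rightarrow> (complex^'n \<Rightarrow> complex^'n \<Rightarrow> complex) \<Rightarrow> (complex^'n \<Rightarrow> complex) \<Rightarrow> ('n \<Rightarrow> complex^'n) \<Rightarrow> complex^'n" where
  "dual_vector J B \<beta> Q = (\<Sum>j\<in>J. solv (gram_mat J B Q) (\<lambda>k. if k \<in> J then \<beta> (Q k) else 0) j *s Q j)"

lemma dual_vector:
  assumes V: "vec.subspace V" and B: "altform V B" and Q: "tbasis J V Q" and d: "det (gram_mat J B Q) \<noteq> 0"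
    and \<beta>: "\<And>c. \<beta> (\<Sum>j\<in>J. c j *s Q j) = (\<Sum>j\<in>J. c j * \<beta> (Q j))"
  shows "dual_vector J B \<beta> Q \<in> V" "v \<in> V \<Longrightarrow> B (dual_vector J B \<beta> Q) v = \<beta> v"
proof -
  have QV: "\<And>j. j \<in> J \<Longrightarrow> Q j \<in> V" using Q by (simp add: tbasis_def)
  let ?b = "\<lambda>k. if k \<in> J then \<beta> (Q k) else 0"
  show in_V: "dual_vector J B \<beta> Q \<in> V" unfolding dual_vector_def by (rule tbasis_sum_in[OF V Q])
  have key: "B (dual_vector J B \<beta> Q) (Q k) = \<beta> (Q k)" if k: "k \<in> J" for k
  proof -
    have "B (dual_vector J B \<beta> Q) (Q k) = (\<Sum>j\<in>J. solv (gram_mat J B Q) ?b j * B (Q j) (Q k))"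
      unfolding dual_vector_def by (rule altform_sum_left[OF V B QV QV[OF k]])
    also have "\<dots> = (\<Sum>j\<in>UNIV. solv (gram_mat J B Q) ?b j * gram_mat J B Q $ j $ k)"
      using k by (intro sum.mono_neutral_cong_left) (auto simp: gram_mat_def)
    also have "\<dots> = \<beta> (Q k)" using solv_solves[OF d, of ?b k] k by simp
    finally show ?thesis .
  qed
  assume "v \<in> V"
  then obtain c where c: "v = (\<Sum>j\<in>J. c j *s Q j)" using Q by (auto simp: tbasis_def)
  have "B (dual_vector J B \<beta> Q) (\<Sum>j\<in>J. c j *s Q j) = (\<Sum>j\<in>J. c j * B (dual_vector J B \<beta> Q) (Q j))"
    by (rule altform_sum_right[OF V B QV in_V])
  then show "B (dual_vector J B \<beta> Q) v = \<beta> v" unfolding c \<beta> using key by simp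
qed

lemma altform_rational_form: "altform V (rational_form a g x)"
  by (auto simp: altform_def rational_form_bilinear intro: rational_form_swap)

lemma altform_cong: "altform V B \<Longrightarrow> vec.subspace V \<Longrightarrow> (\<And>u v. u \<in> V \<Longrightarrow> v \<in> V \<Longrightarrow> B' u v = B u v) \<Longrightarrow> altform V B'"
  unfolding altform_def by (metis vec.subspace_add vec.subspace_scale)

lemma gram_mat_cong: "(\<And>j k. j \<in> J \<Longrightarrow> k \<in> J \<Longrightarrow> B (Q j) (Q k) = B' (Q' j) (Q' k)) \<Longrightarrow> gram_mat J B Q = gram_mat J B' Q'"
  by (auto simp: gram_mat_def vec_eq_iff)

lemma regfun_regat:
  assumes "\<And>q. q \<in> regular_locus X \<Longrightarrow> \<exists>f k. regat q f \<and> polyfun k \<and> k q \<noteq> 0 \<and> (\<forall>x\<in>regular_locus X. k x \<noteq> 0 \<longrightarrow> h x = f x)"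
  shows "regfun X h"
  unfolding regfun_def
proof
  fix q assume "q \<in> regular_locus X"
  then obtain f k where f: "regat q f" "polyfun k" "k q \<noteq> 0" "\<And>x. x \<in> regular_locus X \<Longrightarrow> k x \<noteq> 0 \<Longrightarrow> h x = f x"
    using assms by blast
  then obtain a g where *: "polyfun a" "polyfun g" "g q \<noteq> 0" "\<And>x. g x \<noteq> 0 \<Longrightarrow> f x = a x / g x" unfolding regat_def by blast
  show "\<exists>a g. polyfun a \<and> polyfun g \<and> g q \<noteq> 0 \<and> (\<forall>x\<in>regular_locus X. g x \<noteq> 0 \<longrightarrow> h x = a x / g x)"
    by (rule exI[of _ "\<lambda>x. a x * k x"], rule exI[of _ "\<lambda>x. g x * k x"]) (use * f in \<open>auto intro: polyfun.mult\<close>)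
qed

lemma det_affine_poly:
  fixes A B :: "complex^'n^'n"
  obtains P where "\<And>s. poly P s = det (\<chi> i j. A $ i $ j + s * B $ i $ j)"
proof
  fix s
  show "poly (\<Sum>p | p permutes UNIV. smult (of_int (sign p)) (\<Prod>i\<in>UNIV. [:A $ i $ p i, B $ i $ p i:])) s
      = det (\<chi> i j. A $ i $ j + s * B $ i $ j)"
    by (simp add: det_def poly_sum poly_prod)
qed

section \<open>The pencil of forms and its relative determinant\<close>

context moser
begin

lemma T_subspace: "vec.subspace (T x)" by (rule tangent_space_subspace)

lemma closed_altform:
  assumes "closed_two_form X \<eta>" "x \<in> R" shows "altform (T x) (\<eta> x)"
proof -
  obtain a g where "local_expression X \<eta> x a g" using assms unfolding closed_two_form_def by blast
  from local_expressionD[OF this] assms(2) show ?thesis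
    by (intro altform_cong[OF altform_rational_form[of _ a g x] T_subspace]) auto
qed

text \<open>The columns of the inverse frame are dual to its rows: those with index in J are
  annihilated by the gradients outside J, so they form a basis of the tangent space, and Cramer's
  rule makes them regular.\<close>

lemma local_tbasis:
  assumes x0: "x0 \<in> R"
  shows "\<exists>w h. polyfun h \<and> h x0 \<noteq> 0 \<and> (\<forall>j i. regat x0 (\<lambda>x. w j x $ i)) \<and>
    (\<forall>x\<in>R. h x \<noteq> 0 \<longrightarrow> tbasis J (T x) (\<lambda>j. w j x))"
proof -
  have dimT: "vec.dim (T x) = card J" if "x \<in> R" for x
    using that regq cardJ by (simp add: regular_locus_def) (metis enat.inject)
  obtain F H0 where F: "\<And>i. F i \<in> vanishing X" "invertible (frame J F H0 x0)"
    by (rule tangent_frame[OF dimT[OF x0, symmetric]]) blast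
  let ?H = "frame J F H0"
  have dH: "det (?H x0) \<noteq> 0" using F(2) by (simp add: invertible_det_nz)
  have pH: "polyfun (\<lambda>x. ?H x $ i $ j)" for i j by (rule polyfun_frame[where F=F, OF F(1)])
  have pdH: "polyfun (\<lambda>x. det (?H x))" by (rule polyfun_det[OF pH])
  define w where "w j x = (\<chi> i. inv_entry (?H x) i j)" for j x
  have rw: "regat x0 (\<lambda>x. w j x $ i)" for j i
    unfolding w_def using regat_inv_entry[of x0 ?H, OF regat_polyfun[OF pH] dH] by simp
  have tb: "tbasis J (T x) (\<lambda>j. w j x)" if x: "x \<in> R" "det (?H x) \<noteq> 0" for x
  proof -
    have inv: "invertible (?H x)" using x(2) by (simp add: invertible_det_nz)
    have Teq: "T x = ker_rows J (?H x)"
      by (rule tangent_space_eq_ker_rows[where F=F, OF F(1) inv]) (simp add: dimT[OF x(1)])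
    have Hw: "?H x *v w j x = axis j 1" for j unfolding w_def by (rule inv_entry_right[OF x(2)])
    have Hs: "?H x *v (\<Sum>j\<in>J. c j *s w j x) = (\<Sum>j\<in>J. c j *s axis j 1)" for c
      by (simp add: vec.sum vec.scale Hw)
    have comp: "(\<Sum>j\<in>J. c j *s axis j 1 :: complex^'n) $ i = (if i \<in> J then c i else 0)" for c i
      by (simp add: axis_def if_distrib[where f="\<lambda>z. _ * z"] cong: if_cong)
    show ?thesis unfolding tbasis_def
    proof (intro conjI ballI allI impI)
      show "w j x \<in> T x" if "j \<in> J" for j
        using that by (auto simp: Teq ker_rows_def Hw axis_def)
    next
      fix v assume v: "v \<in> T x"
      define c where "c j = (?H x *v v) $ j" for j
      have "?H x *v v = (\<Sum>j\<in>J. c j *s axis j 1)"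
        unfolding vec_eq_iff comp using v by (auto simp: Teq ker_rows_def c_def)
      then have "?H x *v v = ?H x *v (\<Sum>j\<in>J. c j *s w j x)" by (simp add: Hs)
      then have "v = (\<Sum>j\<in>J. c j *s w j x)" using invertible_matrix_inv(2)[OF inv] by metis
      then show "\<exists>c. v = (\<Sum>j\<in>J. c j *s w j x)" by blast
    next
      fix c j assume 0: "(\<Sum>j\<in>J. c j *s w j x) = 0" and j: "j \<in> J"
      have "(\<Sum>j\<in>J. c j *s axis j 1 :: complex^'n) = 0" using Hs[of c] by (simp add: 0)
      then show "c j = 0" using comp[of c j] j by simp
    qed
  qed
  show ?thesis
    by (rule exI[of _ w], rule exI[of _ "\<lambda>x. det (?H x)"]) (use pdH dH rw tb in simp)
qed

lemma tbasis_exists: assumes "x \<in> R" obtains Q where "tbasis J (T x) Q"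
  using local_tbasis[OF assms] assms by blast

definition \<omega>t :: "complex \<Rightarrow> 'n two_form" where "\<omega>t s x u v = (1 - s) * \<omega> x u v + s * \<omega>' x u v"
text \<open>The coefficients -1 and 1 are written out so that \<open>closed_two_form_comb\<close>
  and \<open>wt_comb\<close> apply literally.\<close>

definition \<delta> :: "'n two_form" where "\<delta> x u v = (-1) * \<omega> x u v + 1 * \<omega>' x u v"

lemma \<omega>t_closed: "closed_two_form X (\<omega>t s)"
  unfolding \<omega>t_def[abs_def] by (intro closed_two_form_comb symplectic_closed symp)
lemma \<delta>_closed: "closed_two_form X \<delta>"
  unfolding \<delta>_def[abs_def] by (intro closed_two_form_comb symplectic_closed symp)
lemma \<omega>t_wt: "wt (\<omega>t s)"
  unfolding \<omega>t_def[abs_def] by (intro wt_comb form_weight_wt weight)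
lemma \<delta>_wt: "wt \<delta>"
  unfolding \<delta>_def[abs_def] by (intro wt_comb form_weight_wt weight)
lemma \<omega>t_diff: "\<omega>t s x u v = \<omega>t r x u v + (s - r) * \<delta> x u v"
  by (simp add: \<omega>t_def \<delta>_def algebra_simps)

text \<open>A change of basis multiplies every Gram determinant by the same factor, the square of
  its own determinant, whatever the form.\<close>

lemma gram_\<omega>t_ratio_basis:
  assumes x: "x \<in> R" and Q: "tbasis J (T x) Q" and Q': "tbasis J (T x) Q'"
  shows "det (gram_mat J (\<omega>t s x) Q') * det (gram_mat J (\<omega>t 0 x) Q) = det (gram_mat J (\<omega>t s x) Q) * det (gram_mat J (\<omega>t 0 x) Q')"
proof -
  have "\<forall>j. \<exists>D. j \<in> J \<longrightarrow> Q' j = (\<Sum>k\<in>J. D k *s Q k)" using Q Q' unfolding tbasis_def by blast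
  then obtain D where D: "\<And>j. j \<in> J \<Longrightarrow> Q' j = (\<Sum>k\<in>J. D j k *s Q k)" by metis
  have QT: "\<And>j. j \<in> J \<Longrightarrow> Q j \<in> T x" using Q by (simp add: tbasis_def)
  define M where "M = (\<chi> j k. if j \<in> J \<and> k \<in> J then D j k else if j = k then 1 else 0)"
  have "det (gram_mat J (\<omega>t s x) Q') = det M * det (gram_mat J (\<omega>t s x) Q) * det M" for s
    using gram_mat_change[OF T_subspace closed_altform[OF \<omega>t_closed x] QT D] by (simp add: M_def det_mul det_transpose)
  then show ?thesis by simp
qed

lemma \<omega>_nondegenerate:
  assumes x: "x \<in> R" and u: "u \<in> T x" and 0: "\<And>v. v \<in> T x \<Longrightarrow> \<omega>t 0 x u v = 0" shows "u = 0"
  using symp(1) x u 0 unfolding symplectic_form_def nondegenerate_def \<omega>t_def by simp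

lemma gram_\<omega>_nonzero: "x \<in> R \<Longrightarrow> tbasis J (T x) Q \<Longrightarrow> det (gram_mat J (\<omega>t 0 x) Q) \<noteq> 0"
  by (rule gram_mat_nondegenerate[OF T_subspace closed_altform[OF \<omega>t_closed]]) (auto intro: \<omega>_nondegenerate)

lemma gram_\<omega>'_nonzero:
  assumes x: "x \<in> R" and Q: "tbasis J (T x) Q" shows "det (gram_mat J (\<omega>t 1 x) Q) \<noteq> 0"
proof (rule gram_mat_nondegenerate[OF T_subspace closed_altform[OF \<omega>t_closed x] Q])
  fix u assume "u \<in> T x" "\<And>v. v \<in> T x \<Longrightarrow> \<omega>t 1 x u v = 0"
  then show "u = 0" using symp(2) x unfolding symplectic_form_def nondegenerate_def \<omega>t_def by simp
qed

text \<open>The determinant of \<open>\<omega>t s\<close> relative to \<open>\<omega>\<close>; independent of the basis by \<open>ratio_eq\<close>.\<close>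

definition ratio :: "complex \<Rightarrow> complex^'n \<Rightarrow> complex" where
  "ratio s x = (let Q = (SOME Q. tbasis J (T x) Q) in det (gram_mat J (\<omega>t s x) Q) / det (gram_mat J (\<omega>t 0 x) Q))"

lemma ratio_eq:
  assumes x: "x \<in> R" and Q: "tbasis J (T x) Q"
  shows "ratio s x = det (gram_mat J (\<omega>t s x) Q) / det (gram_mat J (\<omega>t 0 x) Q)"
proof -
  define Q' where "Q' = (SOME Q. tbasis J (T x) Q)"
  have Q': "tbasis J (T x) Q'" unfolding Q'_def using Q by (rule someI[of "tbasis J (T x)"])
  have "det (gram_mat J (\<omega>t s x) Q') / det (gram_mat J (\<omega>t 0 x) Q') = det (gram_mat J (\<omega>t s x) Q) / det (gram_mat J (\<omega>t 0 x) Q)"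
    using gram_\<omega>t_ratio_basis[OF x Q Q', of s] gram_\<omega>_nonzero[OF x Q] gram_\<omega>_nonzero[OF x Q'] by (simp add: frac_eq_eq)
  then show ?thesis by (simp add: ratio_def Q'_def Let_def)
qed

lemma tbasis_transport:
  assumes t: "t \<noteq> 0" and x: "x \<in> X" and Q: "tbasis J (T x) Q"
  shows "tbasis J (T (S t x)) (\<lambda>j. jac (S t) x (Q j))"
  unfolding tbasis_def
proof (intro conjI ballI allI impI)
  show "jac (S t) x (Q j) \<in> T (S t x)" if "j \<in> J" for j using Q that by (intro jac_S_tangent[OF t]) (simp add: tbasis_def)
next
  fix w assume "w \<in> T (S t x)"
  then obtain v where v: "v \<in> T x" "w = jac (S t) x v" using jac_S_surj[OF t x] by blast
  then obtain c where c: "v = (\<Sum>j\<in>J. c j *s Q j)" using Q by (auto simp: tbasis_def)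
  show "\<exists>c. w = (\<Sum>j\<in>J. c j *s jac (S t) x (Q j))" unfolding v(2) c jac_sum by blast
next
  fix c j assume "(\<Sum>j\<in>J. c j *s jac (S t) x (Q j)) = 0" and j: "j \<in> J"
  then have 0: "jac (S t) x (\<Sum>j\<in>J. c j *s Q j) = 0" by (simp add: jac_sum)
  have "(\<Sum>j\<in>J. c j *s Q j) = jac (S (inverse t)) (S t x) (jac (S t) x (\<Sum>j\<in>J. c j *s Q j))"
    by (rule jac_S_inv[OF t tbasis_sum_in[OF T_subspace Q], symmetric])
  also have "\<dots> = 0" unfolding 0 by (simp add: jac_def vec_eq_iff)
  finally show "c j = 0" using Q j unfolding tbasis_def by blast
qed

text \<open>Both forms in the quotient have weight l, so transport by the action multiplies their
  Gram matrices by the same invertible diagonal matrix K.\<close>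

lemma ratio_invariant:
  assumes t: "t \<noteq> 0" and x: "x \<in> R" shows "ratio s (S t x) = ratio s x"
proof -
  obtain Q where Q: "tbasis J (T x) Q" using tbasis_exists[OF x] by blast
  let ?Q = "\<lambda>j. jac (S t) x (Q j)"
  have QT: "\<And>j. j \<in> J \<Longrightarrow> Q j \<in> T x" using Q by (simp add: tbasis_def)
  define K where "K = (\<chi> j k. if j = k then (if j \<in> J then t powi l else 1) else 0)"
  have G: "gram_mat J (\<omega>t s (S t x)) ?Q = K ** gram_mat J (\<omega>t s x) Q" for s
  proof -
    have "(K ** gram_mat J (\<omega>t s x) Q) $ j $ k = gram_mat J (\<omega>t s (S t x)) ?Q $ j $ k" for j k
    proof -
      have "(K ** gram_mat J (\<omega>t s x) Q) $ j $ k = (if j \<in> J then t powi l else 1) * gram_mat J (\<omega>t s x) Q $ j $ k"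
        by (simp add: K_def matrix_matrix_mult_def if_distrib[where f="\<lambda>z. z * _"] cong: if_cong)
      moreover have "\<omega>t s (S t x) (?Q j) (?Q k) = t powi l * \<omega>t s x (Q j) (Q k)" if "j \<in> J" "k \<in> J"
        using \<omega>t_wt[of s] t x QT that unfolding wt_def by blast
      ultimately show ?thesis by (auto simp: gram_mat_def)
    qed
    then show ?thesis by (simp add: vec_eq_iff)
  qed
  have "det K = (\<Prod>i\<in>UNIV. K $ i $ i)" by (rule det_diagonal) (simp add: K_def)
  then have "det K \<noteq> 0" using t by (simp add: K_def)
  then show ?thesis
    unfolding ratio_eq[OF S_reg[OF t x] tbasis_transport[OF t reg_in[OF x] Q]] ratio_eq[OF x Q] G det_mul by simp
qed

lemma regat_gram:
  assumes "\<And>j k. j \<in> J \<Longrightarrow> k \<in> J \<Longrightarrow> regat y (\<lambda>x. B x (w j x) (w k x))"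
  shows "regat y (\<lambda>x. gram_mat J (B x) (\<lambda>j. w j x) $ j $ k)"
proof (cases "j \<in> J \<and> k \<in> J")
  case True
  then show ?thesis using assms by (simp add: gram_mat_def)
next
  case False
  then have "(\<lambda>x. gram_mat J (B x) (\<lambda>j. w j x) $ j $ k) = (\<lambda>x. if j = k then 1 else 0)"
    by (auto simp: gram_mat_def)
  then show ?thesis by (simp add: regat_const)
qed

lemma gram_local:
  assumes "local_expression X \<eta> x0 a g" "x \<in> R" "g x \<noteq> 0" "tbasis J (T x) Q"
  shows "gram_mat J (\<eta> x) Q = gram_mat J (rational_form a g x) Q"
  using local_expressionD(4)[OF assms(1-3)] assms(4) by (intro gram_mat_cong) (auto simp: tbasis_def)

lemma ratio_regfun: "regfun X (ratio s)"
proof (rule regfun_regat)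
  fix x0 assume x0: "x0 \<in> R"
  obtain w h where wh: "polyfun h" "h x0 \<noteq> 0" "\<And>j i. regat x0 (\<lambda>x. w j x $ i)"
    "\<And>x. x \<in> R \<Longrightarrow> h x \<noteq> 0 \<Longrightarrow> tbasis J (T x) (\<lambda>j. w j x)" using local_tbasis[OF x0] by blast
  obtain a g where a: "local_expression X (\<omega>t s) x0 a g" using \<omega>t_closed x0 unfolding closed_two_form_def by blast
  obtain b k where b: "local_expression X (\<omega>t 0) x0 b k" using \<omega>t_closed x0 unfolding closed_two_form_def by blast
  note aD = local_expressionD[OF a] and bD = local_expressionD[OF b]
  let ?A = "\<lambda>x. det (gram_mat J (rational_form a g x) (\<lambda>j. w j x))"
  let ?B = "\<lambda>x. det (gram_mat J (rational_form b k x) (\<lambda>j. w j x))"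
  have rA: "regat x0 ?A" 
    by (rule regat_det, rule regat_gram[where B="\<lambda>x. rational_form a g x" and w=w],
        rule regat_rational_form[where u="w _" and v="w _"]) (rule aD wh(3))+
  have rB: "regat x0 ?B" 
    by (rule regat_det, rule regat_gram[where B="\<lambda>x. rational_form b k x" and w=w],
        rule regat_rational_form[where u="w _" and v="w _"]) (rule bD wh(3))+
  have B0: "?B x0 \<noteq> 0"
    using gram_\<omega>_nonzero[OF x0 wh(4)[OF x0 wh(2)]] gram_local[OF b x0 bD(3) wh(4)[OF x0 wh(2)]] by simp
  have "ratio s x = ?A x / ?B x" if "x \<in> R" "h x * (g x * k x) \<noteq> 0" for x
    using that ratio_eq[OF that(1) wh(4)] gram_local[OF a that(1) _ wh(4)] gram_local[OF b that(1) _ wh(4)] by auto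
  moreover have "polyfun (\<lambda>x. h x * (g x * k x))" by (intro polyfun.mult wh aD bD)
  moreover have "h x0 * (g x0 * k x0) \<noteq> 0" using wh(2) aD(3) bD(3) by simp
  ultimately show "\<exists>f k. regat x0 f \<and> polyfun k \<and> k x0 \<noteq> 0 \<and> (\<forall>x\<in>R. k x \<noteq> 0 \<longrightarrow> ratio s x = f x)"
    using regat_divide[OF rA rB B0] by (intro exI[of _ "\<lambda>x. ?A x / ?B x"] exI[of _ "\<lambda>x. h x * (g x * k x)"]) auto
qed

lemma reg_dense: "polyfun f \<Longrightarrow> (\<And>x. x \<in> R \<Longrightarrow> f x = 0) \<Longrightarrow> x \<in> X \<Longrightarrow> f x = 0"
  by (rule regular_locus_dense[where f=f and h="\<lambda>x. 1", OF affX regq _ polyfun.const qX]) auto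

lemma hom_of_regular:
  assumes f: "polyfun f" and eq: "\<And>t x. t \<noteq> 0 \<Longrightarrow> x \<in> R \<Longrightarrow> f (S t x) = t powi k * f x"
  shows "hom k f"
  unfolding hom_def
proof (intro conjI f ballI allI impI)
  fix x t assume x: "x \<in> X" and t: "t \<noteq> (0::complex)"
  have "f (S t x) - t powi k * f x = 0"
  proof (rule reg_dense[OF _ _ x])
    show "polyfun (\<lambda>x. f (S t x) - t powi k * f x)"
      by (intro polyfun_diff polyfun.mult polyfun.const f polyfun_compose[OF f pmapD[OF S_pmap]])
  qed (simp add: eq[OF t])
  then show "f (\<sigma> t x) = t powi k * f x" using S_eq[OF t x] by simp
qed

lemma ratio_constant: assumes x: "x \<in> R" shows "ratio s x = ratio s q"
proof -
  obtain F where F: "polyfun F" "\<And>x. x \<in> R \<Longrightarrow> ratio s x = F x" using hartogs[OF normal ratio_regfun regq] by blast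
  have "hom 0 F"
  proof (rule hom_of_regular[OF F(1)])
    fix t x assume "t \<noteq> (0::complex)" "x \<in> R"
    then show "F (S t x) = t powi 0 * F x" using ratio_invariant[of t x s] F(2) S_reg by simp
  qed
  from hom_weight_zero[OF this] show ?thesis using F(2) x regq reg_in by metis
qed

text \<open>The pencil is affine in s, so its Gram determinant in one fixed basis at q is a
  polynomial in s; that 0 and 1 are no roots is the nondegeneracy of the two given forms.\<close>

lemma ratio_polynomial:
  obtains P where "\<And>s. poly P s = 0 \<longleftrightarrow> ratio s q = 0" "poly P 0 \<noteq> 0" "poly P 1 \<noteq> 0"
proof -
  obtain Q where Q: "tbasis J (T q) Q" using tbasis_exists[OF regq] by blast
  obtain P where P: "\<And>s. poly P s = det (\<chi> i j. gram_mat J (\<omega>t 0 q) Q $ i $ j + s * (gram_mat J (\<omega>t 1 q) Q - gram_mat J (\<omega>t 0 q) Q) $ i $ j)"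
    by (rule det_affine_poly[of "gram_mat J (\<omega>t 0 q) Q" "gram_mat J (\<omega>t 1 q) Q - gram_mat J (\<omega>t 0 q) Q"]) blast
  have "(\<chi> i j. gram_mat J (\<omega>t 0 q) Q $ i $ j + s * (gram_mat J (\<omega>t 1 q) Q - gram_mat J (\<omega>t 0 q) Q) $ i $ j) = gram_mat J (\<omega>t s q) Q" for s
    by (auto simp: vec_eq_iff gram_mat_def \<omega>t_def algebra_simps)
  then have Ps: "poly P s = det (gram_mat J (\<omega>t s q) Q)" for s by (simp add: P)
  show ?thesis
  proof (rule that[of P])
    show "poly P s = 0 \<longleftrightarrow> ratio s q = 0" for s using ratio_eq[OF regq Q] gram_\<omega>_nonzero[OF regq Q] by (simp add: Ps)
    show "poly P 0 \<noteq> 0" using gram_\<omega>_nonzero[OF regq Q] by (simp add: Ps)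
    show "poly P 1 \<noteq> 0" using gram_\<omega>'_nonzero[OF regq Q] by (simp add: Ps)
  qed
qed

lemma gram_\<omega>t_nonzero:
  assumes s: "ratio s q \<noteq> 0" and x: "x \<in> R" and Q: "tbasis J (T x) Q"
  shows "det (gram_mat J (\<omega>t s x) Q) \<noteq> 0"
  using s ratio_constant[OF x, of s] ratio_eq[OF x Q, of s] by auto

lemma \<omega>t_unique:
  assumes s: "ratio s q \<noteq> 0" and x: "x \<in> R" and V: "V \<in> T x" "V' \<in> T x" and eq: "\<And>v. v \<in> T x \<Longrightarrow> \<omega>t s x V v = \<omega>t s x V' v"
  shows "V = V'"
proof -
  obtain Q where Q: "tbasis J (T x) Q" using tbasis_exists[OF x] by blast
  have alt: "altform (T x) (\<omega>t s x)" by (rule closed_altform[OF \<omega>t_closed x])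
  have d: "V - V' \<in> T x" by (rule vec.subspace_diff[OF T_subspace V])
  have 0: "\<omega>t s x v (V - V') = 0" if v: "v \<in> T x" for v
  proof -
    have "\<omega>t s x (V - V' + V') v = \<omega>t s x (V - V') v + \<omega>t s x V' v" using alt d V v unfolding altform_def by blast
    then show ?thesis using eq[OF v] altform_swap[OF alt v d] by simp
  qed
  obtain c where c: "V - V' = (\<Sum>j\<in>J. c j *s Q j)" using Q d by (auto simp: tbasis_def)
  define z where "z = (\<chi> j. if j \<in> J then c j else 0)"
  have QT: "\<And>j. j \<in> J \<Longrightarrow> Q j \<in> T x" using Q by (simp add: tbasis_def)
  have "gram_mat J (\<omega>t s x) Q *v z = 0"
  proof (simp add: vec_eq_iff matrix_vector_mult_def, intro allI)
    fix j
    show "(\<Sum>k\<in>UNIV. gram_mat J (\<omega>t s x) Q $ j $ k * z $ k) = 0"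
    proof (cases "j \<in> J")
      case True
      have "(\<Sum>k\<in>UNIV. gram_mat J (\<omega>t s x) Q $ j $ k * z $ k) = (\<Sum>k\<in>J. c k * \<omega>t s x (Q j) (Q k))"
        using True by (intro sum.mono_neutral_cong_right) (auto simp: gram_mat_def z_def)
      also have "\<dots> = \<omega>t s x (Q j) (V - V')"
        unfolding c by (rule altform_sum_right[OF T_subspace alt QT QT[OF True], symmetric])
      finally show ?thesis using 0[OF QT[OF True]] by simp
    next
      case False
      then show ?thesis by (intro sum.neutral) (auto simp: gram_mat_def z_def)
    qed
  qed
  moreover have "invertible (gram_mat J (\<omega>t s x) Q)" using gram_\<omega>t_nonzero[OF s x Q] by (simp add: invertible_det_nz)
  ultimately have "z = 0" using invertible_matrix_inv(2) by (metis matrix_vector_mult_0_right)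
  then have "c j = 0" if "j \<in> J" for j using that by (simp add: z_def vec_eq_iff) (metis)
  then have "V - V' = 0" unfolding c by (intro sum.neutral) simp
  then show ?thesis by simp
qed

section \<open>The vector field of the isotopy\<close>

lemma \<delta>_E_linear:
  assumes x: "x \<in> R" and Q: "tbasis J (T x) Q"
  shows "c * \<delta> x (E x) (\<Sum>j\<in>J. d j *s Q j) = (\<Sum>j\<in>J. d j * (c * \<delta> x (E x) (Q j)))"
  using altform_sum_right[OF T_subspace closed_altform[OF \<delta>_closed x], of J Q "E x" d] Q E_tangent[OF reg_in[OF x]]
  by (simp add: tbasis_def sum_distrib_left mult.left_commute)

lemma moser_field_at:
  assumes s: "ratio s q \<noteq> 0" and x: "x \<in> R" and Q: "tbasis J (T x) Q"
  shows "dual_vector J (\<omega>t s x) (\<lambda>v. c * \<delta> x (E x) v) Q \<in> T x"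
    "v \<in> T x \<Longrightarrow> \<omega>t s x (dual_vector J (\<omega>t s x) (\<lambda>v. c * \<delta> x (E x) v) Q) v = c * \<delta> x (E x) v"
  using dual_vector[OF T_subspace closed_altform[OF \<omega>t_closed x] Q gram_\<omega>t_nonzero[OF s x Q], of "\<lambda>v. c * \<delta> x (E x) v"]
    \<delta>_E_linear[OF x Q] by blast+

text \<open>Nondegeneracy determines the field at regular points; Cramer's formula in a local basis
  shows that its components are regular, normality extends each of them to X, and tangency follows
  by density.\<close>

lemma moser_field:
  assumes s: "ratio s q \<noteq> 0"
  obtains V where "pmap V" "\<And>x. x \<in> X \<Longrightarrow> V x \<in> T x" "\<And>x v. x \<in> R \<Longrightarrow> v \<in> T x \<Longrightarrow> \<omega>t s x (V x) v = c * \<delta> x (E x) v"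
proof -
  define W where "W x = dual_vector J (\<omega>t s x) (\<lambda>v. c * \<delta> x (E x) v) (SOME Q. tbasis J (T x) Q)" for x
  have W: "W x \<in> T x" "v \<in> T x \<Longrightarrow> \<omega>t s x (W x) v = c * \<delta> x (E x) v" if x: "x \<in> R" for x v
  proof -
    obtain Q where "tbasis J (T x) Q" using tbasis_exists[OF x] by blast
    then have "tbasis J (T x) (SOME Q. tbasis J (T x) Q)" by (rule someI[of "tbasis J (T x)"])
    from moser_field_at[OF s x this, where c=c] show "W x \<in> T x" "v \<in> T x \<Longrightarrow> \<omega>t s x (W x) v = c * \<delta> x (E x) v"
      unfolding W_def by blast+
  qed
  \<comment> \<open>W is defined through a basis picked separately at each point; uniqueness permits
    any other basis, in particular one that varies regularly.\<close>
  have Weq: "W x = dual_vector J (\<omega>t s x) (\<lambda>v. c * \<delta> x (E x) v) Q" if x: "x \<in> R" and Q: "tbasis J (T x) Q" for x Q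
    by (rule \<omega>t_unique[OF s x W(1)[OF x] moser_field_at(1)[OF s x Q]]) (simp add: W(2)[OF x] moser_field_at(2)[OF s x Q])
  have reg: "regfun X (\<lambda>x. W x $ i)" for i
  proof (rule regfun_regat)
    fix x0 assume x0: "x0 \<in> R"
    obtain w h where wh: "polyfun h" "h x0 \<noteq> 0" "\<And>j i. regat x0 (\<lambda>x. w j x $ i)"
      "\<And>x. x \<in> R \<Longrightarrow> h x \<noteq> 0 \<Longrightarrow> tbasis J (T x) (\<lambda>j. w j x)" using local_tbasis[OF x0] by blast
    obtain a g where a: "local_expression X (\<omega>t s) x0 a g" using \<omega>t_closed x0 unfolding closed_two_form_def by blast
    obtain b k where b: "local_expression X \<delta> x0 b k" using \<delta>_closed x0 unfolding closed_two_form_def by blast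
    note aD = local_expressionD[OF a] and bD = local_expressionD[OF b]
    let ?G = "\<lambda>x. gram_mat J (rational_form a g x) (\<lambda>j. w j x)"
    let ?b = "\<lambda>x k'. if k' \<in> J then c * rational_form b k x (E x) (w k' x) else 0"
    let ?f = "\<lambda>x. \<Sum>j\<in>J. solv (?G x) (?b x) j * w j x $ i"
    have rG: "regat x0 (\<lambda>x. ?G x $ j $ k)" for j k 
      by (rule regat_gram[where B="\<lambda>x. rational_form a g x" and w=w],
        rule regat_rational_form[where u="w _" and v="w _"]) (rule aD wh(3))+
    have rb: "regat x0 (\<lambda>x. ?b x k')" for k'
    proof -
      have "regat x0 (\<lambda>x. c * rational_form b k x (E x) (w k' x))"
        by (rule regat_mult[OF regat_const], rule regat_rational_form[where u=E and v="w k'"])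
           (rule bD wh(3) regat_polyfun[OF pmapD[OF E_pmap]])+
      then show ?thesis by (cases "k' \<in> J") (simp_all add: regat_const)
    qed
    have G0: "det (?G x0) \<noteq> 0"
      using gram_\<omega>t_nonzero[OF s x0 wh(4)[OF x0 wh(2)]] gram_local[OF a x0 aD(3) wh(4)[OF x0 wh(2)]] by simp
    have rs: "regat x0 (\<lambda>x. solv (?G x) (?b x) j)" for j
    proof -
      have "regat x0 (\<lambda>x. (\<chi> i k. if k = j then ?b x i else ?G x $ k $ i) $ i' $ k')" for i' k'
      proof (cases "k' = j")
        case True
        then show ?thesis using rb[of i'] by simp
      next
        case False
        then show ?thesis using rG[of k' i'] by simp
      qed
      from regat_divide[where p=x0 and h="\<lambda>x. det (?G x)", OF regat_det[OF this] regat_det[OF rG] G0]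
      show ?thesis unfolding solv_def .
    qed
    have rf: "regat x0 ?f" by (intro regat_sum regat_mult rs wh(3))
    have "W x $ i = ?f x" if x: "x \<in> R" "h x * (g x * k x) \<noteq> 0" for x
    proof -
      have nz: "h x \<noteq> 0" "g x \<noteq> 0" "k x \<noteq> 0" using x by auto
      have tb: "tbasis J (T x) (\<lambda>j. w j x)" by (rule wh(4)[OF x(1) nz(1)])
      have wT: "w j x \<in> T x" if "j \<in> J" for j using tb that by (simp add: tbasis_def)
      have G: "gram_mat J (\<omega>t s x) (\<lambda>j. w j x) = ?G x" by (rule gram_local[OF a x(1) nz(2) tb])
      have "\<delta> x (E x) (w k' x) = rational_form b k x (E x) (w k' x)" if "k' \<in> J" for k'
        by (rule bD(4)[OF x(1) nz(3) E_tangent[OF reg_in[OF x(1)]] wT[OF that]])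
      then have bb: "(\<lambda>k'. if k' \<in> J then c * \<delta> x (E x) (w k' x) else 0) = ?b x" by auto
      show ?thesis unfolding Weq[OF x(1) tb] dual_vector_def G bb by (simp add: sum_component)
    qed
    moreover have "polyfun (\<lambda>x. h x * (g x * k x))" by (intro polyfun.mult wh aD bD)
    moreover have "h x0 * (g x0 * k x0) \<noteq> 0" using wh(2) aD(3) bD(3) by simp
    ultimately show "\<exists>f k. regat x0 f \<and> polyfun k \<and> k x0 \<noteq> 0 \<and> (\<forall>x\<in>R. k x \<noteq> 0 \<longrightarrow> W x $ i = f x)"
      using rf by (intro exI[of _ ?f] exI[of _ "\<lambda>x. h x * (g x * k x)"]) auto
  qed
  have "\<forall>i. \<exists>F. polyfun F \<and> (\<forall>x\<in>R. W x $ i = F x)"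
  proof
    fix i show "\<exists>F. polyfun F \<and> (\<forall>x\<in>R. W x $ i = F x)" by (rule hartogs[OF normal reg regq]) blast
  qed
  then obtain F where F: "\<And>i. polyfun (F i)" "\<And>i x. x \<in> R \<Longrightarrow> W x $ i = F i x" by metis
  define V where "V x = (\<chi> i. F i x)" for x
  have VW: "V x = W x" if "x \<in> R" for x using F(2)[OF that] by (simp add: V_def vec_eq_iff)
  have Vp: "pmap V" by (simp add: pmap_def V_def F(1))
  have "V x \<in> T x" if x: "x \<in> X" for x
    unfolding tangent_space_iff
  proof
    fix f assume f: "f \<in> vanishing X"
    then have pf: "polyfun f" by (simp add: vanishing_def)
    have "polyfun (\<lambda>x. dd f x (V x))" unfolding dd_def by (intro polyfun_sum polyfun.mult pmapD[OF Vp] polyfun_pd[OF pf])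
    then show "dd f x (V x) = 0"
      by (rule reg_dense[OF _ _ x]) (use W(1) VW f in \<open>auto simp: tangent_space_iff\<close>)
  qed
  then show ?thesis by (rule that[OF Vp]) (simp_all add: VW W(2))
qed

text \<open>V is invariant under the action: its transport and V itself represent the same
  functional, since all forms involved have weight l and E is invariant. Differentiation along an
  invariant field preserves weights.\<close>

lemma moser_field_weight:
  assumes s: "ratio s q \<noteq> 0" and V: "pmap V" "\<And>x. x \<in> X \<Longrightarrow> V x \<in> T x"
    "\<And>x v. x \<in> R \<Longrightarrow> v \<in> T x \<Longrightarrow> \<omega>t s x (V x) v = c * \<delta> x (E x) v" and f: "hom k f"
  shows "hom k (\<lambda>x. dd f x (V x))"
proof (rule hom_of_regular)
  have pf: "polyfun f" by (rule hom_polyfun[OF f])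
  show "polyfun (\<lambda>x. dd f x (V x))" unfolding dd_def by (intro polyfun_sum polyfun.mult pmapD[OF V(1)] polyfun_pd[OF pf])
  fix t x assume t: "t \<noteq> (0::complex)" and x: "x \<in> R"
  have xX: "x \<in> X" by (rule reg_in[OF x])
  have Vx: "V x \<in> T x" by (rule V(2)[OF xX])
  have "jac (S t) x (V x) = V (S t x)"
  proof (rule \<omega>t_unique[OF s S_reg[OF t x] jac_S_tangent[OF t Vx] V(2)[OF S_in[OF t xX]]])
    fix w assume "w \<in> T (S t x)"
    then obtain v where v: "v \<in> T x" "w = jac (S t) x v" using jac_S_surj[OF t xX] by blast
    have "\<omega>t s (S t x) (jac (S t) x (V x)) w = t powi l * \<omega>t s x (V x) v"
      using \<omega>t_wt[of s] t x Vx v unfolding wt_def by blast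
    also have "\<dots> = c * (t powi l * \<delta> x (E x) v)" by (simp add: V(3)[OF x v(1)])
    also have "t powi l * \<delta> x (E x) v = \<delta> (S t x) (jac (S t) x (E x)) w"
      using \<delta>_wt t x E_tangent[OF xX] v unfolding wt_def by simp
    also have "c * \<dots> = \<omega>t s (S t x) (V (S t x)) w"
      using V(3)[OF S_reg[OF t x] \<open>w \<in> T (S t x)\<close>] by (simp add: E_invariant[OF t xX])
    finally show "\<omega>t s (S t x) (jac (S t) x (V x)) w = \<omega>t s (S t x) (V (S t x)) w" .
  qed
  then have "dd f (S t x) (V (S t x)) = dd (\<lambda>x. f (S t x)) x (V x)" by (simp add: dd_compose_pmap[OF pf S_pmap])
  also have "\<dots> = dd (\<lambda>x. t powi k * f x) x (V x)"
    by (rule vanishing_pointwise_dd[OF polyfun_compose[OF pf pmapD[OF S_pmap]] polyfun.mult[OF polyfun.const pf] _ Vx])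
       (simp add: S_eq[OF t] homD[OF f _ t])
  also have "\<dots> = t powi k * dd f x (V x)" by (rule dd_cmult[OF pf])
  finally show "dd f (S t x) (V (S t x)) = t powi k * dd f x (V x)" .
qed

end

section \<open>Flows that are linear in suitable coordinates\<close>

definition fundamental :: "'a set \<Rightarrow> (real \<Rightarrow> 'a \<Rightarrow> 'a \<Rightarrow> complex) \<Rightarrow> (real \<Rightarrow> 'a \<Rightarrow> 'a \<Rightarrow> complex) \<Rightarrow>
    (real \<Rightarrow> 'a \<Rightarrow> 'a \<Rightarrow> complex) \<Rightarrow> bool" where
  "fundamental I M Y Z \<longleftrightarrow> (\<forall>a\<in>I. \<forall>b\<in>I. Y 0 a b = (if a = b then 1 else 0) \<and> Z 0 a b = (if a = b then 1 else 0)) \<and>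
    (\<forall>t\<in>{0..1}. \<forall>a\<in>I. \<forall>b\<in>I.
      ((\<lambda>t. Y t a b) has_vector_derivative (\<Sum>c\<in>I. Y t a c * M t c b)) (at t within {0..1}) \<and>
      ((\<lambda>t. Z t a b) has_vector_derivative (- (\<Sum>c\<in>I. M t a c * Z t c b))) (at t within {0..1}) \<and>
      (\<Sum>c\<in>I. Z t a c * Y t c b) = (if a = b then 1 else 0))"

text \<open>Y is solved for row by row and Z column by column. Their product is compared with the
  identity by uniqueness: W = Z Y - 1 satisfies the linear equation W' = W M - M W with W = 0 at
  time 0.\<close>

lemma fundamental_matrices:
  fixes M :: "real \<Rightarrow> 'a \<Rightarrow> 'a \<Rightarrow> complex"
  assumes I: "finite I" and cont: "\<And>a b. a \<in> I \<Longrightarrow> b \<in> I \<Longrightarrow> continuous_on {0..1} (\<lambda>t. M t a b)"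
  shows "\<exists>Y Z. fundamental I M Y Z"
proof -
  have "\<forall>r. \<exists>v. (\<forall>b\<in>I. v 0 b = (if r = b then 1 else 0)) \<and> (\<forall>t\<in>{0..1}. \<forall>b\<in>I.
      ((\<lambda>t. v t b) has_vector_derivative (\<Sum>c\<in>I. M t c b * v t c)) (at t within {0..1}))"
    by (intro allI linear_ode_exists[OF I, where K="\<lambda>t b c. M t c b"] cont)
  then obtain y where y: "\<And>r b. b \<in> I \<Longrightarrow> y r 0 b = (if r = b then 1 else 0)"
    "\<And>r t b. t \<in> {0..1} \<Longrightarrow> b \<in> I \<Longrightarrow> ((\<lambda>t. y r t b) has_vector_derivative (\<Sum>c\<in>I. M t c b * y r t c)) (at t within {0..1})"
    by metis
  have "\<forall>b. \<exists>v. (\<forall>a\<in>I. v 0 a = (if a = b then 1 else 0)) \<and> (\<forall>t\<in>{0..1}. \<forall>a\<in>I.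
      ((\<lambda>t. v t a) has_vector_derivative (\<Sum>c\<in>I. (- M t a c) * v t c)) (at t within {0..1}))"
    by (intro allI linear_ode_exists[OF I, where K="\<lambda>t a c. - M t a c"] continuous_intros cont)
  then obtain z where z: "\<And>a b. a \<in> I \<Longrightarrow> z b 0 a = (if a = b then 1 else 0)"
    "\<And>b t a. t \<in> {0..1} \<Longrightarrow> a \<in> I \<Longrightarrow> ((\<lambda>t. z b t a) has_vector_derivative (\<Sum>c\<in>I. (- M t a c) * z b t c)) (at t within {0..1})"
    by metis
  let ?Y = "\<lambda>t a b. y a t b" and ?Z = "\<lambda>t a b. z b t a"
  have Y': "((\<lambda>t. y a t b) has_vector_derivative (\<Sum>c\<in>I. y a t c * M t c b)) (at t within {0..1})"
    if "t \<in> {0..1}" "b \<in> I" for t a b using y(2)[OF that, of a] by (simp add: mult.commute)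
  have Z': "((\<lambda>t. z b t a) has_vector_derivative (- (\<Sum>c\<in>I. M t a c * z b t c))) (at t within {0..1})"
    if "t \<in> {0..1}" "a \<in> I" for t a b using z(2)[OF that, of b] by (simp add: sum_negf)
  define W where "W t ab = (\<Sum>c\<in>I. z c t (fst ab) * y c t (snd ab)) - (if fst ab = snd ab then 1 else 0)" for t ab
  \<comment> \<open>The linear operator W \<mapsto> W M - M W as a matrix indexed by pairs.\<close>
  define K where "K t ab cd = (if snd ab = snd cd then - M t (fst ab) (fst cd) else 0) +
    (if fst ab = fst cd then M t (snd cd) (snd ab) else 0)" for t and ab cd :: "'a \<times> 'a"
  have II: "finite (I \<times> I)" using I by simp
  have contK: "continuous_on {0..1} (\<lambda>t. K t ab cd)" if "ab \<in> I \<times> I" "cd \<in> I \<times> I" for ab cd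
  proof (cases "snd ab = snd cd"; cases "fst ab = fst cd")
  qed (use that in \<open>auto simp: K_def intro!: continuous_intros cont\<close>)
  obtain B where B: "\<And>ab cd t. ab \<in> I \<times> I \<Longrightarrow> cd \<in> I \<times> I \<Longrightarrow> t \<in> {0..1} \<Longrightarrow> norm (K t ab cd) \<le> B"
    using continuous_family_bounded[of "I \<times> I" K, OF II contK] by blast
  have KW: "(\<Sum>cd\<in>I\<times>I. K t (a, b) cd * w cd) = - (\<Sum>c\<in>I. M t a c * w (c, b)) + (\<Sum>d\<in>I. w (a, d) * M t d b)"
    if ab: "a \<in> I" "b \<in> I" for t a b and w :: "'a \<times> 'a \<Rightarrow> complex"
  proof -
    have "(\<Sum>cd\<in>I\<times>I. K t (a, b) cd * w cd) = (\<Sum>c\<in>I. \<Sum>d\<in>I. K t (a, b) (c, d) * w (c, d))"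
      by (simp add: sum.cartesian_product)
    also have "\<dots> = (\<Sum>c\<in>I. \<Sum>d\<in>I. (if d = b then - M t a c * w (c, d) else 0)) + (\<Sum>c\<in>I. \<Sum>d\<in>I. (if c = a then w (c, d) * M t d b else 0))"
      unfolding sum.distrib[symmetric] by (intro sum.cong refl) (auto simp: K_def algebra_simps)
    also have "(\<Sum>c\<in>I. \<Sum>d\<in>I. (if d = b then - M t a c * w (c, d) else 0)) = - (\<Sum>c\<in>I. M t a c * w (c, b))"
      using ab I by (simp add: sum_negf)
    also have "(\<Sum>c\<in>I. \<Sum>d\<in>I. (if c = a then w (c, d) * M t d b else 0)) = (\<Sum>d\<in>I. w (a, d) * M t d b)"
      using ab I by (subst sum.swap) simp
    finally show ?thesis .
  qed
  have W': "((\<lambda>t. W t ab) has_vector_derivative (\<Sum>cd\<in>I\<times>I. K t ab cd * W t cd)) (at t within {0..1})"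
    if t: "t \<in> {0..1}" and abI: "ab \<in> I \<times> I" for t ab
  proof -
    obtain a b where ab: "ab = (a, b)" "a \<in> I" "b \<in> I" using abI by auto
    have "((\<lambda>t. W t ab) has_vector_derivative
       (\<Sum>c\<in>I. z c t a * (\<Sum>d\<in>I. y c t d * M t d b) + - (\<Sum>d\<in>I. M t a d * z c t d) * y c t b) - 0) (at t within {0..1})"
      unfolding W_def ab fst_conv snd_conv using ab t
      by (intro has_vector_derivative_diff has_vector_derivative_sum has_vector_derivative_const has_vector_derivative_mult_complex Y' Z')
    moreover have "(\<Sum>c\<in>I. z c t a * (\<Sum>d\<in>I. y c t d * M t d b) + - (\<Sum>d\<in>I. M t a d * z c t d) * y c t b) - 0
      = (\<Sum>cd\<in>I\<times>I. K t ab cd * W t cd)"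
    proof -
      have "(\<Sum>c\<in>I. z c t a * (\<Sum>d\<in>I. y c t d * M t d b)) = (\<Sum>d\<in>I. (\<Sum>c\<in>I. z c t a * y c t d) * M t d b)"
        unfolding sum_distrib_left sum_distrib_right by (subst sum.swap) (simp add: mult.assoc)
      moreover have "(\<Sum>c\<in>I. (\<Sum>d\<in>I. M t a d * z c t d) * y c t b) = (\<Sum>d\<in>I. M t a d * (\<Sum>c\<in>I. z c t d * y c t b))"
        unfolding sum_distrib_left sum_distrib_right by (subst sum.swap) (simp add: mult.assoc)
      moreover have "(\<Sum>d\<in>I. (\<Sum>c\<in>I. z c t a * y c t d) * M t d b) = (\<Sum>d\<in>I. W t (a, d) * M t d b) + M t a b"
      proof -
        have "(\<Sum>d\<in>I. (\<Sum>c\<in>I. z c t a * y c t d) * M t d b) = (\<Sum>d\<in>I. W t (a, d) * M t d b + (if d = a then M t d b else 0))"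
          by (intro sum.cong refl) (auto simp: W_def algebra_simps)
        then show ?thesis using I ab by (simp add: sum.distrib)
      qed
      moreover have "(\<Sum>d\<in>I. M t a d * (\<Sum>c\<in>I. z c t d * y c t b)) = (\<Sum>d\<in>I. M t a d * W t (d, b)) + M t a b"
      proof -
        have "(\<Sum>d\<in>I. M t a d * (\<Sum>c\<in>I. z c t d * y c t b)) = (\<Sum>d\<in>I. M t a d * W t (d, b) + (if d = b then M t a d else 0))"
          by (intro sum.cong refl) (auto simp: W_def algebra_simps)
        then show ?thesis using I ab by (simp add: sum.distrib)
      qed
      ultimately show ?thesis using KW[OF ab(2,3), of t "W t"] by (simp add: ab(1) sum_subtractf)
    qed
    ultimately show ?thesis by simp
  qed
  have W0: "W 0 ab = 0" if abI: "ab \<in> I \<times> I" for ab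
  proof -
    obtain a b where ab: "ab = (a, b)" "a \<in> I" "b \<in> I" using abI by auto
    have "(\<Sum>c\<in>I. z c 0 a * y c 0 b) = (\<Sum>c\<in>I. if c = a then (if a = b then 1 else 0) else 0)"
      using ab by (intro sum.cong refl) (auto simp: y(1) z(1))
    then show ?thesis using ab I by (simp add: W_def)
  qed
  have W: "W t ab = 0" if "t \<in> {0..1}" "ab \<in> I \<times> I" for t ab
    by (rule linear_ode_zero[where v=W and K=K and I="I \<times> I" and B=B and ?t0.0=0, OF II W' B _ W0]) (use that in auto)
  have ZY: "(\<Sum>c\<in>I. z c t a * y c t b) = (if a = b then 1 else 0)" if "t \<in> {0..1}" "a \<in> I" "b \<in> I" for t a b
    using W[of t "(a, b)"] that by (simp add: W_def)
  show ?thesis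
    unfolding fundamental_def by (intro exI[of _ ?Y] exI[of _ ?Z] conjI ballI) (simp_all add: y(1) z(1) Y' Z' ZY)
qed

text \<open>For fixed b the entries Z t a b with a of a different weight than b form a linear system
  of their own, with initial value 0.\<close>

lemma linear_flow_block:
  fixes M Z :: "real \<Rightarrow> 'a \<Rightarrow> 'a \<Rightarrow> complex"
  assumes I: "finite I" and cont: "\<And>a b. a \<in> I \<Longrightarrow> b \<in> I \<Longrightarrow> continuous_on {0..1} (\<lambda>t. M t a b)"
    and Z0: "\<And>a b. a \<in> I \<Longrightarrow> b \<in> I \<Longrightarrow> Z 0 a b = (if a = b then 1 else 0)"
    and Z': "\<And>t a b. t \<in> {0..1} \<Longrightarrow> a \<in> I \<Longrightarrow> b \<in> I \<Longrightarrow>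
      ((\<lambda>t. Z t a b) has_vector_derivative (- (\<Sum>c\<in>I. M t a c * Z t c b))) (at t within {0..1})"
    and block: "\<And>t a b. k a \<noteq> k b \<Longrightarrow> M t a b = 0"
    and t: "t \<in> {0..1}" and ab: "a \<in> I" "b \<in> I" "k a \<noteq> k b"
  shows "Z t a b = 0"
proof -
  let ?J = "{a\<in>I. k a \<noteq> k b}"
  have J: "finite ?J" using I by simp
  have contJ: "continuous_on {0..1} (\<lambda>t. - M t a c)" if "a \<in> ?J" "c \<in> ?J" for a c
    using that by (auto intro!: continuous_intros cont)
  obtain B where B: "\<And>a c t. a \<in> ?J \<Longrightarrow> c \<in> ?J \<Longrightarrow> t \<in> {0..1} \<Longrightarrow> norm (- M t a c) \<le> B"
    using continuous_family_bounded[of ?J "\<lambda>t a c. - M t a c", OF J contJ] by blast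
  have D: "((\<lambda>t. Z t a b) has_vector_derivative (\<Sum>c\<in>?J. - M t a c * Z t c b)) (at t within {0..1})"
    if "t \<in> {0..1}" "a \<in> ?J" for t a
  proof -
    have "(\<Sum>c\<in>I. M t a c * Z t c b) = (\<Sum>c\<in>?J. M t a c * Z t c b)"
      using I block that by (intro sum.mono_neutral_right) auto
    then show ?thesis using Z'[of t a b] that ab by (simp add: sum_negf)
  qed
  show ?thesis
    by (rule linear_ode_zero[where v="\<lambda>t a. Z t a b" and K="\<lambda>t a c. - M t a c" and I="?J" and B=B and ?t0.0=0, OF J D B])
      (use Z0 ab t in auto)
qed

lemma lin_polyfun: assumes "\<And>g. g \<in> S \<Longrightarrow> polyfun g" "f \<in> lin S" shows "polyfun f"
  using assms unfolding lin_def by (auto intro!: polyfun_sum polyfun.mult polyfun.const)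

text \<open>The functions \<open>e a\<close> span a \<open>V\<close>-stable space of functions that generates the coordinate ring. Pulling back
  along the flow of \<open>V\<close> therefore amounts to \<open>e \<mapsto> Y e\<close> with \<open>Y' = Y M\<close>, and along its inverse
  to \<open>e \<mapsto> Z e\<close> with \<open>Z' = - M Z\<close>. That these linear substitutions respect the relations among the
  \<open>e a\<close> follows from uniqueness for the transport equation \<open>u' = V u\<close> in finite-dimensional spaces
  of functions.\<close>

locale linear_flow =
  fixes X :: "(complex^'n::finite) set" and I :: "'a set" and e :: "'a \<Rightarrow> complex^'n \<Rightarrow> complex"
    and b0 :: "'n \<Rightarrow> complex" and L :: "'n \<Rightarrow> 'a \<Rightarrow> complex"
    and V :: "real \<Rightarrow> complex^'n \<Rightarrow> complex^'n" and M :: "real \<Rightarrow> 'a \<Rightarrow> 'a \<Rightarrow> complex"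
  assumes closed: "zariski_closed X" and finI: "finite I" and e_poly: "\<And>a. a \<in> I \<Longrightarrow> polyfun (e a)"
    and coords: "\<And>x i. x \<in> X \<Longrightarrow> x $ i = b0 i + (\<Sum>a\<in>I. L i a * e a x)"
    and V_tangent: "\<And>t x. t \<in> {0..1} \<Longrightarrow> x \<in> X \<Longrightarrow> V t x \<in> tangent_space X x"
    and V_lin: "\<And>t x a. t \<in> {0..1} \<Longrightarrow> x \<in> X \<Longrightarrow> a \<in> I \<Longrightarrow> dd (e a) x (V t x) = (\<Sum>b\<in>I. M t a b * e b x)"
    and M_cont: "\<And>a b. a \<in> I \<Longrightarrow> b \<in> I \<Longrightarrow> continuous_on {0..1} (\<lambda>t. M t a b)"
begin

text \<open>The polynomial map obtained from \<open>coords\<close> by substituting for the e a their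
  images under the matrix A. That it preserves X, and that e a then transforms as prescribed, is
  proved only along the flow.\<close>

definition emap :: "('a \<Rightarrow> 'a \<Rightarrow> complex) \<Rightarrow> complex^'n \<Rightarrow> complex^'n" where
  "emap A x = (\<chi> i. b0 i + (\<Sum>a\<in>I. L i a * (\<Sum>b\<in>I. A a b * e b x)))"

lemma emap_pmap: "pmap (emap A)"
  unfolding pmap_def emap_def by (auto intro!: polyfun_sum polyfun.intros e_poly)

lemma coords_dd: assumes "v \<in> tangent_space X x" shows "v $ i = (\<Sum>a\<in>I. L i a * dd (e a) x v)"
proof -
  have "dd (\<lambda>x. x $ i) x v = dd (\<lambda>x. b0 i + (\<Sum>a\<in>I. L i a * e a x)) x v"
    by (rule vanishing_pointwise_dd[OF _ _ coords assms]) (auto intro!: polyfun_sum polyfun.intros e_poly)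
  then show ?thesis
    by (simp add: dd_plus dd_sum dd_cmult polyfun.const polyfun_sum polyfun.mult e_poly)
qed

lemma V_coords: "t \<in> {0..1} \<Longrightarrow> x \<in> X \<Longrightarrow> V t x $ i = (\<Sum>a\<in>I. L i a * (\<Sum>b\<in>I. M t a b * e b x))"
  using coords_dd[OF V_tangent] V_lin by simp

lemma jac_emap: "jac (emap A) x v = (\<chi> i. \<Sum>a\<in>I. L i a * (\<Sum>b\<in>I. A a b * dd (e b) x v))"
  unfolding jac_def emap_def
  by (simp add: dd_plus dd_sum dd_cmult polyfun.const polyfun_sum polyfun.mult e_poly)

lemma emap_derivative:
  assumes "\<And>a b. a \<in> I \<Longrightarrow> b \<in> I \<Longrightarrow> ((\<lambda>t. A t a b) has_vector_derivative A' a b) (at t within U)"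
  shows "((\<lambda>t. emap (A t) x) has_vector_derivative (\<chi> i. \<Sum>a\<in>I. L i a * (\<Sum>b\<in>I. A' a b * e b x))) (at t within U)"
proof (rule has_vector_derivative_vecI)
  fix i
  have "((\<lambda>t. b0 i + (\<Sum>a\<in>I. L i a * (\<Sum>b\<in>I. A t a b * e b x))) has_vector_derivative
     0 + (\<Sum>a\<in>I. L i a * (\<Sum>b\<in>I. A' a b * e b x))) (at t within U)"
    by (intro has_vector_derivative_add has_vector_derivative_const has_vector_derivative_sum
        has_vector_derivative_mult_right has_vector_derivative_mult_left assms)
  then show "((\<lambda>t. emap (A t) x $ i) has_vector_derivative (\<chi> i. \<Sum>a\<in>I. L i a * (\<Sum>b\<in>I. A' a b * e b x)) $ i) (at t within U)"
    by (simp add: emap_def)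
qed

lemma lin_product:
  assumes "finite S" "finite S'" "f \<in> lin S" "g \<in> lin S'"
  shows "(\<lambda>x. f x * g x) \<in> lin ((\<lambda>(g, h) x. g x * h x) ` (S \<times> S'))"
proof -
  obtain c d where f: "f = (\<lambda>x. \<Sum>g\<in>S. c g * g x)" and g: "g = (\<lambda>x. \<Sum>h\<in>S'. d h * h x)"
    using assms unfolding lin_def by blast
  have "(\<lambda>x. \<Sum>g\<in>S. c g * (\<Sum>h\<in>S'. d h * (g x * h x))) \<in> lin ((\<lambda>(g, h) x. g x * h x) ` (S \<times> S'))"
    using assms by (intro lin_sum lin_base) force+
  moreover have "(\<lambda>x. \<Sum>g\<in>S. c g * (\<Sum>h\<in>S'. d h * (g x * h x))) = (\<lambda>x. f x * g x)"
    unfolding f g sum_product by (intro ext sum.cong refl) (simp add: sum_distrib_left mult_ac)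
  ultimately show ?thesis by simp
qed

text \<open>One finite S serves for all matrices A, so that a family of pullbacks moves inside a
  fixed finite-dimensional space as time varies.\<close>

lemma emap_finite_dimensional:
  assumes "polyfun F"
  shows "\<exists>S. finite S \<and> (\<forall>g\<in>S. polyfun g) \<and> (\<forall>A. (\<lambda>x. F (emap A x)) \<in> lin S)"
  using assms
proof (induction rule: polyfun.induct)
  case (const c)
  have "(\<lambda>x. c) \<in> lin {\<lambda>x. 1}" using lin_scale[OF lin_base[of "{\<lambda>x. 1}" "\<lambda>x. 1"], of c] by simp
  then show ?case by (intro exI[of _ "{\<lambda>x. 1}"]) (auto intro: polyfun.const)
next
  case (coord i)
  let ?S = "insert (\<lambda>x. 1) (e ` I)"
  have fin: "finite ?S" using finI by simp
  have "(\<lambda>x. emap A x $ i) \<in> lin ?S" for A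
  proof -
    have "(\<lambda>x. b0 i * 1) \<in> lin ?S" by (rule lin_scale, rule lin_base) (use fin in auto)
    moreover have "(\<lambda>x. \<Sum>a\<in>I. L i a * (\<Sum>b\<in>I. A a b * e b x)) \<in> lin ?S"
      using fin by (intro lin_sum lin_base) auto
    ultimately show ?thesis using lin_add by (fastforce simp: emap_def)
  qed
  then show ?case using fin e_poly by (intro exI[of _ ?S]) (auto intro: polyfun.const)
next
  case (add f g)
  then obtain S S' where S: "finite S" "\<forall>g\<in>S. polyfun g" "\<And>A. (\<lambda>x. f (emap A x)) \<in> lin S"
    and S': "finite S'" "\<forall>g\<in>S'. polyfun g" "\<And>A. (\<lambda>x. g (emap A x)) \<in> lin S'" by blast
  have "(\<lambda>x. f (emap A x) + g (emap A x)) \<in> lin (S \<union> S')" for A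
    by (rule lin_add; rule lin_mono[OF _ _ S(3)] lin_mono[OF _ _ S'(3)]) (use S(1) S'(1) in auto)
  then show ?case using S S' by (intro exI[of _ "S \<union> S'"]) auto
next
  case (mult f g)
  then obtain S S' where S: "finite S" "\<forall>g\<in>S. polyfun g" "\<And>A. (\<lambda>x. f (emap A x)) \<in> lin S"
    and S': "finite S'" "\<forall>g\<in>S'. polyfun g" "\<And>A. (\<lambda>x. g (emap A x)) \<in> lin S'" by blast
  show ?case
    using lin_product[OF S(1) S'(1) S(3) S'(3)] S S'
    by (intro exI[of _ "(\<lambda>(g, h) x. g x * h x) ` (S \<times> S')"]) (auto intro: polyfun.mult)
qed

text \<open>Values at the interpolation points z i determine u t, and they satisfy a linear ordinary
  differential equation with continuous coefficients.\<close>

lemma transport_unique: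
  assumes S: "finite S" "\<And>g. g \<in> S \<Longrightarrow> polyfun g" and u: "\<And>t. u t \<in> lin S"
    and D: "\<And>t x. t \<in> {0..1} \<Longrightarrow> x \<in> X \<Longrightarrow> ((\<lambda>t. u t x) has_vector_derivative dd (u t) x (V t x)) (at t within {0..1})"
    and t0: "t0 \<in> {0..1}" "\<And>x. x \<in> X \<Longrightarrow> u t0 x = 0" and t: "t \<in> {0..1}" and x: "x \<in> X"
  shows "u t x = 0"
proof -
  obtain m :: nat and z d where z: "\<And>i. i < m \<Longrightarrow> z i \<in> X" "\<And>i. i < m \<Longrightarrow> d i \<in> lin S"
    and exp: "\<And>w y. w \<in> lin S \<Longrightarrow> y \<in> X \<Longrightarrow> w y = (\<Sum>i<m. w (z i) * d i y)"
    using interpolation_basis[OF S(1), of X] by blast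
  have pd: "polyfun (d i)" if "i < m" for i by (rule lin_polyfun[OF S(2) z(2)[OF that]])
  have pu: "polyfun (u t)" for t by (rule lin_polyfun[OF S(2) u])
  define K where "K t j i = dd (d i) (z j) (V t (z j))" for t j i
  have contV: "continuous_on {0..1} (\<lambda>t. V t y $ k)" if "y \<in> X" for y k
  proof -
    have "continuous_on {0..1} (\<lambda>t. \<Sum>a\<in>I. L k a * (\<Sum>b\<in>I. M t a b * e b y))"
      by (intro continuous_intros M_cont)
    then show ?thesis by (rule continuous_on_eq) (simp add: V_coords that)
  qed
  have contK: "continuous_on {0..1} (\<lambda>t. K t j i)" if "j \<in> {..<m}" "i \<in> {..<m}" for i j
    unfolding K_def dd_def using that z by (intro continuous_intros contV) auto
  obtain B where B: "\<And>j i t. j \<in> {..<m} \<Longrightarrow> i \<in> {..<m} \<Longrightarrow> t \<in> {0..1} \<Longrightarrow> norm (K t j i) \<le> B"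
    using continuous_family_bounded[of "{..<m}" K, OF finite_lessThan contK] by blast
  have D': "((\<lambda>t. u t (z j)) has_vector_derivative (\<Sum>i<m. K t j i * u t (z i))) (at t within {0..1})"
    if t: "t \<in> {0..1}" and j: "j \<in> {..<m}" for t j
  proof -
    have zj: "z j \<in> X" using j z by simp
    have "dd (u t) (z j) (V t (z j)) = dd (\<lambda>y. \<Sum>i<m. u t (z i) * d i y) (z j) (V t (z j))"
      by (rule vanishing_pointwise_dd[OF pu _ exp[OF u] V_tangent[OF t zj]]) (auto intro!: polyfun_sum polyfun.intros pd)
    also have "\<dots> = (\<Sum>i<m. dd (\<lambda>y. u t (z i) * d i y) (z j) (V t (z j)))"
      by (rule dd_sum) (auto intro!: polyfun.intros pd)
    also have "\<dots> = (\<Sum>i<m. K t j i * u t (z i))"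
      by (intro sum.cong refl) (rule trans[OF dd_cmult[OF pd]], auto simp: K_def)
    finally show ?thesis using D[OF t zj] by simp
  qed
  have "u t (z i) = 0" if "i \<in> {..<m}" for i
    by (rule linear_ode_zero[where v="\<lambda>t i. u t (z i)" and K=K and I="{..<m}" and B=B and ?t0.0=t0, OF _ D' B])
      (use t0 t that z in auto)
  then show ?thesis using exp[OF u x] by simp
qed

lemma flow_exists:
  shows "\<exists>Z \<phi>. (\<forall>a\<in>I. \<forall>b\<in>I. Z 0 a b = (if a = b then 1 else 0)) \<and>
    (\<forall>t\<in>{0..1}. \<forall>a\<in>I. \<forall>b\<in>I. ((\<lambda>t. Z t a b) has_vector_derivative (- (\<Sum>c\<in>I. M t a c * Z t c b))) (at t within {0..1})) \<and>
    (\<forall>t\<in>{0..1}. pmap (\<phi> t) \<and> (\<forall>x\<in>X. emap (Z t) x \<in> X \<and> \<phi> t x \<in> X \<and> \<phi> t (emap (Z t) x) = x \<and> emap (Z t) (\<phi> t x) = x \<and>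
      (\<forall>a\<in>I. e a (emap (Z t) x) = (\<Sum>b\<in>I. Z t a b * e b x))))"
proof -
  obtain Y Z where fund: "fundamental I M Y Z" using fundamental_matrices[of I M, OF finI M_cont] by blast
  have init: "\<And>a b. a \<in> I \<Longrightarrow> b \<in> I \<Longrightarrow> Y 0 a b = (if a = b then 1 else 0)"
      "\<And>a b. a \<in> I \<Longrightarrow> b \<in> I \<Longrightarrow> Z 0 a b = (if a = b then 1 else 0)"
    and Y': "\<And>t a b. t \<in> {0..1} \<Longrightarrow> a \<in> I \<Longrightarrow> b \<in> I \<Longrightarrow> ((\<lambda>t. Y t a b) has_vector_derivative (\<Sum>c\<in>I. Y t a c * M t c b)) (at t within {0..1})"
    and Z': "\<And>t a b. t \<in> {0..1} \<Longrightarrow> a \<in> I \<Longrightarrow> b \<in> I \<Longrightarrow> ((\<lambda>t. Z t a b) has_vector_derivative (- (\<Sum>c\<in>I. M t a c * Z t c b))) (at t within {0..1})"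
    and ZY: "\<And>t a b. t \<in> {0..1} \<Longrightarrow> a \<in> I \<Longrightarrow> b \<in> I \<Longrightarrow> (\<Sum>c\<in>I. Z t a c * Y t c b) = (if a = b then 1 else 0)"
    using fund unfolding fundamental_def by blast+
  define \<phi> where "\<phi> t = emap (Y t)" for t
  have eY: "(\<Sum>b\<in>I. Y 0 a b * e b x) = e a x" if "a \<in> I" for a x
  proof -
    have "(\<Sum>b\<in>I. Y 0 a b * e b x) = (\<Sum>b\<in>I. if b = a then e b x else 0)" using that init by (intro sum.cong) auto
    then show ?thesis using that finI by simp
  qed
  have \<phi>0: "\<phi> 0 x = x" if "x \<in> X" for x
    using coords[OF that] eY by (simp add: \<phi>_def emap_def vec_eq_iff)
  \<comment> \<open>In Y' = Y M the matrix M stands next to the functions e, where it acts as V;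
    hence the time derivative of a pullback along \<phi> is V applied to it.\<close>
  have transport: "((\<lambda>t. F (\<phi> t x)) has_vector_derivative dd (\<lambda>x. F (\<phi> t x)) x (V t x)) (at t within {0..1})"
    if F: "polyfun F" and t: "t \<in> {0..1}" and x: "x \<in> X" for F t x
  proof -
    have "(\<Sum>b\<in>I. (\<Sum>c\<in>I. Y t a c * M t c b) * e b x) = (\<Sum>c\<in>I. Y t a c * dd (e c) x (V t x))" for a
    proof -
      have "(\<Sum>b\<in>I. (\<Sum>c\<in>I. Y t a c * M t c b) * e b x) = (\<Sum>c\<in>I. Y t a c * (\<Sum>b\<in>I. M t c b * e b x))"
        unfolding sum_distrib_left sum_distrib_right by (subst sum.swap) (simp add: mult.assoc)
      then show ?thesis using V_lin[OF t x] by simp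
    qed
    then have "((\<lambda>t. \<phi> t x) has_vector_derivative jac (\<phi> t) x (V t x)) (at t within {0..1})"
      using emap_derivative[where A=Y and A'="\<lambda>a b. \<Sum>c\<in>I. Y t a c * M t c b" and t=t and U="{0..1}" and x=x, OF Y'[OF t]]
      unfolding \<phi>_def jac_emap by simp
    from polyfun_along_curve[OF F this] show ?thesis
      using dd_compose_pmap[OF F, of "\<phi> t" x "V t x"] emap_pmap[of "Y t"] by (simp add: \<phi>_def)
  qed
  have zero: "F (\<phi> t x) = 0"
    if F: "polyfun F" and s: "s \<in> {0..1}" "\<And>x. x \<in> X \<Longrightarrow> F (\<phi> s x) = 0" and t: "t \<in> {0..1}" "x \<in> X" for F s t x
  proof -
    obtain S where S: "finite S" "\<And>g. g \<in> S \<Longrightarrow> polyfun g" "\<And>A. (\<lambda>x. F (emap A x)) \<in> lin S"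
      using emap_finite_dimensional[OF F] by blast
    show ?thesis
      by (rule transport_unique[where u="\<lambda>t x. F (\<phi> t x)", OF S(1,2) _ transport[OF F] s t]) (use S(3) in \<open>auto simp: \<phi>_def\<close>)
  qed
  \<comment> \<open>An equation F of X, pulled back along \<phi>, solves the transport equation and
    vanishes at time 0.\<close>
  have \<phi>_in: "\<phi> t x \<in> X" if "t \<in> {0..1}" "x \<in> X" for t x
  proof (rule zariski_closed_vanishing[OF closed])
    fix F assume F: "F \<in> vanishing X"
    show "F (\<phi> t x) = 0" by (rule zero[of F 0]) (use F that \<phi>0 in \<open>auto simp: vanishing_def\<close>)
  qed
  have e\<phi>: "e a (\<phi> t x) = (\<Sum>b\<in>I. Y t a b * e b x)" if a: "a \<in> I" and t: "t \<in> {0..1}" and x: "x \<in> X" for a t x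
  proof -
    obtain S where S: "finite S" "\<And>g. g \<in> S \<Longrightarrow> polyfun g" "\<And>A. (\<lambda>x. e a (emap A x)) \<in> lin S"
      using emap_finite_dimensional[OF e_poly[OF a]] by blast
    \<comment> \<open>The defect between the pullback of e a and its linear expression solves the
      transport equation with value 0 at time 0.\<close>
    let ?u = "\<lambda>t x. e a (\<phi> t x) + (\<Sum>b\<in>I. (- Y t a b) * e b x)"
    have fin: "finite (S \<union> e ` I)" using S(1) finI by simp
    have "?u t x = 0"
    proof (rule transport_unique[where u="?u", OF fin _ _ _ _ _ t x, where ?t0.0=0])
      show "\<And>g. g \<in> S \<union> e ` I \<Longrightarrow> polyfun g" using S(2) e_poly by auto
      show "?u t \<in> lin (S \<union> e ` I)" for t
      proof (rule lin_add)
        show "(\<lambda>x. e a (\<phi> t x)) \<in> lin (S \<union> e ` I)" unfolding \<phi>_def by (rule lin_mono[OF _ fin S(3)]) simp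
        show "(\<lambda>x. \<Sum>b\<in>I. (- Y t a b) * e b x) \<in> lin (S \<union> e ` I)" by (intro lin_sum lin_base fin) auto
      qed
      show "?u 0 x = 0" if "x \<in> X" for x using eY[OF a, of x] \<phi>0[OF that] by (simp add: sum_negf)
      fix t x assume t: "t \<in> {0..1::real}" and x: "x \<in> X"
      have "((\<lambda>t. ?u t x) has_vector_derivative dd (\<lambda>x. e a (\<phi> t x)) x (V t x) + (\<Sum>b\<in>I. (- (\<Sum>c\<in>I. Y t a c * M t c b)) * e b x)) (at t within {0..1})"
        by (intro has_vector_derivative_add transport[OF e_poly[OF a] t x] has_vector_derivative_sum
            has_vector_derivative_mult_left has_vector_derivative_minus Y' t a)
      moreover have "(\<Sum>b\<in>I. (- (\<Sum>c\<in>I. Y t a c * M t c b)) * e b x) = dd (\<lambda>x. \<Sum>b\<in>I. (- Y t a b) * e b x) x (V t x)"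
      proof -
        have "(\<Sum>b\<in>I. (\<Sum>c\<in>I. Y t a c * M t c b) * e b x) = (\<Sum>c\<in>I. Y t a c * (\<Sum>b\<in>I. M t c b * e b x))"
          unfolding sum_distrib_left sum_distrib_right by (subst sum.swap) (simp add: mult.assoc)
        moreover have "dd (\<lambda>x. \<Sum>b\<in>I. (- Y t a b) * e b x) x (V t x) = (\<Sum>b\<in>I. dd (\<lambda>x. (- Y t a b) * e b x) x (V t x))"
          by (rule dd_sum, rule polyfun.mult, rule polyfun.const, rule e_poly)
        moreover have "\<dots> = (\<Sum>c\<in>I. - (Y t a c * (\<Sum>b\<in>I. M t c b * e b x)))"
          by (intro sum.cong refl) (simp only: dd_cmult[OF e_poly] V_lin[OF t x] minus_mult_left)
        ultimately show ?thesis by (simp add: sum_negf)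
      qed
      moreover have "polyfun (\<lambda>x. e a (\<phi> t x))"
        unfolding \<phi>_def by (rule polyfun_compose[OF e_poly[OF a] pmapD[OF emap_pmap]])
      moreover have "polyfun (\<lambda>x. \<Sum>b\<in>I. (- Y t a b) * e b x)"
        by (intro polyfun_sum polyfun.mult polyfun.const e_poly)
      ultimately show "((\<lambda>t. ?u t x) has_vector_derivative dd (?u t) x (V t x)) (at t within {0..1})" by (simp only: dd_plus)
    qed simp
    then show ?thesis by (simp add: sum_negf)
  qed
  have ZYe: "(\<Sum>b\<in>I. Z t a b * e b (\<phi> t x)) = e a x" if a: "a \<in> I" and t: "t \<in> {0..1}" "x \<in> X" for a t x
  proof -
    have "(\<Sum>b\<in>I. Z t a b * e b (\<phi> t x)) = (\<Sum>b\<in>I. Z t a b * (\<Sum>c\<in>I. Y t b c * e c x))" using e\<phi>[OF _ t] by simp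
    also have "\<dots> = (\<Sum>c\<in>I. (\<Sum>b\<in>I. Z t a b * Y t b c) * e c x)"
      unfolding sum_distrib_left sum_distrib_right by (subst sum.swap) (simp add: mult.assoc)
    also have "\<dots> = (\<Sum>c\<in>I. if c = a then e c x else 0)" using ZY[OF t(1) a] by (intro sum.cong) auto
    finally show ?thesis using a finI by simp
  qed
  have left: "emap (Z t) (\<phi> t x) = x" if t: "t \<in> {0..1}" "x \<in> X" for t x
    using ZYe[OF _ t] coords[OF t(2)] by (simp add: emap_def vec_eq_iff)
  \<comment> \<open>Uniqueness run backwards from time t to time 0: pullback along \<phi> t is
    injective on functions on X. Statements on \<open>emap (Z t)\<close> are then checked after
    composition with \<phi> t, where \<open>left\<close> applies.\<close>
  have faithful: "F x = 0" if F: "polyfun F" and t: "t \<in> {0..1}" and 0: "\<And>x. x \<in> X \<Longrightarrow> F (\<phi> t x) = 0" and x: "x \<in> X" for F t x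
    using zero[OF F t 0, of 0 x] x \<phi>0[OF x] by simp
  have \<psi>_in: "emap (Z t) x \<in> X" if t: "t \<in> {0..1}" "x \<in> X" for t x
  proof (rule zariski_closed_vanishing[OF closed])
    fix F assume F: "F \<in> vanishing X"
    show "F (emap (Z t) x) = 0"
    proof (rule faithful[where F="\<lambda>x. F (emap (Z t) x)", OF _ t(1) _ t(2)])
      show "polyfun (\<lambda>x. F (emap (Z t) x))" using F by (auto simp: vanishing_def intro: polyfun_compose pmapD[OF emap_pmap])
    qed (use F t(1) left in \<open>auto simp: vanishing_def\<close>)
  qed
  have e\<psi>: "e a (emap (Z t) x) = (\<Sum>b\<in>I. Z t a b * e b x)" if a: "a \<in> I" and t: "t \<in> {0..1}" "x \<in> X" for a t x
  proof -
    have "e a (emap (Z t) x) - (\<Sum>b\<in>I. Z t a b * e b x) = 0"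
    proof (rule faithful[where F="\<lambda>x. e a (emap (Z t) x) - (\<Sum>b\<in>I. Z t a b * e b x)", OF _ t(1) _ t(2)])
      show "polyfun (\<lambda>x. e a (emap (Z t) x) - (\<Sum>b\<in>I. Z t a b * e b x))"
        by (intro polyfun_diff polyfun_compose[OF e_poly[OF a] pmapD[OF emap_pmap]] polyfun_sum polyfun.mult polyfun.const e_poly)
    qed (use left[OF t(1)] ZYe[OF a t(1)] in auto)
    then show ?thesis by simp
  qed
  have right: "\<phi> t (emap (Z t) x) = x" if t: "t \<in> {0..1}" "x \<in> X" for t x
  proof -
    have "\<phi> t (emap (Z t) x) $ i - x $ i = 0" for i
    proof (rule faithful[where F="\<lambda>x. \<phi> t (emap (Z t) x) $ i - x $ i", OF _ t(1) _ t(2)])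
      show "polyfun (\<lambda>x. \<phi> t (emap (Z t) x) $ i - x $ i)"
        unfolding \<phi>_def by (intro polyfun_diff polyfun.coord pmapD[OF pmap_compose[OF emap_pmap emap_pmap]])
    qed (use left[OF t(1)] in auto)
    then show ?thesis by (simp add: vec_eq_iff)
  qed
  have \<phi>p: "pmap (\<phi> t)" for t by (simp add: \<phi>_def emap_pmap)
  show ?thesis
    by (intro exI[of _ Z] exI[of _ \<phi>] conjI ballI) (simp_all add: init Z' \<phi>p \<psi>_in \<phi>_in right left e\<psi>)
qed

end

section \<open>Moser isotopy\<close>

text \<open>The arcs from 0 to 1 for different values of \<kappa> meet only at their ends, so each
  root rules out at most one value.\<close>

lemma path_avoiding_roots:
  fixes P :: "complex poly"
  assumes "poly P 0 \<noteq> 0" "poly P 1 \<noteq> 0"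
  shows "\<exists>\<kappa>::real. \<forall>t\<in>{0..1}. poly P (of_real t + \<i> * of_real (\<kappa> * t * (1 - t))) \<noteq> 0"
proof -
  have "P \<noteq> 0" using assms(1) by auto
  \<comment> \<open>Solving for \<kappa> at a root. For real part 0 or 1 the quotient is 0 by the
    convention for division by zero, which merely excludes one more value.\<close>
  then have "finite ((\<lambda>z. Im z / (Re z * (1 - Re z))) ` {z. poly P z = 0})" by (simp add: poly_roots_finite)
  then obtain \<kappa> where \<kappa>: "\<kappa> \<notin> (\<lambda>z. Im z / (Re z * (1 - Re z))) ` {z. poly P z = 0}"
    using ex_new_if_finite[OF infinite_UNIV_char_0] by blast
  have "poly P (of_real t + \<i> * of_real (\<kappa> * t * (1 - t))) \<noteq> 0" if t: "t \<in> {0..1}" for t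
  proof (cases "t = 0 \<or> t = 1")
    case True
    then show ?thesis using assms by auto
  next
    case False
    show ?thesis
    proof
      let ?z = "of_real t + \<i> * of_real (\<kappa> * t * (1 - t))"
      assume "poly P ?z = 0"
      then have "Im ?z / (Re ?z * (1 - Re ?z)) \<in> (\<lambda>z. Im z / (Re z * (1 - Re z))) ` {z. poly P z = 0}" by blast
      moreover have "Im ?z / (Re ?z * (1 - Re ?z)) = \<kappa>" using False by simp
      ultimately show False using \<kappa> by simp
    qed
  qed
  then show ?thesis by blast
qed

lemma continuous_on_det:
  fixes A :: "'b::topological_space \<Rightarrow> complex^'n^'n"
  assumes "\<And>i j. continuous_on U (\<lambda>t. A t $ i $ j)"
  shows "continuous_on U (\<lambda>t. det (A t))"
  unfolding det_def by (intro continuous_intros assms)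

lemma continuous_on_dual_vector:
  fixes Q :: "'n \<Rightarrow> complex^'n"
  assumes B: "\<And>u v. continuous_on U (\<lambda>t. B t u v)" and \<beta>: "\<And>v. continuous_on U (\<lambda>t. \<beta> t v)"
    and d: "\<And>t. t \<in> U \<Longrightarrow> det (gram_mat J (B t) Q) \<noteq> 0"
  shows "continuous_on U (\<lambda>t. dual_vector J (B t) (\<beta> t) Q $ i)"
proof -
  have G: "continuous_on U (\<lambda>t. gram_mat J (B t) Q $ j $ k)" for j k
    by (cases "j \<in> J \<and> k \<in> J") (auto simp: gram_mat_def B)
  have b: "continuous_on U (\<lambda>t. if k \<in> J then \<beta> t (Q k) else 0)" for k by (cases "k \<in> J") (auto simp: \<beta>)
  have "continuous_on U (\<lambda>t. (\<chi> i k. if k = j then (if i \<in> J then \<beta> t (Q i) else 0) else gram_mat J (B t) Q $ k $ i) $ i' $ k')" for j i' k'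
    using G[of k' i'] b[of i'] by (cases "k' = j") auto
  then have "continuous_on U (\<lambda>t. solv (gram_mat J (B t) Q) (\<lambda>k. if k \<in> J then \<beta> t (Q k) else 0) j)" for j
    unfolding solv_def by (intro continuous_on_divide continuous_on_det G ballI d)
  then show ?thesis unfolding dual_vector_def sum_component vector_smult_component
    by (intro continuous_intros)
qed

text \<open>Here \<open>emap (Z t)\<close> is the flow of - V and \<phi> t its inverse, which
  secures that regular points stay regular along the isotopy.\<close>

locale moser_flow = moser X \<sigma> p q C N J \<omega> \<omega>' l + linear_flow X I e b0 L V M
  for X \<sigma> p q C N J \<omega> \<omega>' l I e b0 L V M +
  fixes \<tau> \<tau>' :: "real \<Rightarrow> complex" and Z \<phi>
  assumes \<tau>: "\<And>t. t \<in> {0..1} \<Longrightarrow> (\<tau> has_vector_derivative \<tau>' t) (at t within {0..1})" "\<tau> 0 = 0" "\<tau> 1 = 1"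
    and V_pmap: "\<And>t. t \<in> {0..1} \<Longrightarrow> pmap (V t)"
    and V_eq: "\<And>t x v. t \<in> {0..1} \<Longrightarrow> x \<in> R \<Longrightarrow> v \<in> T x \<Longrightarrow> \<omega>t (\<tau> t) x (V t x) v = \<tau>' t / of_int l * \<delta> x (E x) v"
    and Z0: "\<And>a b. a \<in> I \<Longrightarrow> b \<in> I \<Longrightarrow> Z 0 a b = (if a = b then 1 else 0)"
    and Z': "\<And>t a b. t \<in> {0..1} \<Longrightarrow> a \<in> I \<Longrightarrow> b \<in> I \<Longrightarrow>
      ((\<lambda>t. Z t a b) has_vector_derivative (- (\<Sum>c\<in>I. M t a c * Z t c b))) (at t within {0..1})"
    and \<phi>_pmap: "\<And>t. t \<in> {0..1} \<Longrightarrow> pmap (\<phi> t)"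
    and \<psi>_in: "\<And>t x. t \<in> {0..1} \<Longrightarrow> x \<in> X \<Longrightarrow> emap (Z t) x \<in> X" and \<phi>_in: "\<And>t x. t \<in> {0..1} \<Longrightarrow> x \<in> X \<Longrightarrow> \<phi> t x \<in> X"
    and \<phi>\<psi>: "\<And>t x. t \<in> {0..1} \<Longrightarrow> x \<in> X \<Longrightarrow> \<phi> t (emap (Z t) x) = x"
    and \<psi>\<phi>: "\<And>t x. t \<in> {0..1} \<Longrightarrow> x \<in> X \<Longrightarrow> emap (Z t) (\<phi> t x) = x"
    and e\<psi>: "\<And>t x a. t \<in> {0..1} \<Longrightarrow> x \<in> X \<Longrightarrow> a \<in> I \<Longrightarrow> e a (emap (Z t) x) = (\<Sum>b\<in>I. Z t a b * e b x)"
begin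

lemma \<psi>_reg: "t \<in> {0..1} \<Longrightarrow> x \<in> R \<Longrightarrow> emap (Z t) x \<in> R"
  by (rule automorphism_regular_locus[OF emap_pmap \<psi>_in \<phi>_pmap \<phi>_in \<phi>\<psi> \<psi>\<phi>])

lemma MZ_reassoc: "(\<Sum>b\<in>I. - (\<Sum>c\<in>I. M t a c * Z t c b) * f b) = - (\<Sum>c\<in>I. M t a c * (\<Sum>b\<in>I. Z t c b * f b))"
proof -
  have "(\<Sum>b\<in>I. (\<Sum>c\<in>I. M t a c * Z t c b) * f b) = (\<Sum>c\<in>I. M t a c * (\<Sum>b\<in>I. Z t c b * f b))"
    unfolding sum_distrib_left sum_distrib_right by (subst sum.swap) (simp add: mult.assoc)
  then show ?thesis by (simp add: sum_negf)
qed

lemma \<psi>_derivative: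
  assumes t: "t \<in> {0..1}" and y: "y \<in> X"
  shows "((\<lambda>t. emap (Z t) y) has_vector_derivative - V t (emap (Z t) y)) (at t within {0..1})"
proof -
  have "(\<chi> i. \<Sum>a\<in>I. L i a * (\<Sum>b\<in>I. - (\<Sum>c\<in>I. M t a c * Z t c b) * e b y)) = - V t (emap (Z t) y)"
    unfolding MZ_reassoc vec_eq_iff using V_coords[OF t \<psi>_in[OF t y]] e\<psi>[OF t y] by (simp add: sum_negf)
  then show ?thesis
    using emap_derivative[where A=Z and A'="\<lambda>a b. - (\<Sum>c\<in>I. M t a c * Z t c b)" and t=t and U="{0..1}" and x=y, OF Z'[OF t]] by simp
qed

lemma jac_\<psi>_tangent: "t \<in> {0..1} \<Longrightarrow> u \<in> T y \<Longrightarrow> jac (emap (Z t)) y u \<in> T (emap (Z t) y)"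
  by (rule jac_tangent[OF emap_pmap \<psi>_in])

lemma jac_\<psi>_derivative:
  assumes t: "t \<in> {0..1}" and y: "y \<in> X" and u: "u \<in> T y"
  shows "((\<lambda>t. jac (emap (Z t)) y u $ i) has_vector_derivative (- jac (V t) (emap (Z t) y) (jac (emap (Z t)) y u)) $ i) (at t within {0..1})"
proof -
  let ?x = "emap (Z t) y" and ?u = "jac (emap (Z t)) y u"
  have de: "dd (e c) ?x ?u = (\<Sum>b\<in>I. Z t c b * dd (e b) y u)" if c: "c \<in> I" for c
  proof -
    have "dd (e c) ?x ?u = dd (\<lambda>x. e c (emap (Z t) x)) y u" by (simp add: dd_compose_pmap[OF e_poly[OF c] emap_pmap])
    also have "\<dots> = dd (\<lambda>x. \<Sum>b\<in>I. Z t c b * e b x) y u"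
      by (rule vanishing_pointwise_dd[OF polyfun_compose[OF e_poly[OF c] pmapD[OF emap_pmap]] _ e\<psi>[OF t _ c] u])
         (auto intro!: polyfun_sum polyfun.intros e_poly)
    finally show ?thesis by (simp add: dd_sum dd_cmult polyfun.mult polyfun.const e_poly)
  qed
  have "jac (V t) ?x ?u $ i = dd (\<lambda>x. V t x $ i) ?x ?u" by (simp add: jac_def)
  also have "\<dots> = dd (\<lambda>x. \<Sum>a\<in>I. L i a * (\<Sum>b\<in>I. M t a b * e b x)) ?x ?u"
    by (rule vanishing_pointwise_dd[OF pmapD[OF V_pmap[OF t]] _ V_coords[OF t] jac_\<psi>_tangent[OF t u]])
       (auto intro!: polyfun_sum polyfun.intros e_poly)
  also have "\<dots> = (\<Sum>a\<in>I. L i a * (\<Sum>c\<in>I. M t a c * dd (e c) ?x ?u))"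
    by (simp add: dd_sum dd_cmult polyfun_sum polyfun.mult polyfun.const e_poly)
  also have "\<dots> = (\<Sum>a\<in>I. L i a * (\<Sum>c\<in>I. M t a c * (\<Sum>b\<in>I. Z t c b * dd (e b) y u)))" by (simp add: de)
  finally have *: "(- jac (V t) ?x ?u) $ i = (\<Sum>a\<in>I. L i a * (\<Sum>b\<in>I. - (\<Sum>c\<in>I. M t a c * Z t c b) * dd (e b) y u))"
    unfolding MZ_reassoc by (simp add: sum_negf)
  show ?thesis unfolding * unfolding jac_emap vec_lambda_beta
    by (intro has_vector_derivative_sum has_vector_derivative_mult_right has_vector_derivative_mult_left Z' t)
qed

text \<open>Freeze the form at time t0: moving the point contributes - \<tau>' \<delta> by
  \<open>moser_lie\<close>, while the change of the form is (\<tau> t - \<tau> t0) \<delta> and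
  contributes + \<tau>' \<delta>.\<close>

lemma form_constant_along_flow:
  assumes y: "y \<in> R" and u: "u \<in> T y" and v: "v \<in> T y" and t0: "t0 \<in> {0..1}"
  shows "((\<lambda>t. \<omega>t (\<tau> t) (emap (Z t) y) (jac (emap (Z t)) y u) (jac (emap (Z t)) y v)) has_vector_derivative 0) (at t0 within {0..1})"
proof -
  define \<gamma> where "\<gamma> t = emap (Z t) y" for t
  define u1 where "u1 t = jac (emap (Z t)) y u" for t
  define v1 where "v1 t = jac (emap (Z t)) y v" for t
  have yX: "y \<in> X" by (rule reg_in[OF y])
  have \<gamma>R: "\<gamma> t \<in> R" and u1T: "u1 t \<in> T (\<gamma> t)" and v1T: "v1 t \<in> T (\<gamma> t)" if "t \<in> {0..1}" for t
    unfolding \<gamma>_def u1_def v1_def using that y u v by (blast intro: \<psi>_reg jac_\<psi>_tangent)+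
  obtain a g where ag: "local_expression X (\<omega>t (\<tau> t0)) (\<gamma> t0) a g"
    "\<And>u v w. u \<in> T (\<gamma> t0) \<Longrightarrow> v \<in> T (\<gamma> t0) \<Longrightarrow> w \<in> T (\<gamma> t0) \<Longrightarrow> ext_deriv (rational_form a g) (\<gamma> t0) u v w = 0"
    using \<omega>t_closed[of "\<tau> t0"] \<gamma>R[OF t0] unfolding closed_two_form_def by blast
  obtain b k where bk: "local_expression X \<delta> (\<gamma> t0) b k"
    "\<And>u v w. u \<in> T (\<gamma> t0) \<Longrightarrow> v \<in> T (\<gamma> t0) \<Longrightarrow> w \<in> T (\<gamma> t0) \<Longrightarrow> ext_deriv (rational_form b k) (\<gamma> t0) u v w = 0"
    using \<delta>_closed \<gamma>R[OF t0] unfolding closed_two_form_def by blast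
  note agD = local_expressionD[OF ag(1)] and bkD = local_expressionD[OF bk(1)]
  have D\<gamma>: "(\<gamma> has_vector_derivative - V t0 (\<gamma> t0)) (at t0 within {0..1})"
    unfolding \<gamma>_def by (rule \<psi>_derivative[OF t0 yX])
  have Du: "((\<lambda>t. u1 t $ i) has_vector_derivative (- jac (V t0) (\<gamma> t0) (u1 t0)) $ i) (at t0 within {0..1})" for i
    unfolding \<gamma>_def u1_def by (rule jac_\<psi>_derivative[OF t0 yX u])
  have Dv: "((\<lambda>t. v1 t $ i) has_vector_derivative (- jac (V t0) (\<gamma> t0) (v1 t0)) $ i) (at t0 within {0..1})" for i
    unfolding \<gamma>_def v1_def by (rule jac_\<psi>_derivative[OF t0 yX v])
  have neg: "rational_form a g x (- w) w' = - rational_form a g x w w'" "rational_form a g x w (- w') = - rational_form a g x w w'" for x w w'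
    by (simp_all add: rational_form_def sum_negf[symmetric] algebra_simps)
  have dneg: "drv (\<lambda>x. rational_form a g x w w') (\<gamma> t0) (- z) = - drv (\<lambda>x. rational_form a g x w w') (\<gamma> t0) z" for w w' z
    by (rule linear_neg[OF has_derivative_linear[OF regat_has_derivative[OF regat_rational_form_const[OF agD(1-3)]]]])
  have "lie (rational_form a g) (V t0) (\<gamma> t0) (u1 t0) (v1 t0) = \<tau>' t0 / of_int l * of_int l * \<delta> (\<gamma> t0) (u1 t0) (v1 t0)"
    by (rule moser_lie[OF ag \<delta>_wt bk V_pmap[OF t0] V_tangent[OF t0] V_eq[OF t0] \<gamma>R[OF t0] u1T[OF t0] v1T[OF t0]])
  then have lie: "lie (rational_form a g) (V t0) (\<gamma> t0) (u1 t0) (v1 t0) = \<tau>' t0 * \<delta> (\<gamma> t0) (u1 t0) (v1 t0)" using l0 by simp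
  let ?f = "\<lambda>t. rational_form a g (\<gamma> t) (u1 t) (v1 t)" and ?h = "\<lambda>t. rational_form b k (\<gamma> t) (u1 t) (v1 t)"
  have Df: "(?f has_vector_derivative - (\<tau>' t0 * \<delta> (\<gamma> t0) (u1 t0) (v1 t0))) (at t0 within {0..1})"
    using form_along_curve[where a=a and g=g, OF agD(1-3) D\<gamma> Du Dv] unfolding lie[symmetric]
    by (simp add: lie_def neg dneg jac_def algebra_simps)
  have Dh: "\<exists>h'. (?h has_vector_derivative h') (at t0 within {0..1})"
    using form_along_curve[where a=b and g=k, OF bkD(1-3) D\<gamma> Du Dv] by blast
  then obtain h' where Dh: "(?h has_vector_derivative h') (at t0 within {0..1})" ..
  \<comment> \<open>The unknown derivative h' is multiplied by \<tau> t0 - \<tau> t0 = 0, so its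
    existence is enough.\<close>
  have "((\<lambda>t. (\<tau> t - \<tau> t0) * ?h t) has_vector_derivative (\<tau> t0 - \<tau> t0) * h' + (\<tau>' t0 - 0) * ?h t0) (at t0 within {0..1})"
    by (intro has_vector_derivative_mult_complex has_vector_derivative_diff has_vector_derivative_const \<tau>(1) t0 Dh)
  from has_vector_derivative_add[OF Df this]
  have D: "((\<lambda>t. ?f t + (\<tau> t - \<tau> t0) * ?h t) has_vector_derivative 0) (at t0 within {0..1})"
    using bkD(4)[OF \<gamma>R[OF t0] bkD(3) u1T[OF t0] v1T[OF t0]] by simp
  have cont: "continuous (at t0 within {0..1}) (\<lambda>t. G (\<gamma> t))" if "polyfun G" for G
    by (rule has_vector_derivative_continuous[OF polyfun_along_curve[OF that D\<gamma>]])
  obtain d1 where d1: "d1 > 0" "\<And>t. t \<in> {0..1} \<Longrightarrow> dist t0 t < d1 \<Longrightarrow> g (\<gamma> t) \<noteq> 0"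
    using continuous_within_avoid[OF cont[OF agD(2)] agD(3)] by blast
  obtain d2 where d2: "d2 > 0" "\<And>t. t \<in> {0..1} \<Longrightarrow> dist t0 t < d2 \<Longrightarrow> k (\<gamma> t) \<noteq> 0"
    using continuous_within_avoid[OF cont[OF bkD(2)] bkD(3)] by blast
  have "((\<lambda>t. \<omega>t (\<tau> t) (\<gamma> t) (u1 t) (v1 t)) has_vector_derivative 0) (at t0 within {0..1})"
  proof (rule has_vector_derivative_transform_within[OF D, of "min d1 d2"])
    fix t assume t: "t \<in> {0..1}" "dist t t0 < min d1 d2"
    then have "g (\<gamma> t) \<noteq> 0" "k (\<gamma> t) \<noteq> 0" using d1 d2 by (auto simp: dist_commute)
    then show "?f t + (\<tau> t - \<tau> t0) * ?h t = \<omega>t (\<tau> t) (\<gamma> t) (u1 t) (v1 t)"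
      using \<omega>t_diff[of "\<tau> t" "\<gamma> t" "u1 t" "v1 t" "\<tau> t0"] agD(4) bkD(4) \<gamma>R u1T v1T t by simp
  qed (use d1 d2 t0 in auto)
  then show ?thesis by (simp add: \<gamma>_def u1_def v1_def)
qed

lemma flow_pulls_back:
  assumes y: "y \<in> R" and u: "u \<in> T y" and v: "v \<in> T y"
  shows "\<omega> y u v = \<omega>' (emap (Z 1) y) (jac (emap (Z 1)) y u) (jac (emap (Z 1)) y v)"
proof -
  let ?f = "\<lambda>t. \<omega>t (\<tau> t) (emap (Z t) y) (jac (emap (Z t)) y u) (jac (emap (Z t)) y v)"
  obtain c where c: "\<And>t. t \<in> {0..1} \<Longrightarrow> ?f t = c"
    using has_vector_derivative_zero_constant[of "{0..1::real}" ?f] form_constant_along_flow[OF assms] by auto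
  have "(\<Sum>b\<in>I. Z 0 a b * e b x) = e a x" if "a \<in> I" for a x
  proof -
    have "(\<Sum>b\<in>I. Z 0 a b * e b x) = (\<Sum>b\<in>I. if b = a then e b x else 0)" using that Z0 by (intro sum.cong) auto
    then show ?thesis using that finI by simp
  qed
  then have id: "emap (Z 0) x = x" if "x \<in> X" for x using coords[OF that] by (simp add: emap_def vec_eq_iff)
  have "jac (emap (Z 0)) y w = w" if "w \<in> T y" for w
    using jac_cong[OF emap_pmap pmap_id id that] by (simp add: jac_id)
  then have "?f 0 = \<omega> y u v" using id[OF reg_in[OF y]] u v by (simp add: \<tau> \<omega>t_def)
  moreover have "?f 1 = \<omega>' (emap (Z 1) y) (jac (emap (Z 1)) y u) (jac (emap (Z 1)) y v)" by (simp add: \<tau> \<omega>t_def)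
  ultimately show ?thesis using c[of 0] c[of 1] by simp
qed

text \<open>By \<open>linear_flow_block\<close> the matrix Z mixes only functions of equal weight.
  Both points therefore give the same value to every e a, and these values determine a point of
  X.\<close>

lemma flow_equivariant:
  assumes e_hom: "\<And>a. a \<in> I \<Longrightarrow> hom (k a) (e a)" and block: "\<And>t a b. k a \<noteq> k b \<Longrightarrow> M t a b = 0"
    and t: "t \<in> {0..1}" and s: "s \<noteq> 0" and x: "x \<in> X"
  shows "emap (Z t) (\<sigma> s x) = \<sigma> s (emap (Z t) x)"
proof -
  have Zb: "Z t a b = 0" if "a \<in> I" "b \<in> I" "k a \<noteq> k b" for a b
    by (rule linear_flow_block[where M=M and Z=Z and k=k, OF finI M_cont Z0 Z' block t that])
  have "e a (emap (Z t) (\<sigma> s x)) = e a (\<sigma> s (emap (Z t) x))" if a: "a \<in> I" for a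
  proof -
    have "e a (emap (Z t) (\<sigma> s x)) = (\<Sum>b\<in>I. Z t a b * e b (\<sigma> s x))" by (rule e\<psi>[OF t \<sigma>_in[OF s x] a])
    also have "\<dots> = (\<Sum>b\<in>I. s powi k a * (Z t a b * e b x))"
    proof (rule sum.cong[OF refl])
      fix b assume b: "b \<in> I"
      show "Z t a b * e b (\<sigma> s x) = s powi k a * (Z t a b * e b x)"
        using Zb[OF a b] homD[OF e_hom[OF b] x s] by (cases "k a = k b") auto
    qed
    also have "\<dots> = s powi k a * e a (emap (Z t) x)" using e\<psi>[OF t x a] by (simp add: sum_distrib_left)
    also have "\<dots> = e a (\<sigma> s (emap (Z t) x))" using homD[OF e_hom[OF a] \<psi>_in[OF t x] s] by simp
    finally show ?thesis .
  qed
  then show ?thesis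
    using coords[OF \<psi>_in[OF t \<sigma>_in[OF s x]]] coords[OF \<sigma>_in[OF s \<psi>_in[OF t x]]] by (simp add: vec_eq_iff)
qed

end

section \<open>Weight coordinates and assembly of the isotopy\<close>

context moser
begin

text \<open>The interpolation points are taken in the regular locus, because there the isotopy field
  is given by an explicit formula that is continuous in time.\<close>

lemma hom_basis:
  "\<exists>(m::nat) x d. (\<forall>i<m. x i \<in> R \<and> hom k (d i)) \<and> (\<forall>f. hom k f \<longrightarrow> (\<forall>y\<in>X. f y = (\<Sum>i<m. f (x i) * d i y)))"
proof -
  obtain S where S: "finite S" "\<And>g. g \<in> S \<Longrightarrow> hom k g" "\<And>f. hom k f \<Longrightarrow> \<exists>w\<in>lin S. \<forall>x\<in>X. f x = w x"
    by (rule hom_finite_dimensional) blast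
  obtain m :: nat and x d where x: "\<And>i. i < m \<Longrightarrow> x i \<in> R" "\<And>i. i < m \<Longrightarrow> d i \<in> lin S"
    and exp: "\<And>w y. w \<in> lin S \<Longrightarrow> y \<in> R \<Longrightarrow> w y = (\<Sum>i<m. w (x i) * d i y)"
    using interpolation_basis[OF S(1), of R] by blast
  have d: "hom k (d i)" if "i < m" for i by (rule hom_lin[OF S(2) x(2)[OF that]])
  have "f y = (\<Sum>i<m. f (x i) * d i y)" if f: "hom k f" and y: "y \<in> X" for f y
  proof -
    obtain w where w: "w \<in> lin S" "\<And>x. x \<in> X \<Longrightarrow> f x = w x" using S(3)[OF f] by blast
    have "f y - (\<Sum>i<m. f (x i) * d i y) = 0"
    proof (rule reg_dense[where f="\<lambda>y. f y - (\<Sum>i<m. f (x i) * d i y)", OF _ _ y])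
      show "polyfun (\<lambda>y. f y - (\<Sum>i<m. f (x i) * d i y))"
        by (intro polyfun_diff hom_polyfun[OF f] polyfun_sum polyfun.mult polyfun.const hom_polyfun[OF d]) simp
      fix y assume y: "y \<in> R"
      have "(\<Sum>i<m. f (x i) * d i y) = (\<Sum>i<m. w (x i) * d i y)"
        by (intro sum.cong refl) (simp add: w(2) reg_in x)
      then show "f y - (\<Sum>i<m. f (x i) * d i y) = 0" using exp[OF w(1) y] w(2)[OF reg_in[OF y]] by simp
    qed
    then show ?thesis by simp
  qed
  then show ?thesis using x(1) d by (intro exI[of _ m] exI[of _ x] exI[of _ d]) blast
qed

text \<open>The weights 1 to N suffice: on X the components of the coordinate functions with
  negative weight vanish, and those of weight 0 are the constants b0. The case distinction on
  weights makes the expansion of a function of weight \<open>fst a\<close> stay in its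
  block.\<close>

lemma weight_coordinates:
  "\<exists>(I :: (int \<times> nat) set) e pt b0 L. finite I \<and> (\<forall>a\<in>I. pt a \<in> R \<and> hom (fst a) (e a)) \<and>
    (\<forall>a\<in>I. \<forall>f. hom (fst a) f \<longrightarrow> (\<forall>y\<in>X. f y = (\<Sum>b\<in>I. (if fst b = fst a then f (pt b) else 0) * e b y))) \<and>
    (\<forall>x\<in>X. \<forall>i. x $ i = b0 i + (\<Sum>a\<in>I. L i a * e a x))"
proof -
  have "\<forall>k. \<exists>(m::nat) x d. (\<forall>i<m. x i \<in> R \<and> hom k (d i)) \<and> (\<forall>f. hom k f \<longrightarrow> (\<forall>y\<in>X. f y = (\<Sum>i<m. f (x i) * d i y)))"
    using hom_basis by blast
  then obtain m :: "int \<Rightarrow> nat" where "\<forall>k. \<exists>x d. (\<forall>i<m k. x i \<in> R \<and> hom k (d i)) \<and> (\<forall>f. hom k f \<longrightarrow> (\<forall>y\<in>X. f y = (\<Sum>i<m k. f (x i) * d i y)))"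
    unfolding choice_iff by (rule exE)
  then obtain x where "\<forall>k. \<exists>d. (\<forall>i<m k. x k i \<in> R \<and> hom k (d i)) \<and> (\<forall>f. hom k f \<longrightarrow> (\<forall>y\<in>X. f y = (\<Sum>i<m k. f (x k i) * d i y)))"
    unfolding choice_iff by (rule exE)
  then obtain d where "\<forall>k. (\<forall>i<m k. x k i \<in> R \<and> hom k (d k i)) \<and> (\<forall>f. hom k f \<longrightarrow> (\<forall>y\<in>X. f y = (\<Sum>i<m k. f (x k i) * d k i y)))"
    unfolding choice_iff by (rule exE)
  then have x: "\<And>k i. i < m k \<Longrightarrow> x k i \<in> R" and d: "\<And>k i. i < m k \<Longrightarrow> hom k (d k i)"
    and exp: "\<And>k f y. hom k f \<Longrightarrow> y \<in> X \<Longrightarrow> f y = (\<Sum>i<m k. f (x k i) * d k i y)" by blast+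
  define I where "I = (SIGMA k:{1..int N}. {..<m k})"
  define e where "e a = d (fst a) (snd a)" for a
  define pt where "pt a = x (fst a) (snd a)" for a
  have sumI: "(\<Sum>a\<in>I. h (fst a) (snd a)) = (\<Sum>k=1..int N. \<Sum>i<m k. h k i)" for h :: "int \<Rightarrow> nat \<Rightarrow> complex"
    unfolding I_def by (subst sum.Sigma) (auto intro!: sum.cong)
  have "f y = (\<Sum>b\<in>I. (if fst b = fst a then f (pt b) else 0) * e b y)" if a: "a \<in> I" and f: "hom (fst a) f" and y: "y \<in> X" for a f y
  proof -
    have "(\<Sum>b\<in>I. (if fst b = fst a then f (pt b) else 0) * e b y)
      = (\<Sum>k=1..int N. \<Sum>i<m k. (if k = fst a then f (x k i) else 0) * d k i y)"
      unfolding e_def pt_def by (rule sumI)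
    also have "\<dots> = (\<Sum>k=1..int N. if k = fst a then \<Sum>i<m k. f (x k i) * d k i y else 0)"
      by (intro sum.cong refl) simp
    also have "\<dots> = (\<Sum>i<m (fst a). f (x (fst a) i) * d (fst a) i y)" using a by (auto simp: I_def)
    finally show ?thesis using exp[OF f y] by simp
  qed
  moreover have "y $ i = C i 0 p + (\<Sum>a\<in>I. C i (fst a) (pt a) * e a y)" if y: "y \<in> X" for y i
  proof -
    have "y $ i = (\<Sum>j = - int N..int N. C i j y)" using C_exp[OF _ y, of 1 i] \<sigma>_one[OF y] by simp
    also have "\<dots> = (\<Sum>j\<in>insert 0 {1..int N}. C i j y)"
    proof (rule sum.mono_neutral_right)
      show "\<forall>j\<in>{- int N..int N} - insert 0 {1..int N}. C i j y = 0"
      proof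
        fix j assume "j \<in> {- int N..int N} - insert 0 {1..int N}"
        then have "j < 0" by auto
        then show "C i j y = 0" by (rule hom_negative[OF C_hom _ y])
      qed
    qed auto
    also have "\<dots> = C i 0 y + (\<Sum>k=1..int N. C i k y)" by simp
    also have "(\<Sum>k=1..int N. C i k y) = (\<Sum>k=1..int N. \<Sum>j<m k. C i k (x k j) * d k j y)"
      by (rule sum.cong[OF refl], rule exp[OF C_hom y])
    also have "\<dots> = (\<Sum>a\<in>I. C i (fst a) (pt a) * e a y)" unfolding e_def pt_def by (rule sumI[symmetric])
    finally show ?thesis using hom_weight_zero[OF C_hom y] by simp
  qed
  moreover have "finite I" by (auto simp: I_def)
  moreover have "pt a \<in> R \<and> hom (fst a) (e a)" if "a \<in> I" for a using that x d by (auto simp: I_def e_def pt_def)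
  ultimately show ?thesis
    by (intro exI[of _ I] exI[of _ e] exI[of _ pt] exI[of _ "\<lambda>i. C i 0 p"] exI[of _ "\<lambda>i a. C i (fst a) (pt a)"]) blast
qed

definition dual_field :: "complex \<Rightarrow> complex \<Rightarrow> (complex^'n \<Rightarrow> complex^'n) \<Rightarrow> bool" where
  "dual_field s c V \<longleftrightarrow> pmap V \<and> (\<forall>x\<in>X. V x \<in> T x) \<and> (\<forall>x\<in>R. \<forall>v\<in>T x. \<omega>t s x (V x) v = c * \<delta> x (E x) v)"

lemma moser_equivalence:
  "\<exists>\<psi> \<phi>. pmap \<psi> \<and> pmap \<phi> \<and> (\<forall>x\<in>X. \<psi> x \<in> X \<and> \<phi> x \<in> X \<and> \<phi> (\<psi> x) = x \<and> \<psi> (\<phi> x) = x) \<and>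
    (\<forall>s x. s \<noteq> 0 \<longrightarrow> x \<in> X \<longrightarrow> \<psi> (\<sigma> s x) = \<sigma> s (\<psi> x)) \<and>
    (\<forall>x\<in>R. \<forall>u\<in>T x. \<forall>v\<in>T x. \<omega> x u v = \<omega>' (\<psi> x) (jac \<psi> x u) (jac \<psi> x v))"
proof -
  obtain P where P: "\<And>s. poly P s = 0 \<longleftrightarrow> ratio s q = 0" "poly P 0 \<noteq> 0" "poly P 1 \<noteq> 0" by (rule ratio_polynomial) blast
  obtain \<kappa> where \<kappa>: "\<And>t. t \<in> {0..1} \<Longrightarrow> poly P (of_real t + \<i> * of_real (\<kappa> * t * (1 - t))) \<noteq> 0"
    using path_avoiding_roots[OF P(2,3)] by blast
  define \<tau> where "\<tau> t = of_real t + \<i> * of_real (\<kappa> * t * (1 - t))" for t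
  define \<tau>' where "\<tau>' t = 1 + \<i> * of_real (\<kappa> * (1 - 2 * t))" for t
  have \<tau>: "(\<tau> has_vector_derivative \<tau>' t) (at t within {0..1})" for t
  proof -
    have "((\<lambda>t. (\<kappa> * t) * (1 - t)) has_vector_derivative (\<kappa> * t) * (0 - 1) + (\<kappa> * 1) * (1 - t)) (at t within {0..1})"
      by (intro has_vector_derivative_mult has_vector_derivative_mult_right has_vector_derivative_diff
          has_vector_derivative_const has_vector_derivative_id)
    moreover have "(\<kappa> * t) * (0 - 1) + (\<kappa> * 1) * (1 - t) = \<kappa> * (1 - 2 * t)" by (simp add: algebra_simps)
    ultimately have r: "((\<lambda>t. \<kappa> * t * (1 - t)) has_real_derivative \<kappa> * (1 - 2 * t)) (at t within {0..1})"
      unfolding has_real_derivative_iff_has_vector_derivative by (simp only:)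
    have "((\<lambda>t. of_real t + \<i> * of_real (\<kappa> * t * (1 - t))) has_vector_derivative of_real 1 + \<i> * of_real (\<kappa> * (1 - 2 * t))) (at t within {0..1})"
      by (intro has_vector_derivative_add has_vector_derivative_mult_right has_vector_derivative_of_real r DERIV_ident)
    then show ?thesis by (simp add: \<tau>_def[abs_def] \<tau>'_def)
  qed
  have \<tau>01: "\<tau> 0 = 0" "\<tau> 1 = 1" by (simp_all add: \<tau>_def)
  have \<tau>_cont: "continuous_on {0..1} \<tau>" and \<tau>'_cont: "continuous_on {0..1} \<tau>'"
    unfolding \<tau>_def[abs_def] \<tau>'_def[abs_def] by (intro continuous_intros)+
  have ratio: "ratio (\<tau> t) q \<noteq> 0" if "t \<in> {0..1}" for t using \<kappa>[OF that] P(1) by (simp add: \<tau>_def)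
  define c where "c t = \<tau>' t / of_int l" for t
  have c_cont: "continuous_on {0..1} c" unfolding c_def[abs_def] by (intro continuous_intros \<tau>'_cont) (simp add: l0)
  have "\<forall>t. \<exists>V. t \<in> {0..1} \<longrightarrow> dual_field (\<tau> t) (c t) V"
  proof (intro allI)
    fix t :: real
    show "\<exists>V. t \<in> {0..1} \<longrightarrow> dual_field (\<tau> t) (c t) V"
    proof (cases "t \<in> {0..1}")
      case True
      show ?thesis
        by (rule moser_field[OF ratio[OF True], of "c t"]) (auto simp: dual_field_def)
    qed blast
  qed
  then obtain V where V: "\<And>t. t \<in> {0..1} \<Longrightarrow> dual_field (\<tau> t) (c t) (V t)" by metis
  have Vp: "pmap (V t)" if "t \<in> {0..1}" for t using V[OF that] by (simp add: dual_field_def)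
  have VT: "V t x \<in> T x" if "t \<in> {0..1}" "x \<in> X" for t x using V[OF that(1)] that(2) by (simp add: dual_field_def)
  have Veq: "\<omega>t (\<tau> t) x (V t x) v = c t * \<delta> x (E x) v" if "t \<in> {0..1}" "x \<in> R" "v \<in> T x" for t x v
    using V[OF that(1)] that(2,3) by (simp add: dual_field_def)
  \<comment> \<open>The fields V t were chosen independently for each t. Uniqueness identifies V t x
    with Cramer's formula in a basis Q that does not depend on t, and this formula is continuous in
    t.\<close>
  have Vcont: "continuous_on {0..1} (\<lambda>t. V t x $ i)" if x: "x \<in> R" for x i
  proof -
    obtain Q where Q: "tbasis J (T x) Q" using tbasis_exists[OF x] by blast
    have eq: "V t x = dual_vector J (\<omega>t (\<tau> t) x) (\<lambda>v. c t * \<delta> x (E x) v) Q" if t: "t \<in> {0..1}" for t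
      by (rule \<omega>t_unique[OF ratio[OF t] x VT[OF t reg_in[OF x]] moser_field_at(1)[OF ratio[OF t] x Q]])
         (simp add: Veq[OF t x] moser_field_at(2)[OF ratio[OF t] x Q])
    have "continuous_on {0..1} (\<lambda>t. dual_vector J (\<omega>t (\<tau> t) x) (\<lambda>v. c t * \<delta> x (E x) v) Q $ i)"
    proof (rule continuous_on_dual_vector[where B="\<lambda>t. \<omega>t (\<tau> t) x" and \<beta>="\<lambda>t v. c t * \<delta> x (E x) v"])
      show "continuous_on {0..1} (\<lambda>t. \<omega>t (\<tau> t) x u v)" for u v unfolding \<omega>t_def by (intro continuous_intros \<tau>_cont)
      show "continuous_on {0..1} (\<lambda>t. c t * \<delta> x (E x) v)" for v by (intro continuous_intros c_cont)
      show "det (gram_mat J (\<omega>t (\<tau> t) x) Q) \<noteq> 0" if "t \<in> {0..1}" for t by (rule gram_\<omega>t_nonzero[OF ratio[OF that] x Q])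
    qed
    then show ?thesis by (rule continuous_on_eq) (simp only: eq)
  qed
  obtain I :: "(int \<times> nat) set" and e pt b0 L where "finite I \<and> (\<forall>a\<in>I. pt a \<in> R \<and> hom (fst a) (e a)) \<and>
    (\<forall>a\<in>I. \<forall>f. hom (fst a) f \<longrightarrow> (\<forall>y\<in>X. f y = (\<Sum>b\<in>I. (if fst b = fst a then f (pt b) else 0) * e b y))) \<and>
    (\<forall>x\<in>X. \<forall>i. x $ i = b0 i + (\<Sum>a\<in>I. L i a * e a x))"
    using weight_coordinates by (elim exE) (rule that)
  then have I: "finite I" and pt: "\<And>a. a \<in> I \<Longrightarrow> pt a \<in> R" and e: "\<And>a. a \<in> I \<Longrightarrow> hom (fst a) (e a)"
    and exp: "\<And>a f y. a \<in> I \<Longrightarrow> hom (fst a) f \<Longrightarrow> y \<in> X \<Longrightarrow> f y = (\<Sum>b\<in>I. (if fst b = fst a then f (pt b) else 0) * e b y)"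
    and coords: "\<And>x i. x \<in> X \<Longrightarrow> x $ i = b0 i + (\<Sum>a\<in>I. L i a * e a x)" by blast+
  \<comment> \<open>Coefficients are values at the regular points pt b, hence continuous in t; the
    case distinction is the block structure by weight.\<close>
  define M where "M t a b = (if fst b = fst a then dd (e a) (pt b) (V t (pt b)) else 0)" for t a b
  interpret linear_flow X I e b0 L V M
  proof
    show "zariski_closed X" using affX by (simp add: affine_variety_def)
    show "dd (e a) x (V t x) = (\<Sum>b\<in>I. M t a b * e b x)" if "t \<in> {0..1}" "x \<in> X" "a \<in> I" for t x a
      unfolding M_def
      by (rule exp[OF that(3) moser_field_weight[OF ratio[OF that(1)] Vp[OF that(1)] VT[OF that(1)] Veq[OF that(1)] e[OF that(3)]] that(2)])
    show "continuous_on {0..1} (\<lambda>t. M t a b)" if "a \<in> I" "b \<in> I" for a b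
    proof (cases "fst b = fst a")
      case True
      then show ?thesis unfolding M_def dd_def using that by (auto intro!: continuous_intros Vcont pt)
    qed (simp add: M_def)
  qed (use I e hom_polyfun coords VT in blast)+
  obtain Z \<phi> where "(\<forall>a\<in>I. \<forall>b\<in>I. Z 0 a b = (if a = b then 1 else 0)) \<and>
    (\<forall>t\<in>{0..1}. \<forall>a\<in>I. \<forall>b\<in>I. ((\<lambda>t. Z t a b) has_vector_derivative (- (\<Sum>c\<in>I. M t a c * Z t c b))) (at t within {0..1})) \<and>
    (\<forall>t\<in>{0..1}. pmap (\<phi> t) \<and> (\<forall>x\<in>X. emap (Z t) x \<in> X \<and> \<phi> t x \<in> X \<and> \<phi> t (emap (Z t) x) = x \<and> emap (Z t) (\<phi> t x) = x \<and>
      (\<forall>a\<in>I. e a (emap (Z t) x) = (\<Sum>b\<in>I. Z t a b * e b x))))"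
    using flow_exists by (elim exE) (rule that)
  then interpret moser_flow X \<sigma> p q C N J \<omega> \<omega>' l I e b0 L V M \<tau> \<tau>' Z \<phi>
  proof (intro moser_flow.intro moser_flow_axioms.intro)
  qed (auto simp: Vp Veq \<tau> c_def \<tau>01 intro: moser_axioms linear_flow_axioms)
  have one: "(1::real) \<in> {0..1}" by simp
  have block: "M t a b = 0" if "fst a \<noteq> fst b" for t a b using that by (simp add: M_def)
  show ?thesis
    using emap_pmap[of "Z 1"] \<phi>_pmap[OF one] \<psi>_in[OF one] \<phi>_in[OF one] \<phi>\<psi>[OF one] \<psi>\<phi>[OF one]
      flow_equivariant[of fst, OF e block one] flow_pulls_back
    by (intro exI[of _ "emap (Z 1)"] exI[of _ "\<phi> 1"] conjI ballI allI impI) simp_all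
qed

end

theorem mainTheorem1:
  fixes X :: "(complex^'n) set"
    and \<sigma> :: "complex \<Rightarrow> complex^'n \<Rightarrow> complex^'n"
    and \<omega> :: "'n two_form"
    and l :: int
  assumes "normal_variety X"
    and "good_Cstar_action X \<sigma>"
    and "symplectic_form X \<omega>"
    and "form_weight X \<sigma> \<omega> l"
    and "l \<noteq> 0"
  shows "\<forall>\<omega>'. symplectic_form X \<omega>' \<and> form_weight X \<sigma> \<omega>' l \<longrightarrow>
           (\<exists>\<phi>. automorphism X \<phi> \<and> equivariant X \<sigma> \<phi> \<and> form_eq X \<omega> (pullback X \<phi> \<omega>'))"
proof (intro allI impI)
  fix \<omega>' :: "'n two_form" assume \<omega>': "symplectic_form X \<omega>' \<and> form_weight X \<sigma> \<omega>' l"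
  have morph: "morphism X X f" if "pmap f" "\<And>x. x \<in> X \<Longrightarrow> f x \<in> X" for f
    unfolding morphism_def coord_ring_def using that pmapD by blast
  show "\<exists>\<phi>. automorphism X \<phi> \<and> equivariant X \<sigma> \<phi> \<and> form_eq X \<omega> (pullback X \<phi> \<omega>')"
  proof (cases "regular_locus X = {}")
    \<comment> \<open>Without regular points the equality of forms is vacuous, and the identity
      serves.\<close>
    case True
    have m: "morphism X X (\<lambda>x. x)" by (rule morph[OF pmap_id])
    have "automorphism X (\<lambda>x. x)" unfolding automorphism_def by (intro conjI m exI[of _ "\<lambda>x. x"]) auto
    then show ?thesis using True by (intro exI[of _ "\<lambda>x. x"]) (simp add: equivariant_def form_eq_def)
  next
    case False
    then obtain q where q: "q \<in> regular_locus X" by blast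
    obtain p where p: "fixed_points X \<sigma> = {p}" "\<And>k. cotangent_weight X \<sigma> p k \<Longrightarrow> k > 0" and act: "Cstar_action X \<sigma>"
      using assms(2) unfolding good_Cstar_action_def by blast
    interpret cone X \<sigma> p q by unfold_locales (fact assms(1) act p q)+
    obtain C and N :: nat where C: "\<And>i j. hom j (C i j)"
      "\<And>t x i. t \<noteq> 0 \<Longrightarrow> x \<in> X \<Longrightarrow> \<sigma> t x $ i = (\<Sum>j = - int N..int N. t powi j * C i j x)"
      by (rule action_coordinates) blast
    obtain J :: "'n set" where J: "card J = vec.dim (tangent_space X q)" by (rule exists_index_set)
    interpret moser X \<sigma> p q C N J \<omega> \<omega>' l
      by unfold_locales (use C J assms \<omega>' in auto)
    obtain \<psi> \<phi> where F: "pmap \<psi>" "pmap \<phi>" "\<And>x. x \<in> X \<Longrightarrow> \<psi> x \<in> X" "\<And>x. x \<in> X \<Longrightarrow> \<phi> x \<in> X"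
      "\<And>x. x \<in> X \<Longrightarrow> \<phi> (\<psi> x) = x" "\<And>x. x \<in> X \<Longrightarrow> \<psi> (\<phi> x) = x"
      and eqv: "\<And>s x. s \<noteq> 0 \<Longrightarrow> x \<in> X \<Longrightarrow> \<psi> (\<sigma> s x) = \<sigma> s (\<psi> x)"
      and pull: "\<And>x u v. x \<in> R \<Longrightarrow> u \<in> T x \<Longrightarrow> v \<in> T x \<Longrightarrow> \<omega> x u v = \<omega>' (\<psi> x) (jac \<psi> x u) (jac \<psi> x v)"
      using moser_equivalence by blast
    have "automorphism X \<psi>"
      unfolding automorphism_def using morph[OF F(1,3)] morph[OF F(2,4)] F(5,6) by blast
    moreover have "equivariant X \<sigma> \<psi>" using eqv by (simp add: equivariant_def)
    moreover have "form_eq X \<omega> (pullback X \<psi> \<omega>')"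
      unfolding form_eq_def pullback_def
    proof (intro ballI)
      fix x u v assume "x \<in> R" and u: "u \<in> T x" and v: "v \<in> T x"
      moreover have "differential X \<psi> x w = jac \<psi> x w" if "w \<in> T x" for w by (rule differential_jac[OF F(1) refl that])
      ultimately show "\<omega> x u v = \<omega>' (\<psi> x) (differential X \<psi> x u) (differential X \<psi> x v)" using pull by simp
    qed
    ultimately show ?thesis by blast
  qed
qed

end
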